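(* Let $X_{/\mathbb{C}}$ be a compact Riemann surface and consider the hypercohomology $H^\cdot(X^* )$ of $\mathrm{Cone}(N)^\cdot$. The inner product $\langle\cdot,\cdot\rangle$ defined by the polarization $\psi$ induces an inner product on $H^\cdot(X^* )$. Moreover, the representation $\rho$ of $\mathrm{SL}(2,\mathbb{R})$ on (the completion of) $\mathbb{H}^\cdot(K,d)$ induces an action of the real group ring $\mathbb{R}[\mathrm{SL}(2,\mathbb{R})]$ by bounded operators on the real Hilbert space completion of $H^\cdot(X^* )$. Let ${\rm A}$ be the image of the group ring under this representation. Then, for the data $({\rm A},H^\cdot(X^* ),\Phi)$, the operator $\Phi$ satisfies the properties of a $1$-summable Dirac operator, with bounded commutators with the elements of ${\rm A}$; that is, $\Phi$ is self-adjoint, its resolvent $(\Phi-\lambda)^{-1}$, $\lambda\notin\mathbb{R}$, is compact, $[\Phi,a]$ is bounded for all $a\in{\rm A}$, and $|\Phi|^{-1}$ (on the complement of the zero modes) is an infinitesimal of order one.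
   Context: **The complex.** $\mathbb{R}(p)=(2\pi\sqrt{-1})^p\mathbb{R}$. $(A^{a,b}\oplus A^{b,a})_{\mathbb{R}}$ denotes the real $C^\infty$ forms on $X_{/\mathbb{C}}$ of type $(a,b)+(b,a)$, and $(\cdot)(p)=(2\pi\sqrt{-1})^p(\cdot)$. Set $K^{i,j,k}=\bigoplus_{a+b=j+1,|a-b|\le2k-i}(A^{a,b}\oplus A^{b,a})_{\mathbb{R}}(\frac{1+j-i}{2})$ if $1+j-i$ is even and $k\ge\max(0,i)$, and $0$ otherwise; $K^{i,j}=\bigoplus_kK^{i,j,k}$. $d'=\partial+\bar\partial:K^{i,j,k}\to K^{i+1,j+1,k+1}$, $d''=P^\perp\sqrt{-1}(\bar\partial-\partial):K^{i,j,k}\to K^{i+1,j+1,k}$ ($P^\perp$ the orthogonal projection onto the target), $d=d'+d''$; $N:K^{i,j,k}\to K^{i+2,j,k+1}$, $N(f)=(2\pi\sqrt{-1})^{-1}f$; $\ell:K^{i,j,k}\to K^{i,j+2,k}$, $\ell(f)=(2\pi\sqrt{-1})f\wedge\omega$, with $\omega$ a real closed fundamental (K\"ahler) $(1,1)$-form. **Lefschetz module structure (known).** $(K^{\cdot,\cdot},d,N,\ell,\psi)$ is a polarized bigraded Lefschetz module, with $\psi(x,y)=\frac{1}{2\pi\sqrt{-1}}\epsilon(1-j)(-1)^k\int x\wedge Cy$ on $K^{-i,-j,k}\otimes K^{i,j,k+i}$, $\epsilon(m)=(-1)^{m(m+1)/2}$, $C(x)=(\sqrt{-1})^{a-b}x$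 on forms of type $(a,b)$. It corresponds to a representation $\sigma$ of $\mathrm{SL}(2,\mathbb{R})\times\mathrm{SL}(2,\mathbb{R})$ with $\sigma\{\mathrm{diag}(a,a^{-1}),\mathrm{diag}(b,b^{-1})\}x=a^ib^jx$ for $x\in K^{i,j}$, $d\sigma\{E,0\}=N$, $d\sigma\{0,E\}=\ell$, where $E=\begin{pmatrix}0&1\\0&0\end{pmatrix}$. With $w=\begin{pmatrix}0&1\\-1&0\end{pmatrix}$ and $\tilde w=\{w,w\}$, the form $\langle x,y\rangle=\psi(x,\sigma(\tilde w)y)$ is symmetric and positive definite. All this descends to the hypercohomology $\mathbb{H}^\cdot(K,d)=H^\cdot(\tilde X^* )$. The representation $\rho$ is the restriction $\sigma_2$ of $\sigma$ to the second factor $\{1\}\times\mathrm{SL}(2,\mathbb{R})$, acting on the real Hilbert space completion of $\mathbb{H}^\cdot(K,d)$ for $\langle\cdot,\cdot\rangle$. **Cohomologies.** $gr^w_{2p}H^q(\tilde X^* )$ is the cohomology of $d$ at $K^{q-2p,q-1}$; $gr^w_{2p}H^q(X^* )$ is the cohomology at the middle term of the mapping cone of $N$, i.e. on pairs $(a,b)\in K^{q-2p,q-1}\oplus K^{q-2p+1,q-2}$ with differential $D(a,b)=(-da,Na+db)$; $H^q(\cdot)=\bigoplus_pgr^w_{2p}H^q(\cdot)$. For $q\ge2p$, $gr^w_{2p}H^q(X^* )$ is identified with $\ker(N)\subset gr^w_{2p}H^q(\tilde X^* )$; for $q\le2(p-1)$, $gr^w_{2p}H^{q+1}(X^* )$ is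 identified with $\mathrm{coker}(N:gr^w_{2p}H^q(\tilde X^* )\to gr^w_{2(p-1)}H^q(\tilde X^* ))$. The inner product on $H^\cdot(X^* )$ is the one induced through these identifications (as a subspace, resp. quotient). Powers of $N$ induce duality isomorphisms $\delta_q:gr^w_{2p}H^q(X^* )\to gr^w_{2(q-p+1)}H^{q+1}(X^* )$, $q\ge2p$, $q=0,1,2$; put $\delta=\bigoplus_q\delta_q$. The induced action on $H^\cdot(X^* )$ is the restriction of $\rho$ on the part identified with $\ker N$, and $\delta\circ\rho\circ\delta^{-1}$ on the dual part. **The operator.** $\Phi$ acts on $gr^w_{2p}H^q(X^* )$ as multiplication by $p$ if $q\ge2p$ and by $p-1$ if $q\le2p-1$. A positive compact operator is an infinitesimal of order one if its eigenvalues $\lambda_k$ in decreasing order satisfy $\lambda_k=O(k^{-1})$; $D$ is $n$-summable if $|D|^{-n}$ is an infinitesimal of order one. *)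

theory Defs
  imports "HOL-Analysis.Analysis" "HOL-Library.Landau_Symbols" "HOL-Library.Function_Algebras"
begin

instantiation "fun" :: (type, real_vector) real_vector
begin

definition scaleR_fun_def: "scaleR r f = (\<lambda>x. r *\<^sub>R f x)"

instance
  by standard (simp_all add: scaleR_fun_def fun_eq_iff scaleR_add_right scaleR_add_left)

end


section \<open>Compact Riemann surfaces\<close>

text \<open>A chart is a pair of its domain and its coordinate function; only the values of the
  coordinate on the domain matter. The surface is the whole type.\<close>

type_synonym 'a chart = "'a set \<times> ('a \<Rightarrow> complex)"

definition chart_range :: "'a chart \<Rightarrow> complex set" where
  "chart_range c = snd c ` fst c"

definition transition :: "'a chart \<Rightarrow> 'a chart \<Rightarrow> complex \<Rightarrow> complex" where
  "transition c c' = snd c' \<circ> inv_into (fst c) (snd c)"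

definition compact_riemann_surface :: "'a::t2_space chart set \<Rightarrow> bool" where
  "compact_riemann_surface \<A> \<longleftrightarrow>
     compact (UNIV :: 'a set) \<and> connected (UNIV :: 'a set) \<and>
     (\<Union>c\<in>\<A>. fst c) = UNIV \<and>
     (\<forall>c\<in>\<A>. open (fst c) \<and> open (chart_range c) \<and>
        homeomorphism (fst c) (chart_range c) (snd c) (inv_into (fst c) (snd c))) \<and>
     (\<forall>c\<in>\<A>. \<forall>c'\<in>\<A>. transition c c' holomorphic_on snd c ` (fst c \<inter> fst c'))"


section \<open>Differential forms\<close>

text \<open>A complex form is given by its coefficients: \<open>\<theta> a b c z\<close> is the coefficient of
  $dz^a \wedge d\bar z^b$ in the coordinate of the chart \<open>c\<close>, at the point with
  coordinate \<open>z\<close>. Coefficients are 0 wherever they have no meaning, so that equality of forms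
  is equality of functions.\<close>

type_synonym 'a form = "nat \<Rightarrow> nat \<Rightarrow> 'a chart \<Rightarrow> complex \<Rightarrow> complex"

primrec Ck_on :: "nat \<Rightarrow> complex set \<Rightarrow> (complex \<Rightarrow> complex) \<Rightarrow> bool" where
  "Ck_on 0 S f \<longleftrightarrow> continuous_on S f"
| "Ck_on (Suc n) S f \<longleftrightarrow>
     (\<forall>z\<in>S. f differentiable (at z)) \<and> (\<forall>v. Ck_on n S (\<lambda>z. frechet_derivative f (at z) v))"

definition smooth_form :: "'a chart set \<Rightarrow> 'a form \<Rightarrow> bool" where
  "smooth_form \<A> \<theta> \<longleftrightarrow>
     (\<forall>a b c z. \<theta> a b c z \<noteq> 0 \<longrightarrow> a \<le> 1 \<and> b \<le> 1 \<and> c \<in> \<A> \<and> z \<in> chart_range c) \<and>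
     (\<forall>a b. \<forall>c\<in>\<A>. \<forall>n. Ck_on n (chart_range c) (\<theta> a b c)) \<and>
     (\<forall>a b. \<forall>c\<in>\<A>. \<forall>c'\<in>\<A>. \<forall>x\<in>fst c \<inter> fst c'.
        \<theta> a b c (snd c x) =
          \<theta> a b c' (snd c' x) * deriv (transition c c') (snd c x) ^ a
                                * cnj (deriv (transition c c') (snd c x)) ^ b)"

text \<open>The sign below comes from $\overline{dz \wedge d\bar z} = - dz \wedge d\bar z$.\<close>

definition form_cnj :: "'a form \<Rightarrow> 'a form" where
  "form_cnj \<theta> = (\<lambda>a b c z. (- 1) ^ (a * b) * cnj (\<theta> b a c z))"

definition real_form :: "'a chart set \<Rightarrow> 'a form \<Rightarrow> bool" where
  "real_form \<A> \<theta> \<longleftrightarrow> smooth_form \<A> \<theta> \<and> form_cnj \<theta> = \<theta>"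

definition cmult :: "complex \<Rightarrow> 'a form \<Rightarrow> 'a form" where
  "cmult s \<theta> = (\<lambda>a b c z. s * \<theta> a b c z)"

definition wirtinger :: "(complex \<Rightarrow> complex) \<Rightarrow> complex \<Rightarrow> complex" where
  "wirtinger f z = (frechet_derivative f (at z) 1 - \<i> * frechet_derivative f (at z) \<i>) / 2"

definition wirtinger_bar :: "(complex \<Rightarrow> complex) \<Rightarrow> complex \<Rightarrow> complex" where
  "wirtinger_bar f z = (frechet_derivative f (at z) 1 + \<i> * frechet_derivative f (at z) \<i>) / 2"

definition del :: "'a form \<Rightarrow> 'a form" where
  "del \<theta> = (\<lambda>a b c z. if a = 1 \<and> z \<in> chart_range c then wirtinger (\<theta> 0 b c) z else 0)"

text \<open>The sign comes from moving $d\bar z$ past $dz^a$.\<close>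

definition delbar :: "'a form \<Rightarrow> 'a form" where
  "delbar \<theta> = (\<lambda>a b c z. if b = 1 \<and> z \<in> chart_range c
     then (- 1) ^ a * wirtinger_bar (\<theta> a 0 c) z else 0)"

definition wedge :: "'a form \<Rightarrow> 'a form \<Rightarrow> 'a form" where
  "wedge \<eta> \<theta> = (\<lambda>a b c z. if a \<le> 1 \<and> b \<le> 1 then
     (\<Sum>r\<le>a. \<Sum>s\<le>b. (- 1) ^ (s * (a - r)) * \<eta> r s c z * \<theta> (a - r) (b - s) c z) else 0)"

text \<open>The Weil operator $C$.\<close>

definition weil :: "'a form \<Rightarrow> 'a form" where
  "weil \<theta> = (\<lambda>a b c z. \<i> powi (int a - int b) * \<theta> a b c z)"

text \<open>Integral of the degree two part over the surface: cut the surface into Borel pieces, each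
  inside one chart, and use $dz \wedge d\bar z = -2 i\, dx \wedge dy$. For a smooth form the
  value does not depend on the chosen finite cover.\<close>

definition chart_cover :: "'a chart set \<Rightarrow> 'a chart list" where
  "chart_cover \<A> = (SOME cs. set cs \<subseteq> \<A> \<and> (\<Union>c\<in>set cs. fst c) = UNIV)"

definition surface_integral :: "'a chart set \<Rightarrow> 'a form \<Rightarrow> complex" where
  "surface_integral \<A> \<theta> = (let cs = chart_cover \<A> in
     \<Sum>m<length cs.
       set_lebesgue_integral lborel
         (snd (cs ! m) ` (fst (cs ! m) - (\<Union>c\<in>set (take m cs). fst c)))
         (\<lambda>z. - 2 * \<i> * \<theta> 1 1 (cs ! m) z))"

text \<open>Positivity of $\omega$ reads $\omega = \frac{i}{2} h\, dz \wedge d\bar z$ with $h > 0$.\<close>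

definition kaehler_form :: "'a chart set \<Rightarrow> 'a form \<Rightarrow> bool" where
  "kaehler_form \<A> \<omega> \<longleftrightarrow> real_form \<A> \<omega> \<and> del \<omega> + delbar \<omega> = 0 \<and>
     (\<forall>a b. \<omega> a b \<noteq> 0 \<longrightarrow> a = 1 \<and> b = 1) \<and>
     (\<forall>c\<in>\<A>. \<forall>z\<in>chart_range c. \<exists>h>0. \<omega> 1 1 c z = \<i> / 2 * complex_of_real h)"


section \<open>The complex\<close>

abbreviation two_pi_i :: complex where
  "two_pi_i \<equiv> 2 * complex_of_real pi * \<i>"

definition K_nonzero :: "int \<Rightarrow> int \<Rightarrow> int \<Rightarrow> bool" where
  "K_nonzero i j k \<longleftrightarrow> even (1 + j - i) \<and> max 0 i \<le> k"

definition K_type :: "int \<Rightarrow> int \<Rightarrow> int \<Rightarrow> nat \<Rightarrow> nat \<Rightarrow> bool" where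
  "K_type i j k a b \<longleftrightarrow> int a + int b = j + 1 \<and> \<bar>int a - int b\<bar> \<le> 2 * k - i"

definition K_piece :: "'a chart set \<Rightarrow> int \<Rightarrow> int \<Rightarrow> int \<Rightarrow> 'a form set" where
  "K_piece \<A> i j k = (if K_nonzero i j k
     then {cmult (two_pi_i powi ((1 + j - i) div 2)) \<theta> | \<theta>.
             real_form \<A> \<theta> \<and> (\<forall>a b. \<theta> a b \<noteq> 0 \<longrightarrow> K_type i j k a b)}
     else {0})"

text \<open>Projection of forms onto the types occurring in $K^{i,j,k}$. Forms of different types are
  pointwise orthogonal, so this is the orthogonal projection $P^\perp$; it is also used to
  send to 0 whatever would land in a vanishing $K^{i,j,k}$.\<close>

definition K_proj :: "int \<Rightarrow> int \<Rightarrow> int \<Rightarrow> 'a form \<Rightarrow> 'a form" where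
  "K_proj i j k \<theta> =
     (\<lambda>a b. if K_nonzero i j k \<and> K_type i j k a b then \<theta> a b else 0)"

text \<open>Elements of the total space $\bigoplus_{i,j,k} K^{i,j,k}$.\<close>

type_synonym 'a cochain = "int \<Rightarrow> int \<Rightarrow> int \<Rightarrow> 'a form"

definition K :: "'a chart set \<Rightarrow> 'a cochain set" where
  "K \<A> = {x. (\<forall>i j k. x i j k \<in> K_piece \<A> i j k) \<and> finite {(i, j, k). x i j k \<noteq> 0}}"

definition K_comp :: "int \<Rightarrow> int \<Rightarrow> 'a cochain \<Rightarrow> 'a cochain" where
  "K_comp i j x = (\<lambda>i' j'. if i' = i \<and> j' = j then x i j else 0)"

definition K_bi :: "'a chart set \<Rightarrow> int \<Rightarrow> int \<Rightarrow> 'a cochain set" where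
  "K_bi \<A> i j = {x \<in> K \<A>. K_comp i j x = x}"

definition dK :: "'a cochain \<Rightarrow> 'a cochain" where
  "dK x = (\<lambda>i j k. K_proj i j k
     (del (x (i - 1) (j - 1) (k - 1)) + delbar (x (i - 1) (j - 1) (k - 1)) +
      cmult \<i> (delbar (x (i - 1) (j - 1) k) - del (x (i - 1) (j - 1) k))))"

definition NK :: "'a cochain \<Rightarrow> 'a cochain" where
  "NK x = (\<lambda>i j k. K_proj i j k (cmult (inverse two_pi_i) (x (i - 2) j (k - 1))))"

definition ellK :: "'a form \<Rightarrow> 'a cochain \<Rightarrow> 'a cochain" where
  "ellK \<omega> x = (\<lambda>i j k. K_proj i j k (cmult two_pi_i (wedge (x i (j - 2) k) \<omega>)))"

definition eps :: "int \<Rightarrow> complex" where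
  "eps m = (- 1) powi (m * (m + 1) div 2)"

definition polarization :: "'a chart set \<Rightarrow> 'a cochain \<Rightarrow> 'a cochain \<Rightarrow> complex" where
  "polarization \<A> x y =
     (\<Sum>(i, j, k) \<in> {(i, j, k). x (- i) (- j) k \<noteq> 0 \<and> y i j (k + i) \<noteq> 0}.
        1 / two_pi_i * eps (1 - j) * (- 1) powi k *
        surface_integral \<A> (wedge (x (- i) (- j) k) (weil (y i j (k + i)))))"

definition cocycles :: "'a chart set \<Rightarrow> 'a cochain set" where
  "cocycles \<A> = {x \<in> K \<A>. dK x = 0}"

definition coboundaries :: "'a chart set \<Rightarrow> 'a cochain set" where
  "coboundaries \<A> = dK ` K \<A>"


section \<open>The group and its representation on hypercohomology\<close>

definition SL2 :: "(real^2^2) set" where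
  "SL2 = {g. det g = 1}"

definition diag2 :: "real \<Rightarrow> real^2^2" where
  "diag2 a = vector [vector [a, 0], vector [0, inverse a]]"

text \<open>$\exp(tE) = 1 + tE$ for $E$ the upper nilpotent matrix.\<close>

definition exp_E :: "real \<Rightarrow> real^2^2" where
  "exp_E t = vector [vector [1, t], vector [0, 1]]"

definition weyl :: "real^2^2" where
  "weyl = vector [vector [0, 1], vector [- 1, 0]]"

definition linear_on_subspace :: "'v::real_vector set \<Rightarrow> ('v \<Rightarrow> 'w::real_vector) \<Rightarrow> bool" where
  "linear_on_subspace V f \<longleftrightarrow> subspace V \<and>
     (\<forall>x\<in>V. \<forall>y\<in>V. f (x + y) = f x + f y) \<and> (\<forall>r. \<forall>x\<in>V. f (r *\<^sub>R x) = r *\<^sub>R f x)"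

text \<open>The map \<open>\<kappa>\<close> sends a cocycle to its class, viewed in the Hilbert space completion \<open>'h\<close> of
  $\mathbb{H}^\cdot(K,d)$; so \<open>\<kappa> ` cocycles \<A>\<close> is the algebraic hypercohomology. The
  representation \<open>\<sigma>\<close> is constrained only there: the first factor acts by operators that do not
  in general extend to the completion.
  On $K$ itself $\sigma$ does not commute with $d$. The representation on hypercohomology is
  the one corresponding to the induced operators $N$, $\ell$ and the induced bigrading, which is
  what is required here. Existence of \<open>\<kappa>\<close> and \<open>\<sigma>\<close> is the known fact that the
  polarized bigraded Lefschetz structure descends.\<close>

definition lefschetz_hypercohomology ::
  "'a chart set \<Rightarrow> 'a form \<Rightarrow> ('a cochain \<Rightarrow> 'h::{real_inner, complete_space}) \<Rightarrow>
   (real^2^2 \<Rightarrow> real^2^2 \<Rightarrow> 'h \<Rightarrow> 'h) \<Rightarrow> bool" where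
  "lefschetz_hypercohomology \<A> \<omega> \<kappa> \<sigma> \<longleftrightarrow>
     linear_on_subspace (cocycles \<A>) \<kappa> \<and>
     (\<forall>x\<in>cocycles \<A>. \<kappa> x = 0 \<longleftrightarrow> x \<in> coboundaries \<A>) \<and>
     closure (\<kappa> ` cocycles \<A>) = UNIV \<and>
     (\<forall>g\<in>SL2. \<forall>h\<in>SL2. linear_on_subspace (\<kappa> ` cocycles \<A>) (\<sigma> g h) \<and>
        \<sigma> g h ` \<kappa> ` cocycles \<A> \<subseteq> \<kappa> ` cocycles \<A>) \<and>
     (\<forall>v\<in>\<kappa> ` cocycles \<A>. \<sigma> (mat 1) (mat 1) v = v) \<and>
     (\<forall>g\<in>SL2. \<forall>h\<in>SL2. \<forall>g'\<in>SL2. \<forall>h'\<in>SL2. \<forall>v\<in>\<kappa> ` cocycles \<A>.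
        \<sigma> (g ** g') (h ** h') v = \<sigma> g h (\<sigma> g' h' v)) \<and>
     (\<forall>a b i j. \<forall>x\<in>cocycles \<A> \<inter> K_bi \<A> i j. a \<noteq> 0 \<longrightarrow> b \<noteq> 0 \<longrightarrow>
        \<sigma> (diag2 a) (diag2 b) (\<kappa> x) = (a powi i * b powi j) *\<^sub>R \<kappa> x) \<and>
     (\<forall>x\<in>cocycles \<A>.
        ((\<lambda>t. \<sigma> (exp_E t) (mat 1) (\<kappa> x)) has_vector_derivative \<kappa> (NK x)) (at 0) \<and>
        ((\<lambda>t. \<sigma> (mat 1) (exp_E t) (\<kappa> x)) has_vector_derivative \<kappa> (ellK \<omega> x)) (at 0)) \<and>
     (\<forall>x\<in>cocycles \<A>. \<forall>y\<in>cocycles \<A>. \<forall>y'\<in>cocycles \<A>. \<kappa> y' = \<sigma> weyl weyl (\<kappa> y) \<longrightarrow>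
        complex_of_real (\<kappa> x \<bullet> \<kappa> y) = polarization \<A> x y')"

abbreviation rho :: "(real^2^2 \<Rightarrow> real^2^2 \<Rightarrow> 'h \<Rightarrow> 'h) \<Rightarrow> real^2^2 \<Rightarrow> 'h \<Rightarrow> 'h" where
  "rho \<sigma> g \<equiv> \<sigma> (mat 1) g"


section \<open>Cohomology of the cone of N\<close>

definition D_cone :: "'a cochain \<times> 'a cochain \<Rightarrow> 'a cochain \<times> 'a cochain" where
  "D_cone x = (- dK (fst x), NK (fst x) + dK (snd x))"

definition cone_cocycles :: "'a chart set \<Rightarrow> ('a cochain \<times> 'a cochain) set" where
  "cone_cocycles \<A> = {x \<in> K \<A> \<times> K \<A>. D_cone x = 0}"

definition cone_coboundaries :: "'a chart set \<Rightarrow> ('a cochain \<times> 'a cochain) set" where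
  "cone_coboundaries \<A> = D_cone ` (K \<A> \<times> K \<A>)"

text \<open>The component in $K^{q-2p,q-1} \oplus K^{q-2p+1,q-2}$, whose cohomology is
  $gr^w_{2p} H^q(X^*)$. Each nonzero $K^{i,j}$ occurs exactly once as first and once as second
  summand, so the total cone computes $H^\cdot(X^*) = \bigoplus_{p,q} gr^w_{2p} H^q(X^*)$.\<close>

definition gr :: "int \<Rightarrow> int \<Rightarrow> 'a cochain \<times> 'a cochain \<Rightarrow> 'a cochain \<times> 'a cochain" where
  "gr p q x = (K_comp (q - 2 * p) (q - 1) (fst x), K_comp (q - 2 * p + 1) (q - 2) (snd x))"

definition gr_support :: "'a cochain \<times> 'a cochain \<Rightarrow> (int \<times> int) set" where
  "gr_support x = {(p, q). gr p q x \<noteq> 0}"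

text \<open>In the range $q \le 2p - 1$ the class of \<open>x\<close> is identified with the class of \<open>b\<close> in the
  cokernel of $N$, where \<open>(0, b)\<close> is cohomologous to \<open>x\<close>.\<close>

definition coker_rep :: "'a chart set \<Rightarrow> int \<Rightarrow> int \<Rightarrow> 'a cochain \<times> 'a cochain \<Rightarrow> 'a cochain" where
  "coker_rep \<A> p q x = (SOME b. b \<in> cocycles \<A> \<inter> K_bi \<A> (q - 2 * p + 1) (q - 2) \<and>
     x - (0, b) \<in> cone_coboundaries \<A>)"

text \<open>Component of \<open>v\<close> orthogonal to the closure of \<open>S\<close>. The inner product on a quotient by \<open>S\<close> is
  the inner product of these components.\<close>

definition orth_part :: "'h::real_inner set \<Rightarrow> 'h \<Rightarrow> 'h" where
  "orth_part S v = (THE u. v - u \<in> closure S \<and> (\<forall>s\<in>S. s \<bullet> u = 0))"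

definition gr_embed ::
  "'a chart set \<Rightarrow> ('a cochain \<Rightarrow> 'h::real_inner) \<Rightarrow> int \<Rightarrow> int \<Rightarrow> 'a cochain \<times> 'a cochain \<Rightarrow> 'h" where
  "gr_embed \<A> \<kappa> p q x =
     (if 2 * p \<le> q then \<kappa> (fst x)
      else orth_part (\<kappa> ` NK ` (cocycles \<A> \<inter> K_bi \<A> (q - 1 - 2 * p) (q - 2)))
             (\<kappa> (coker_rep \<A> p q x)))"

definition ip_X ::
  "'a chart set \<Rightarrow> ('a cochain \<Rightarrow> 'h::real_inner) \<Rightarrow>
   'a cochain \<times> 'a cochain \<Rightarrow> 'a cochain \<times> 'a cochain \<Rightarrow> real" where
  "ip_X \<A> \<kappa> x y = (\<Sum>(p, q) \<in> gr_support x \<inter> gr_support y.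
     gr_embed \<A> \<kappa> p q (gr p q x) \<bullet> gr_embed \<A> \<kappa> p q (gr p q y))"

text \<open>\<open>ip\<close> is a symmetric bilinear form on \<open>Z\<close> inducing an inner product on \<open>Z / B\<close>.\<close>

definition inner_product_on_quotient ::
  "'v::real_vector set \<Rightarrow> 'v set \<Rightarrow> ('v \<Rightarrow> 'v \<Rightarrow> real) \<Rightarrow> bool" where
  "inner_product_on_quotient Z B ip \<longleftrightarrow>
     subspace Z \<and> subspace B \<and> B \<subseteq> Z \<and>
     (\<forall>x\<in>Z. linear_on_subspace Z (ip x)) \<and>
     (\<forall>x\<in>Z. \<forall>y\<in>Z. ip x y = ip y x) \<and>
     (\<forall>x\<in>Z. 0 \<le> ip x x) \<and>
     (\<forall>x\<in>Z. ip x x = 0 \<longleftrightarrow> x \<in> B)"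

text \<open>The Hilbert space \<open>'m\<close> together with \<open>\<iota>\<close> is the completion of \<open>Z / B\<close>.\<close>

definition hilbert_completion ::
  "'v::real_vector set \<Rightarrow> ('v \<Rightarrow> 'v \<Rightarrow> real) \<Rightarrow> ('v \<Rightarrow> 'm::{real_inner, complete_space}) \<Rightarrow> bool" where
  "hilbert_completion Z ip \<iota> \<longleftrightarrow>
     linear_on_subspace Z \<iota> \<and> (\<forall>x\<in>Z. \<forall>y\<in>Z. \<iota> x \<bullet> \<iota> y = ip x y) \<and> closure (\<iota> ` Z) = UNIV"


section \<open>The induced action\<close>

text \<open>Cocycles all of whose components lie in the range $q \ge 2p$, resp. in the dual range
  $q \le 2p - 1$.\<close>

definition ker_part :: "'a chart set \<Rightarrow> ('a cochain \<times> 'a cochain) set" where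
  "ker_part \<A> = {x \<in> cone_cocycles \<A>. \<forall>(p, q) \<in> gr_support x. 2 * p \<le> q}"

definition dual_part :: "'a chart set \<Rightarrow> ('a cochain \<times> 'a cochain) set" where
  "dual_part \<A> = {x \<in> cone_cocycles \<A>. \<forall>(p, q) \<in> gr_support x. q \<le> 2 * p - 1}"

text \<open>\<open>duality \<A> \<kappa> x x'\<close>: the class of \<open>x'\<close> is the image under $\delta$ of the class of \<open>x\<close>. On
  $gr^w_{2p} H^q(X^*)$ with $q \ge 2p$, $\delta$ inverts the isomorphism
  $N^{q-2p} : gr^w_{2(q-p)} H^q(\tilde X^*) \to gr^w_{2p} H^q(\tilde X^*)$ on
  $\ker N$ and then projects to the cokernel of $N$.\<close>

definition duality ::
  "'a chart set \<Rightarrow> ('a cochain \<Rightarrow> 'h) \<Rightarrow> 'a cochain \<times> 'a cochain \<Rightarrow> 'a cochain \<times> 'a cochain \<Rightarrow> bool" where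
  "duality \<A> \<kappa> x x' \<longleftrightarrow> x \<in> ker_part \<A> \<and> x' \<in> dual_part \<A> \<and>
     (\<forall>p q. 2 * p \<le> q \<longrightarrow>
       (\<exists>b \<in> cocycles \<A> \<inter> K_bi \<A> (2 * p - q) (q - 1).
          \<kappa> ((NK ^^ nat (q - 2 * p)) b) = \<kappa> (fst (gr p q x)) \<and>
          gr (q - p + 1) (q + 1) x' - (0, b) \<in> cone_coboundaries \<A>))"

text \<open>\<open>T\<close> is the operator on the completion by which \<open>g\<close> acts: $\rho(g)$ on the part identified with
  $\ker N$ and $\delta \rho(g) \delta^{-1}$ on the dual part.\<close>

definition induced_operator ::
  "'a chart set \<Rightarrow> ('a cochain \<Rightarrow> 'h) \<Rightarrow> (real^2^2 \<Rightarrow> real^2^2 \<Rightarrow> 'h \<Rightarrow> 'h) \<Rightarrow>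
   ('a cochain \<times> 'a cochain \<Rightarrow> 'm::real_normed_vector) \<Rightarrow> real^2^2 \<Rightarrow> ('m \<Rightarrow> 'm) \<Rightarrow> bool" where
  "induced_operator \<A> \<kappa> \<sigma> \<iota> g T \<longleftrightarrow> bounded_linear T \<and>
     (\<forall>x\<in>ker_part \<A>. \<forall>y\<in>ker_part \<A>. \<kappa> (fst y) = rho \<sigma> g (\<kappa> (fst x)) \<longrightarrow>
        T (\<iota> x) = \<iota> y \<and>
        (\<forall>x' y'. duality \<A> \<kappa> x x' \<longrightarrow> duality \<A> \<kappa> y y' \<longrightarrow> T (\<iota> x') = \<iota> y'))"

definition rho_X ::
  "'a chart set \<Rightarrow> ('a cochain \<Rightarrow> 'h) \<Rightarrow> (real^2^2 \<Rightarrow> real^2^2 \<Rightarrow> 'h \<Rightarrow> 'h) \<Rightarrow>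
   ('a cochain \<times> 'a cochain \<Rightarrow> 'm::real_normed_vector) \<Rightarrow> real^2^2 \<Rightarrow> 'm \<Rightarrow> 'm" where
  "rho_X \<A> \<kappa> \<sigma> \<iota> g = (THE T. induced_operator \<A> \<kappa> \<sigma> \<iota> g T)"

text \<open>The real group ring of $\mathrm{SL}(2,\mathbb{R})$ as an abstract group: finitely supported
  functions with convolution.\<close>

definition group_ring :: "(real^2^2 \<Rightarrow> real) set" where
  "group_ring = {f. finite {g. f g \<noteq> 0} \<and> {g. f g \<noteq> 0} \<subseteq> SL2}"

definition gr_ring_one :: "real^2^2 \<Rightarrow> real" where
  "gr_ring_one g = (if g = mat 1 then 1 else 0)"

definition gr_ring_mult :: "(real^2^2 \<Rightarrow> real) \<Rightarrow> (real^2^2 \<Rightarrow> real) \<Rightarrow> real^2^2 \<Rightarrow> real" where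
  "gr_ring_mult f h g = (\<Sum>u | f u \<noteq> 0. f u * h (matrix_inv u ** g))"

definition ring_action :: "(real^2^2 \<Rightarrow> 'm \<Rightarrow> 'm::real_vector) \<Rightarrow> (real^2^2 \<Rightarrow> real) \<Rightarrow> 'm \<Rightarrow> 'm" where
  "ring_action \<pi> f = (\<lambda>v. \<Sum>g | f g \<noteq> 0. f g *\<^sub>R \<pi> g v)"

definition bounded_group_ring_action :: "(real^2^2 \<Rightarrow> 'm \<Rightarrow> 'm::real_normed_vector) \<Rightarrow> bool" where
  "bounded_group_ring_action \<pi> \<longleftrightarrow>
     (\<forall>f\<in>group_ring. bounded_linear (ring_action \<pi> f)) \<and>
     ring_action \<pi> gr_ring_one = id \<and>
     (\<forall>f\<in>group_ring. \<forall>h\<in>group_ring.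
        ring_action \<pi> (f + h) = ring_action \<pi> f + ring_action \<pi> h \<and>
        ring_action \<pi> (gr_ring_mult f h) = ring_action \<pi> f \<circ> ring_action \<pi> h) \<and>
     (\<forall>f\<in>group_ring. \<forall>r. ring_action \<pi> (r *\<^sub>R f) = r *\<^sub>R ring_action \<pi> f)"


section \<open>The operator and its analytic properties\<close>

definition Phi_eigenvalue :: "int \<Rightarrow> int \<Rightarrow> int" where
  "Phi_eigenvalue p q = (if 2 * p \<le> q then p else p - 1)"

definition Phi_alg :: "'a cochain \<times> 'a cochain \<Rightarrow> 'a cochain \<times> 'a cochain" where
  "Phi_alg x = (\<Sum>(p, q) \<in> gr_support x. of_int (Phi_eigenvalue p q) *\<^sub>R gr p q x)"

text \<open>Unbounded operators on a Hilbert space are represented by their graphs. $\Phi$ on the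
  completion is the closure of $\Phi$ on $H^\cdot(X^*)$.\<close>

definition Phi ::
  "'a chart set \<Rightarrow> ('a cochain \<times> 'a cochain \<Rightarrow> 'm::real_normed_vector) \<Rightarrow> ('m \<times> 'm) set" where
  "Phi \<A> \<iota> = closure {(\<iota> x, \<iota> (Phi_alg x)) | x. x \<in> cone_cocycles \<A>}"

definition adjoint_graph :: "('m::real_inner \<times> 'm) set \<Rightarrow> ('m \<times> 'm) set" where
  "adjoint_graph G = {(u, v). \<forall>(x, y)\<in>G. y \<bullet> u = x \<bullet> v}"

definition self_adjoint :: "('m::real_inner \<times> 'm) set \<Rightarrow> bool" where
  "self_adjoint G \<longleftrightarrow>
     subspace G \<and> single_valued G \<and> closure (Domain G) = UNIV \<and> adjoint_graph G = G"

definition compact_operator :: "('m::real_normed_vector \<Rightarrow> 'n::real_normed_vector) \<Rightarrow> bool" where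
  "compact_operator T \<longleftrightarrow> bounded_linear T \<and> compact (closure (T ` cball 0 1))"

text \<open>Graph of $\Phi - s$ on the complexification of the real Hilbert space, with \<open>(u, v)\<close> standing
  for $u + iv$.\<close>

definition shifted_complexification :: "('m::real_vector \<times> 'm) set \<Rightarrow> complex \<Rightarrow>
    (('m \<times> 'm) \<times> ('m \<times> 'm)) set" where
  "shifted_complexification G s =
     {((u, v), (u' - Re s *\<^sub>R u + Im s *\<^sub>R v, v' - Re s *\<^sub>R v - Im s *\<^sub>R u)) | u u' v v'.
        (u, u') \<in> G \<and> (v, v') \<in> G}"

definition compact_resolvent :: "('m::real_inner \<times> 'm) set \<Rightarrow> bool" where
  "compact_resolvent G \<longleftrightarrow> (\<forall>s. s \<notin> \<real> \<longrightarrow>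
     (\<exists>R. compact_operator R \<and> {(R z, z) | z. True} = shifted_complexification G s))"

text \<open>\<open>a\<close> preserves the domain and the commutator, defined there, extends to a bounded operator.\<close>

definition bounded_commutator :: "('m::real_normed_vector \<times> 'm) set \<Rightarrow> ('m \<Rightarrow> 'm) \<Rightarrow> bool" where
  "bounded_commutator G a \<longleftrightarrow> (\<exists>B. bounded_linear B \<and>
     (\<forall>(x, y)\<in>G. \<exists>z. (a x, z) \<in> G \<and> z - a y = B x))"

text \<open>\<open>P\<close> is the absolute value of the self-adjoint operator \<open>G\<close>: the positive self-adjoint operator
  with $P^2 = G^2$.\<close>

definition is_abs_operator :: "('m::real_inner \<times> 'm) set \<Rightarrow> ('m \<times> 'm) set \<Rightarrow> bool" where
  "is_abs_operator G P \<longleftrightarrow> self_adjoint P \<and> (\<forall>(x, y)\<in>P. 0 \<le> x \<bullet> y) \<and> P O P = G O G"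

definition zero_modes :: "('m::real_vector \<times> 'm) set \<Rightarrow> 'm set" where
  "zero_modes G = {v. (v, 0) \<in> G}"

text \<open>\<open>T\<close> is the inverse of \<open>P\<close> on the orthogonal complement of the kernel of \<open>P\<close>, extended by 0 to
  the kernel.\<close>

definition inverse_off_zero_modes :: "('m::real_inner \<times> 'm) set \<Rightarrow> ('m \<Rightarrow> 'm) \<Rightarrow> bool" where
  "inverse_off_zero_modes P T \<longleftrightarrow> bounded_linear T \<and>
     (\<forall>x\<in>zero_modes P. T x = 0) \<and>
     (\<forall>x. (\<forall>n\<in>zero_modes P. n \<bullet> x = 0) \<longrightarrow>
        (T x, x) \<in> P \<and> (\<forall>n\<in>zero_modes P. n \<bullet> T x = 0))"

text \<open>\<open>\<mu>\<close> lists the positive eigenvalues of \<open>T\<close> in decreasing order with multiplicities, padded by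
  zeros if there are only finitely many.\<close>

definition infinitesimal_of_order_one :: "('m::real_inner \<Rightarrow> 'm) \<Rightarrow> bool" where
  "infinitesimal_of_order_one T \<longleftrightarrow> compact_operator T \<and>
     (\<forall>x y. T x \<bullet> y = x \<bullet> T y) \<and> (\<forall>x. 0 \<le> T x \<bullet> x) \<and>
     (\<exists>\<mu> :: nat \<Rightarrow> real. decseq \<mu> \<and> (\<forall>k. 0 \<le> \<mu> k) \<and>
        (\<forall>s>0. finite {k. \<mu> k = s} \<and> card {k. \<mu> k = s} = dim {x. T x = s *\<^sub>R x}) \<and>
        \<mu> \<in> O(\<lambda>k. 1 / real k))"

definition one_summable :: "('m::real_inner \<times> 'm) set \<Rightarrow> bool" where
  "one_summable G \<longleftrightarrow>
     (\<exists>P T. is_abs_operator G P \<and> inverse_off_zero_modes P T \<and> infinitesimal_of_order_one T)"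

end

theory Submission
 imports Defs "HOL-Complex_Analysis.Complex_Analysis"
begin

text \<open>The weight decomposition and the infinitesimal $\mathrm{sl}(2)$-actions are recovered from
 \<open>\<sigma>\<close> itself. By the Lefschetz decomposition the cone cohomology is the sum of the kernel of \<open>N\<close> in
 nonnegative first weight \<open>i\<close> and of the kernel of the adjoint lowering operator in nonpositive first
 weight. On bidegree $(i,j)$ the operator \<open>\<Phi>\<close> is the scalar $(1+j-i)/2$;
 \<open>i\<close> commutes with the second factor and $j \in \{-1,0,1\}$, so commutators with the group ring
 only see the bounded weight \<open>j\<close>. The eigenspaces have uniformly bounded dimension: for $j = \mp 1$
 classes are determined by constant functions, and for $j = 0$ by the first cohomology, which is finite
 dimensional since a closed form has local primitives and finitely many test points detect exactness.\<close>

text \<open>The hypotheses give a representation of the group on algebraic classes, without any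
  bound or continuity for a single operator and without a lowering operator. Limits are therefore
  never moved through \<open>\<sigma>\<close>: matrix coefficients are tested against weight
  vectors, where the torus makes them homogeneous in the parameter and forces the exponential
  series. The lowering operator is defined by conjugating with the Weyl element; its commutator with
  \<open>N\<close> is read off from a matrix identity, and its adjointness to \<open>N\<close> comes
  from the skewness of the polarization under \<open>N\<close>. Adjointness then replaces finite
  dimension: positivity of norms yields the Lefschetz decomposition for an \<open>N\<close> that is
  only locally nilpotent. Kernel and cokernel classes of the cone can share a bidegree, so the cone
  is modelled in two copies of the Hilbert space, as \<open>kerN \<times> kerF\<close>. The model
  also removes the choices of representatives hidden in the definitions of the inner product and of
  the duality, and every operator on the abstract completion is transported from it.\<close>

lemma lin_zero: "linear_on_subspace V f ==> f 0 = 0"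
 unfolding linear_on_subspace_def by (metis scale_zero_left subspace_0)

lemma lin_subspace: "linear_on_subspace V f ==> subspace V"
 by (simp add: linear_on_subspace_def)

lemma lin_add:
 "linear_on_subspace V f ==> x \<in> V ==> y \<in> V ==> f (x + y) = f x + f y"
 by (simp add: linear_on_subspace_def)

lemma lin_scale:
 "linear_on_subspace V f ==> x \<in> V ==> f (r *\<^sub>R x) = r *\<^sub>R f x"
 by (simp add: linear_on_subspace_def)

lemma lin_minus:
 "linear_on_subspace V f ==> x \<in> V ==> f (- x) = - f x"
 using lin_scale[of V f x "-1"] by simp

lemma lin_diff:
 "linear_on_subspace V f ==> x \<in> V ==> y \<in> V ==> f (x - y) = f x - f y"
 using lin_add[of V f x "- y"] lin_minus[of V f y]
 by (simp add: lin_subspace subspace_neg)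

lemma lin_sum:
 assumes "linear_on_subspace V f" "\<And>i. i \<in> I ==> x i \<in> V"
 shows "f (\<Sum>i\<in>I. x i) = (\<Sum>i\<in>I. f (x i))"
proof (cases "finite I")
 case True
 thus ?thesis using assms(2)
 proof (induction I rule: finite_induct)
  case empty
  thus ?case using lin_zero[OF assms(1)] by simp
 next
  case (insert i I)
  have "(\<Sum>i\<in>I. x i) \<in> V"
   using insert by (intro subspace_sum lin_subspace[OF assms(1)]) auto
  thus ?case using insert lin_add[OF assms(1)] by simp
 qed
qed (use lin_zero[OF assms(1)] in simp)

lemma lin_sum_scale:
 assumes f: "linear_on_subspace V f" and x: "\<And>i. i \<in> I ==> x i \<in> V" shows "f (\<Sum>i\<in>I. c i *\<^sub>R x i) = (\<Sum>i\<in>I. c i *\<^sub>R f (x i))"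
 using lin_sum[OF f, of I "\<lambda>i. c i *\<^sub>R x i"] subspace_scale[OF lin_subspace[OF f] x] lin_scale[OF f x] by simp

lemma lin_mono:
 "linear_on_subspace V f ==> U \<subseteq> V ==> subspace U ==> linear_on_subspace U f"
 unfolding linear_on_subspace_def by blast

lemma lin_image: assumes "linear_on_subspace V f" shows "subspace (f ` V)"
 unfolding subspace_def
 using lin_subspace[OF assms] lin_zero[OF assms]
 by (auto simp: lin_add[OF assms, symmetric] lin_scale[OF assms, symmetric] subspace_add subspace_scale
   intro: image_eqI[of 0 f 0] subspace_0)

lemma lin_span: assumes f: "linear_on_subspace V f" and S: "S \<subseteq> V" shows "f ` span S = span (f ` S)"
proof
 have l: "linear_on_subspace (span S) f" by (rule lin_mono[OF f span_minimal[OF S lin_subspace[OF f]] subspace_span])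
 show "span (f ` S) \<subseteq> f ` span S" by (rule span_minimal[OF image_mono[OF span_superset] lin_image[OF l]])
 have "subspace {x \<in> span S. f x \<in> span (f ` S)}"
  using lin_add[OF l] lin_scale[OF l] lin_zero[OF l] by (auto simp: subspace_def span_zero span_add span_scale)
 hence "span S \<subseteq> {x \<in> span S. f x \<in> span (f ` S)}" by (intro span_minimal) (auto intro: span_base)
 thus "f ` span S \<subseteq> span (f ` S)" by blast
qed

lemma linI:
 "subspace V ==> (\<And>x y. x \<in> V ==> y \<in> V ==> f (x + y) = f x + f y) ==>
  (\<And>r x. x \<in> V ==> f (r *\<^sub>R x) = r *\<^sub>R f x) ==> linear_on_subspace V f"
 by (simp add: linear_on_subspace_def)

lemma lin_cong: "linear_on_subspace V f ==> (\<And>x. x \<in> V ==> g x = f x) ==> linear_on_subspace V g"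
 unfolding linear_on_subspace_def by (simp add: subspace_add subspace_scale)

lemma lin_compose:
 "linear_on_subspace V f ==> linear_on_subspace U g ==> (\<And>x. x \<in> V ==> f x \<in> U) ==> linear_on_subspace V (\<lambda>x. g (f x))"
 unfolding linear_on_subspace_def by simp

lemma lin_Pair: "linear_on_subspace V f ==> linear_on_subspace V g ==> linear_on_subspace V (\<lambda>x. (f x, g x))"
 unfolding linear_on_subspace_def by simp

lemma lin_plus: "linear_on_subspace V f ==> linear_on_subspace V g ==> linear_on_subspace V (\<lambda>x. f x + g x)"
 unfolding linear_on_subspace_def by (simp add: scaleR_add_right add_ac del: plus_fun_apply)

lemma lin_uminus: "linear_on_subspace V f ==> linear_on_subspace V (\<lambda>x. - f x)"
 unfolding linear_on_subspace_def by (simp del: plus_fun_apply uminus_apply)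

lemma lin_fst: "subspace V ==> linear_on_subspace V fst" and lin_snd: "subspace V ==> linear_on_subspace V snd"
 by (simp_all add: linear_on_subspace_def)

text \<open>Linearity descends along a surjection. The map \<open>f\<close> is already given as a
  function with \<open>f (g x) = h x\<close>, so well-definedness is contained in that equation. It
  serves the passage to classes and later the passage to the completion.\<close>

lemma lin_factor:
 assumes g: "linear_on_subspace V g" and h: "linear_on_subspace V h" and f: "\<And>x. x \<in> V ==> f (g x) = h x"
 shows "linear_on_subspace (g ` V) f"
 using lin_subspace[OF g]
 by (intro linI lin_image[OF g])
  (auto simp: lin_add[OF g, symmetric] lin_scale[OF g, symmetric] f lin_add[OF h] lin_scale[OF h] subspace_add subspace_scale)

lemma lin_kernel:
 assumes "subspace V" "\<And>i. i \<in> I ==> linear_on_subspace V (f i)" shows "subspace {v \<in> V. \<forall>i\<in>I. f i v = 0}"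
 using assms(1) lin_add[OF assms(2)] lin_scale[OF assms(2)] lin_zero[OF assms(2)] by (auto simp: subspace_def)

lemma lin_id: "subspace V ==> linear_on_subspace V (\<lambda>x. x)"
 and lin_0: "subspace V ==> linear_on_subspace V (\<lambda>x. 0)"
 and lin_scaleR: "subspace V ==> linear_on_subspace V (\<lambda>x. c *\<^sub>R x)"
 by (simp_all add: linear_on_subspace_def scaleR_add_right)

section \<open>Weights of $\mathrm{SL}(2,\mathbb{R})$-representations\<close>

text \<open>Adjointness of \<open>E\<close> and \<open>F\<close> takes the place of finite
  dimension: the weight spaces may be infinite-dimensional, and nilpotency is only local.\<close>

locale sl2_module =
 fixes W :: "int => 'h::real_inner set" and E F :: "'h => 'h"
 assumes E_lin: "linear_on_subspace (W m) E" and F_lin: "linear_on_subspace (W m) F"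
  and E_in: "x \<in> W m ==> E x \<in> W (m + 2)"
  and F_in: "x \<in> W m ==> F x \<in> W (m - 2)"
  and adj: "x \<in> W m ==> y \<in> W (m + 2) ==> E x \<bullet> y = x \<bullet> F y"
  and comm: "x \<in> W m ==> E (F x) - F (E x) = of_int m *\<^sub>R x"
  and E_nil: "x \<in> W m ==> \<exists>k. (E ^^ k) x = 0"
  and F_nil: "x \<in> W m ==> \<exists>k. (F ^^ k) x = 0"
begin

text \<open>Reversing the grading exchanges raising and lowering and keeps all axioms, so each
  statement about \<open>E\<close> has a mirror image about \<open>F\<close>.\<close>

lemma swap: "sl2_module (\<lambda>m. W (- m)) F E"
proof
 fix x m assume x: "x \<in> W (- m)"
 show "F x \<in> W (- (m + 2))" "E x \<in> W (- (m - 2))"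
  using F_in[OF x] E_in[OF x] by (simp_all add: algebra_simps)
 show "F (E x) - E (F x) = of_int m *\<^sub>R x" using comm[OF x] by (simp add: algebra_simps)
 show "\<exists>k. (F ^^ k) x = 0" "\<exists>k. (E ^^ k) x = 0" using E_nil[OF x] F_nil[OF x] by auto
 fix y assume "y \<in> W (- (m + 2))"
 thus "F x \<bullet> y = x \<bullet> E y"
  using adj[of y "- (m + 2)" x] x by (simp add: inner_commute)
qed (rule F_lin E_lin)+

lemma sub: "subspace (W m)"
 using E_lin lin_subspace by blast

lemma Epow_in: "x \<in> W m ==> (E ^^ k) x \<in> W (m + 2 * int k)"
proof (induction k)
 case (Suc k)
 thus ?case using E_in[of "(E ^^ k) x" "m + 2 * int k"] by (simp add: algebra_simps)
qed simp

lemma Epow_lin: "linear_on_subspace (W m) (E ^^ k)"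
proof (induction k)
 case 0 thus ?case using sub by (simp add: linear_on_subspace_def)
next
 case (Suc k)
 have i: "(E ^^ k) x \<in> W (m + 2 * int k)" if "x \<in> W m" for x using Epow_in that by blast
 show ?case unfolding linear_on_subspace_def
  using sub lin_add[OF Suc] lin_scale[OF Suc]
   lin_add[OF E_lin i i] lin_scale[OF E_lin i]
  by simp
qed

text \<open>One \<open>E\<close> moves across as \<open>F\<close> and is commuted back. The sign of
  the weight then decides injectivity; this positivity replaces a classification of irreducible
  modules.\<close>

lemma norm_E:
 assumes x: "x \<in> W m" shows "E x \<bullet> E x = F x \<bullet> F x - of_int m * (x \<bullet> x)"
proof -
 have "E x \<bullet> E x = x \<bullet> F (E x)" using adj[OF x E_in[OF x]] .
 also have "F (E x) = E (F x) - of_int m *\<^sub>R x" using comm[OF x] by (simp add: algebra_simps)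
 also have "x \<bullet> (E (F x)) = F x \<bullet> F x"
  using adj[of "F x" "m - 2" x] F_in[OF x] x by (simp add: inner_commute)
 ultimately show ?thesis by (simp add: inner_diff_right)
qed

text \<open>For negative weight \<open>norm_E\<close> writes the squared norm of \<open>E x\<close>
  as a sum of two nonnegative terms, one of them a positive multiple of
  \<open>x \<bullet> x\<close>.\<close>

lemma E_inj:
 assumes "x \<in> W m" "m < 0" "E x = 0" shows "x = 0"
proof -
 have "0 = F x \<bullet> F x + of_int (- m) * (x \<bullet> x)" using norm_E[OF assms(1)] assms(3) by simp
 moreover have "F x \<bullet> F x \<ge> 0" "of_int (- m) * (x \<bullet> x) \<ge> 0"
  using assms(2) by (simp_all add: mult_nonpos_nonneg)
 ultimately have "of_int (- m) * (x \<bullet> x) = 0" by linarith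
 thus ?thesis using assms(2) by simp
qed

lemma F_Epow: \<comment> \<open>$[F,E^k]$ on a weight space\<close>
 assumes x: "x \<in> W m"
 shows "F ((E ^^ Suc k) x) = (E ^^ Suc k) (F x) - (of_nat (Suc k) * of_int (m + int k)) *\<^sub>R (E ^^ k) x"
proof (induction k)
 case 0 thus ?case using comm[OF x] by (simp add: algebra_simps)
next
 case (Suc k)
 let ?y = "(E ^^ Suc k) x"
 have y: "?y \<in> W (m + 2 * int (Suc k))" using Epow_in[OF x] .
 have k: "(E ^^ k) x \<in> W (m + 2 * int k)" using Epow_in[OF x] .
 have fx: "(E ^^ Suc k) (F x) \<in> W (m - 2 + 2 * int (Suc k))" using Epow_in[OF F_in[OF x]] .
 have eq: "m - 2 + 2 * int (Suc k) = m + 2 * int k" by simp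
 have "F ((E ^^ Suc (Suc k)) x) = E (F ?y) - of_int (m + 2 * int (Suc k)) *\<^sub>R ?y"
  using comm[OF y] by (simp add: algebra_simps)
 also have "E (F ?y) = E ((E ^^ Suc k) (F x)) - (of_nat (Suc k) * of_int (m + int k)) *\<^sub>R E ((E ^^ k) x)"
  unfolding Suc using fx[unfolded eq] k sub
  by (subst lin_diff[OF E_lin[of "m + 2 * int k"]])
   (auto intro: subspace_scale simp: lin_scale[OF E_lin[of "m + 2 * int k"]])
 also have "E ((E ^^ Suc k) (F x)) - (of_nat (Suc k) * of_int (m + int k)) *\<^sub>R E ((E ^^ k) x)
   - of_int (m + 2 * int (Suc k)) *\<^sub>R ?y
  = (E ^^ Suc (Suc k)) (F x) - (of_nat (Suc k) * of_int (m + int k) + of_int (m + 2 * int (Suc k))) *\<^sub>R ?y"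
  unfolding scaleR_left_distrib by simp
 also have "of_nat (Suc k) * of_int (m + int k) + of_int (m + 2 * int (Suc k))
  = (of_nat (Suc (Suc k)) * of_int (m + int (Suc k)) :: real)" by (simp add: algebra_simps)
 finally show ?case .
qed

text \<open>Induction on the nilpotency order of \<open>F\<close> at \<open>x\<close>. For a
  suitable constant the vector \<open>E (F x) - c x\<close> is killed by one power of
  \<open>F\<close> less, so the induction hypothesis splits it, and division by \<open>c\<close>
  recovers \<open>x\<close>.\<close>

lemma lowest_decomposition:
 assumes "m \<le> 0" "x \<in> W m" shows "\<exists>e\<in>W (m - 2). \<exists>f\<in>W m. x = E e + f \<and> F f = 0"
proof -
 interpret s: sl2_module "\<lambda>m. W (- m)" F E by (rule swap)
 have "x \<in> W m ==> (F ^^ Suc k) x = 0 ==> \<exists>e\<in>W (m - 2). \<exists>f\<in>W m. x = E e + f \<and> F f = 0" for k x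
 proof (induction k arbitrary: x)
  case 0
  thus ?case using lin_zero[OF E_lin] subspace_0[OF sub] by (intro bexI[of _ 0] bexI[of _ x]) simp_all
 next
  case (Suc k)
  \<comment> \<open>The coefficient of the commutator of \<open>E\<close> with
    \<open>F ^^ Suc k\<close> at \<open>F x\<close>, taken in the swapped module, where
    \<open>F x\<close> has weight \<open>2 - m\<close>. It is positive because \<open>m\<close> is
    at most 0.\<close>
  define c where "c = real (Suc k) * real_of_int (2 - m + int k)"
  have c: "c \<noteq> 0" using assms(1) unfolding c_def mult_eq_0_iff of_int_eq_0_iff of_nat_eq_0_iff by linarith
  have Fx: "F x \<in> W (m - 2)" "F x \<in> W (- (2 - m))" using F_in[OF Suc.prems(1)] by simp_all
  have u: "E (F x) \<in> W m" using E_in[OF Fx(1)] by simp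
  have lin: "linear_on_subspace (W m) (F ^^ Suc k)" using s.Epow_lin[of "- m" "Suc k"] by (simp del: funpow.simps)
  have "(F ^^ Suc k) (F x) = 0" "(F ^^ k) (F x) = (F ^^ Suc k) x" using Suc.prems(2) by (simp_all add: funpow_swap1)
  hence "(F ^^ Suc k) (E (F x)) = c *\<^sub>R (F ^^ Suc k) x"
   using s.F_Epow[OF Fx(2), of k] lin_zero[OF E_lin] unfolding c_def by (simp del: funpow.simps)
  hence "(F ^^ Suc k) (E (F x) - c *\<^sub>R x) = 0"
   using lin_diff[OF lin u subspace_scale[OF sub Suc.prems(1)]] lin_scale[OF lin Suc.prems(1)] by simp
  from Suc.IH[OF subspace_diff[OF sub u subspace_scale[OF sub Suc.prems(1)]] this]
  obtain e f where ef: "e \<in> W (m - 2)" "f \<in> W m" "E (F x) - c *\<^sub>R x = E e + f" "F f = 0" by blast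
  have "E ((1 / c) *\<^sub>R (F x - e)) = (1 / c) *\<^sub>R (E (F x) - E e)"
   using lin_scale[OF E_lin subspace_diff[OF sub Fx(1) ef(1)]] lin_diff[OF E_lin Fx(1) ef(1)] by simp
  also have "E (F x) - E e = c *\<^sub>R x + f" using ef(3) by (simp add: algebra_simps)
  finally have "x = E ((1 / c) *\<^sub>R (F x - e)) + (- (1 / c)) *\<^sub>R f" using c by (simp add: scaleR_add_right)
  moreover have "(1 / c) *\<^sub>R (F x - e) \<in> W (m - 2)" "(- (1 / c)) *\<^sub>R f \<in> W m" "F ((- (1 / c)) *\<^sub>R f) = 0"
   using subspace_scale[OF sub subspace_diff[OF sub Fx(1) ef(1)]] subspace_scale[OF sub ef(2)] lin_scale[OF F_lin ef(2), of "- (1 / c)"] ef(4)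
   by (blast, blast, simp)
  ultimately show ?case by blast
 qed
 moreover obtain k where "(F ^^ k) x = 0" using F_nil assms(2) by blast
 hence "(F ^^ Suc k) x = 0" using lin_zero[OF F_lin] by simp
 ultimately show ?thesis using assms(2) by blast
qed

lemma F_Epow_lowest:
 assumes "f \<in> W m" "F f = 0"
 shows "F ((E ^^ Suc k) f) = (- (of_nat (Suc k) * of_int (m + int k))) *\<^sub>R (E ^^ k) f"
 using F_Epow[OF assms(1), of k] assms(2) lin_zero[OF Epow_lin[of m "Suc k"]]
 by (simp del: funpow.simps)

text \<open>At weight \<open>- n\<close> the commutator coefficient of \<open>F\<close> with
  \<open>E ^^ Suc n\<close> is a multiple of \<open>- n + n\<close>, hence 0. One further
  \<open>E\<close> adapts the exponent to the weight \<open>- (n + 2)\<close> of \<open>F x\<close>,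
  as the induction in \<open>Epow_inj\<close> wants it.\<close>

lemma E_Suc_F: assumes "x \<in> W (- int n)" "(E ^^ Suc n) x = 0" shows "(E ^^ Suc (Suc n)) (F x) = 0"
proof -
 have "(E ^^ Suc n) (F x) = 0" using F_Epow[OF assms(1), of n] assms(2) lin_zero[OF F_lin] by (simp del: funpow.simps)
 thus ?thesis using lin_zero[OF E_lin] by simp
qed

text \<open>\<open>F\<close> kills \<open>(E ^^ Suc n) f\<close> because the commutator coefficient
  vanishes there, while this vector has the positive weight \<open>n + 2\<close>. Then
  \<open>norm_E\<close> equates a squared norm with a negative multiple of another one, so both
  vanish.\<close>

lemma lowest_top:
 assumes "f \<in> W (- int n)" "F f = 0" shows "(E ^^ Suc n) f = 0"
proof -
 let ?u = "(E ^^ Suc n) f"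
 have u: "?u \<in> W (int n + 2)" using Epow_in[OF assms(1), of "Suc n"] by (simp add: algebra_simps del: funpow.simps)
 have "F ?u = 0" using F_Epow_lowest[OF assms, of n] by simp
 hence "E ?u \<bullet> E ?u = - of_int (int n + 2) * (?u \<bullet> ?u)" using norm_E[OF u] by (simp del: funpow.simps add: algebra_simps)
 moreover have "E ?u \<bullet> E ?u \<ge> 0" "?u \<bullet> ?u \<ge> 0" by (rule inner_ge_zero)+
 ultimately have "?u \<bullet> ?u = 0"
  by (smt (verit, best) minus_mult_minus mult_minus_left mult_nonneg_nonneg mult_pos_pos of_int_0_less_iff of_nat_0_le_iff)
 thus ?thesis by simp
qed

text \<open>Up to exponent \<open>n\<close> the coefficients in \<open>F_Epow_lowest\<close> are
  nonzero, so \<open>F\<close> leads back from \<open>(E ^^ k) f\<close> to \<open>f\<close> one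
  power at a time.\<close>

lemma lowest_inj:
 assumes "f \<in> W (- int n)" "F f = 0" "k \<le> n" "(E ^^ k) f = 0" shows "f = 0"
 using assms(3,4)
proof (induction k)
 case (Suc k)
 have "real (Suc k) * real_of_int (- int n + int k) \<noteq> 0" using Suc.prems(1) by simp
 moreover have "(real (Suc k) * real_of_int (- int n + int k)) *\<^sub>R (E ^^ k) f = 0"
  using F_Epow_lowest[OF assms(1,2), of k] Suc.prems(2) lin_zero[OF F_lin] by (simp del: funpow.simps)
 ultimately have "(E ^^ k) f = 0" by (simp only: scaleR_eq_0_iff) blast
 thus ?case using Suc by simp
qed simp

text \<open>The injective half of hard Lefschetz, by induction on the nilpotency order of
  \<open>F\<close>: the vector \<open>F x\<close> satisfies the hypothesis at weight
  \<open>- (n + 2)\<close>, so it is 0, and \<open>x\<close> is a lowest weight vector to which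
  \<open>lowest_inj\<close> applies.\<close>

lemma Epow_inj: assumes "x \<in> W (- int n)" "(E ^^ n) x = 0" shows "x = 0"
proof -
 have "x \<in> W (- int n) ==> (F ^^ k) x = 0 ==> (E ^^ n) x = 0 ==> x = 0" for k
 proof (induction k arbitrary: n x)
  case (Suc k)
  have "(E ^^ Suc n) x = 0" using Suc.prems(3) lin_zero[OF E_lin] by simp
  from E_Suc_F[OF Suc.prems(1) this] have "F x = 0"
   using Suc.IH[of "F x" "Suc (Suc n)"] F_in[OF Suc.prems(1)] Suc.prems(2) by (simp add: funpow_swap1 algebra_simps)
  thus ?case by (rule lowest_inj[OF Suc.prems(1) _ order_refl Suc.prems(3)])
 qed simp
 thus ?thesis using assms F_nil by blast
qed

text \<open>Converse of \<open>lowest_top\<close>, so both descriptions of primitive vectors agree: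
  \<open>F f\<close> has weight \<open>- (n + 2)\<close>, where \<open>E_Suc_F\<close> and
  \<open>Epow_inj\<close> force it to be 0.\<close>

lemma lowest_of_power: "f \<in> W (- int n) ==> (E ^^ Suc n) f = 0 ==> F f = 0"
 using Epow_inj[of "F f" "Suc (Suc n)"] F_in[of f "- int n"] E_Suc_F[of f n] by (simp add: algebra_simps)

text \<open>Counterpart of \<open>lowest_decomposition\<close>, by induction on the nilpotency order
  of \<open>E\<close>. Nothing is left over here, since the constant
  \<open>(k + 1) * (m + 2 + k)\<close> is positive from \<open>m = - 1\<close> on.\<close>

lemma E_surj: assumes "- 1 \<le> m" "x \<in> W (m + 2)" shows "\<exists>y\<in>W m. E y = x"
proof -
 have "x \<in> W (m + 2) ==> (E ^^ k) x = 0 ==> \<exists>y\<in>W m. E y = x" for k x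
 proof (induction k arbitrary: x)
  case 0
  thus ?case using lin_zero[OF E_lin] subspace_0[OF sub] by (intro bexI[of _ 0]) simp_all
 next
  case (Suc k)
  define c where "c = real (Suc k) * real_of_int (m + 2 + int k)"
  have c: "c \<noteq> 0" using assms(1) unfolding c_def mult_eq_0_iff of_int_eq_0_iff of_nat_eq_0_iff by linarith
  have Fx: "F x \<in> W m" using F_in[OF Suc.prems(1)] by simp
  note u = E_in[OF Fx] and cx = subspace_scale[OF sub Suc.prems(1), of c]
  have "(E ^^ k) (E (F x)) = c *\<^sub>R (E ^^ k) x"
   using F_Epow[OF Suc.prems(1), of k] Suc.prems(2) lin_zero[OF F_lin] unfolding c_def by (simp add: funpow_swap1)
  hence "(E ^^ k) (E (F x) - c *\<^sub>R x) = 0"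
   using lin_diff[OF Epow_lin u cx] lin_scale[OF Epow_lin Suc.prems(1)] by simp
  from Suc.IH[OF subspace_diff[OF sub u cx] this] obtain y where y: "y \<in> W m" "E y = E (F x) - c *\<^sub>R x" by blast
  have "E ((1 / c) *\<^sub>R (F x - y)) = (1 / c) *\<^sub>R (E (F x) - E y)"
   using lin_scale[OF E_lin subspace_diff[OF sub Fx y(1)]] lin_diff[OF E_lin Fx y(1)] by simp
  hence "E ((1 / c) *\<^sub>R (F x - y)) = x" using y(2) c by simp
  thus ?case using subspace_scale[OF sub subspace_diff[OF sub Fx y(1)]] by blast
 qed
 thus ?thesis using assms(2) E_nil by blast
qed

end

section \<open>Generators and matrix identities of SL(2,R)\<close>

definition weyl_inv :: "real^2^2" where
 "weyl_inv = vector [vector [0, - 1], vector [1, 0]]"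

text \<open>The one-parameter group of the lower nilpotent matrix, conjugate to \<open>exp_E\<close>
  under \<open>weyl\<close>.\<close>

definition lower :: "real => real^2^2" where
 "lower s = vector [vector [1, 0], vector [s, 1]]"

lemma vector2_mult:
 "(vector [vector [a, b], vector [c, d]] :: real^2^2) ** (vector [vector [a', b'], vector [c', d']] :: real^2^2)
  = vector [vector [a * a' + b * c', a * b' + b * d'], vector [c * a' + d * c', c * b' + d * d']]"
 by (simp add: vec_eq_iff forall_2 matrix_matrix_mult_def sum_2)

lemma vector2_eq_iff:
 "(vector [vector [a, b], vector [c, d]] :: real^2^2) = vector [vector [a', b'], vector [c', d']]
  \<longleftrightarrow> a = a' \<and> b = b' \<and> c = c' \<and> d = d'"
 by (simp add: vec_eq_iff forall_2)

lemma mat_1_vector2: "(mat 1 :: real^2^2) = vector [vector [1, 0], vector [0, 1]]"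
 by (simp add: vec_eq_iff forall_2 mat_def)

lemma vector2_exhaust:
 obtains a b c d where "(g :: real^2^2) = vector [vector [a, b], vector [c, d]]"
 by (rule that[of "g $ 1 $ 1" "g $ 1 $ 2" "g $ 2 $ 1" "g $ 2 $ 2"]) (simp add: vec_eq_iff forall_2)

lemma SL2_vector2: "(vector [vector [a, b], vector [c, d]] :: real^2^2) \<in> SL2 \<longleftrightarrow> a * d - b * c = 1"
 by (simp add: SL2_def det_2)

lemmas sl2_defs = weyl_def weyl_inv_def lower_def exp_E_def diag2_def mat_1_vector2

lemma SL2_mat_1 [simp, intro]: "mat 1 \<in> SL2"
 and SL2_weyl [simp, intro]: "weyl \<in> SL2" and SL2_weyl_inv [simp, intro]: "weyl_inv \<in> SL2"
 and SL2_exp_E [simp, intro]: "exp_E t \<in> SL2" and SL2_lower [simp, intro]: "lower t \<in> SL2"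
 and SL2_diag2 [simp, intro]: "a \<noteq> 0 ==> diag2 a \<in> SL2"
 by (simp_all add: sl2_defs SL2_vector2)

lemma SL2_mult [simp, intro]: "g \<in> SL2 ==> h \<in> SL2 ==> g ** h \<in> SL2"
 by (simp add: SL2_def det_mul)

text \<open>Bruhat decomposition. A matrix with lower left entry \<open>c \<noteq> 0\<close> is a
  product of upper unipotents, a diagonal matrix and one \<open>weyl\<close>. If
  \<open>c = 0\<close>, multiplying by \<open>weyl\<close> moves into this open cell, and
  \<open>weyl ** weyl = diag2 (- 1)\<close> moves back.\<close>

lemma SL2_induct [consumes 1, case_names mult diag exp weyl]:
 assumes g: "g \<in> SL2"
  and mult: "\<And>g h. g \<in> SL2 ==> h \<in> SL2 ==> P g ==> P h ==> P (g ** h)"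
  and diag: "\<And>a. a \<noteq> 0 ==> P (diag2 a)" and exp: "\<And>t. P (exp_E t)" and weyl: "P weyl"
 shows "P g"
proof -
 have 1: "P g" if g: "g \<in> SL2" and c: "g = vector [vector [a, b], vector [c, d]]" "c \<noteq> 0" for g a b c d
 proof -
  have "a * d - b * c = 1" using g unfolding c SL2_vector2 .
  hence "b = (a * d - 1) / c" using c(2) by (simp add: nonzero_eq_divide_eq algebra_simps)
  hence "g = ((exp_E (a / c) ** diag2 (- 1 / c)) ** weyl) ** exp_E (d / c)"
   using c(2) unfolding c(1) sl2_defs vector2_mult vector2_eq_iff
   by (simp add: diff_divide_distrib)
  moreover have "- 1 / c \<noteq> 0" using c by simp
  ultimately show ?thesis by (simp add: mult diag exp weyl)
 qed
 obtain a b c d where gv: "g = vector [vector [a, b], vector [c, d]]" by (rule vector2_exhaust)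
 show ?thesis
 proof (cases "c = 0")
  case True
  hence "a \<noteq> 0" using g unfolding gv SL2_vector2 by auto
  have w: "weyl ** g = vector [vector [c, d], vector [- a, - b]]"
   unfolding gv sl2_defs vector2_mult by simp
  have Pwg: "P (weyl ** g)" using 1[OF _ w] \<open>a \<noteq> 0\<close> g by auto
  have "g = diag2 (- 1) ** (weyl ** (weyl ** g))"
   unfolding gv sl2_defs vector2_mult by simp
  moreover have "P (diag2 (- 1) ** (weyl ** (weyl ** g)))"
   using g by (intro mult diag weyl Pwg SL2_mult SL2_diag2 SL2_weyl) auto
  ultimately show ?thesis by simp
 qed (use 1[OF g gv] in auto)
qed

lemma inner_pick: "finite S ==> b \<in> S ==> (\<And>n. n \<in> S ==> n \<noteq> b ==> x n \<bullet> y = 0) ==> (\<Sum>n\<in>S. x n) \<bullet> y = x b \<bullet> y"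
 by (simp add: inner_sum_left sum.remove[of S b "\<lambda>n. x n \<bullet> y"])

text \<open>No \<open>\<pi> g\<close> is assumed bounded, so limits cannot be taken inside it; the
  only analytic input is the derivative of the upper unipotent orbit at 0. The lowering operator is
  built below.\<close>

locale sl2_rep =
 fixes V :: "'h::real_inner set" and W :: "int => 'h set" and \<pi> :: "real^2^2 => 'h => 'h" and E :: "'h => 'h"
 assumes W_sub: "subspace (W m)" and W_V: "x \<in> W m ==> x \<in> V"
  and decomp: "v \<in> V ==> \<exists>S f. finite S \<and> (\<forall>m. f m \<in> W m) \<and> v = (\<Sum>m\<in>S. f m)"
  and orth: "x \<in> W m ==> y \<in> W n ==> m \<noteq> n ==> x \<bullet> y = 0"
  and pi_lin: "g \<in> SL2 ==> linear_on_subspace V (\<pi> g)"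
  and pi_in: "g \<in> SL2 ==> v \<in> V ==> \<pi> g v \<in> V"
  and pi_one: "v \<in> V ==> \<pi> (mat 1) v = v"
  and pi_mult: "g \<in> SL2 ==> h \<in> SL2 ==> v \<in> V ==> \<pi> (g ** h) v = \<pi> g (\<pi> h v)"
  and pi_diag: "a \<noteq> 0 ==> x \<in> W m ==> \<pi> (diag2 a) x = (a powi m) *\<^sub>R x"
  and pi_deriv: "v \<in> V ==> ((\<lambda>t. \<pi> (exp_E t) v) has_vector_derivative E v) (at 0)"
  and E_lin: "linear_on_subspace V E"
  and E_in: "x \<in> W m ==> E x \<in> W (m + 2)"
  and E_nil: "x \<in> V ==> \<exists>k. (E ^^ k) x = 0"
begin

lemma V_sub: "subspace V" using E_lin lin_subspace by blast

lemma lin_inI: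
 assumes T: "linear_on_subspace V T" and S: "subspace S" and TW: "\<And>m x. x \<in> W m ==> T x \<in> S" and v: "v \<in> V"
 shows "T v \<in> S"
proof -
 obtain I f where f: "\<forall>m. f m \<in> W m" "v = (\<Sum>m\<in>I. f m)" using decomp v by blast
 have "T v = (\<Sum>m\<in>I. T (f m))" unfolding f(2) using f(1) W_V by (auto intro: lin_sum[OF T])
 thus ?thesis using f(1) TW by (auto intro: subspace_sum[OF S])
qed

lemma lin_eq:
 assumes "linear_on_subspace V S" "linear_on_subspace V T" "\<And>m x. x \<in> W m ==> S x = T x" "v \<in> V"
 shows "S v = T v"
 using lin_inI[OF lin_plus[OF assms(1) lin_uminus[OF assms(2)]] subspace_single_0, of v] assms(3,4) by simp

lemma Epow_zero_mono: assumes "(E ^^ k) v = 0" "k \<le> n" shows "(E ^^ n) v = 0"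
proof -
 have "(E ^^ (j + k)) v = 0" for j using assms by (induction j) (simp_all add: lin_zero[OF E_lin])
 thus ?thesis using assms(2) by (metis le_add_diff_inverse2)
qed

lemma E_V: "v \<in> V ==> E v \<in> V"
 by (rule lin_inI[OF E_lin V_sub W_V[OF E_in]])

lemma Epow_V: "v \<in> V ==> (E ^^ k) v \<in> V"
 by (induction k) (auto intro: E_V)

lemma Epow_in: "x \<in> W m ==> (E ^^ k) x \<in> W (m + 2 * int k)"
proof (induction k)
 case (Suc k)
 thus ?case using E_in[of "(E ^^ k) x" "m + 2 * int k"] by (simp add: algebra_simps)
qed simp

lemma eq_0I: assumes "x \<in> V" "\<And>m y. y \<in> W m ==> x \<bullet> y = 0" shows "x = 0"
proof -
 obtain S f where f: "\<forall>m. f m \<in> W m" "x = (\<Sum>m\<in>S. f m)" using decomp assms by blast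
 have "x \<bullet> x = (\<Sum>m\<in>S. x \<bullet> f m)" using f(2) by (metis inner_sum_right)
 also have "\<dots> = 0" using f(1) assms(2) by (intro sum.neutral) auto
 finally show ?thesis by simp
qed

lemma eqI: assumes "x \<in> V" "x' \<in> V" "\<And>m y. y \<in> W m ==> x \<bullet> y = x' \<bullet> y" shows "x = x'"
 using eq_0I[of "x - x'"] assms V_sub by (auto simp: subspace_diff inner_diff_left)

lemma diag_sym:
 assumes x: "x \<in> V" and y: "y \<in> W m" and a: "a \<noteq> 0" shows "\<pi> (diag2 a) x \<bullet> y = a powi m * (x \<bullet> y)"
proof (rule lin_eq[OF _ _ _ x])
 have l: "linear_on_subspace V (\<lambda>x. x \<bullet> y)" using V_sub by (simp add: linear_on_subspace_def inner_add_left)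
 show "linear_on_subspace V (\<lambda>x. \<pi> (diag2 a) x \<bullet> y)" using lin_compose[OF pi_lin l] pi_in a by simp
 show "linear_on_subspace V (\<lambda>x. a powi m * (x \<bullet> y))" using V_sub by (simp add: linear_on_subspace_def inner_add_left distrib_left)
 show "\<pi> (diag2 a) x \<bullet> y = a powi m * (x \<bullet> y)" if "x \<in> W n" for n x
  using pi_diag[OF a that] orth[OF that y] by (cases "n = m") simp_all
qed

lemma in_weight_spaceI:
 assumes "v \<in> V" "\<And>n y. n \<noteq> m ==> y \<in> W n ==> v \<bullet> y = 0" shows "v \<in> W m"
proof -
 obtain S f where f: "finite S" "\<forall>m. f m \<in> W m" "v = (\<Sum>m\<in>S. f m)" using decomp assms by blast
 have "f n = 0" if "n \<in> S" "n \<noteq> m" for n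
 proof -
  have "v \<bullet> f n = f n \<bullet> f n" unfolding f(3) using that by (intro inner_pick[OF f(1)] orth[OF f(2)[rule_format] f(2)[rule_format]]) auto
  thus ?thesis using assms(2)[OF that(2)] f(2) by simp
 qed
 hence "v = (\<Sum>k\<in>S. if k = m then f m else 0)" unfolding f(3) by (intro sum.cong) auto
 also have "\<dots> \<in> W m" using f W_sub by (simp add: subspace_0)
 finally show ?thesis .
qed

text \<open>One diagonal matrix separates all integer weights, since the powers of 2 are distinct.
  Symmetry of the torus turns the eigenvalue equation into orthogonality to the other weight
  spaces.\<close>

lemma weightI:
 assumes v: "v \<in> V" and e: "\<pi> (diag2 2) v = (2 powi m) *\<^sub>R v" shows "v \<in> W m"
proof (rule in_weight_spaceI[OF v])
 fix n y assume n: "n \<noteq> m" "y \<in> W n"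
 have "2 powi n * (v \<bullet> y) = 2 powi m * (v \<bullet> y)"
  using diag_sym[OF v n(2), of 2] unfolding e inner_scaleR_left by (simp only: zero_neq_numeral not_False_eq_True)
 moreover have "(2::real) powi n \<noteq> 2 powi m" using n(1) by (metis linorder_neqE power_int_strict_increasing one_less_numeral_iff semiring_norm(76) less_irrefl)
 ultimately show "v \<bullet> y = 0" by (metis mult_cancel_right)
qed

text \<open>\<open>E\<close> shifts weights by 2, so against \<open>W (m + 2)\<close> it sees only
  the component of weight \<open>m\<close>. This makes the differential equations of the matrix
  coefficients triangular in the weight.\<close>

lemma E_inner_cong:
 assumes "x \<in> V" "x' \<in> V" "\<And>y. y \<in> W m ==> x \<bullet> y = x' \<bullet> y" "z \<in> W (m + 2)"
 shows "E x \<bullet> z = E x' \<bullet> z"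
proof -
 define d where "d = x - x'"
 have d: "d \<in> V" "\<And>y. y \<in> W m ==> d \<bullet> y = 0"
  using assms V_sub by (auto simp: d_def subspace_diff inner_diff_left)
 obtain S f where f: "finite S" "\<forall>m. f m \<in> W m" "d = (\<Sum>m\<in>S. f m)" using decomp d by blast
 have fm: "f m = 0" if "m \<in> S"
 proof -
  have "d \<bullet> f m = f m \<bullet> f m" unfolding f(3) using that by (intro inner_pick[OF f(1)] orth[OF f(2)[rule_format] f(2)[rule_format]]) auto
  thus ?thesis using d(2) f(2) by simp
 qed
 have "E d = (\<Sum>k\<in>S. E (f k))" unfolding f(3) using f W_V by (intro lin_sum[OF E_lin]) auto
 hence "E d \<bullet> z = (\<Sum>k\<in>S. E (f k) \<bullet> z)" by (simp add: inner_sum_left)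
 also have "\<dots> = 0"
 proof (rule sum.neutral, rule ballI)
  fix k assume k: "k \<in> S"
  show "E (f k) \<bullet> z = 0"
  proof (cases "k = m")
   case True thus ?thesis using fm k lin_zero[OF E_lin] by simp
  next
   case False
   thus ?thesis using orth[OF E_in[of "f k" k] assms(4)] f by auto
  qed
 qed
 finally show ?thesis using lin_diff[OF E_lin assms(1,2)] by (simp add: d_def inner_diff_left)
qed

context
 fixes v m0 assumes v: "v \<in> W m0"
begin

lemma vV: "v \<in> V" using W_V v .

text \<open>Conjugation by \<open>diag2 a\<close> rescales the parameter of \<open>exp_E\<close> by
  the square of \<open>a\<close>, and on weight vectors both outer factors act by scalars.\<close>

lemma exp_homogeneous:
 assumes "y \<in> W m" "a \<noteq> 0"
 shows "\<pi> (exp_E (a\<^sup>2 * t)) v \<bullet> y = a powi (m - m0) * (\<pi> (exp_E t) v \<bullet> y)"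
proof -
 have "exp_E (a\<^sup>2 * t) = (diag2 a ** exp_E t) ** diag2 (inverse a)"
  using assms(2) unfolding sl2_defs vector2_mult vector2_eq_iff by (simp add: power2_eq_square field_simps)
 hence "\<pi> (exp_E (a\<^sup>2 * t)) v = \<pi> (diag2 a) (\<pi> (exp_E t) (\<pi> (diag2 (inverse a)) v))"
  using assms(2) vV pi_in by (simp add: pi_mult)
 also have "\<pi> (diag2 (inverse a)) v = (inverse a powi m0) *\<^sub>R v" using pi_diag v assms(2) by simp
 also have "\<pi> (exp_E t) \<dots> = (inverse a powi m0) *\<^sub>R \<pi> (exp_E t) v"
  using lin_scale[OF pi_lin] vV by simp
 also have "\<pi> (diag2 a) \<dots> = (inverse a powi m0) *\<^sub>R \<pi> (diag2 a) (\<pi> (exp_E t) v)"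
  using lin_scale[OF pi_lin] vV pi_in assms(2) by simp
 finally have "\<pi> (exp_E (a\<^sup>2 * t)) v \<bullet> y = inverse a powi m0 * (a powi m * (\<pi> (exp_E t) v \<bullet> y))"
  using diag_sym[OF _ assms(1,2)] pi_in vV by simp
 also have "inverse a powi m0 * (a powi m * (\<pi> (exp_E t) v \<bullet> y)) = a powi (m - m0) * (\<pi> (exp_E t) v \<bullet> y)"
  using assms(2) by (simp add: power_int_diff power_int_inverse field_simps)
 finally show ?thesis .
qed

text \<open>With the shift on the right, as \<open>exp_E s ** exp_E t\<close>, the derivative at 0
  is taken at the fixed vector \<open>\<pi> (exp_E t) v\<close>, and no limit has to pass through an
  operator.\<close>

lemma exp_deriv:
 "((\<lambda>t. \<pi> (exp_E t) v \<bullet> y) has_real_derivative E (\<pi> (exp_E t) v) \<bullet> y) (at t)"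
proof -
 have u: "\<pi> (exp_E t) v \<in> V" using pi_in vV by simp
 have "exp_E (s + t) = exp_E s ** exp_E t" for s
  unfolding sl2_defs vector2_mult vector2_eq_iff by simp
 hence eq: "\<pi> (exp_E (s + t)) v = \<pi> (exp_E s) (\<pi> (exp_E t) v)" for s
  using pi_mult vV by simp
 have "((\<lambda>s. \<pi> (exp_E (s + t)) v \<bullet> y) has_real_derivative E (\<pi> (exp_E t) v) \<bullet> y) (at 0)"
  unfolding eq has_real_derivative_iff_has_vector_derivative
  by (rule bounded_linear.has_vector_derivative[OF bounded_linear_inner_left pi_deriv[OF u]])
 thus ?thesis using DERIV_shift[of "\<lambda>t. \<pi> (exp_E t) v \<bullet> y" _ 0 t] by (simp add: add.commute)
qed

lemma exp_homogeneous_sqrt: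
 assumes "y \<in> W m" "t > 0"
 shows "\<pi> (exp_E t) v \<bullet> y = sqrt t powi (m - m0) * (\<pi> (exp_E 1) v \<bullet> y)"
 using exp_homogeneous[OF assms(1), of "sqrt t" 1] assms(2) by simp

lemma exp_tendsto: "((\<lambda>t. \<pi> (exp_E t) v \<bullet> y) \<longlongrightarrow> v \<bullet> y) (at_right 0)"
proof -
 have "isCont (\<lambda>t. \<pi> (exp_E t) v \<bullet> y) 0" using exp_deriv DERIV_isCont by blast
 moreover have "exp_E 0 = mat 1" unfolding sl2_defs by simp
 ultimately have "((\<lambda>t. \<pi> (exp_E t) v \<bullet> y) \<longlongrightarrow> v \<bullet> y) (at 0)"
  using pi_one[OF vV] by (simp add: isCont_def)
 thus ?thesis by (rule filterlim_at_split[THEN iffD1, THEN conjunct2])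
qed

text \<open>By homogeneity the coefficient at \<open>t\<close> is a constant times a negative power
  of \<open>sqrt t\<close>, yet it converges as \<open>t\<close> tends to 0 from the right. So the
  constant is 0.\<close>

lemma exp1_below:
 assumes "y \<in> W m" "m < m0" shows "\<pi> (exp_E 1) v \<bullet> y = 0"
proof -
 define c where "c = \<pi> (exp_E 1) v \<bullet> y"
 define k where "k = nat (m0 - m)"
 have k: "k > 0" "m - m0 = - int k" using assms(2) by (simp_all add: k_def)
 have "((\<lambda>t. (\<pi> (exp_E t) v \<bullet> y) * sqrt t ^ k) \<longlongrightarrow> (v \<bullet> y) * sqrt 0 ^ k) (at_right 0)"
  by (intro tendsto_intros exp_tendsto)
 moreover have "\<forall>\<^sub>F t in at_right 0. (\<pi> (exp_E t) v \<bullet> y) * sqrt t ^ k = c"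
  unfolding eventually_at_right_field
 proof (intro exI[of _ 1] conjI allI impI)
  fix t :: real assume "0 < t" "t < 1"
  thus "(\<pi> (exp_E t) v \<bullet> y) * sqrt t ^ k = c"
   using exp_homogeneous_sqrt[OF assms(1), of t] unfolding k c_def
   by (simp add: power_int_minus field_simps)
 qed simp
 ultimately have "((\<lambda>t. c) \<longlongrightarrow> (v \<bullet> y) * sqrt 0 ^ k) (at_right (0::real))"
  by (rule Lim_transform_eventually)
 hence "c = (v \<bullet> y) * sqrt 0 ^ k" by (intro tendsto_unique[OF _ tendsto_const]) auto
 thus ?thesis using k by (simp add: c_def)
qed

text \<open>Induction on the weight \<open>m\<close> of the test vector. Below \<open>m0\<close>
  both sides vanish. From there on both matrix coefficients have equal derivatives, because
  \<open>E_inner_cong\<close> reduces these to weight \<open>m - 2\<close>, and they agree at 0. The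
  homogeneity used below \<open>m0\<close> concerns positive parameters, hence
  \<open>t > 0\<close>.\<close>

lemma exp_formula:
 assumes k: "(E ^^ k) v = 0" and t: "t > 0"
 shows "\<pi> (exp_E t) v = (\<Sum>n<k. (t ^ n / fact n) *\<^sub>R (E ^^ n) v)"
proof -
 define p where "p t = (\<Sum>n<k. (t ^ n / fact n) *\<^sub>R (E ^^ n) v)" for t :: real
 have pV: "p t \<in> V" for t unfolding p_def using Epow_V vV V_sub by (auto intro: subspace_sum subspace_scale)
 have Ep: "E (p t) = (\<Sum>n<k. (t ^ n / fact n) *\<^sub>R (E ^^ Suc n) v)" for t
  unfolding p_def by (simp add: lin_sum_scale[OF E_lin] Epow_V vV)
 have p0: "p 0 = v" using k by (cases k) (simp_all add: p_def sum.lessThan_Suc_shift del: sum.lessThan_Suc)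
 have dp: "((\<lambda>t. p t \<bullet> z) has_real_derivative E (p t) \<bullet> z) (at t)" for t z
 proof -
  have "((\<lambda>t. p t \<bullet> z) has_real_derivative (\<Sum>n<k. real n * t ^ (n - 1) / fact n * ((E ^^ n) v \<bullet> z))) (at t)"
   unfolding p_def inner_sum_left inner_scaleR_left
   by (rule DERIV_sum, rule DERIV_cmult_right, rule DERIV_cdivide) (auto intro!: derivative_eq_intros)
  moreover have "(\<Sum>n<k. real n * t ^ (n - 1) / fact n * ((E ^^ n) v \<bullet> z)) = E (p t) \<bullet> z"
  proof (cases k)
   case (Suc j)
   have "(\<Sum>n<k. real n * t ^ (n - 1) / fact n * ((E ^^ n) v \<bullet> z)) = (\<Sum>n<j. t ^ n / fact n * ((E ^^ Suc n) v \<bullet> z))"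
    unfolding Suc sum.lessThan_Suc_shift by (simp del: of_nat_Suc funpow.simps)
   thus ?thesis using k unfolding Ep inner_sum_left Suc by simp
  qed (simp add: Ep)
  ultimately show ?thesis by simp
 qed
 have "\<forall>t>0. \<forall>y\<in>W m. \<pi> (exp_E t) v \<bullet> y = p t \<bullet> y" for m
 \<comment> \<open>The summand 2 makes the measure drop from \<open>m\<close> to
   \<open>m - 2\<close> also at \<open>m = m0\<close>, where \<open>nat\<close> would otherwise
   truncate.\<close>
 proof (induction "nat (m - m0 + 2)" arbitrary: m rule: less_induct)
  case less
  show ?case
  proof (intro allI impI ballI)
   fix t :: real and y assume t: "t > 0" and y: "y \<in> W m"
   show "\<pi> (exp_E t) v \<bullet> y = p t \<bullet> y"
   proof (cases "m < m0")
    case True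
    thus ?thesis using exp_homogeneous_sqrt[OF y t] exp1_below[OF y] orth[OF Epow_in[OF v] y] by (simp add: p_def inner_sum_left)
   next
    case False
    hence IH: "\<forall>t>0. \<forall>y\<in>W (m - 2). \<pi> (exp_E t) v \<bullet> y = p t \<bullet> y" using less[of "m - 2"] by simp
    let ?f = "\<lambda>s. \<pi> (exp_E s) v \<bullet> y - p s \<bullet> y"
    have df: "(?f has_real_derivative E (\<pi> (exp_E s) v) \<bullet> y - E (p s) \<bullet> y) (at s)" for s by (rule DERIV_diff[OF exp_deriv dp])
    have d0: "E (\<pi> (exp_E s) v) \<bullet> y = E (p s) \<bullet> y" if "s > 0" for s
     by (rule E_inner_cong[OF pi_in[OF SL2_exp_E vV] pV, of "m - 2"]) (use IH that y in simp_all)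
    have "?f t = ?f 0"
    proof (rule DERIV_isconst2[OF t])
     show "continuous_on {0..t} ?f" by (intro continuous_at_imp_continuous_on ballI DERIV_isCont[OF df])
     show "(?f has_real_derivative 0) (at s)" if "0 < s" for s using df[of s] d0[OF that] by simp
    qed (use t in simp_all)
    moreover have "exp_E 0 = mat 1" unfolding sl2_defs by simp
    ultimately show ?thesis using pi_one[OF vV] p0 by simp
   qed
  qed
 qed
 hence "\<pi> (exp_E t) v = p t" using t by (intro eqI[OF pi_in[OF SL2_exp_E vV] pV]) blast
 thus ?thesis unfolding p_def .
qed

lemma exp1_above:
 assumes y: "y \<in> W (m0 + 2 * int n)" shows "\<pi> (exp_E 1) v \<bullet> y = ((1 / fact n) *\<^sub>R (E ^^ n) v) \<bullet> y"
proof -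
 obtain k where "(E ^^ k) v = 0" using E_nil[OF vV] by blast
 \<comment> \<open>The exponent is raised beyond \<open>n\<close> so that the term of index
   \<open>n\<close> is in the sum even if it is 0.\<close>
 hence "(E ^^ (k + Suc n)) v = 0" by (rule Epow_zero_mono) simp
 from exp_formula[OF this, of 1] show ?thesis
  using inner_pick[of "{..<k + Suc n}" n "\<lambda>n. (1 / fact n) *\<^sub>R (E ^^ n) v" y] orth[OF Epow_in[OF v] y] by simp
qed

end

lemma weyl_inv_weyl: "weyl_inv ** weyl = mat 1" and weyl_weyl_inv: "weyl ** weyl_inv = mat 1"
 unfolding sl2_defs vector2_mult by simp_all

lemma pi_weyl_cancel [simp]:
 "v \<in> V ==> \<pi> weyl (\<pi> weyl_inv v) = v" "v \<in> V ==> \<pi> weyl_inv (\<pi> weyl v) = v"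
 by (simp_all add: pi_one weyl_inv_weyl weyl_weyl_inv flip: pi_mult)

text \<open>Both Weyl elements conjugate \<open>diag2 2\<close> into its inverse, so the exponent of
  the eigenvalue, which is the weight, changes sign.\<close>

lemma weyl_in:
 assumes "v \<in> W m" shows "\<pi> weyl v \<in> W (- m)" "\<pi> weyl_inv v \<in> W (- m)"
proof -
 have v: "v \<in> V" using assms W_V by blast
 have 1: "\<pi> g v \<in> W (- m)" if g: "g \<in> SL2" "diag2 2 ** g = g ** diag2 (1/2)" for g
 proof (rule weightI)
  show "\<pi> g v \<in> V" using v g pi_in by blast
  have "\<pi> (diag2 2) (\<pi> g v) = \<pi> g (\<pi> (diag2 (1/2)) v)"
   using g v by (simp flip: pi_mult)
  also have "\<pi> (diag2 (1/2)) v = ((1/2) powi m) *\<^sub>R v" using pi_diag assms by simp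
  also have "\<pi> g \<dots> = ((1/2) powi m) *\<^sub>R \<pi> g v" using g v lin_scale[OF pi_lin] by blast
  also have "((1/2::real)) powi m = 2 powi (- m)" by (simp add: power_int_minus power_int_divide_distrib field_simps)
  finally show "\<pi> (diag2 2) (\<pi> g v) = (2 powi - m) *\<^sub>R \<pi> g v" .
 qed
 have "diag2 2 ** weyl = weyl ** diag2 (1/2)" "diag2 2 ** weyl_inv = weyl_inv ** diag2 (1/2)"
  unfolding sl2_defs vector2_mult vector2_eq_iff by simp_all
 thus "\<pi> weyl v \<in> W (- m)" "\<pi> weyl_inv v \<in> W (- m)" using 1 by blast+
qed

text \<open>Conjugation by \<open>weyl\<close> sends the upper nilpotent matrix to minus the lower
  one. So this is the infinitesimal action of \<open>lower\<close>, obtained without differentiating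
  it.\<close>

definition F :: "'h => 'h" where "F v = - \<pi> weyl (E (\<pi> weyl_inv v))"

lemma F_lin: "linear_on_subspace V F"
 unfolding linear_on_subspace_def F_def
 using V_sub pi_in E_V lin_add[OF pi_lin] lin_scale[OF pi_lin]
  lin_add[OF E_lin] lin_scale[OF E_lin]
 by simp

lemma F_in: "x \<in> W m ==> F x \<in> W (m - 2)"
 using weyl_in(1)[OF E_in[OF weyl_in(2)]] unfolding F_def
 by (simp add: subspace_neg[OF W_sub] algebra_simps)

lemma F_V: "v \<in> V ==> F v \<in> V"
 unfolding F_def using V_sub pi_in E_V by (simp add: subspace_neg)

lemma Fpow: "v \<in> V ==> (F ^^ n) v = (- 1) ^ n *\<^sub>R \<pi> weyl ((E ^^ n) (\<pi> weyl_inv v))"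
proof (induction n)
 case (Suc n)
 let ?u = "(E ^^ n) (\<pi> weyl_inv v)"
 have u: "?u \<in> V" using Suc.prems pi_in Epow_V by simp
 have "(F ^^ Suc n) v = F ((- 1) ^ n *\<^sub>R \<pi> weyl ?u)" using Suc by simp
 also have "\<dots> = (- 1) ^ n *\<^sub>R F (\<pi> weyl ?u)"
  using lin_scale[OF F_lin] u pi_in by simp
 also have "F (\<pi> weyl ?u) = - \<pi> weyl (E ?u)" unfolding F_def using u by simp
 finally show ?case by simp
qed simp

lemma F_nil: assumes "v \<in> V" shows "\<exists>k. (F ^^ k) v = 0"
proof -
 obtain k where "(E ^^ k) (\<pi> weyl_inv v) = 0" using E_nil pi_in assms by blast
 thus ?thesis using Fpow[OF assms, of k] lin_zero[OF pi_lin] by (intro exI[of _ k]) simp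
qed

text \<open>Conjugate of \<open>exp_formula\<close> through
  \<open>lower s = weyl ** (exp_E (- s) ** weyl_inv)\<close>; the positive parameter required there
  becomes \<open>s < 0\<close> here.\<close>

lemma lower_formula:
 assumes v: "v \<in> W m" and k: "(E ^^ k) (\<pi> weyl_inv v) = 0" and "s < 0"
 shows "\<pi> (lower s) v = (\<Sum>n<k. (s ^ n / fact n) *\<^sub>R (F ^^ n) v)"
proof -
 have vV: "v \<in> V" using v W_V by blast
 let ?u = "\<pi> weyl_inv v"
 have u: "?u \<in> W (- m)" "?u \<in> V" using weyl_in v W_V by blast+
 have "lower s = weyl ** (exp_E (- s) ** weyl_inv)" unfolding sl2_defs vector2_mult by simp
 hence "\<pi> (lower s) v = \<pi> weyl (\<pi> (exp_E (- s)) ?u)" using vV by (simp add: pi_mult)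
 also have "\<pi> (exp_E (- s)) ?u = (\<Sum>n<k. ((- s) ^ n / fact n) *\<^sub>R (E ^^ n) ?u)"
  using exp_formula[OF u(1) k] assms(3) by simp
 also have "\<pi> weyl \<dots> = (\<Sum>n<k. ((- s) ^ n / fact n) *\<^sub>R \<pi> weyl ((E ^^ n) ?u))"
  by (rule lin_sum_scale[OF pi_lin]) (simp_all add: Epow_V u)
 also have "\<dots> = (\<Sum>n<k. (s ^ n / fact n) *\<^sub>R (F ^^ n) v)"
 proof (rule sum.cong[OF refl])
  fix n
  have "(- s) ^ n = s ^ n * (- 1) ^ n" by (simp flip: power_mult_distrib)
  thus "((- s) ^ n / fact n) *\<^sub>R \<pi> weyl ((E ^^ n) ?u) = (s ^ n / fact n) *\<^sub>R (F ^^ n) v"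
   unfolding Fpow[OF vV] by (simp only: scaleR_scaleR times_divide_eq_left)
 qed
 finally show ?thesis .
qed

lemma Fpow_in: "x \<in> W m ==> (F ^^ k) x \<in> W (m - 2 * int k)"
proof (induction k)
 case (Suc k)
 thus ?case using F_in[of "(F ^^ k) x" "m - 2 * int k"] by (simp add: algebra_simps)
qed simp

text \<open>Compare the components of weight \<open>m\<close> on both sides of
 $\exp(E)\exp(sF) = \exp(\frac{s}{1+s}F)\,\mathrm{diag}(1+s)\exp(\frac{1}{1+s}E)$; the
 coefficients of \<open>s\<close> give $EF = FE + m$.\<close>

lemma exp_lower_component:
 assumes v: "v \<in> W m" and y: "y \<in> W m" and s: "- 1 < s" "s < 0"
  and k: "\<And>n. n \<ge> k ==> (E ^^ n) v = 0" "\<And>n. n \<ge> k ==> (F ^^ n) v = 0"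
 shows "(\<Sum>b<k. s ^ b / (fact b)\<^sup>2 * ((E ^^ b) ((F ^^ b) v) \<bullet> y))
  = (\<Sum>b<k. s ^ b * (1 + s) powi m / (fact b)\<^sup>2 * ((F ^^ b) ((E ^^ b) v) \<bullet> y))"
proof -
 have vV: "v \<in> V" using v W_V by blast
 have kw: "(E ^^ n) (\<pi> weyl_inv v) = 0" if "n \<ge> k" for n
 proof -
  have "\<pi> weyl ((E ^^ n) (\<pi> weyl_inv v)) = 0" using k(2)[OF that] Fpow[OF vV, of n] by simp
  thus ?thesis using pi_weyl_cancel(2)[of "(E ^^ n) (\<pi> weyl_inv v)"] Epow_V pi_in vV
    lin_zero[OF pi_lin] by simp
 qed
 have EF: "\<pi> (exp_E 1) ((F ^^ b) v) \<bullet> y = (1 / fact b) * ((E ^^ b) ((F ^^ b) v) \<bullet> y)" for b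
  using exp1_above[OF Fpow_in[OF v, of b], of y b] y by simp
 have Fb: "(F ^^ b) v \<in> V" for b using Fpow_in[OF v] W_V by blast
 have "\<pi> (exp_E 1 ** lower s) v = \<pi> (exp_E 1) (\<Sum>b<k. (s ^ b / fact b) *\<^sub>R (F ^^ b) v)"
  using lower_formula[OF v kw[OF order_refl] s(2)] pi_mult vV by simp
 also have "\<dots> = (\<Sum>b<k. (s ^ b / fact b) *\<^sub>R \<pi> (exp_E 1) ((F ^^ b) v))" by (rule lin_sum_scale[OF pi_lin]) (simp_all add: Fb)
 finally have L: "\<pi> (exp_E 1 ** lower s) v \<bullet> y
   = (\<Sum>b<k. s ^ b / (fact b)\<^sup>2 * ((E ^^ b) ((F ^^ b) v) \<bullet> y))"
  by (simp add: inner_sum_left EF power2_eq_square)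
 \<comment> \<open>The upper right entry of the matrix identity forces
   \<open>(1 + s) * t = 1\<close>. The range \<open>- 1 < s < 0\<close> makes \<open>t\<close>
   positive and \<open>s * t\<close> negative, as \<open>exp_formula\<close> and
   \<open>lower_formula\<close> demand.\<close>
 define t where "t = 1 / (1 + s)"
 have t: "t > 0" "(1 + s) * t = 1" using s by (simp_all add: t_def)
 have st: "s * t < 0" using s(2) t(1) by (simp add: mult_neg_pos)
 have "exp_E 1 ** lower s = lower (s * t) ** (diag2 (1 + s) ** exp_E t)"
  using t s unfolding sl2_defs vector2_mult vector2_eq_iff t_def by (simp add: field_simps)
 hence "\<pi> (exp_E 1 ** lower s) v = \<pi> (lower (s * t)) (\<pi> (diag2 (1 + s)) (\<pi> (exp_E t) v))"
  using s vV pi_in by (simp add: pi_mult)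
 also have "\<pi> (exp_E t) v = (\<Sum>b<k. (t ^ b / fact b) *\<^sub>R (E ^^ b) v)"
  using exp_formula[OF v k(1)[OF order_refl] t(1)] .
 also have "\<pi> (diag2 (1 + s)) \<dots> = (\<Sum>b<k. (t ^ b / fact b) *\<^sub>R \<pi> (diag2 (1 + s)) ((E ^^ b) v))"
  by (rule lin_sum_scale[OF pi_lin]) (use s Epow_V[OF vV] in auto)
 also have "\<dots> = (\<Sum>b<k. (t ^ b / fact b * (1 + s) powi (m + 2 * int b)) *\<^sub>R (E ^^ b) v)"
  using s pi_diag[OF _ Epow_in[OF v]] by (intro sum.cong refl) simp
 also have "\<pi> (lower (s * t)) \<dots> = (\<Sum>b<k. (t ^ b / fact b * (1 + s) powi (m + 2 * int b)) *\<^sub>R \<pi> (lower (s * t)) ((E ^^ b) v))"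
  by (rule lin_sum_scale[OF pi_lin]) (use Epow_V[OF vV] in auto)
 finally have R: "\<pi> (exp_E 1 ** lower s) v \<bullet> y =
  (\<Sum>b<k. t ^ b / fact b * (1 + s) powi (m + 2 * int b) * (\<pi> (lower (s * t)) ((E ^^ b) v) \<bullet> y))"
  by (simp add: inner_sum_left)
 have FE: "\<pi> (lower (s * t)) ((E ^^ b) v) \<bullet> y = ((s * t) ^ b / fact b) * ((F ^^ b) ((E ^^ b) v) \<bullet> y)" for b
 proof -
  let ?x = "(E ^^ b) v"
  have x: "?x \<in> W (m + 2 * int b)" "?x \<in> V" using Epow_in[OF v] W_V by blast+
  obtain j where j: "(E ^^ j) (\<pi> weyl_inv ?x) = 0" using E_nil pi_in x(2) by blast
  have j': "(E ^^ (max j (Suc b))) (\<pi> weyl_inv ?x) = 0" using Epow_zero_mono[OF j] by simp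
  show ?thesis
   unfolding lower_formula[OF x(1) j' st]
   using inner_pick[of "{..<max j (Suc b)}" b "\<lambda>n. ((s * t) ^ n / fact n) *\<^sub>R (F ^^ n) ?x" y] orth[OF Fpow_in[OF x(1)] y] by simp
 qed
 have c: "t ^ b / fact b * (1 + s) powi (m + 2 * int b) * ((s * t) ^ b / fact b) = s ^ b * (1 + s) powi m / (fact b)\<^sup>2" for b
 proof -
  define r where "r = 1 + s"
  have r: "r \<noteq> 0" "r * t = 1" using s t(2) by (simp_all add: r_def)
  have "r powi (m + 2 * int b) = r powi m * r powi int (b + b)"
   using r(1) power_int_add[of r m "int (b + b)"] by (simp only: of_nat_add mult_2 disj_not1 simp_thms)
  also have "r powi int (b + b) = r ^ b * r ^ b" unfolding power_int_of_nat power_add ..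
  finally have "t ^ b * r powi (m + 2 * int b) * (s * t) ^ b = s ^ b * r powi m * ((r * t) ^ b * (r * t) ^ b)"
   by (simp only: power_mult_distrib mult_ac)
  hence "t ^ b * r powi (m + 2 * int b) * (s * t) ^ b = s ^ b * r powi m" unfolding r(2) by simp
  thus ?thesis unfolding r_def[symmetric] power2_eq_square by (simp only: times_divide_eq_right times_divide_eq_left divide_divide_eq_left)
 qed
 show ?thesis unfolding L[symmetric] R FE
  unfolding mult.assoc[symmetric] c ..
qed

text \<open>Comparison of derivatives at \<open>s = 0\<close> in \<open>exp_lower_component\<close>:
  the left side gives \<open>E (F v)\<close>, the right side \<open>F (E v)\<close> and, from the
  factor \<open>(1 + s) powi m\<close>, the multiple \<open>m\<close> of \<open>v\<close>. The
  identity holds for negative \<open>s\<close>, so the derivative is taken from the left.\<close>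

lemma comm: assumes v: "v \<in> W m" shows "E (F v) - F (E v) = of_int m *\<^sub>R v"
proof (rule eqI)
 have vV: "v \<in> V" using v W_V by blast
 show "E (F v) - F (E v) \<in> V" "of_int m *\<^sub>R v \<in> V"
  using vV E_V F_V V_sub by (simp_all add: subspace_diff subspace_scale)
 fix n y assume yn: "y \<in> W n"
 show "(E (F v) - F (E v)) \<bullet> y = (of_int m *\<^sub>R v) \<bullet> y"
 proof (cases "n = m")
  case False
  have "E (F v) \<in> W m" "F (E v) \<in> W m" using E_in[OF F_in[OF v]] F_in[OF E_in[OF v]] by simp_all
  thus ?thesis using orth[OF _ yn] v False by (simp add: inner_diff_left)
 next
  case True
  hence y: "y \<in> W m" using yn by simp
  obtain k1 where k1: "(E ^^ k1) v = 0" using E_nil[OF vV] by blast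
  obtain k2 where k2: "(E ^^ k2) (\<pi> weyl_inv v) = 0" using E_nil[OF pi_in[OF SL2_weyl_inv vV]] by blast
  \<comment> \<open>The summand 2 guarantees that the indices 0 and 1 occur in the sums.\<close>
  define k where "k = k1 + k2 + 2"
  have k: "(E ^^ n) v = 0" "(F ^^ n) v = 0" if "n \<ge> k" for n
  proof -
   have "k1 \<le> n" "k2 \<le> n" using that by (simp_all add: k_def)
   hence "(E ^^ n) v = 0" "(E ^^ n) (\<pi> weyl_inv v) = 0" using Epow_zero_mono k1 k2 by blast+
   thus "(E ^^ n) v = 0" "(F ^^ n) v = 0"
    using Fpow[OF vV, of n] lin_zero[OF pi_lin[OF SL2_weyl]] by simp_all
  qed
  define f g where "f = (\<lambda>s. \<Sum>b<k. s ^ b / (fact b)\<^sup>2 * ((E ^^ b) ((F ^^ b) v) \<bullet> y))"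
   and "g = (\<lambda>s. \<Sum>b<k. s ^ b * (1 + s) powi m / (fact b)\<^sup>2 * ((F ^^ b) ((E ^^ b) v) \<bullet> y))"
  have df0: "(f has_real_derivative (\<Sum>b<k. real b * 0 ^ (b - 1) / (fact b)\<^sup>2 * ((E ^^ b) ((F ^^ b) v) \<bullet> y))) (at 0)"
   unfolding f_def by (rule DERIV_sum, rule DERIV_cmult_right, rule DERIV_cdivide) (auto intro!: derivative_eq_intros)
  have dg0: "(g has_real_derivative (\<Sum>b<k. (real b * 0 ^ (b - 1) + 0 ^ b * of_int m) / (fact b)\<^sup>2 * ((F ^^ b) ((E ^^ b) v) \<bullet> y))) (at 0)"
   unfolding g_def by (rule DERIV_sum, rule DERIV_cmult_right, rule DERIV_cdivide) (auto intro!: derivative_eq_intros)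
  \<comment> \<open>Only the terms of index 0 and 1 contribute to value and derivative at 0.\<close>
  have low: "(\<Sum>b<k. h b) = h 0 + h 1" if "\<And>b. b \<ge> 2 ==> h b = 0" for h :: "nat => real"
  proof -
   have "(\<Sum>b<k. h b) = (\<Sum>b\<in>{0,1}. h b)"
    using that by (intro sum.mono_neutral_right) (auto simp: k_def not_less_eq_eq numeral_2_eq_2 Suc_le_eq)
   thus ?thesis by simp
  qed
  have df: "(f has_real_derivative (E (F v) \<bullet> y)) (at 0)"
   using df0 by (subst (asm) low) auto
  have dg: "(g has_real_derivative (F (E v) \<bullet> y + of_int m * (v \<bullet> y))) (at 0)"
   using dg0 by (subst (asm) low) (auto simp: add.commute power_0_left)
  define D where "D = E (F v) \<bullet> y - (F (E v) \<bullet> y + of_int m * (v \<bullet> y))"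
  have fg: "f s - g s = 0" if "s \<in> {-1/2..0}" for s
  proof (cases "s = 0")
   case True thus ?thesis unfolding f_def g_def by (subst (1 2) low) (simp_all add: power_0_left)
  next
   case False
   thus ?thesis using exp_lower_component[OF v y, of s k] k that unfolding f_def g_def by auto
  qed
  have "((\<lambda>s. f s - g s) has_real_derivative D) (at 0 within {-1/2..0})"
   unfolding D_def using has_field_derivative_at_within[OF DERIV_diff[OF df dg]] .
  hence "((\<lambda>s. 0) has_real_derivative D) (at (0::real) within {-1/2..0})"
   by (rule has_field_derivative_transform_within[where d = 1]) (auto simp: fg)
  hence "((\<lambda>s. (0 - 0) / (s - 0)) \<longlongrightarrow> D) (at_left (0::real))"
   unfolding has_field_derivative_iff by (simp add: at_within_Icc_at_left)
  hence "((\<lambda>s::real. 0) \<longlongrightarrow> D) (at_left (0::real))" by simp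
  hence "D = 0" by (intro tendsto_unique[OF _ _ tendsto_const]) auto
  thus ?thesis by (simp add: D_def inner_diff_left)
 qed
qed

text \<open>Adjointness is the one axiom that the representation does not supply. It is passed in
  here and comes later from the polarization.\<close>

lemma sl2_module:
 assumes "\<And>x y m. x \<in> W m ==> y \<in> W (m + 2) ==> E x \<bullet> y = x \<bullet> F y"
 shows "sl2_module W E F"
proof
 fix m x
 show "linear_on_subspace (W m) E" "linear_on_subspace (W m) F"
  using lin_mono[OF E_lin _ W_sub] lin_mono[OF F_lin _ W_sub] W_V by blast+
 assume "x \<in> W m"
 thus "\<exists>k. (E ^^ k) x = 0" "\<exists>k. (F ^^ k) x = 0" using E_nil F_nil W_V by blast+
qed (fact E_in F_in comm assms)+

end

text \<open>Representations with weights $-1, 0, 1$ only: sums of trivial and of two-dimensional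
 ones.\<close>

locale sl2_rep_small = sl2_rep +
 assumes W_bound: "x \<in> W m ==> m \<notin> {- 1, 0, 1} ==> x = 0"
begin

lemma decompE:
 assumes "v \<in> V" obtains a b c where "a \<in> W (- 1)" "b \<in> W 0" "c \<in> W 1" "v = a + b + c"
proof -
 obtain S f where f: "finite S" "\<forall>m. f m \<in> W m" "v = (\<Sum>m\<in>S. f m)" using decomp assms by blast
 define g where "g m = (if m \<in> S then f m else 0)" for m
 have g: "g m \<in> W m" for m using f(2) W_sub by (simp add: g_def subspace_0)
 have "v = (\<Sum>m\<in>S \<union> {- 1, 0, 1}. g m)"
  unfolding f(3) using f(1) by (intro sum.mono_neutral_cong_left) (auto simp: g_def)
 also have "\<dots> = (\<Sum>m\<in>{- 1, 0, 1}. g m)"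
  using f(1) W_bound[OF g] by (intro sum.mono_neutral_right) auto
 also have "\<dots> = g (- 1) + g 0 + g 1" by (simp add: add.assoc)
 finally show thesis using that g by blast
qed

lemma E_0: "x \<in> W 0 ==> E x = 0" and E_1: "x \<in> W 1 ==> E x = 0"
 and E_neg1: "x \<in> W (- 1) ==> E x \<in> W 1"
 using W_bound[OF E_in[of x 0]] W_bound[OF E_in[of x 1]] E_in[of x "- 1"] by simp_all

lemma E_E: assumes "v \<in> V" shows "E (E v) = 0"
proof (rule lin_eq[OF lin_compose[OF E_lin E_lin E_V] lin_0[OF V_sub] _ assms])
 fix m x assume x: "x \<in> W m"
 show "E (E x) = 0"
  using W_bound[OF x] W_bound[OF E_in[OF E_in[OF x]]] lin_zero[OF E_lin] by (cases "m \<in> {- 1, 0, 1}") auto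
qed

lemma exp_pos: assumes "v \<in> V" "t > 0" shows "\<pi> (exp_E t) v = v + t *\<^sub>R E v"
proof (rule lin_eq[OF pi_lin lin_plus[OF lin_id[OF V_sub] lin_compose[OF E_lin lin_scaleR[OF V_sub] E_V]] _ assms(1)])
 show "\<pi> (exp_E t) x = x + t *\<^sub>R E x" if "x \<in> W m" for x m
  using exp_formula[OF that, of 2] E_E[OF W_V[OF that]] assms(2) by (simp add: numeral_2_eq_2)
qed simp

text \<open>For negative \<open>t\<close> the formula is recovered from the inverse group element:
  as \<open>E\<close> squares to 0, the vector \<open>v + t E v\<close> is carried back to
  \<open>v\<close> by \<open>exp_E (- t)\<close>.\<close>

lemma exp_all: assumes v: "v \<in> V" shows "\<pi> (exp_E t) v = v + t *\<^sub>R E v"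
proof (cases t "0 :: real" rule: linorder_cases)
 case greater thus ?thesis using exp_pos v by blast
next
 case equal
 have "exp_E 0 = mat 1" unfolding sl2_defs by simp
 thus ?thesis using equal pi_one v by simp
next
 case less
 define x where "x = v + t *\<^sub>R E v"
 have x: "x \<in> V" unfolding x_def using v E_V V_sub by (simp add: subspace_add subspace_scale)
 have "E x = E v" unfolding x_def using v E_V V_sub E_E
  by (simp add: lin_add[OF E_lin] lin_scale[OF E_lin] subspace_scale)
 hence "\<pi> (exp_E (- t)) x = v" using exp_pos[OF x, of "- t"] less by (simp add: x_def)
 moreover have "exp_E t ** exp_E (- t) = mat 1" unfolding sl2_defs vector2_mult by simp
 hence "\<pi> (exp_E t) (\<pi> (exp_E (- t)) x) = x" using x pi_one by (simp flip: pi_mult)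
 ultimately show ?thesis by (simp add: x_def)
qed

text \<open>The factorisation \<open>exp_E 1 ** lower (- 1) ** exp_E 1\<close> of
  \<open>weyl\<close>, with \<open>lower (- 1)\<close> written as a conjugate of
  \<open>exp_E 1\<close>. Each unipotent factor is then known from \<open>exp_all\<close>.\<close>

lemma weyl_factors: "weyl = exp_E 1 ** (weyl ** (exp_E 1 ** (weyl_inv ** exp_E 1)))"
 unfolding sl2_defs vector2_mult by simp

lemma weyl_eq: "v \<in> V ==> \<pi> weyl v = \<pi> (exp_E 1) (\<pi> weyl (\<pi> (exp_E 1) (\<pi> weyl_inv (\<pi> (exp_E 1) v))))"
 by (subst weyl_factors) (simp add: pi_mult pi_in)

text \<open>There is no weight 2, so \<open>E\<close> kills weight 0, including the vector
  \<open>\<pi> weyl_inv v\<close>. All unipotent factors act trivially and the two remaining Weyl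
  factors cancel.\<close>

lemma weyl_0: assumes v: "v \<in> W 0" shows "\<pi> weyl v = v"
proof -
 have "v \<in> V" using v W_V by blast
 moreover have "\<pi> weyl_inv v \<in> W 0" using weyl_in(2)[OF v] by simp
 moreover have "\<pi> weyl_inv v \<in> V" using \<open>v \<in> V\<close> pi_in by simp
 ultimately show ?thesis using v E_0 by (simp add: weyl_eq[of v] exp_all)
qed

text \<open>Written out by \<open>weyl_eq\<close>, the vector \<open>\<pi> weyl v\<close> is a part
  \<open>v + r\<close> of weight -1 plus a part of weight 1. But \<open>weyl\<close> sends weight -1
  to weight 1, so \<open>v + r = 0\<close>, and what survives is \<open>E v\<close>.\<close>

lemma weyl_neg1: assumes v: "v \<in> W (- 1)" shows "\<pi> weyl v = E v"
proof -
 have vV: "v \<in> V" using v W_V by blast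
 define p where "p = \<pi> weyl_inv (E v)"
 define q where "q = \<pi> weyl_inv v"
 define r where "r = \<pi> weyl (E p)"
 have p: "p \<in> W (- 1)" "p \<in> V" unfolding p_def using weyl_in(2)[OF E_neg1[OF v]] W_V by simp_all
 have q: "q \<in> W 1" "q \<in> V" unfolding q_def using weyl_in(2)[OF v] W_V by simp_all
 have r: "r \<in> W (- 1)" "r \<in> V" unfolding r_def using weyl_in(1)[OF E_neg1[OF p(1)]] W_V by simp_all
 have wp: "\<pi> weyl p = E v" "\<pi> weyl q = v" unfolding p_def q_def using vV E_V by simp_all
 have "\<pi> weyl_inv (\<pi> (exp_E 1) v) = q + p"
  using vV E_V by (simp add: exp_all p_def q_def lin_add[OF pi_lin])
 moreover have "\<pi> (exp_E 1) (q + p) = q + p + E p"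
  using p q E_1 V_sub by (simp add: exp_all subspace_add lin_add[OF E_lin])
 moreover have "\<pi> weyl (q + p + E p) = v + E v + r"
  using p q E_V V_sub wp by (simp add: subspace_add lin_add[OF pi_lin] r_def)
 moreover have "\<pi> (exp_E 1) (v + E v + r) = v + E v + r + E v + E r"
  using r vV E_V V_sub by (simp add: exp_all E_E subspace_add lin_add[OF E_lin])
 ultimately have w: "\<pi> weyl v = v + E v + r + E v + E r" using weyl_eq[OF vV] by simp
 define s where "s = v + r"
 have s: "s \<in> W (- 1)" unfolding s_def using v r W_sub by (simp add: subspace_add)
 have Es: "E s = E v + E r" unfolding s_def using vV r by (simp add: lin_add[OF E_lin])
 have "s = \<pi> weyl v - (E v + E s)" using w Es by (simp add: s_def)
 moreover have "\<pi> weyl v - (E v + E s) \<in> W 1"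
  using weyl_in(1)[OF v] E_neg1[OF v] E_neg1[OF s] W_sub by (simp add: subspace_add subspace_diff)
 ultimately have "s \<bullet> s = 0" using orth[OF s, of s 1] by simp
 hence "s = 0" by simp
 moreover have "\<pi> weyl v = s + E v + E s" using w Es by (simp add: s_def)
 ultimately show ?thesis by (simp add: lin_zero[OF E_lin])
qed

text \<open>\<open>weyl_neg1\<close> matches the weights -1 and 1. The sign comes from
  \<open>weyl = diag2 (- 1) ** weyl_inv\<close>, where \<open>diag2 (- 1)\<close> acts by -1 on odd
  weights.\<close>

lemma weyl_1: assumes x: "x \<in> W 1" shows "\<exists>y\<in>W (- 1). x = E y \<and> \<pi> weyl x = - y"
proof (intro bexI conjI)
 let ?y = "\<pi> weyl_inv x"
 have xV: "x \<in> V" using x W_V by blast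
 show y: "?y \<in> W (- 1)" using weyl_in(2)[OF x] by simp
 show "x = E ?y" using weyl_neg1[OF y] xV by simp
 have "weyl = diag2 (- 1) ** weyl_inv" unfolding sl2_defs vector2_mult by simp
 hence "\<pi> weyl x = \<pi> (diag2 (- 1) ** weyl_inv) x" by (rule arg_cong[where f = "\<lambda>g. \<pi> g x"])
 also have "\<dots> = \<pi> (diag2 (- 1)) ?y" using xV by (intro pi_mult) auto
 finally have "\<pi> weyl x = \<pi> (diag2 (- 1)) ?y" .
 thus "\<pi> weyl x = - ?y" using pi_diag[OF _ y, of "- 1"] by simp
qed

text \<open>Checked on the generators of \<open>SL2_induct\<close>. For \<open>weyl\<close>
  everything is expressed by \<open>E\<close>: on the weights -1, 0 and 1 it is \<open>E\<close>,
  the identity and minus an inverse of \<open>E\<close>.\<close>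

lemma commutes:
 assumes S: "linear_on_subspace V S" "\<And>x m. x \<in> W m ==> S x \<in> W (m :: int)"
  and SE: "\<And>x. x \<in> V ==> S (E x) = E (S x)" and g: "g \<in> SL2" and v: "v \<in> V"
 shows "S (\<pi> g v) = \<pi> g (S v)"
proof -
 have SV: "S x \<in> V" if "x \<in> V" for x by (rule lin_inI[OF S(1) V_sub W_V[OF S(2)] that])
 have eq: "S (\<pi> g v) = \<pi> g (S v)" if "g \<in> SL2" "\<And>m x. x \<in> W m ==> S (\<pi> g x) = \<pi> g (S x)" "v \<in> V" for g v
  by (rule lin_eq[OF lin_compose[OF pi_lin S(1) pi_in] lin_compose[OF S(1) pi_lin SV]]) (use that in auto)
 have "\<forall>v\<in>V. S (\<pi> g v) = \<pi> g (S v)" using g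
 proof (induction rule: SL2_induct)
  case (mult g h)
  thus ?case using SV pi_in by (simp add: pi_mult)
 next
  case (exp t)
  thus ?case using SV E_V SE V_sub
   by (simp add: exp_all lin_add[OF S(1)] lin_scale[OF S(1)] subspace_scale)
 next
  case (diag a)
  have "S (\<pi> (diag2 a) u) = \<pi> (diag2 a) (S u)" if "u \<in> W m" for u m
   using pi_diag[OF diag that] pi_diag[OF diag S(2)[OF that]] W_V[OF that]
   by (simp add: lin_scale[OF S(1)])
  thus ?case using eq diag by blast
 next
  case weyl
  have "S (\<pi> weyl x) = \<pi> weyl (S x)" if x: "x \<in> W m" for x m
  proof -
   consider "m = - 1" | "m = 0" | "m = 1" | "m \<notin> {- 1, 0, 1}" by blast
   thus ?thesis
   proof cases
    case 1
    thus ?thesis using weyl_neg1[of x] weyl_neg1[of "S x"] SE[OF W_V[OF x]] x S(2)[OF x] by simp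
   next
    case 2
    thus ?thesis using weyl_0 x S(2) by simp
   next
    case 3
    then obtain z where z: "z \<in> W (- 1)" "x = E z" "\<pi> weyl x = - z" using weyl_1 x by blast
    have zV: "z \<in> V" using z W_V by blast
    have "\<pi> weyl (S x) = \<pi> weyl (\<pi> weyl (S z))" using SE[OF zV] weyl_neg1[OF S(2)[OF z(1)]] z by simp
    also have "weyl ** weyl = diag2 (- 1)" unfolding sl2_defs vector2_mult by simp
    hence "\<pi> weyl (\<pi> weyl (S z)) = \<pi> (diag2 (- 1)) (S z)" using SV[OF zV] by (simp flip: pi_mult)
    also have "\<dots> = - S z" using pi_diag[OF _ S(2)[OF z(1)], of "- 1"] by simp
    finally show ?thesis using z lin_minus[OF S(1) zV] by simp
   next
    case 4
    thus ?thesis using W_bound[OF x] lin_zero[OF S(1)] lin_zero[OF pi_lin] by simp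
   qed
  qed
  thus ?case using eq by blast
 qed
 thus ?thesis using v by blast
qed

lemma norm_sum:
 assumes "a \<in> W i" "b \<in> W j" "c \<in> W k" "i \<noteq> j" "i \<noteq> k" "j \<noteq> k"
 shows "(norm (a + b + c))\<^sup>2 = (norm a)\<^sup>2 + (norm b)\<^sup>2 + (norm c)\<^sup>2"
 using orth[OF assms(1,2)] orth[OF assms(1,3)] orth[OF assms(2,3)] assms(4-)
 by (simp add: power2_norm_eq_inner inner_add_left inner_add_right inner_commute)

text \<open>A word in the generators is bounded because each generator is, and a generator is
  bounded because it is so on each of three orthogonal weight spaces. The isometry hypothesis enters
  for \<open>exp_E\<close> and \<open>weyl\<close>.\<close>

lemma bounded:
 assumes iso: "\<And>x. x \<in> W (- 1) ==> norm (E x) = norm x" and g: "g \<in> SL2"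
 shows "\<exists>C. \<forall>v\<in>V. norm (\<pi> g v) \<le> C * norm v"
proof -
 have bound: "\<exists>C. \<forall>v\<in>V. norm (T v) \<le> C * norm v"
  if T: "linear_on_subspace V T" and C: "\<And>m x. x \<in> W m ==> norm (T x) \<le> C m * norm x" for T and C :: "int => real"
 proof (intro exI ballI)
  fix v assume "v \<in> V"
  then obtain x y z where xyz: "x \<in> W (- 1)" "y \<in> W 0" "z \<in> W 1" "v = x + y + z" using decompE by blast
  have le: "norm x \<le> norm v" "norm y \<le> norm v" "norm z \<le> norm v"
   using norm_sum[OF xyz(1-3)] unfolding xyz(4) by (auto intro!: power2_le_imp_le[OF _ norm_ge_zero])
  have bd: "norm (T u) \<le> \<bar>C m\<bar> * norm v" if "u \<in> W m" "norm u \<le> norm v" for u m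
   by (rule order_trans[OF C[OF that(1)] mult_mono]) (use that in auto)
  have "T v = T x + T y + T z"
   unfolding xyz(4) using xyz W_V V_sub by (simp add: lin_add[OF T] subspace_add)
  hence "norm (T v) \<le> norm (T x) + norm (T y) + norm (T z)"
   using norm_triangle_ineq[of "T x + T y" "T z"] norm_triangle_ineq[of "T x" "T y"] by simp
  also have "\<dots> \<le> \<bar>C (- 1)\<bar> * norm v + \<bar>C 0\<bar> * norm v + \<bar>C 1\<bar> * norm v"
   by (intro add_mono bd xyz le)
  finally show "norm (T v) \<le> (\<bar>C (- 1)\<bar> + \<bar>C 0\<bar> + \<bar>C 1\<bar>) * norm v" by (simp add: algebra_simps)
 qed
 have E: "norm (E x) \<le> norm x" if "x \<in> W m" for x m
  using that iso E_0 E_1 W_bound[OF that] lin_zero[OF E_lin] by (cases "m \<in> {- 1, 0, 1}") auto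
 show ?thesis using g
 proof (induction rule: SL2_induct)
  case (mult g h)
  then obtain C D where CD: "\<forall>v\<in>V. norm (\<pi> g v) \<le> C * norm v" "\<forall>v\<in>V. norm (\<pi> h v) \<le> D * norm v" by blast
  show ?case
  proof (intro exI ballI)
   fix v assume v: "v \<in> V"
   have "norm (\<pi> (g ** h) v) \<le> C * norm (\<pi> h v)" using CD(1) pi_in v mult by (simp add: pi_mult)
   also have "\<dots> \<le> \<bar>C\<bar> * norm (\<pi> h v)" by (intro mult_right_mono) auto
   also have "\<dots> \<le> \<bar>C\<bar> * (D * norm v)" using CD(2) v by (intro mult_left_mono) auto
   finally show "norm (\<pi> (g ** h) v) \<le> (\<bar>C\<bar> * D) * norm v" by (simp add: mult.assoc)
  qed
 next
  case (exp t)
  show ?case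
  proof (rule bound[of "\<pi> (exp_E t)" "\<lambda>m. 1 + \<bar>t\<bar>", OF pi_lin[OF SL2_exp_E]])
   fix m x assume x: "x \<in> W m"
   show "norm (\<pi> (exp_E t) x) \<le> (1 + \<bar>t\<bar>) * norm x"
    using norm_triangle_ineq[of x "t *\<^sub>R E x"] mult_left_mono[OF E[OF x], of "\<bar>t\<bar>"] exp_all[OF W_V[OF x], of t]
    by (simp add: algebra_simps)
  qed
 next
  case (diag a)
  show ?case by (rule bound[of "\<pi> (diag2 a)" "\<lambda>m. \<bar>a powi m\<bar>", OF pi_lin[OF SL2_diag2[OF diag]]]) (simp add: pi_diag[OF diag])
 next
  case weyl
  show ?case
  proof (rule bound[of "\<pi> weyl" "\<lambda>m. 1", OF pi_lin[OF SL2_weyl]])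
   fix m x assume x: "x \<in> W m"
   consider "m = - 1" | "m = 0" | "m = 1" | "m \<notin> {- 1, 0, 1}" by blast
   thus "norm (\<pi> weyl x) \<le> 1 * norm x"
   proof cases
    case 3
    then obtain z where z: "z \<in> W (- 1)" "x = E z" "\<pi> weyl x = - z" using weyl_1 x by blast
    thus ?thesis using iso by simp
   qed (use x weyl_neg1 weyl_0 iso W_bound[OF x] lin_zero[OF pi_lin[OF SL2_weyl]] in auto)
  qed
 qed
qed

end

section \<open>Extension of operators from a dense subspace\<close>

lemma dense_induct:
 assumes "closure Y = UNIV" "closed {x. P x}" "\<And>y. y \<in> Y ==> P y" shows "P x"
 using closure_minimal[of Y "{x. P x}"] assms by auto

lemma bounded_linear_eq_on_dense:
 assumes "bounded_linear S" "bounded_linear T" "closure Y = UNIV" "\<And>y. y \<in> Y ==> S y = T y"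
 shows "S = T"
proof
 show "S x = T x" for x
  by (rule dense_induct[OF assms(3) _ assms(4)], rule closed_Collect_eq) (auto intro: linear_continuous_on assms(1,2))
qed

lemma bounded_linear_extension:
 fixes f :: "'m::real_normed_vector => 'n::{real_normed_vector, complete_space}"
 assumes lin: "linear_on_subspace Y f" and dense: "closure Y = UNIV"
  and bd: "\<And>y. y \<in> Y ==> norm (f y) \<le> C * norm y"
 shows "\<exists>T. bounded_linear T \<and> (\<forall>y\<in>Y. T y = f y) \<and> (\<forall>x. norm (T x) \<le> C * norm x)"
proof -
 have Y: "subspace Y" using lin lin_subspace by blast
 have "\<bar>C\<bar>-lipschitz_on Y f"
 proof (rule lipschitz_onI)
  fix x y assume xy: "x \<in> Y" "y \<in> Y"
  have "norm (f (x - y)) \<le> C * norm (x - y)" using bd Y xy by (simp add: subspace_diff)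
  also have "\<dots> \<le> \<bar>C\<bar> * norm (x - y)" by (intro mult_right_mono) auto
  finally show "dist (f x) (f y) \<le> \<bar>C\<bar> * dist x y" using xy lin_diff[OF lin] by (simp add: dist_norm)
 qed simp
 hence "uniformly_continuous_on Y f" by (rule lipschitz_on_uniformly_continuous)
 then obtain g where g: "uniformly_continuous_on (closure Y) g" "\<And>x. x \<in> Y ==> f x = g x"
  by (rule uniformly_continuous_on_extension_on_closure) blast
 have cont: "continuous_on UNIV g"
  using uniformly_continuous_imp_continuous[OF g(1)] unfolding dense .
 hence cont': "continuous_on S (\<lambda>x. g (h x))" if "continuous_on S h" for S and h :: "'b::topological_space => 'm"
  using continuous_on_compose2[OF cont that] by simp
 have d: "closure (Y \<times> Y) = UNIV" unfolding closure_Times dense by simp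
 have "g (fst p + snd p) = g (fst p) + g (snd p)" for p
  by (rule dense_induct[OF d], intro closed_Collect_eq cont' continuous_intros)
   (use lin_add[OF lin] g(2) Y in \<open>auto simp: subspace_add\<close>)
 hence add: "g (x + y) = g x + g y" for x y by (metis fst_conv snd_conv)
 have scale: "g (r *\<^sub>R x) = r *\<^sub>R g x" for r x
  by (rule dense_induct[OF dense], intro closed_Collect_eq cont' continuous_on_scaleR[OF continuous_on_const cont] continuous_intros)
   (use lin_scale[OF lin] g(2) Y in \<open>auto simp: subspace_scale\<close>)
 have bound: "norm (g x) \<le> C * norm x" for x
  by (rule dense_induct[OF dense], intro closed_Collect_le continuous_on_norm[OF cont] continuous_intros) (use bd g(2) in auto)
 have "bounded_linear g"
  by (rule bounded_linear_intro[where K = C]) (auto simp: add scale bound mult.commute)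
 thus ?thesis using g(2) bound by (intro exI[of _ g]) auto
qed

lemma in_span_finite_subset:
 assumes "x \<in> span B" shows "\<exists>F. finite F \<and> F \<subseteq> B \<and> x \<in> span F"
proof -
 obtain t r where "finite t" "t \<subseteq> B" "x = (\<Sum>a\<in>t. r a *\<^sub>R a)"
  using assms unfolding span_explicit by blast
 thus ?thesis by (intro exI[of _ t]) (auto intro!: span_sum span_scale intro: span_base)
qed

section \<open>Diagonal operators\<close>

text \<open>The basis is an arbitrary set without enumeration, so expansions converge along its
  finite subsets.\<close>

locale orthonormal_system =
 fixes B :: "'m::{real_inner, complete_space} set"
 assumes orthonormal: "e \<in> B ==> e' \<in> B ==> e \<bullet> e' = (if e = e' then 1 else 0)"
  and total: "closure (span B) = UNIV"
begin

lemma inner_sum_basis: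
 assumes "finite F" "F \<subseteq> B" "e \<in> B"
 shows "e \<bullet> (\<Sum>x\<in>F. a x *\<^sub>R x) = (if e \<in> F then a e else 0)"
proof -
 have "e \<bullet> (\<Sum>x\<in>F. a x *\<^sub>R x) = (\<Sum>x\<in>F. if e = x then a e else 0)"
  unfolding inner_sum_right using assms by (intro sum.cong) (auto simp: orthonormal subset_iff)
 thus ?thesis using assms by simp
qed

definition proj :: "'m set => 'm => 'm" where "proj F x = (\<Sum>e\<in>F. (e \<bullet> x) *\<^sub>R e)"

lemma proj_span: "proj F x \<in> span F"
 unfolding proj_def by (intro span_sum span_scale span_base)

lemma inner_proj: "finite F ==> F \<subseteq> B ==> e \<in> B ==> e \<bullet> proj F x = (if e \<in> F then e \<bullet> x else 0)"
 unfolding proj_def by (rule inner_sum_basis)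

lemma proj_orth:
 assumes "finite F" "F \<subseteq> B" "y \<in> span F" shows "y \<bullet> (x - proj F x) = 0"
 using assms(3)
proof (induction rule: span_induct_alt)
 case (step c e y)
 thus ?case using inner_proj[of F e x] assms by (auto simp: inner_add_left inner_diff_right)
qed simp

lemma proj_best:
 assumes "finite F" "F \<subseteq> B" "y \<in> span F" shows "norm (x - proj F x) \<le> norm (x - y)"
proof -
 let ?a = "x - proj F x" and ?b = "proj F x - y"
 have "?b \<bullet> ?a = 0" using assms proj_span by (intro proj_orth) (auto intro: span_diff)
 hence "(norm (?a + ?b))\<^sup>2 = (norm ?a)\<^sup>2 + (norm ?b)\<^sup>2"
  by (simp only: power2_norm_eq_inner inner_add_left inner_add_right inner_commute add_0_left add_0_right)
 hence "(norm ?a)\<^sup>2 \<le> (norm (x - y))\<^sup>2" by simp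
 thus ?thesis by (rule power2_le_imp_le) simp
qed

lemma proj_span_id: "finite F ==> F \<subseteq> B ==> x \<in> span F ==> proj F x = x"
 using proj_best[of F x x] by simp

text \<open>Once a finite set has a good approximation in its span, the projection to any larger
  finite set is at least as good by \<open>proj_best\<close>.\<close>

lemma proj_tendsto: "((\<lambda>F. proj F x) \<longlongrightarrow> x) (finite_subsets_at_top B)"
proof (rule tendstoI)
 fix \<epsilon> :: real assume "\<epsilon> > 0"
 moreover have "x \<in> closure (span B)" using total by simp
 ultimately obtain y where y: "y \<in> span B" "dist y x < \<epsilon>" using closure_approachable by blast
 obtain F where F: "finite F" "F \<subseteq> B" "y \<in> span F" using in_span_finite_subset[OF y(1)] by blast
 show "\<forall>\<^sub>F G in finite_subsets_at_top B. dist (proj G x) x < \<epsilon>"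
  unfolding eventually_finite_subsets_at_top
 proof (intro exI[of _ F] conjI allI impI F(1,2))
  fix G assume G: "finite G \<and> F \<subseteq> G \<and> G \<subseteq> B"
  hence "y \<in> span G" using F(3) span_mono by blast
  hence "norm (x - proj G x) \<le> norm (x - y)" using G by (intro proj_best) auto
  thus "dist (proj G x) x < \<epsilon>" using y(2) by (simp add: dist_norm norm_minus_commute)
 qed
qed

lemma basis_eqI: assumes "\<And>e. e \<in> B ==> e \<bullet> x = e \<bullet> y" shows "x = y"
proof -
 have "\<forall>\<^sub>F F in finite_subsets_at_top B. proj F (x - y) = 0"
  using assms by (intro eventually_finite_subsets_at_top_weakI) (auto simp: proj_def inner_diff_right subset_iff intro!: sum.neutral)
 from Lim_transform_eventually[OF proj_tendsto this] have "x - y = 0"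
  by (intro tendsto_unique[OF _ _ tendsto_const]) auto
 thus ?thesis by simp
qed

lemma inner_tendsto: "((\<lambda>F. \<Sum>e\<in>F. (e \<bullet> x) * (e \<bullet> y)) \<longlongrightarrow> x \<bullet> y) (finite_subsets_at_top B)"
 using tendsto_inner[OF proj_tendsto[of x] tendsto_const[of y]] by (simp add: proj_def inner_sum_left)

lemma inner_eqI:
 assumes "\<And>e. e \<in> B ==> (e \<bullet> x) * (e \<bullet> y) = (e \<bullet> x') * (e \<bullet> y')" shows "x \<bullet> y = x' \<bullet> y'"
proof -
 have "\<forall>\<^sub>F F in finite_subsets_at_top B. (\<Sum>e\<in>F. (e \<bullet> x) * (e \<bullet> y)) = (\<Sum>e\<in>F. (e \<bullet> x') * (e \<bullet> y'))"
  using assms by (intro eventually_finite_subsets_at_top_weakI sum.cong) auto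
 from Lim_transform_eventually[OF inner_tendsto this] show ?thesis
  by (intro tendsto_unique[OF _ _ inner_tendsto]) auto
qed

lemma inner_nonnegI:
 assumes "\<And>e. e \<in> B ==> 0 \<le> (e \<bullet> x) * (e \<bullet> y)" shows "0 \<le> x \<bullet> y"
 using assms
 by (intro tendsto_lowerbound[OF inner_tendsto] eventually_finite_subsets_at_top_weakI sum_nonneg) auto

lemma norm_leI:
 assumes "\<And>e. e \<in> B ==> \<bar>e \<bullet> w\<bar> \<le> M * \<bar>e \<bullet> x\<bar>" "0 \<le> M" shows "norm w \<le> M * norm x"
proof -
 have le: "(e \<bullet> w) * (e \<bullet> w) \<le> M\<^sup>2 * ((e \<bullet> x) * (e \<bullet> x))" if "e \<in> B" for e
  unfolding power2_eq_square[symmetric] using power_mono[OF assms(1)[OF that], of 2] by (simp add: power_mult_distrib)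
 have "w \<bullet> w \<le> M\<^sup>2 * (x \<bullet> x)"
  by (rule tendsto_le[OF _ tendsto_mult_left[OF inner_tendsto] inner_tendsto])
   (auto simp: sum_distrib_left intro!: eventually_finite_subsets_at_top_weakI sum_mono le)
 hence "(norm w)\<^sup>2 \<le> (M * norm x)\<^sup>2" by (simp add: power2_norm_eq_inner power_mult_distrib)
 thus ?thesis by (rule power2_le_imp_le) (simp add: assms(2))
qed

lemma independent_basis: "independent B"
proof (rule pairwise_orthogonal_independent)
 show "pairwise orthogonal B" by (auto simp: pairwise_def orthogonal_def orthonormal)
 show "0 \<notin> B" using orthonormal[of 0 0] by auto
qed

text \<open>The multiplier is defined on the span of the basis, bounded there by
  \<open>norm_leI\<close>, and extended by density. The coefficient formula is a closed condition
  and survives the extension.\<close>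

lemma diagonal_operator:
 assumes c: "\<And>e. e \<in> B ==> \<bar>c e\<bar> \<le> M" and M: "0 \<le> M"
 shows "\<exists>D. bounded_linear D \<and> (\<forall>x. \<forall>e\<in>B. e \<bullet> D x = c e * (e \<bullet> x)) \<and> (\<forall>x. norm (D x) \<le> M * norm x)"
proof -
 obtain f where f: "linear f" "\<forall>e\<in>B. f e = c e *\<^sub>R e"
  using linear_independent_extend[OF independent_basis, of "\<lambda>e. c e *\<^sub>R e"] by blast
 have ef: "e \<bullet> f x = c e * (e \<bullet> x)" if e: "e \<in> B" and x: "x \<in> span B" for e x
  using x
 proof (induction rule: span_induct_alt)
  case (step r e' y)
  thus ?case using f(2) e
   by (simp add: linear_add[OF f(1)] linear_scale[OF f(1)] inner_add_right orthonormal algebra_simps)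
 qed (simp add: linear_0[OF f(1)])
 have "norm (f x) \<le> M * norm x" if "x \<in> span B" for x
  by (rule norm_leI[OF _ M]) (simp add: ef[OF _ that] abs_mult mult_right_mono c)
 moreover have "linear_on_subspace (span B) f"
  by (rule linI) (simp_all add: linear_add[OF f(1)] linear_scale[OF f(1)])
 ultimately obtain D where D: "bounded_linear D" "\<And>y. y \<in> span B ==> D y = f y" "\<And>x. norm (D x) \<le> M * norm x"
  using bounded_linear_extension[OF _ total, of f M] by blast
 have "e \<bullet> D x = c e * (e \<bullet> x)" if "e \<in> B" for e x
  by (rule dense_induct[OF total], intro closed_Collect_eq continuous_intros bounded_linear.continuous_on[OF D(1)])
   (simp add: D(2) ef that)
 thus ?thesis using D by blast
qed

text \<open>A box is a finite Minkowski sum of segments.\<close>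

lemma compact_box: "finite F ==> compact {\<Sum>e\<in>F. a e *\<^sub>R e | a. \<forall>e\<in>F. \<bar>a e\<bar> \<le> M}" for F :: "'m set"
proof (induction F rule: finite_induct)
 case (insert e F)
 let ?S = "(\<lambda>r. r *\<^sub>R e) ` {- M..M}" and ?T = "{\<Sum>e\<in>F. a e *\<^sub>R e | a. \<forall>e\<in>F. \<bar>a e\<bar> \<le> M}"
 have "{\<Sum>e\<in>insert e F. a e *\<^sub>R e | a. \<forall>e\<in>insert e F. \<bar>a e\<bar> \<le> M} = {x + y |x y. x \<in> ?S \<and> y \<in> ?T}" (is "?L = ?R")
 proof
  show "?L \<subseteq> ?R" using insert by (fastforce simp: abs_le_iff)
  show "?R \<subseteq> ?L"
  proof
   fix z assume "z \<in> ?R"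
   then obtain r a where ra: "r \<in> {- M..M}" "\<forall>e\<in>F. \<bar>a e\<bar> \<le> M" "z = r *\<^sub>R e + (\<Sum>e\<in>F. a e *\<^sub>R e)" by blast
   define a' where "a' = a(e := r)"
   have "(\<Sum>x\<in>F. a x *\<^sub>R x) = (\<Sum>x\<in>F. a' x *\<^sub>R x)" using insert(2) by (intro sum.cong) (auto simp: a'_def)
   hence "z = (\<Sum>x\<in>insert e F. a' x *\<^sub>R x)" using ra insert by (simp add: a'_def)
   moreover have "\<forall>x\<in>insert e F. \<bar>a' x\<bar> \<le> M" using ra by (auto simp: a'_def abs_le_iff)
   ultimately show "z \<in> ?L" by blast
  qed
 qed
 moreover have "compact ?S" by (intro compact_continuous_image continuous_intros compact_Icc)
 ultimately show ?case using compact_sums[OF _ insert.IH] by simp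
qed simp

text \<open>Total boundedness of the image of the unit ball: all but finitely many multipliers are
  small, so the image lies uniformly near a compact box in the span of the remaining basis
  vectors.\<close>

lemma compact_diagonal:
 assumes D: "bounded_linear D" "\<And>x e. e \<in> B ==> e \<bullet> D x = c e * (e \<bullet> x)"
  and fin: "\<And>\<epsilon>. \<epsilon> > 0 ==> finite {e\<in>B. \<bar>c e\<bar> \<ge> \<epsilon>}"
 shows "compact_operator D"
 unfolding compact_operator_def
proof (intro conjI D(1))
 let ?S = "closure (D ` cball 0 1)"
 obtain M where M: "\<And>x. norm (D x) \<le> norm x * M" using bounded_linear.bounded[OF D(1)] by blast
 show "compact ?S"
  unfolding compact_eq_totally_bounded
 proof (intro conjI allI impI)
  show "complete ?S" by (simp add: complete_eq_closed)
  fix \<epsilon> :: real assume \<epsilon>: "\<epsilon> > 0"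
  define F where "F = {e\<in>B. \<bar>c e\<bar> \<ge> \<epsilon> / 8}"
  have F: "finite F" "F \<subseteq> B" unfolding F_def using fin[of "\<epsilon> / 8"] \<epsilon> by auto
  define T where "T = {\<Sum>e\<in>F. a e *\<^sub>R e | a. \<forall>e\<in>F. \<bar>a e\<bar> \<le> \<bar>M\<bar>}"
  have "compact T" unfolding T_def by (rule compact_box[OF F(1)])
  then obtain k where k: "finite k" "T \<subseteq> (\<Union>x\<in>k. ball x (\<epsilon> / 4))"
   unfolding compact_eq_totally_bounded using \<epsilon> by (meson divide_pos_pos zero_less_numeral)
  have near: "\<exists>t\<in>T. norm (D x - t) \<le> \<epsilon> / 4" if x: "norm x \<le> 1" for x
  proof
   show "proj F (D x) \<in> T"
    unfolding T_def proj_def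
   proof (intro CollectI exI[of _ "\<lambda>e. e \<bullet> D x"] conjI refl ballI)
    fix e assume "e \<in> F"
    hence "norm e = 1" using F orthonormal[of e e] by (auto simp: norm_eq_1)
    hence "\<bar>e \<bullet> D x\<bar> \<le> norm (D x)" using Cauchy_Schwarz_ineq2[of e "D x"] by simp
    also have "\<dots> \<le> norm x * \<bar>M\<bar>" using M[of x] by (smt (verit) mult_left_mono norm_ge_zero)
    also have "\<dots> \<le> \<bar>M\<bar>" using x by (simp add: mult_left_le_one_le)
    finally show "\<bar>e \<bullet> D x\<bar> \<le> \<bar>M\<bar>" .
   qed
   have "norm (D x - proj F (D x)) \<le> \<epsilon> / 4 * norm x"
   proof (rule norm_leI)
    fix e assume e: "e \<in> B"
    have "\<bar>c e\<bar> * \<bar>e \<bullet> x\<bar> \<le> \<epsilon> / 4 * \<bar>e \<bullet> x\<bar>" if "e \<notin> F"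
     using that e \<epsilon> by (intro mult_right_mono) (auto simp: F_def)
    thus "\<bar>e \<bullet> (D x - proj F (D x))\<bar> \<le> \<epsilon> / 4 * \<bar>e \<bullet> x\<bar>"
     using \<epsilon> by (simp add: inner_diff_right inner_proj[OF F e] D(2)[OF e] abs_mult)
   qed (use \<epsilon> in simp)
   also have "\<dots> \<le> \<epsilon> / 4" using x \<epsilon> by (simp add: mult_left_le)
   finally show "norm (D x - proj F (D x)) \<le> \<epsilon> / 4" .
  qed
  show "\<exists>k. finite k \<and> ?S \<subseteq> (\<Union>x\<in>k. ball x \<epsilon>)"
  proof (intro exI[of _ k] conjI k subsetI)
   fix z assume "z \<in> ?S"
   then obtain w where "w \<in> D ` cball 0 1" "dist w z < \<epsilon> / 4"
    unfolding closure_approachable using \<epsilon> by (metis divide_pos_pos zero_less_numeral)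
   then obtain x where x: "norm x \<le> 1" "dist (D x) z < \<epsilon> / 4" by auto
   obtain t where t: "t \<in> T" "norm (D x - t) \<le> \<epsilon> / 4" using near[OF x(1)] by blast
   obtain u where u: "u \<in> k" "dist u t < \<epsilon> / 4" using k t by auto
   have "dist u z \<le> dist u t + dist t (D x) + dist (D x) z" using dist_triangle[of u z t] dist_triangle[of t z "D x"] by simp
   hence "dist u z < \<epsilon>" using t u x \<epsilon> by (simp add: dist_norm norm_minus_commute)
   thus "z \<in> (\<Union>x\<in>k. ball x \<epsilon>)" using u by auto
  qed
 qed
qed

text \<open>The domain is implicit: \<open>u\<close> belongs to it when the numbers
  \<open>c e * (e \<bullet> u)\<close> are the coefficients of some vector. This is the maximal
  domain of the multiplier.\<close>

definition diagonal_graph :: "('m => real) => ('m \<times> 'm) set" where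
 "diagonal_graph c = {(u, v). \<forall>e\<in>B. e \<bullet> v = c e * (e \<bullet> u)}"

lemma subspace_diagonal_graph: "subspace (diagonal_graph c)"
 unfolding subspace_def diagonal_graph_def
 by (auto simp: inner_add_right algebra_simps zero_prod_def)

lemma closed_diagonal_graph: "closed (diagonal_graph c)"
proof -
 have "diagonal_graph c = (\<Inter>e\<in>B. {p. e \<bullet> snd p = c e * (e \<bullet> fst p)})"
  by (auto simp: diagonal_graph_def)
 also have "closed \<dots>"
  by (intro closed_INT ballI closed_Collect_eq continuous_intros)
 finally show ?thesis .
qed

text \<open>The span of the basis is a core: truncation to finitely many basis vectors commutes with
  the multiplier and converges in both components. This identifies an operator closed up from
  algebraic eigenvectors with the maximal diagonal one.\<close>

lemma diagonal_graph_eq_closure: "diagonal_graph c = closure (span ((\<lambda>e. (e, c e *\<^sub>R e)) ` B))"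
proof
 have "(e, c e *\<^sub>R e) \<in> diagonal_graph c" if "e \<in> B" for e
  using that by (auto simp: diagonal_graph_def orthonormal)
 hence "span ((\<lambda>e. (e, c e *\<^sub>R e)) ` B) \<subseteq> diagonal_graph c"
  by (intro span_minimal subspace_diagonal_graph) auto
 thus "closure (span ((\<lambda>e. (e, c e *\<^sub>R e)) ` B)) \<subseteq> diagonal_graph c"
  by (rule closure_minimal[OF _ closed_diagonal_graph])
 show "diagonal_graph c \<subseteq> closure (span ((\<lambda>e. (e, c e *\<^sub>R e)) ` B))"
 proof clarify
  fix u v assume p: "(u, v) \<in> diagonal_graph c"
  have "(proj H u, proj H v) \<in> closure (span ((\<lambda>e. (e, c e *\<^sub>R e)) ` B))" if H: "finite H" "H \<subseteq> B" for H
  proof -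
   have "(proj H u, proj H v) = (\<Sum>e\<in>H. (e \<bullet> u) *\<^sub>R (e, c e *\<^sub>R e))"
    using p H by (intro prod_eqI) (auto simp: diagonal_graph_def proj_def fst_sum snd_sum mult.commute intro!: sum.cong)
   also have "\<dots> \<in> span ((\<lambda>e. (e, c e *\<^sub>R e)) ` B)"
    using H by (intro span_sum span_scale span_base) auto
   finally show ?thesis using closure_subset by blast
  qed
  thus "(u, v) \<in> closure (span ((\<lambda>e. (e, c e *\<^sub>R e)) ` B))"
   by (rule Lim_in_closed_set[OF closed_closure eventually_finite_subsets_at_top_weakI _ tendsto_Pair[OF proj_tendsto proj_tendsto]]) auto
 qed
qed

text \<open>A pair in the adjoint graph, tested against \<open>(e, c e *\<^sub>R e)\<close> for each
  basis vector, has exactly the coefficients that define the graph; the converse is Parseval's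
  identity.\<close>

lemma self_adjoint_diagonal_graph: "self_adjoint (diagonal_graph c)"
 unfolding self_adjoint_def
proof (intro conjI subspace_diagonal_graph)
 show "single_valued (diagonal_graph c)"
  unfolding single_valued_def diagonal_graph_def by (auto intro: basis_eqI)
 have "span B \<subseteq> Domain (diagonal_graph c)"
 proof (rule span_minimal)
  show "B \<subseteq> Domain (diagonal_graph c)"
  proof
   fix e assume "e \<in> B"
   hence "(e, c e *\<^sub>R e) \<in> diagonal_graph c" by (auto simp: diagonal_graph_def orthonormal)
   thus "e \<in> Domain (diagonal_graph c)" by blast
  qed
  show "subspace (Domain (diagonal_graph c))"
   using linear_subspace_image[of fst, OF linear_fst subspace_diagonal_graph] by (simp add: fst_eq_Domain)
 qed
 thus "closure (Domain (diagonal_graph c)) = UNIV"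
  using closure_mono[of "span B" "Domain (diagonal_graph c)"] total by auto
 show "adjoint_graph (diagonal_graph c) = diagonal_graph c"
 proof
  show "adjoint_graph (diagonal_graph c) \<subseteq> diagonal_graph c"
  proof (clarify)
   fix u v assume a: "(u, v) \<in> adjoint_graph (diagonal_graph c)"
   have "e \<bullet> v = c e * (e \<bullet> u)" if e: "e \<in> B" for e
   proof -
    have "(e, c e *\<^sub>R e) \<in> diagonal_graph c" using e by (auto simp: diagonal_graph_def orthonormal)
    thus ?thesis using a unfolding adjoint_graph_def by fastforce
   qed
   thus "(u, v) \<in> diagonal_graph c" by (simp add: diagonal_graph_def)
  qed
  show "diagonal_graph c \<subseteq> adjoint_graph (diagonal_graph c)"
   unfolding adjoint_graph_def diagonal_graph_def by (auto intro!: inner_eqI)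
 qed
qed

text \<open>The multiplier \<open>1 / (c e - s)\<close> is complex but the space is real. Its real
  and imaginary parts become two real diagonal operators \<open>P\<close> and \<open>Q\<close>, and
  the resolvent is the matrix with rows \<open>P, - Q\<close> and \<open>Q, P\<close>.\<close>

lemma compact_resolvent_diagonal_graph:
 assumes fin: "\<And>r. finite {e\<in>B. \<bar>c e\<bar> \<le> r}"
 shows "compact_resolvent (diagonal_graph c)"
 unfolding compact_resolvent_def
proof (intro allI impI)
 fix s :: complex assume "s \<notin> \<real>"
 hence im: "Im s \<noteq> 0" using complex_is_Real_iff by blast
 define w where "w e = inverse (of_real (c e) - s)" for e
 define \<alpha> where "\<alpha> e = Re (w e)" for e
 define \<beta> where "\<beta> e = Im (w e)" for e
 have nz: "of_real (c e) - s \<noteq> 0" for e using im by (auto simp: complex_eq_iff)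
 hence "(of_real (c e) - s) * w e = 1" for e by (simp add: w_def)
 hence ab: "(c e - Re s) * \<alpha> e + Im s * \<beta> e = 1" and ab': "(c e - Re s) * \<beta> e = Im s * \<alpha> e" for e
  unfolding complex_eq_iff by (simp_all add: \<alpha>_def \<beta>_def)
 have le: "\<bar>\<alpha> e\<bar> \<le> inverse (cmod (of_real (c e) - s))" "\<bar>\<beta> e\<bar> \<le> inverse (cmod (of_real (c e) - s))" for e
  using abs_Re_le_cmod[of "w e"] abs_Im_le_cmod[of "w e"] by (simp_all add: \<alpha>_def \<beta>_def w_def norm_inverse)
 have "inverse (cmod (of_real (c e) - s)) \<le> 1 / \<bar>Im s\<bar>" for e
  using abs_Im_le_cmod[of "of_real (c e) - s"] im nz[of e] by (simp add: divide_simps)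
 hence a1: "\<bar>\<alpha> e\<bar> \<le> 1 / \<bar>Im s\<bar>" and b1: "\<bar>\<beta> e\<bar> \<le> 1 / \<bar>Im s\<bar>" for e using order_trans[OF le(1)] order_trans[OF le(2)] by blast+
 have "inverse (cmod (of_real (c e) - s)) * \<bar>c e - Re s\<bar> \<le> 1" for e
  using abs_Re_le_cmod[of "of_real (c e) - s"] nz[of e] by (simp add: divide_simps)
 hence small: "\<bar>\<alpha> e\<bar> * \<bar>c e - Re s\<bar> \<le> 1" "\<bar>\<beta> e\<bar> * \<bar>c e - Re s\<bar> \<le> 1" for e
  using order_trans[OF mult_right_mono[OF le(1) abs_ge_zero]] order_trans[OF mult_right_mono[OF le(2) abs_ge_zero]] by blast+
 \<comment> \<open>Both parts of the multiplier are at most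
   \<open>1 / \<bar>c e - Re s\<bar>\<close>, so they reach a given size on finitely many basis
   vectors only.\<close>
 have fin': "finite {e\<in>B. \<bar>g e\<bar> \<ge> \<epsilon>}" if "\<epsilon> > 0" "\<And>e. \<bar>g e\<bar> * \<bar>c e - Re s\<bar> \<le> 1" for g :: "'m => real" and \<epsilon>
 proof (rule finite_subset[OF _ fin[of "1 / \<epsilon> + \<bar>Re s\<bar>"]], clarify)
  fix e assume "\<epsilon> \<le> \<bar>g e\<bar>"
  hence "\<epsilon> * \<bar>c e - Re s\<bar> \<le> 1" using that(2)[of e] mult_right_mono[of \<epsilon> "\<bar>g e\<bar>" "\<bar>c e - Re s\<bar>"] by linarith
  hence "\<bar>c e - Re s\<bar> \<le> 1 / \<epsilon>" using that(1) by (simp add: pos_le_divide_eq mult.commute)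
  thus "\<bar>c e\<bar> \<le> 1 / \<epsilon> + \<bar>Re s\<bar>" by linarith
 qed
 obtain P where P: "bounded_linear P" "\<And>x e. e \<in> B ==> e \<bullet> P x = \<alpha> e * (e \<bullet> x)"
  using diagonal_operator[of \<alpha> "1 / \<bar>Im s\<bar>"] a1 by auto
 obtain Q where Q: "bounded_linear Q" "\<And>x e. e \<in> B ==> e \<bullet> Q x = \<beta> e * (e \<bullet> x)"
  using diagonal_operator[of \<beta> "1 / \<bar>Im s\<bar>"] b1 by auto
 have cP: "compact (closure (P ` cball 0 1))"
  using compact_diagonal[OF P] fin'[OF _ small(1)] unfolding compact_operator_def by blast
 have cQ: "compact (closure (Q ` cball 0 1))"
  using compact_diagonal[OF Q] fin'[OF _ small(2)] unfolding compact_operator_def by blast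
 define R where "R z = (P (fst z) - Q (snd z), P (snd z) + Q (fst z))" for z
 show "\<exists>R. compact_operator R \<and> {(R z, z) |z. True} = shifted_complexification (diagonal_graph c) s"
 proof (intro exI conjI)
  show "compact_operator R"
   unfolding compact_operator_def
  proof
   show "bounded_linear R"
    unfolding R_def
    by (intro bounded_linear_Pair bounded_linear_sub bounded_linear_add
      bounded_linear_compose[OF P(1)] bounded_linear_compose[OF Q(1)] bounded_linear_fst bounded_linear_snd)
   let ?P = "closure (P ` cball 0 1)" and ?Q = "closure (Q ` cball 0 1)"
   let ?K = "{x - y |x y. x \<in> ?P \<and> y \<in> ?Q} \<times> {x + y |x y. x \<in> ?P \<and> y \<in> ?Q}"
   have K: "compact ?K" by (intro compact_Times compact_sums compact_differences cP cQ)
   have "R ` cball 0 1 \<subseteq> ?K"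
   proof
    fix w assume "w \<in> R ` cball 0 1"
    then obtain z where z: "norm z \<le> 1" "w = R z" by auto
    have "norm (fst z) \<le> 1" "norm (snd z) \<le> 1"
     using z(1) norm_fst_le[of "fst z" "snd z"] norm_snd_le[of "snd z" "fst z"] by auto
    hence "P (fst z) \<in> ?P" "P (snd z) \<in> ?P" "Q (fst z) \<in> ?Q" "Q (snd z) \<in> ?Q"
     by (auto intro!: closure_subset[THEN subsetD])
    thus "w \<in> ?K" unfolding z(2) R_def by blast
   qed
   hence "closure (R ` cball 0 1) \<subseteq> ?K" using K compact_imp_closed by (intro closure_minimal) auto
   thus "compact (closure (R ` cball 0 1))" using compact_Int_closed[OF K closed_closure[of "R ` cball 0 1"]] by (simp add: Int_absorb1)
  qed
  \<comment> \<open>The equation \<open>x + i y = w e * (z + i z')\<close> and its inverse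
    \<open>z + i z' = (c e - s) * (x + i y)\<close>, in real coordinates.\<close>
  have alg: "x = \<alpha> e * z - \<beta> e * z' \<and> y = \<alpha> e * z' + \<beta> e * z \<longleftrightarrow>
    z + Re s * x - Im s * y = c e * x \<and> z' + Re s * y + Im s * x = c e * y" for e x y z z'
  proof -
   let ?k = "c e - Re s" and ?m = "Im s" and ?a = "\<alpha> e" and ?b = "\<beta> e"
   have "?k * (?a * z - ?b * z') + ?m * (?a * z' + ?b * z) = (?k * ?a + ?m * ?b) * z - (?k * ?b - ?m * ?a) * z'"
    "?k * (?a * z' + ?b * z) - ?m * (?a * z - ?b * z') = (?k * ?a + ?m * ?b) * z' + (?k * ?b - ?m * ?a) * z"
    "?a * (?k * x + ?m * y) - ?b * (?k * y - ?m * x) = (?k * ?a + ?m * ?b) * x - (?k * ?b - ?m * ?a) * y"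
    "?a * (?k * y - ?m * x) + ?b * (?k * x + ?m * y) = (?k * ?a + ?m * ?b) * y + (?k * ?b - ?m * ?a) * x"
    by (simp_all add: algebra_simps)
   moreover have "z + Re s * x - ?m * y = c e * x \<longleftrightarrow> z = ?k * x + ?m * y"
    "z' + Re s * y + ?m * x = c e * y \<longleftrightarrow> z' = ?k * y - ?m * x" by (auto simp: left_diff_distrib)
   ultimately show ?thesis unfolding ab ab' diff_self mult_1 mult_zero_left diff_zero add_0_right by metis
  qed
  show "{(R z, z) |z. True} = shifted_complexification (diagonal_graph c) s"
  proof (rule set_eqI)
   fix w :: "('m \<times> 'm) \<times> 'm \<times> 'm"
   obtain x y z z' where w: "w = ((x, y), z, z')" by (metis surj_pair)
   have "w \<in> {(R z, z) |z. True} \<longleftrightarrow> x = P z - Q z' \<and> y = P z' + Q z" by (auto simp: R_def w)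
   also have "\<dots> \<longleftrightarrow> (\<forall>e\<in>B. e \<bullet> x = e \<bullet> (P z - Q z') \<and> e \<bullet> y = e \<bullet> (P z' + Q z))"
    using basis_eqI[of x "P z - Q z'"] basis_eqI[of y "P z' + Q z"] by blast
   also have "\<dots> \<longleftrightarrow> (x, z + Re s *\<^sub>R x - Im s *\<^sub>R y) \<in> diagonal_graph c \<and> (y, z' + Re s *\<^sub>R y + Im s *\<^sub>R x) \<in> diagonal_graph c"
    by (auto simp: diagonal_graph_def P(2) Q(2) inner_add_right inner_diff_right alg)
   also have "\<dots> \<longleftrightarrow> w \<in> shifted_complexification (diagonal_graph c) s"
    unfolding shifted_complexification_def w by (force simp: algebra_simps)
   finally show "w \<in> {(R z, z) |z. True} \<longleftrightarrow> w \<in> shifted_complexification (diagonal_graph c) s" .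
  qed
 qed
qed

lemma eigenspace_diagonal:
 assumes D: "\<And>x e. e \<in> B ==> e \<bullet> D x = c e * (e \<bullet> x)" and fin: "finite {e\<in>B. c e = s}"
 shows "dim {x. D x = s *\<^sub>R x} = card {e\<in>B. c e = s}"
proof -
 let ?F = "{e\<in>B. c e = s}"
 have "{x. D x = s *\<^sub>R x} = span ?F"
 proof
  show "{x. D x = s *\<^sub>R x} \<subseteq> span ?F"
  proof
   fix x assume "x \<in> {x. D x = s *\<^sub>R x}"
   hence x: "D x = s *\<^sub>R x" by simp
   have "x = proj ?F x"
   proof (rule basis_eqI)
    fix e assume e: "e \<in> B"
    have "c e * (e \<bullet> x) = s * (e \<bullet> x)" using D[OF e, of x] x by (metis inner_scaleR_right)
    hence "c e = s \<or> e \<bullet> x = 0" by (metis mult_cancel_right)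
    thus "e \<bullet> x = e \<bullet> proj ?F x" using inner_proj[OF fin _ e, of x] e by auto
   qed
   thus "x \<in> span ?F" using proj_span by metis
  qed
  show "span ?F \<subseteq> {x. D x = s *\<^sub>R x}"
  proof
   fix x assume "x \<in> span ?F"
   hence x: "proj ?F x = x" using proj_span_id[OF fin] by auto
   have "D x = s *\<^sub>R x"
   proof (rule basis_eqI)
    fix e assume e: "e \<in> B"
    have "e \<bullet> x = (if e \<in> ?F then e \<bullet> x else 0)" using inner_proj[OF fin _ e, of x] x by auto
    thus "e \<bullet> D x = e \<bullet> (s *\<^sub>R x)" using D[OF e] e by (auto split: if_splits)
   qed
   thus "x \<in> {x. D x = s *\<^sub>R x}" by simp
  qed
 qed
 moreover have "independent ?F" by (rule independent_mono[OF independent_basis]) auto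
 ultimately show ?thesis using dim_span_eq_card_independent by metis
qed

end

text \<open>Lists the reciprocals $1/k$, each \<open>n k\<close> times, in decreasing order.\<close>

lemma reciprocal_enumeration:
 fixes n :: "nat => nat"
 assumes bound: "\<And>k. n k \<le> C"
 shows "\<exists>\<mu> :: nat => real. decseq \<mu> \<and> (\<forall>r. 0 \<le> \<mu> r) \<and>
  (\<forall>k\<ge>1. finite {r. \<mu> r = 1 / real k} \<and> card {r. \<mu> r = 1 / real k} = n k) \<and>
  (\<forall>s>0. (\<forall>k\<ge>1. s \<noteq> 1 / real k) \<longrightarrow> {r. \<mu> r = s} = {}) \<and> \<mu> \<in> O(\<lambda>r. 1 / real r)"
proof -
 define S where "S k = (\<Sum>m\<in>{1..k}. n m)" for k
 have S0: "S 0 = 0" by (simp add: S_def)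
 have S_Suc: "S (Suc k) = S k + n (Suc k)" for k by (simp add: S_def)
 have S_mono: "S k \<le> S l" if "k \<le> l" for k l using that unfolding S_def by (intro sum_mono2) auto
 have S_le: "S k \<le> k * C" for k
  using sum_bounded_above[of "{1..k}" n C] bound by (simp add: S_def)
 \<comment> \<open>Rank \<open>r\<close> receives \<open>1 / k\<close> for the first
   \<open>k\<close> with \<open>r < S k\<close>, so the ranks from \<open>S (k - 1)\<close> to
   \<open>S k - 1\<close> carry \<open>1 / k\<close>; beyond a bounded \<open>S\<close> the list is
   padded with 0.\<close>
 define \<mu> where "\<mu> r = (if \<exists>k. r < S k then 1 / real (LEAST k. r < S k) else 0)" for r
 have pos: "(LEAST k. r < S k) \<ge> 1" if "r < S k" for r k
  using LeastI[of "\<lambda>k. r < S k", OF that] S0 by (cases "LEAST k. r < S k") auto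
 have eq: "\<mu> r = 1 / real k \<longleftrightarrow> S (k - 1) \<le> r \<and> r < S k" if k: "k \<ge> 1" for r k
 proof
  assume \<mu>: "\<mu> r = 1 / real k"
  hence ex: "\<exists>k. r < S k" using k by (auto simp: \<mu>_def split: if_splits)
  hence L: "(LEAST k. r < S k) = k" using \<mu> pos k by (auto simp: \<mu>_def)
  have "r < S k" using LeastI_ex[OF ex] L by simp
  moreover have "\<not> r < S (k - 1)" using not_less_Least[of "k - 1" "\<lambda>k. r < S k"] L k by simp
  ultimately show "S (k - 1) \<le> r \<and> r < S k" by simp
 next
  assume r: "S (k - 1) \<le> r \<and> r < S k"
  have "(LEAST k. r < S k) = k"
  proof (rule Least_equality)
   fix l assume "r < S l"
   show "k \<le> l"
   proof (rule ccontr)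
    assume "\<not> k \<le> l"
    hence "S l \<le> S (k - 1)" by (intro S_mono) auto
    thus False using r \<open>r < S l\<close> by simp
   qed
  qed (use r in simp)
  thus "\<mu> r = 1 / real k" using r by (auto simp: \<mu>_def)
 qed
 have "decseq \<mu>"
 proof (rule decseq_SucI)
  fix r
  show "\<mu> (Suc r) \<le> \<mu> r"
  proof (cases "\<exists>k. Suc r < S k")
   case True
   hence ex: "\<exists>k. r < S k" using Suc_lessD by blast
   have "r < S (LEAST k. Suc r < S k)" using LeastI_ex[OF True] by simp
   hence "(LEAST k. r < S k) \<le> (LEAST k. Suc r < S k)" by (rule Least_le)
   moreover have "(LEAST k. r < S k) \<ge> 1" using ex pos by blast
   ultimately show ?thesis using True ex by (simp add: \<mu>_def frac_le)
  qed (simp add: \<mu>_def)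
 qed
 moreover have "0 \<le> \<mu> r" for r by (simp add: \<mu>_def)
 moreover have "finite {r. \<mu> r = 1 / real k} \<and> card {r. \<mu> r = 1 / real k} = n k" if k: "k \<ge> 1" for k
 proof -
  have "{r. \<mu> r = 1 / real k} = {S (k - 1)..<S k}" unfolding eq[OF k] by auto
  moreover have "S k = S (k - 1) + n k" using S_Suc[of "k - 1"] k by simp
  ultimately show ?thesis by simp
 qed
 moreover have "{r. \<mu> r = s} = {}" if "s > 0" "\<forall>k\<ge>1. s \<noteq> 1 / real k" for s
 proof (rule equals0I)
  fix r assume "r \<in> {r. \<mu> r = s}"
  hence r: "\<mu> r = s" by simp
  show False
  proof (cases "\<exists>k. r < S k")
   case True
   hence "s = 1 / real (LEAST k. r < S k)" using r by (simp add: \<mu>_def)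
   moreover have "(LEAST k. r < S k) \<ge> 1" using True pos by blast
   ultimately show False using that(2) by blast
  qed (use r that(1) in \<open>simp add: \<mu>_def\<close>)
 qed
 moreover have "\<mu> \<in> O(\<lambda>r. 1 / real r)"
 proof (rule bigoI[of _ "real C"], rule eventually_sequentiallyI[of 1])
  fix r :: nat assume r: "1 \<le> r"
  show "norm (\<mu> r) \<le> real C * norm (1 / real r)"
  proof (cases "\<exists>k. r < S k")
   case True
   let ?k = "LEAST k. r < S k"
   \<comment> \<open>From \<open>r < S k \<le> k * C\<close> follows
     \<open>1 / k \<le> C / r\<close>, the decay of order one.\<close>
   have "r < S ?k" using LeastI_ex[OF True] .
   also have "\<dots> \<le> ?k * C" by (rule S_le)
   finally have "real r < real ?k * real C" by (simp only: flip: of_nat_mult of_nat_less_iff[where 'a = real])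
   moreover have "?k \<ge> 1" using True pos by blast
   ultimately show ?thesis using True r by (simp add: \<mu>_def divide_simps mult.commute)
  qed (simp add: \<mu>_def)
 qed
 ultimately show ?thesis by blast
qed

context orthonormal_system
begin

lemma finite_levels:
 fixes l :: "'m => int" and r :: real
 assumes "\<And>k. finite {e\<in>B. \<bar>l e\<bar> = int k}" shows "finite {e\<in>B. \<bar>of_int (l e)\<bar> \<le> r}"
proof (rule finite_subset)
 show "{e\<in>B. \<bar>of_int (l e)\<bar> \<le> r} \<subseteq> (\<Union>k\<le>nat \<lfloor>r\<rfloor>. {e\<in>B. \<bar>l e\<bar> = int k})"
 proof clarify
  fix e assume e: "e \<in> B" "\<bar>of_int (l e)\<bar> \<le> r"
  hence "\<bar>l e\<bar> \<le> \<lfloor>r\<rfloor>" by linarith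
  thus "e \<in> (\<Union>k\<le>nat \<lfloor>r\<rfloor>. {e\<in>B. \<bar>l e\<bar> = int k})" using e(1) by (intro UN_I[of "nat \<bar>l e\<bar>"]) simp_all
 qed
qed (use assms in simp)

text \<open>The absolute value is the multiplier by \<open>\<bar>l e\<bar>\<close>, and its inverse
  has the eigenvalues \<open>1 / k\<close>, each as often as \<open>k\<close> occurs among the
  \<open>\<bar>l e\<bar>\<close>. The uniform bound on these multiplicities yields order
  one.\<close>

lemma one_summable_diagonal_graph:
 fixes l :: "'m => int"
 assumes fin: "\<And>k. finite {e\<in>B. \<bar>l e\<bar> = int k}" and card: "\<And>k. k \<ge> 1 ==> card {e\<in>B. \<bar>l e\<bar> = int k} \<le> C"
 shows "one_summable (diagonal_graph (\<lambda>e. of_int (l e)))"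
proof -
 define c where "c e = (if l e = 0 then 0 else 1 / \<bar>real_of_int (l e)\<bar>)" for e :: 'm
 have c1: "\<bar>c e\<bar> \<le> 1" "c e \<ge> 0" for e by (auto simp: c_def divide_le_eq)
 have cl: "\<bar>of_int (l e)\<bar> * c e = (if l e = 0 then 0 else 1)" for e by (simp add: c_def)
 obtain T where T: "bounded_linear T" "\<And>x e. e \<in> B ==> e \<bullet> T x = c e * (e \<bullet> x)"
  using diagonal_operator[of c 1] c1 by auto
 \<comment> \<open>The sign operator of the polar decomposition. A composite of relations needs an
   intermediate vector, and \<open>Sg y\<close> supplies it when passing between the squares of the
   two graphs.\<close>
 obtain Sg where Sg: "\<And>x e. e \<in> B ==> e \<bullet> Sg x = sgn (of_int (l e)) * (e \<bullet> x)"
  using diagonal_operator[of "\<lambda>e. sgn (of_int (l e))" 1] by (auto simp: abs_sgn_eq)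
 let ?G = "diagonal_graph (\<lambda>e. of_int (l e))" and ?P = "diagonal_graph (\<lambda>e. \<bar>of_int (l e)\<bar>)"
 have sq: "diagonal_graph a O diagonal_graph a \<subseteq> diagonal_graph b O diagonal_graph b" if ab: "\<And>e. a e = sgn (of_int (l e)) * b e" "\<And>e. b e = sgn (of_int (l e)) * a e" for a b
  proof clarify
   fix x y z assume "(x, y) \<in> diagonal_graph a" "(y, z) \<in> diagonal_graph a"
   hence xyz: "e \<bullet> y = a e * (e \<bullet> x)" "e \<bullet> z = a e * (e \<bullet> y)" if "e \<in> B" for e
    using that by (simp_all add: diagonal_graph_def)
   have "e \<bullet> Sg y = b e * (e \<bullet> x)" if "e \<in> B" for e
    unfolding Sg[OF that] xyz(1)[OF that] ab(2)[of e] by simp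
   moreover have "e \<bullet> z = b e * (e \<bullet> Sg y)" if "e \<in> B" for e
    unfolding Sg[OF that] xyz(2)[OF that] ab(1)[of e] by simp
   ultimately have "(x, Sg y) \<in> diagonal_graph b" "(Sg y, z) \<in> diagonal_graph b"
    by (simp_all add: diagonal_graph_def)
   thus "(x, z) \<in> diagonal_graph b O diagonal_graph b" by blast
  qed
 have abs: "is_abs_operator ?G ?P"
  unfolding is_abs_operator_def
 proof (intro conjI)
  show "\<forall>(x, y)\<in>?P. 0 \<le> x \<bullet> y"
  proof clarify
   fix x y assume "(x, y) \<in> ?P"
   hence "(e \<bullet> x) * (e \<bullet> y) = \<bar>of_int (l e)\<bar> * ((e \<bullet> x) * (e \<bullet> x))" if "e \<in> B" for e
    using that by (auto simp: diagonal_graph_def)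
   moreover have "0 \<le> \<bar>of_int (l e)\<bar> * ((e \<bullet> x) * (e \<bullet> x))" for e
    by (rule mult_nonneg_nonneg[OF abs_ge_zero zero_le_square])
   ultimately show "0 \<le> x \<bullet> y" by (intro inner_nonnegI) (simp only:)
  qed
  show "?P O ?P = ?G O ?G" by (intro subset_antisym sq) (auto simp: sgn_if)
 qed (rule self_adjoint_diagonal_graph)
 have zero: "n \<in> zero_modes ?P \<longleftrightarrow> (\<forall>e\<in>B. l e = 0 \<or> e \<bullet> n = 0)" for n
  by (auto simp: zero_modes_def diagonal_graph_def)
 have inv: "inverse_off_zero_modes ?P T"
  unfolding inverse_off_zero_modes_def
 proof (intro conjI ballI allI impI T(1))
  fix x assume "x \<in> zero_modes ?P"
  thus "T x = 0" unfolding zero by (intro basis_eqI) (auto simp: T c_def)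
 next
  fix x assume x: "\<forall>n\<in>zero_modes ?P. n \<bullet> x = 0"
  have "e \<bullet> x = 0" if "e \<in> B" "l e = 0" for e
  proof -
   have "e \<in> zero_modes ?P" unfolding zero using that orthonormal by auto
   thus ?thesis using x by blast
  qed
  thus "(T x, x) \<in> ?P" by (auto simp: diagonal_graph_def T mult.assoc[symmetric] cl)
  fix n assume n: "n \<in> zero_modes ?P"
  have "n \<bullet> T x = 0 \<bullet> (0 :: 'm)" using n unfolding zero by (intro inner_eqI) (auto simp: T c_def)
  thus "n \<bullet> T x = 0" by simp
 qed
 have finle: "finite {e\<in>B. c e \<ge> \<epsilon>}" if "\<epsilon> > 0" for \<epsilon>
 proof (rule finite_subset[OF _ finite_levels[OF fin, of "1 / \<epsilon>"]], clarify)
  fix e assume e: "\<epsilon> \<le> c e"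
  hence "l e \<noteq> 0" using that by (auto simp: c_def)
  thus "\<bar>of_int (l e)\<bar> \<le> 1 / \<epsilon>" using e that by (simp add: c_def divide_simps mult.commute)
 qed
 have "infinitesimal_of_order_one T"
  unfolding infinitesimal_of_order_one_def
 proof (intro conjI allI)
  show "compact_operator T" using finle c1(2) by (intro compact_diagonal[OF T]) auto
  show "T x \<bullet> y = x \<bullet> T y" for x y by (rule inner_eqI) (simp add: T)
  show "0 \<le> T x \<bullet> x" for x
   by (rule inner_nonnegI) (simp add: T c1 mult.assoc)
  \<comment> \<open>Zero modes get multiplicity 0: \<open>T\<close> vanishes on them, and
    \<open>card\<close> is bounded for positive levels only.\<close>
  define n where "n k = (if k = 0 then 0 else card {e\<in>B. \<bar>l e\<bar> = int k})" for k
  have nC: "n k \<le> C" for k using card by (auto simp: n_def)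
  obtain \<mu> :: "nat => real" where \<mu>: "decseq \<mu>" "\<forall>r. 0 \<le> \<mu> r"
   "\<forall>k\<ge>1. finite {r. \<mu> r = 1 / real k} \<and> card {r. \<mu> r = 1 / real k} = n k"
   "\<forall>s>0. (\<forall>k\<ge>1. s \<noteq> 1 / real k) \<longrightarrow> {r. \<mu> r = s} = {}" "\<mu> \<in> O(\<lambda>r. 1 / real r)"
   using reciprocal_enumeration[of n C, OF nC] by (elim exE conjE) (rule that)
  have "finite {k. \<mu> k = s} \<and> card {k. \<mu> k = s} = dim {x. T x = s *\<^sub>R x}" if s: "s > 0" for s
  proof -
   have "finite {e\<in>B. c e = s}" by (rule finite_subset[OF _ finle[OF s]]) auto
   hence d: "dim {x. T x = s *\<^sub>R x} = card {e\<in>B. c e = s}" by (intro eigenspace_diagonal T)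
   show ?thesis
   proof (cases "\<exists>k\<ge>1. s = 1 / real k")
    case True
    then obtain k where k: "k \<ge> 1" "s = 1 / real k" by blast
    have "c e = s \<longleftrightarrow> \<bar>l e\<bar> = int k" for e
    proof -
     have "\<bar>of_int (l e)\<bar> = real k \<longleftrightarrow> \<bar>l e\<bar> = int k" by linarith
     thus ?thesis using k by (auto simp: c_def)
    qed
    thus ?thesis using \<mu>(3)[rule_format, OF k(1)] d k by (simp add: n_def)
   next
    case False
    have "c e \<noteq> s" for e
    proof
     assume "c e = s"
     hence "s = 1 / real (nat \<bar>l e\<bar>)" "nat \<bar>l e\<bar> \<ge> 1" using s by (auto simp: c_def split: if_splits)
     thus False using False by blast
    qed
    thus ?thesis using \<mu>(4)[rule_format, OF s] False d by simp
   qed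
  qed
  thus "\<exists>\<mu> :: nat => real. decseq \<mu> \<and> (\<forall>k. 0 \<le> \<mu> k) \<and>
    (\<forall>s>0. finite {k. \<mu> k = s} \<and> card {k. \<mu> k = s} = dim {x. T x = s *\<^sub>R x}) \<and>
    \<mu> \<in> O(\<lambda>k. 1 / real k)"
   using \<mu> by blast
 qed
 thus ?thesis unfolding one_summable_def using abs inv by blast
qed

end

section \<open>Forms on a Riemann surface\<close>

definition smooth_on :: "complex set => (complex => complex) => bool" where
 "smooth_on S f \<longleftrightarrow> (\<forall>n. Ck_on n S f)"

lemma frechet_derivative_cong_open:
 assumes "open S" "z \<in> S" "\<And>w. w \<in> S ==> f w = g w"
 shows "f differentiable (at z) \<longleftrightarrow> g differentiable (at z)"
  and "frechet_derivative f (at z) = frechet_derivative g (at z)"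
proof -
 have "(f has_derivative D) (at z) \<longleftrightarrow> (g has_derivative D) (at z)" for D
  using has_derivative_transform_within_open[OF _ assms(1,2)] assms(3) by metis
 thus "f differentiable (at z) \<longleftrightarrow> g differentiable (at z)"
  "frechet_derivative f (at z) = frechet_derivative g (at z)"
  unfolding differentiable_def frechet_derivative_def by simp_all
qed

lemma Ck_on_cong:
 assumes "open S" "\<And>w. w \<in> S ==> f w = g w" shows "Ck_on n S f \<longleftrightarrow> Ck_on n S g"
 using assms(2)
proof (induction n arbitrary: f g)
 case 0 thus ?case by (simp cong: continuous_on_cong)
next
 case (Suc n)
 have d: "frechet_derivative f (at z) = frechet_derivative g (at z)" if "z \<in> S" for z
  using frechet_derivative_cong_open(2)[OF assms(1) that] Suc.prems by blast
 have "Ck_on n S (\<lambda>z. frechet_derivative f (at z) v) \<longleftrightarrow> Ck_on n S (\<lambda>z. frechet_derivative g (at z) v)" for v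
  by (rule Suc.IH) (simp add: d)
 moreover have "f differentiable (at z) \<longleftrightarrow> g differentiable (at z)" if "z \<in> S" for z
  using frechet_derivative_cong_open(1)[OF assms(1) that] Suc.prems by blast
 ultimately show ?case by simp
qed

lemma Ck_on_Suc_imp: "Ck_on (Suc n) S f ==> Ck_on n S f"
proof (induction n arbitrary: f)
 case 0
 thus ?case by (auto intro!: differentiable_imp_continuous_on differentiable_at_imp_differentiable_on)
qed simp

lemma Ck_on_SucI:
 assumes "open S" "\<And>z. z \<in> S ==> (f has_derivative D z) (at z)" "\<And>v. Ck_on n S (\<lambda>z. D z v)"
 shows "Ck_on (Suc n) S f"
proof -
 have "frechet_derivative f (at z) = D z" if "z \<in> S" for z
  using frechet_derivative_at[OF assms(2)[OF that]] by simp
 hence "Ck_on n S (\<lambda>z. frechet_derivative f (at z) v)" for v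
  using Ck_on_cong[OF assms(1), of "\<lambda>z. frechet_derivative f (at z) v" "\<lambda>z. D z v"] assms(3) by simp
 thus ?thesis using assms(2) by (auto simp: differentiable_def)
qed

lemma Ck_on_const: "open S ==> Ck_on n S (\<lambda>z. a)"
proof (induction n arbitrary: a)
 case (Suc n)
 thus ?case by (intro Ck_on_SucI[where D = "\<lambda>_ _. 0"]) auto
qed simp

lemma Ck_on_add: "open S ==> Ck_on n S f ==> Ck_on n S g ==> Ck_on n S (\<lambda>z. f z + g z)"
proof (induction n arbitrary: f g)
 case (Suc n)
 show ?case
 proof (rule Ck_on_SucI[OF Suc.prems(1)])
  fix z assume "z \<in> S"
  thus "((\<lambda>z. f z + g z) has_derivative
    (\<lambda>v. frechet_derivative f (at z) v + frechet_derivative g (at z) v)) (at z)"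
   using Suc.prems by (intro derivative_intros) (auto simp: frechet_derivative_works[symmetric])
 qed (use Suc in auto)
qed (auto intro: continuous_intros)

lemma Ck_on_mult: "open S ==> Ck_on n S f ==> Ck_on n S g ==> Ck_on n S (\<lambda>z. f z * g z)"
proof (induction n arbitrary: f g)
 case (Suc n)
 show ?case
 proof (rule Ck_on_SucI[OF Suc.prems(1)])
  fix z assume "z \<in> S"
  thus "((\<lambda>z. f z * g z) has_derivative
    (\<lambda>v. f z * frechet_derivative g (at z) v + frechet_derivative f (at z) v * g z)) (at z)"
   using Suc.prems by (intro derivative_intros) (auto simp: frechet_derivative_works[symmetric])
 next
  fix v show "Ck_on n S (\<lambda>z. f z * frechet_derivative g (at z) v + frechet_derivative f (at z) v * g z)"
   using Suc Ck_on_Suc_imp by (intro Ck_on_add Suc.IH) auto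
 qed
qed (auto intro: continuous_intros)

lemma Ck_on_cnj: "open S ==> Ck_on n S f ==> Ck_on n S (\<lambda>z. cnj (f z))"
proof (induction n arbitrary: f)
 case (Suc n)
 show ?case
 proof (rule Ck_on_SucI[OF Suc.prems(1)])
  fix z assume "z \<in> S"
  thus "((\<lambda>z. cnj (f z)) has_derivative (\<lambda>v. cnj (frechet_derivative f (at z) v))) (at z)"
   using Suc.prems by (intro bounded_linear.has_derivative[OF bounded_linear_cnj]) (auto simp: frechet_derivative_works[symmetric])
 qed (use Suc in auto)
qed (auto intro: continuous_intros)

lemma smooth_on_cong: "open S ==> (\<And>w. w \<in> S ==> f w = g w) ==> smooth_on S f \<longleftrightarrow> smooth_on S g"
 unfolding smooth_on_def using Ck_on_cong[of S f g] by simp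

lemma smooth_on_const [simp]: "open S ==> smooth_on S (\<lambda>z. a)"
 by (simp add: smooth_on_def Ck_on_const)

lemma smooth_on_add: "open S ==> smooth_on S f ==> smooth_on S g ==> smooth_on S (\<lambda>z. f z + g z)"
 by (simp add: smooth_on_def Ck_on_add)

lemma smooth_on_mult: "open S ==> smooth_on S f ==> smooth_on S g ==> smooth_on S (\<lambda>z. f z * g z)"
 by (simp add: smooth_on_def Ck_on_mult)

lemma smooth_on_cnj: "open S ==> smooth_on S f ==> smooth_on S (\<lambda>z. cnj (f z))"
 by (simp add: smooth_on_def Ck_on_cnj)

lemma smooth_on_cmult: "open S ==> smooth_on S f ==> smooth_on S (\<lambda>z. a * f z)"
 by (intro smooth_on_mult smooth_on_const)

lemma smooth_onD: "smooth_on S f ==> Ck_on n S f"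
 by (simp add: smooth_on_def)

lemma smooth_on_differentiable: "smooth_on S f ==> z \<in> S ==> f differentiable (at z)"
 using smooth_onD[of S f "Suc 0"] by simp

lemma smooth_on_continuous: "smooth_on S f ==> continuous_on S f"
 using smooth_onD[of S f 0] by simp

lemma smooth_on_frechet:
 assumes "smooth_on S f" shows "smooth_on S (\<lambda>z. frechet_derivative f (at z) v)"
 unfolding smooth_on_def
proof
 fix n show "Ck_on n S (\<lambda>z. frechet_derivative f (at z) v)"
  using smooth_onD[OF assms, of "Suc n"] by simp
qed

lemma smooth_onI:
 assumes "open S" "\<And>z. z \<in> S ==> (f has_derivative D z) (at z)" "\<And>v. smooth_on S (\<lambda>z. D z v)"
 shows "smooth_on S f"
 unfolding smooth_on_def
proof
 fix n show "Ck_on n S f"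
  by (rule Ck_on_Suc_imp[OF Ck_on_SucI[OF assms(1,2) smooth_onD[OF assms(3)]]])
qed

lemma complex_linear_decomposition:
 assumes "bounded_linear D"
 shows "D v = (D 1 - \<i> * D \<i>) / 2 * v + (D 1 + \<i> * D \<i>) / 2 * cnj v"
proof -
 have "v = Re v *\<^sub>R 1 + Im v *\<^sub>R \<i>" by (simp add: complex_eq_iff)
 hence "D v = Re v *\<^sub>R D 1 + Im v *\<^sub>R D \<i>"
  using linear_add[OF bounded_linear.linear[OF assms]] linear_scale[OF bounded_linear.linear[OF assms]] by metis
 thus ?thesis by (simp add: complex_eq_iff field_simps)
qed

lemma wirtinger_has_derivative:
 assumes "f differentiable (at z)"
 shows "(f has_derivative (\<lambda>v. wirtinger f z * v + wirtinger_bar f z * cnj v)) (at z)"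
proof -
 have D: "(f has_derivative frechet_derivative f (at z)) (at z)"
  using assms frechet_derivative_works by blast
 moreover have "frechet_derivative f (at z) = (\<lambda>v. wirtinger f z * v + wirtinger_bar f z * cnj v)"
  unfolding wirtinger_def wirtinger_bar_def
  using complex_linear_decomposition[OF has_derivative_bounded_linear[OF D]] by (rule ext)
 ultimately show ?thesis by simp
qed

lemma wirtinger_eqI:
 assumes "(f has_derivative (\<lambda>v. a * v + b * cnj v)) (at z)"
 shows "wirtinger f z = a" "wirtinger_bar f z = b"
proof -
 have "frechet_derivative f (at z) = (\<lambda>v. a * v + b * cnj v)" using frechet_derivative_at[OF assms] by simp
 thus "wirtinger f z = a" "wirtinger_bar f z = b"
  unfolding wirtinger_def wirtinger_bar_def by (simp_all add: complex_eq_iff field_simps)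
qed

lemma wirtinger_cong_open:
 assumes "open S" "z \<in> S" "\<And>w. w \<in> S ==> f w = g w"
 shows "wirtinger f z = wirtinger g z" "wirtinger_bar f z = wirtinger_bar g z"
 using frechet_derivative_cong_open(2)[OF assms] by (simp_all add: wirtinger_def wirtinger_bar_def)

lemma wirtinger_const [simp]: "wirtinger (\<lambda>z. a) z = 0" "wirtinger_bar (\<lambda>z. a) z = 0"
 by (rule wirtinger_eqI[where a = 0 and b = 0]; simp)+

lemma wirtinger_add:
 assumes "f differentiable (at z)" "g differentiable (at z)"
 shows "wirtinger (\<lambda>z. f z + g z) z = wirtinger f z + wirtinger g z"
  "wirtinger_bar (\<lambda>z. f z + g z) z = wirtinger_bar f z + wirtinger_bar g z"
proof -
 have "((\<lambda>z. f z + g z) has_derivative (\<lambda>v. (wirtinger f z + wirtinger g z) * v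
   + (wirtinger_bar f z + wirtinger_bar g z) * cnj v)) (at z)"
  by (rule has_derivative_eq_rhs[OF has_derivative_add[OF assms[THEN wirtinger_has_derivative]]])
   (auto simp: algebra_simps)
 from wirtinger_eqI[OF this] show "wirtinger (\<lambda>z. f z + g z) z = wirtinger f z + wirtinger g z"
  "wirtinger_bar (\<lambda>z. f z + g z) z = wirtinger_bar f z + wirtinger_bar g z" .
qed

lemma wirtinger_mult:
 assumes "f differentiable (at z)" "g differentiable (at z)"
 shows "wirtinger (\<lambda>z. f z * g z) z = f z * wirtinger g z + wirtinger f z * g z"
  "wirtinger_bar (\<lambda>z. f z * g z) z = f z * wirtinger_bar g z + wirtinger_bar f z * g z"
proof -
 have "((\<lambda>z. f z * g z) has_derivative (\<lambda>v. (f z * wirtinger g z + wirtinger f z * g z) * v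
   + (f z * wirtinger_bar g z + wirtinger_bar f z * g z) * cnj v)) (at z)"
  by (rule has_derivative_eq_rhs[OF has_derivative_mult[OF assms[THEN wirtinger_has_derivative]]])
   (auto simp: algebra_simps)
 from wirtinger_eqI[OF this] show "wirtinger (\<lambda>z. f z * g z) z = f z * wirtinger g z + wirtinger f z * g z"
  "wirtinger_bar (\<lambda>z. f z * g z) z = f z * wirtinger_bar g z + wirtinger_bar f z * g z" .
qed

lemma wirtinger_cmult:
 assumes "f differentiable (at z)"
 shows "wirtinger (\<lambda>z. a * f z) z = a * wirtinger f z"
  "wirtinger_bar (\<lambda>z. a * f z) z = a * wirtinger_bar f z"
 using wirtinger_mult[of "\<lambda>_. a" z f] assms by simp_all

lemma wirtinger_cnj:
 assumes "f differentiable (at z)"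
 shows "wirtinger (\<lambda>z. cnj (f z)) z = cnj (wirtinger_bar f z)"
  "wirtinger_bar (\<lambda>z. cnj (f z)) z = cnj (wirtinger f z)"
proof -
 have "((\<lambda>z. cnj (f z)) has_derivative (\<lambda>v. cnj (wirtinger_bar f z) * v + cnj (wirtinger f z) * cnj v)) (at z)"
  by (rule has_derivative_eq_rhs[OF bounded_linear.has_derivative[OF bounded_linear_cnj assms[THEN wirtinger_has_derivative]]])
   (auto simp: algebra_simps)
 from wirtinger_eqI[OF this] show "wirtinger (\<lambda>z. cnj (f z)) z = cnj (wirtinger_bar f z)"
  "wirtinger_bar (\<lambda>z. cnj (f z)) z = cnj (wirtinger f z)" .
qed

lemma wirtinger_compose_has_derivative:
 assumes "f differentiable (at (T z))" "(T has_field_derivative T') (at z)"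
 shows "((\<lambda>w. f (T w)) has_derivative (\<lambda>v. wirtinger f (T z) * T' * v + wirtinger_bar f (T z) * cnj T' * cnj v)) (at z)"
proof -
 have T: "(T has_derivative (*) T') (at z)" using assms(2) by (simp add: has_field_derivative_def)
 show ?thesis
  by (rule has_derivative_eq_rhs[OF has_derivative_compose[OF T wirtinger_has_derivative[OF assms(1)]]])
   (auto simp: mult_ac)
qed

lemma wirtinger_compose:
 assumes "f differentiable (at (T z))" "(T has_field_derivative T') (at z)"
 shows "wirtinger (\<lambda>w. f (T w)) z = wirtinger f (T z) * T'"
  "wirtinger_bar (\<lambda>w. f (T w)) z = wirtinger_bar f (T z) * cnj T'"
 using wirtinger_eqI[OF wirtinger_compose_has_derivative[OF assms]] by simp_all

lemma wirtinger_holomorphic: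
 assumes "(f has_field_derivative f') (at z)"
 shows "wirtinger f z = f'" "wirtinger_bar f z = 0"
 using wirtinger_eqI[of f f' 0 z] assms by (simp_all add: has_field_derivative_def)

lemma smooth_on_wirtinger:
 assumes "open S" "smooth_on S f" shows "smooth_on S (wirtinger f)" "smooth_on S (wirtinger_bar f)"
proof -
 have "smooth_on S (\<lambda>z. (1/2) * (frechet_derivative f (at z) 1 + (- \<i>) * frechet_derivative f (at z) \<i>))"
  "smooth_on S (\<lambda>z. (1/2) * (frechet_derivative f (at z) 1 + \<i> * frechet_derivative f (at z) \<i>))"
  by (intro smooth_on_cmult smooth_on_add smooth_on_frechet assms)+
 thus "smooth_on S (wirtinger f)" "smooth_on S (wirtinger_bar f)"
  unfolding wirtinger_def[abs_def] wirtinger_bar_def[abs_def] by (simp_all add: field_simps)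
qed

lemma smooth_on_chain:
 assumes "smooth_on S g" "c t \<in> S" "(c has_vector_derivative w) (at t within X)"
 shows "((\<lambda>t. g (c t)) has_vector_derivative frechet_derivative g (at (c t)) w) (at t within X)"
 using vector_derivative_diff_chain_within[OF assms(3) has_derivative_at_withinI[OF iffD1[OF frechet_derivative_works smooth_on_differentiable[OF assms(1,2)]]]]
 by (simp add: o_def)

text \<open>Symmetry of mixed second derivatives: differentiate
 $f(x, y) = f(x, y_0) + \int_{y_0}^y \partial_2 f(x, t)\,dt$ first in \<open>x\<close>, under the
 integral sign, and then in \<open>y\<close>.\<close>

lemma mixed_partials:
 fixes f :: "complex => complex"
 assumes "open S" "smooth_on S f" "z0 \<in> S"
 defines "p \<equiv> \<lambda>z. frechet_derivative f (at z) 1" and "q \<equiv> \<lambda>z. frechet_derivative f (at z) \<i>"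
 shows "frechet_derivative p (at z0) \<i> = frechet_derivative q (at z0) 1"
proof -
 obtain r where r: "r > 0" "cball z0 r \<subseteq> S" using assms(1,3) open_contains_cball by blast
 \<comment> \<open>With half the radius the square
   \<open>\<bar>x\<bar>, \<bar>y\<bar> \<le> d\<close> fits into the disk of radius
   \<open>r\<close>.\<close>
 define d where "d = r / 2"
 have d: "d > 0" using r by (simp add: d_def)
 define P where "P x y = z0 + of_real x + of_real y * \<i>" for x y
 have in_S: "P x y \<in> S" if "\<bar>x\<bar> \<le> d" "\<bar>y\<bar> \<le> d" for x y
 proof -
  have "dist z0 (P x y) = norm (P x y - z0)" by (simp add: dist_norm norm_minus_commute)
  also have "\<dots> = norm (of_real x + of_real y * \<i>)" by (simp add: P_def)
  also have "\<dots> \<le> \<bar>x\<bar> + \<bar>y\<bar>" by (rule order_trans[OF norm_triangle_ineq]) (simp add: norm_mult)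
  also have "\<dots> \<le> r" using that by (simp add: d_def)
  finally show ?thesis using r by auto
 qed
 have ps: "smooth_on S p" and qs: "smooth_on S q"
  unfolding p_def q_def by (rule smooth_on_frechet[OF assms(2)])+
 have dP: "((\<lambda>x. P x y) has_vector_derivative 1) (at x within X)" "((\<lambda>y. P x y) has_vector_derivative \<i>) (at y within X)" for x y X
  unfolding P_def by (auto intro!: derivative_eq_intros simp: has_vector_derivative_def scaleR_conv_of_real)
 note dx = smooth_on_chain[of S, OF _ _ dP(1)] and dy = smooth_on_chain[of S, OF _ _ dP(2)]
 have contP: "continuous_on X (\<lambda>t. g (P (a t) (b t)))"
  if "smooth_on S g" "continuous_on X a" "continuous_on X b" "\<And>t. t \<in> X ==> \<bar>a t\<bar> \<le> d \<and> \<bar>b t\<bar> \<le> d"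
  for g and X :: "'b::topological_space set" and a b
  by (rule continuous_on_compose2[OF smooth_on_continuous[OF that(1)]])
   (auto simp: P_def intro!: continuous_intros that(2,3) in_S[unfolded P_def] dest!: that(4))
 have int: "((\<lambda>t. q (P x t)) has_integral f (P x y) - f (P x 0)) {0..y}" if "\<bar>x\<bar> \<le> d" "0 \<le> y" "y \<le> d" for x y
  using that dy[OF assms(2)] in_S unfolding q_def
  by (intro fundamental_theorem_of_calculus) auto
 have dq: "p (P 0 y) - p (P 0 0) = integral {0..y} (\<lambda>t. frechet_derivative q (at (P 0 t)) 1)" if y: "0 \<le> y" "y \<le> d" for y
 proof -
  have A: "((\<lambda>x. integral (cbox 0 y) (\<lambda>t. q (P x t))) has_vector_derivative
    integral (cbox 0 y) (\<lambda>t. frechet_derivative q (at (P 0 t)) 1)) (at 0 within {-d..d})"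
  proof (rule leibniz_rule_vector_derivative)
   fix x t assume "x \<in> {-d..d}" "t \<in> cbox 0 y"
   thus "((\<lambda>x. q (P x t)) has_vector_derivative frechet_derivative q (at (P x t)) 1) (at x within {-d..d})"
    using y by (intro dx qs in_S) auto
  next
   fix x assume "x \<in> {-d..d}"
   thus "(\<lambda>t. q (P x t)) integrable_on cbox 0 y" using int[of x y] y by (auto simp: has_integral_integrable abs_le_iff)
  next
   show "continuous_on ({-d..d} \<times> cbox 0 y) (\<lambda>(x, t). frechet_derivative q (at (P x t)) 1)"
    unfolding split_beta using y
    by (intro contP[OF smooth_on_frechet[OF qs]] continuous_on_fst continuous_on_snd continuous_on_id) auto
  qed (use d in auto)
  \<comment> \<open>The same function of \<open>x\<close>, now evaluated by the fundamental theorem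
    instead of being differentiated under the integral sign; the two derivatives must
    coincide.\<close>
  have B: "((\<lambda>x. integral (cbox 0 y) (\<lambda>t. q (P x t))) has_vector_derivative p (P 0 y) - p (P 0 0)) (at 0 within {-d..d})"
  proof (rule has_vector_derivative_transform[of 0 "{-d..d}"])
   show "((\<lambda>x. f (P x y) - f (P x 0)) has_vector_derivative p (P 0 y) - p (P 0 0)) (at 0 within {-d..d})"
    unfolding p_def using y d by (intro has_vector_derivative_diff dx assms(2) in_S) auto
   fix x assume "x \<in> {-d..d}"
   thus "integral (cbox 0 y) (\<lambda>t. q (P x t)) = f (P x y) - f (P x 0)"
    using int[of x y] y by (auto intro!: integral_unique simp: abs_le_iff)
  qed (use d in auto)
  show ?thesis
   using vector_derivative_unique_within_closed_interval[of "- d" d 0, unfolded cbox_interval, OF _ _ B[unfolded cbox_interval] A[unfolded cbox_interval]] d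
   by simp
 qed
 have "continuous_on {0..d} (\<lambda>t. frechet_derivative q (at (P 0 t)) 1)"
  using d by (intro contP[OF smooth_on_frechet[OF qs]] continuous_on_const continuous_on_id) auto
 hence "((\<lambda>y. integral {0..y} (\<lambda>t. frechet_derivative q (at (P 0 t)) 1)) has_vector_derivative
   frechet_derivative q (at (P 0 0)) 1) (at 0 within {0..d})"
  using d by (intro integral_has_vector_derivative) auto
 hence A: "((\<lambda>y. p (P 0 y) - p (P 0 0)) has_vector_derivative frechet_derivative q (at (P 0 0)) 1) (at 0 within {0..d})"
 proof (rule has_vector_derivative_transform[rotated 2])
  fix y assume "y \<in> {0..d}"
  thus "p (P 0 y) - p (P 0 0) = integral {0..y} (\<lambda>t. frechet_derivative q (at (P 0 t)) 1)" by (intro dq) auto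
 qed (use d in simp)
 have B: "((\<lambda>y. p (P 0 y) - p (P 0 0)) has_vector_derivative frechet_derivative p (at (P 0 0)) \<i> - 0) (at 0 within {0..d})"
  using d by (intro has_vector_derivative_diff dy ps in_S has_vector_derivative_const) auto
 have "frechet_derivative p (at (P 0 0)) \<i> = frechet_derivative q (at (P 0 0)) 1"
  using vector_derivative_unique_within_closed_interval[of 0 d 0, unfolded cbox_interval, OF _ _ B A] d by simp
 thus ?thesis by (simp add: P_def)
qed

text \<open>The pure second derivatives enter both sides alike; the difference is a multiple of the
  difference of the two mixed partials.\<close>

lemma wirtinger_commute:
 assumes "open S" "smooth_on S f" "z \<in> S"
 shows "wirtinger (wirtinger_bar f) z = wirtinger_bar (wirtinger f) z"
proof -
 define p where "p = (\<lambda>z. frechet_derivative f (at z) 1)"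
 define q where "q = (\<lambda>z. frechet_derivative f (at z) \<i>)"
 have pq: "p differentiable (at z)" "q differentiable (at z)"
  unfolding p_def q_def using assms smooth_on_frechet smooth_on_differentiable by blast+
 have D: "(p has_derivative frechet_derivative p (at z)) (at z)" "(q has_derivative frechet_derivative q (at z)) (at z)"
  using pq frechet_derivative_works by blast+
 have "((\<lambda>z. (p z + \<i> * q z) / 2) has_derivative
   (\<lambda>v. (frechet_derivative p (at z) v + \<i> * frechet_derivative q (at z) v) / 2)) (at z)"
  "((\<lambda>z. (p z - \<i> * q z) / 2) has_derivative
   (\<lambda>v. (frechet_derivative p (at z) v - \<i> * frechet_derivative q (at z) v) / 2)) (at z)"
  by (intro bounded_linear.has_derivative[OF bounded_linear_divide] has_derivative_add has_derivative_diff
    has_derivative_mult_right D)+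
 from this[THEN frechet_derivative_at, symmetric]
 have "frechet_derivative (wirtinger_bar f) (at z) = (\<lambda>v. (frechet_derivative p (at z) v + \<i> * frechet_derivative q (at z) v) / 2)"
  "frechet_derivative (wirtinger f) (at z) = (\<lambda>v. (frechet_derivative p (at z) v - \<i> * frechet_derivative q (at z) v) / 2)"
  unfolding wirtinger_def[abs_def] wirtinger_bar_def[abs_def] p_def q_def by simp_all
 moreover have "frechet_derivative p (at z) \<i> = frechet_derivative q (at z) 1"
  using mixed_partials[OF assms] unfolding p_def q_def .
 ultimately show ?thesis
  unfolding wirtinger_def[of "wirtinger_bar f"] wirtinger_bar_def[of "wirtinger f"]
  by (simp add: field_simps)
qed

section \<open>Charts and smooth forms on the surface\<close>

locale compact_surface =
 fixes \<A> :: "'a::t2_space chart set"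
 assumes surface: "compact_riemann_surface \<A>"
begin

lemmas surface_unfolded = surface[unfolded compact_riemann_surface_def]

lemma compact_surface: "compact (UNIV :: 'a set)"
 using surface_unfolded by (rule conjunct1)

lemma connected_surface: "connected (UNIV :: 'a set)"
 using surface_unfolded[THEN conjunct2] by (rule conjunct1)

lemma charts_cover: "\<exists>c\<in>\<A>. x \<in> fst c"
 using surface_unfolded[THEN conjunct2, THEN conjunct2, THEN conjunct1] by blast

lemma chart:
 assumes "c \<in> \<A>"
 shows open_chart: "open (fst c)" and open_chart_range: "open (chart_range c)"
  and chart_homeomorphism: "homeomorphism (fst c) (chart_range c) (snd c) (inv_into (fst c) (snd c))"
 using surface_unfolded[THEN conjunct2, THEN conjunct2, THEN conjunct2, THEN conjunct1, THEN bspec, OF assms]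
 by simp_all

lemma chart_inv: "c \<in> \<A> ==> x \<in> fst c ==> inv_into (fst c) (snd c) (snd c x) = x"
 using homeomorphism_apply1[OF chart_homeomorphism] by blast

lemma chart_inv': "c \<in> \<A> ==> z \<in> chart_range c ==>
  inv_into (fst c) (snd c) z \<in> fst c \<and> snd c (inv_into (fst c) (snd c) z) = z"
 unfolding chart_range_def using chart_inv by auto

lemma chart_range_memI: "x \<in> fst c ==> snd c x \<in> chart_range c"
 by (simp add: chart_range_def)

definition overlap :: "'a chart => 'a chart => complex set" where
 "overlap c c' = snd c ` (fst c \<inter> fst c')"

lemma open_chart_image:
 assumes c: "c \<in> \<A>" and U: "open U" shows "open (snd c ` (fst c \<inter> U))"
proof -
 have "openin (top_of_set (chart_range c)) (snd c ` (fst c \<inter> U))"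
  using U by (intro homeomorphism_imp_open_map[OF chart_homeomorphism[OF c]]) (simp add: openin_open_Int)
 thus ?thesis using openin_open_trans open_chart_range[OF c] by blast
qed

lemma open_chart_preimage:
 assumes c: "c \<in> \<A>" and S: "open S" shows "open {x \<in> fst c. snd c x \<in> S}"
proof -
 have "continuous_on (fst c) (snd c)" using homeomorphism_cont1[OF chart_homeomorphism[OF c]] .
 hence "open (fst c \<inter> snd c -` S)" using continuous_open_preimage open_chart[OF c] S by blast
 thus ?thesis by (simp add: vimage_def Int_def)
qed

lemma open_overlap: "c \<in> \<A> ==> c' \<in> \<A> ==> open (overlap c c')"
 unfolding overlap_def using open_chart_image open_chart by blast

lemma overlap_subset: "overlap c c' \<subseteq> chart_range c"
 by (auto simp: overlap_def chart_range_def)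

lemma transition_apply: "c \<in> \<A> ==> x \<in> fst c ==> transition c c' (snd c x) = snd c' x"
 using chart_inv by (simp add: transition_def)

lemma transition_in: "c \<in> \<A> ==> z \<in> overlap c c' ==> transition c c' z \<in> chart_range c'"
 by (auto simp: overlap_def transition_apply intro: chart_range_memI)

lemma transition_holomorphic: "c \<in> \<A> ==> c' \<in> \<A> ==> transition c c' holomorphic_on overlap c c'"
 unfolding overlap_def
 using surface_unfolded[THEN conjunct2, THEN conjunct2, THEN conjunct2, THEN conjunct2] by blast

lemma transition_deriv:
 assumes "c \<in> \<A>" "c' \<in> \<A>" "z \<in> overlap c c'"
 shows "(transition c c' has_field_derivative deriv (transition c c') z) (at z)"
  "(deriv (transition c c') has_field_derivative deriv (deriv (transition c c')) z) (at z)"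
proof -
 note hol = transition_holomorphic[OF assms(1,2)] and op = open_overlap[OF assms(1,2)]
 show "(transition c c' has_field_derivative deriv (transition c c') z) (at z)"
  by (rule holomorphic_derivI[OF hol op assms(3)])
 show "(deriv (transition c c') has_field_derivative deriv (deriv (transition c c')) z) (at z)"
  by (rule holomorphic_derivI[OF holomorphic_deriv[OF hol op] op assms(3)])
qed

definition transforms :: "nat => nat => ('a chart => complex => complex) => bool" where
 "transforms a b f \<longleftrightarrow> (\<forall>c\<in>\<A>. \<forall>c'\<in>\<A>. \<forall>z\<in>overlap c c'.
   f c z = f c' (transition c c' z) * deriv (transition c c') z ^ a * cnj (deriv (transition c c') z) ^ b)"

lemma smooth_form_iff:
 "smooth_form \<A> \<theta> \<longleftrightarrow>
   (\<forall>a b c z. \<theta> a b c z \<noteq> 0 \<longrightarrow> a \<le> 1 \<and> b \<le> 1 \<and> c \<in> \<A> \<and> z \<in> chart_range c) \<and>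
   (\<forall>a b. \<forall>c\<in>\<A>. smooth_on (chart_range c) (\<theta> a b c)) \<and> (\<forall>a b. transforms a b (\<theta> a b))"
proof -
 have "(\<forall>x\<in>fst c \<inter> fst c'. f c (snd c x) = f c' (snd c' x) * deriv (transition c c') (snd c x) ^ a
   * cnj (deriv (transition c c') (snd c x)) ^ b) \<longleftrightarrow>
  (\<forall>z\<in>overlap c c'. f c z = f c' (transition c c' z) * deriv (transition c c') z ^ a * cnj (deriv (transition c c') z) ^ b)"
  if "c \<in> \<A>" for c c' a b and f :: "'a chart => complex => complex"
  using that by (simp add: overlap_def transition_apply)
 thus ?thesis unfolding smooth_form_def transforms_def smooth_on_def by simp
qed

lemma smooth_formI:
 assumes "\<And>a b c z. \<theta> a b c z \<noteq> 0 ==> a \<le> 1 \<and> b \<le> 1 \<and> c \<in> \<A> \<and> z \<in> chart_range c"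
  and "\<And>a b c. a \<le> 1 ==> b \<le> 1 ==> c \<in> \<A> ==> smooth_on (chart_range c) (\<theta> a b c)"
  and "\<And>a b. a \<le> 1 ==> b \<le> 1 ==> transforms a b (\<theta> a b)"
 shows "smooth_form \<A> \<theta>"
 unfolding smooth_form_iff
proof (intro conjI allI ballI)
 fix a b c assume c: "c \<in> \<A>"
 show "smooth_on (chart_range c) (\<theta> a b c)"
 proof (cases "a \<le> 1 \<and> b \<le> 1")
  case False
  hence "\<theta> a b c = (\<lambda>z. 0)" using assms(1) by blast
  thus ?thesis using open_chart_range[OF c] by simp
 qed (use assms(2) c in auto)
next
 fix a b show "transforms a b (\<theta> a b)"
 proof (cases "a \<le> 1 \<and> b \<le> 1")
  case False
  hence "\<theta> a b c z = 0" for c z using assms(1) by blast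
  thus ?thesis by (simp add: transforms_def)
 qed (use assms(3) in auto)
qed (use assms(1) in blast)+

lemma smooth_formD:
 assumes "smooth_form \<A> \<theta>"
 shows "\<theta> a b c z \<noteq> 0 ==> a \<le> 1 \<and> b \<le> 1 \<and> c \<in> \<A> \<and> z \<in> chart_range c"
  and "c \<in> \<A> ==> smooth_on (chart_range c) (\<theta> a b c)"
  and "transforms a b (\<theta> a b)"
 using assms unfolding smooth_form_iff by blast+

lemma smooth_form_outside: "smooth_form \<A> \<theta> ==> c \<notin> \<A> \<or> z \<notin> chart_range c \<or> a > 1 \<or> b > 1 ==> \<theta> a b c z = 0"
 using smooth_formD(1) by fastforce

lemma smooth_form_differentiable:
 "smooth_form \<A> \<theta> ==> c \<in> \<A> ==> z \<in> chart_range c ==> \<theta> a b c differentiable (at z)"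
 using smooth_formD(2) smooth_on_differentiable by blast

lemma form_differentiable: assumes "smooth_form \<A> \<theta>" "z \<in> chart_range c" shows "\<theta> a b c differentiable (at z)"
proof (cases "c \<in> \<A>")
 case False
 hence "\<theta> a b c = (\<lambda>z. 0)" using smooth_form_outside[OF assms(1)] by blast
 thus ?thesis by simp
qed (use smooth_form_differentiable assms in blast)

lemma smooth_form_zero: "smooth_form \<A> 0"
 by (rule smooth_formI) (auto simp: transforms_def zero_fun_def open_chart_range)

lemma smooth_form_add: assumes "smooth_form \<A> \<eta>" "smooth_form \<A> \<theta>" shows "smooth_form \<A> (\<eta> + \<theta>)"
proof (rule smooth_formI)
 fix a b c z assume "(\<eta> + \<theta>) a b c z \<noteq> 0"
 hence "\<eta> a b c z \<noteq> 0 \<or> \<theta> a b c z \<noteq> 0" by auto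
 thus "a \<le> 1 \<and> b \<le> 1 \<and> c \<in> \<A> \<and> z \<in> chart_range c" using assms smooth_formD(1) by blast
next
 fix a b c assume "c \<in> \<A>"
 hence "smooth_on (chart_range c) (\<lambda>z. \<eta> a b c z + \<theta> a b c z)"
  using assms smooth_formD(2) open_chart_range by (intro smooth_on_add) auto
 thus "smooth_on (chart_range c) ((\<eta> + \<theta>) a b c)" by (simp add: plus_fun_def)
next
 fix a b show "transforms a b ((\<eta> + \<theta>) a b)"
  using smooth_formD(3)[OF assms(1), of a b] smooth_formD(3)[OF assms(2), of a b]
  unfolding transforms_def by (auto simp: distrib_right)
qed

lemma smooth_form_cmult: assumes "smooth_form \<A> \<theta>" shows "smooth_form \<A> (cmult s \<theta>)"
proof (rule smooth_formI)
 fix a b c assume "c \<in> \<A>"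
 thus "smooth_on (chart_range c) (cmult s \<theta> a b c)"
  unfolding cmult_def using assms smooth_formD(2) open_chart_range by (intro smooth_on_cmult) auto
next
 fix a b show "transforms a b (cmult s \<theta> a b)"
  using smooth_formD(3)[OF assms, of a b] unfolding transforms_def cmult_def by auto
qed (use smooth_formD(1)[OF assms] in \<open>auto simp: cmult_def\<close>)

lemma smooth_form_cnj: assumes "smooth_form \<A> \<theta>" shows "smooth_form \<A> (form_cnj \<theta>)"
proof (rule smooth_formI)
 fix a b c z assume "form_cnj \<theta> a b c z \<noteq> 0"
 hence "\<theta> b a c z \<noteq> 0" by (simp add: form_cnj_def)
 thus "a \<le> 1 \<and> b \<le> 1 \<and> c \<in> \<A> \<and> z \<in> chart_range c" using smooth_formD(1)[OF assms] by blast
next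
 fix a b c assume "c \<in> \<A>"
 thus "smooth_on (chart_range c) (form_cnj \<theta> a b c)"
  unfolding form_cnj_def using assms smooth_formD(2) open_chart_range by (intro smooth_on_cmult smooth_on_cnj) auto
next
 fix a b
 have t: "transforms b a (\<theta> b a)" using smooth_formD(3)[OF assms] .
 show "transforms a b (form_cnj \<theta> a b)"
  unfolding transforms_def
 proof (intro ballI)
  fix c c' z assume "c \<in> \<A>" "c' \<in> \<A>" "z \<in> overlap c c'"
  hence "\<theta> b a c z = \<theta> b a c' (transition c c' z) * deriv (transition c c') z ^ b * cnj (deriv (transition c c') z) ^ a"
   using t unfolding transforms_def by blast
  thus "form_cnj \<theta> a b c z = form_cnj \<theta> a b c' (transition c c' z) * deriv (transition c c') z ^ a * cnj (deriv (transition c c') z) ^ b"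
   by (simp add: form_cnj_def)
 qed
qed

text \<open>In the transformation law for type \<open>(0, b)\<close> the factor
  \<open>cnj (deriv T) ^ b\<close> is antiholomorphic, so it passes through
  \<open>wirtinger\<close>, and the chain rule contributes one factor
  \<open>deriv T\<close>.\<close>

lemma smooth_form_del: assumes \<theta>: "smooth_form \<A> \<theta>" shows "smooth_form \<A> (del \<theta>)"
proof (rule smooth_formI)
 have z: "wirtinger (\<theta> 0 b c) z = 0" if "b > 1 \<or> c \<notin> \<A>" for b c z
 proof -
  have "\<theta> 0 b c = (\<lambda>z. 0)" using smooth_form_outside[OF \<theta>] that by blast
  thus ?thesis by simp
 qed
 fix a b c z assume "del \<theta> a b c z \<noteq> 0"
 hence "a = 1 \<and> z \<in> chart_range c \<and> wirtinger (\<theta> 0 b c) z \<noteq> 0" by (auto simp: del_def split: if_splits)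
 thus "a \<le> 1 \<and> b \<le> 1 \<and> c \<in> \<A> \<and> z \<in> chart_range c" using z[of b c z] by (metis leI order_refl)
next
 fix a b :: nat and c assume c: "c \<in> \<A>"
 have "smooth_on (chart_range c) (wirtinger (\<theta> 0 b c))"
  using smooth_on_wirtinger(1) open_chart_range c smooth_formD(2)[OF \<theta>] by blast
 thus "smooth_on (chart_range c) (del \<theta> a b c)"
  using open_chart_range[OF c] smooth_on_cong[of "chart_range c" "del \<theta> a b c" "if a = 1 then wirtinger (\<theta> 0 b c) else (\<lambda>z. 0)"]
  by (auto simp: del_def)
next
 fix a b :: nat assume ab: "a \<le> 1" "b \<le> 1"
 show "transforms a b (del \<theta> a b)"
 proof (cases "a = 1")
  case False
  thus ?thesis by (simp add: del_def transforms_def)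
 next
  case True
  show ?thesis
   unfolding transforms_def
  proof (intro ballI)
   fix c c' z assume c: "c \<in> \<A>" "c' \<in> \<A>" and z: "z \<in> overlap c c'"
   let ?T = "transition c c'"
   define g where "g w = cnj (deriv ?T w) ^ b" for w
   have "(\<lambda>w. deriv ?T w ^ b) field_differentiable (at z)"
    using transition_deriv(2)[OF c z] field_differentiable_def by (intro field_differentiable_power) blast
   hence "((\<lambda>w. deriv ?T w ^ b) has_field_derivative deriv (\<lambda>w. deriv ?T w ^ b) z) (at z)"
    by (simp add: DERIV_deriv_iff_field_differentiable)
   note h = this wirtinger_holomorphic[OF this]
   have hd: "(\<lambda>w. deriv ?T w ^ b) differentiable (at z)"
    using h(1) unfolding has_field_derivative_def differentiable_def by blast
   have gd: "g differentiable (at z)" "wirtinger g z = 0"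
    unfolding g_def complex_cnj_power[symmetric]
    using wirtinger_cnj(1)[OF hd] h(3) bounded_linear.has_derivative[OF bounded_linear_cnj wirtinger_has_derivative[OF hd]]
    by (simp_all add: differentiable_def) blast
   have Tz: "?T z \<in> chart_range c'" using transition_in c z by blast
   have fd: "\<theta> 0 b c' differentiable (at (?T z))" using smooth_form_differentiable[OF \<theta> c(2) Tz] .
   note D = wirtinger_compose_has_derivative[OF fd transition_deriv(1)[OF c z]]
   have "wirtinger (\<theta> 0 b c) z = wirtinger (\<lambda>w. \<theta> 0 b c' (?T w) * g w) z"
   proof (rule wirtinger_cong_open(1)[OF open_overlap[OF c] z])
    fix w assume "w \<in> overlap c c'"
    thus "\<theta> 0 b c w = \<theta> 0 b c' (?T w) * g w"
     using smooth_formD(3)[OF \<theta>, of 0 b] c unfolding transforms_def g_def by fastforce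
   qed
   also have "\<dots> = wirtinger (\<theta> 0 b c') (?T z) * deriv ?T z * g z"
    using wirtinger_mult(1)[of "\<lambda>w. \<theta> 0 b c' (?T w)" z g] gd D wirtinger_compose(1)[OF fd transition_deriv(1)[OF c z]]
    by (auto simp: differentiable_def)
   finally show "del \<theta> a b c z = del \<theta> a b c' (?T z) * deriv ?T z ^ a * cnj (deriv ?T z) ^ b"
    using True subsetD[OF overlap_subset z] Tz by (simp add: del_def g_def)
  qed
 qed
qed

lemma del_cnj: assumes \<theta>: "smooth_form \<A> \<theta>"
 shows "form_cnj (del \<theta>) = delbar (form_cnj \<theta>)" "form_cnj (delbar \<theta>) = del (form_cnj \<theta>)"
proof -
 note d = form_differentiable[OF \<theta>]
 show "form_cnj (del \<theta>) = delbar (form_cnj \<theta>)"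
  by (auto simp: fun_eq_iff form_cnj_def del_def delbar_def wirtinger_cnj d wirtinger_cmult)
 have "cnj (wirtinger_bar (\<theta> b 0 c) z) * (- 1) ^ b * (- 1) ^ b = wirtinger (\<lambda>z. cnj (\<theta> b 0 c z)) z"
  if "z \<in> chart_range c" for b c z
  using wirtinger_cnj(1)[OF d[OF that]] by (cases "even b") auto
 thus "form_cnj (delbar \<theta>) = del (form_cnj \<theta>)"
  by (auto simp: fun_eq_iff form_cnj_def del_def delbar_def mult_ac)
qed

lemma form_cnj_form_cnj: "form_cnj (form_cnj \<theta>) = \<theta>"
proof -
 have "(- 1) ^ n * ((- 1) ^ n * z) = z" for n and z :: complex by (cases "even n") auto
 thus ?thesis by (simp add: fun_eq_iff form_cnj_def mult.commute[of _ "_ :: nat"])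
qed

text \<open>Conjugation interchanges the two operators, which carries the transformation law over
  from \<open>del\<close>.\<close>

lemma smooth_form_delbar: assumes "smooth_form \<A> \<theta>" shows "smooth_form \<A> (delbar \<theta>)"
proof -
 have "delbar \<theta> = form_cnj (del (form_cnj \<theta>))"
  using del_cnj(1)[OF smooth_form_cnj[OF assms]] by (simp add: form_cnj_form_cnj)
 thus ?thesis using assms smooth_form_cnj smooth_form_del by simp
qed

lemma del_add:
 assumes "smooth_form \<A> \<eta>" "smooth_form \<A> \<theta>"
 shows "del (\<eta> + \<theta>) = del \<eta> + del \<theta>" "delbar (\<eta> + \<theta>) = delbar \<eta> + delbar \<theta>"
proof -
 note d = form_differentiable
 show "del (\<eta> + \<theta>) = del \<eta> + del \<theta>" "delbar (\<eta> + \<theta>) = delbar \<eta> + delbar \<theta>"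
  using assms by (auto simp: fun_eq_iff del_def delbar_def plus_fun_def wirtinger_add d distrib_left)
qed

lemma del_cmult:
 assumes "smooth_form \<A> \<theta>"
 shows "del (cmult s \<theta>) = cmult s (del \<theta>)" "delbar (cmult s \<theta>) = cmult s (delbar \<theta>)"
proof -
 note d = form_differentiable[OF assms]
 show "del (cmult s \<theta>) = cmult s (del \<theta>)" "delbar (cmult s \<theta>) = cmult s (delbar \<theta>)"
  by (auto simp: fun_eq_iff del_def delbar_def cmult_def wirtinger_cmult d)
qed

lemma del_del: "del (del \<theta>) = 0" "delbar (delbar \<theta>) = 0"
 by (auto simp: fun_eq_iff del_def delbar_def zero_fun_def)

lemma del_delbar: assumes "smooth_form \<A> \<theta>" shows "del (delbar \<theta>) + delbar (del \<theta>) = 0"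
proof -
 have "del (delbar \<theta>) a b c z + delbar (del \<theta>) a b c z = 0" for a b c z
 proof (cases "a = 1 \<and> b = 1 \<and> c \<in> \<A> \<and> z \<in> chart_range c")
  case True
  hence c: "c \<in> \<A>" "z \<in> chart_range c" by auto
  have "wirtinger (delbar \<theta> 0 1 c) z = wirtinger (wirtinger_bar (\<theta> 0 0 c)) z"
   by (rule wirtinger_cong_open(1)[OF open_chart_range[OF c(1)] c(2)]) (simp add: delbar_def)
  moreover have "wirtinger_bar (del \<theta> 1 0 c) z = wirtinger_bar (wirtinger (\<theta> 0 0 c)) z"
   by (rule wirtinger_cong_open(2)[OF open_chart_range[OF c(1)] c(2)]) (simp add: del_def)
  ultimately show ?thesis
   using True wirtinger_commute[OF open_chart_range[OF c(1)] smooth_formD(2)[OF assms c(1)] c(2), of 0 0]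
   by (simp add: del_def[of "delbar \<theta>"] delbar_def[of "del \<theta>"])
 next
  case False
  then consider "a \<noteq> 1" | "b \<noteq> 1" | "c \<notin> \<A> \<or> z \<notin> chart_range c" by blast
  thus ?thesis
  proof cases
   case 3
   thus ?thesis using smooth_form_outside[OF smooth_form_del[OF smooth_form_delbar[OF assms]], of c z a b]
     smooth_form_outside[OF smooth_form_delbar[OF smooth_form_del[OF assms]], of c z a b] by auto
  qed (auto simp: del_def delbar_def)
 qed
 thus ?thesis by (simp add: fun_eq_iff)
qed

end

section \<open>Real structure, degrees, and the differentials d and d^c\<close>

lemma form_eqI: "(\<And>a b c z. \<eta> a b c z = \<theta> a b c z) ==> \<eta> = (\<theta> :: 'a form)"
 by (intro ext)

lemma form_cnj_apply: "form_cnj \<theta> a b c z = (- 1) ^ (a * b) * cnj (\<theta> b a c z)"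
 by (simp add: form_cnj_def)

lemma cmult_apply: "cmult s \<theta> a b c z = s * \<theta> a b c z"
 by (simp add: cmult_def)

lemma scaleR_form: "(r *\<^sub>R \<theta> :: 'a form) = cmult (of_real r) \<theta>"
 by (rule form_eqI) (simp add: scaleR_fun_def cmult_def scaleR_conv_of_real)

lemma scaleR_fun_apply: "(r *\<^sub>R f) x = r *\<^sub>R f x"
 by (simp add: scaleR_fun_def)

lemma cmult_zero [simp]: "cmult s 0 = 0" "cmult 0 \<theta> = 0"
 by (rule form_eqI; simp add: cmult_apply)+

lemma cmult_add: "cmult s (\<eta> + \<theta>) = cmult s \<eta> + cmult s \<theta>"
 by (rule form_eqI) (simp add: cmult_apply distrib_left)

lemma cmult_diff: "cmult s (\<eta> - \<theta>) = cmult s \<eta> - cmult s \<theta>"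
 by (rule form_eqI) (simp add: cmult_apply right_diff_distrib)

lemma cmult_cmult: "cmult s (cmult t \<theta>) = cmult (s * t) \<theta>"
 by (rule form_eqI) (simp add: cmult_apply mult.assoc)

lemma cmult_eq_0_iff: "s \<noteq> 0 ==> cmult s \<theta> = 0 \<longleftrightarrow> \<theta> = 0"
 by (simp add: fun_eq_iff cmult_def)

lemma form_cnj_add: "form_cnj (\<eta> + \<theta>) = form_cnj \<eta> + form_cnj \<theta>"
 by (rule form_eqI) (simp add: form_cnj_apply distrib_left)

lemma form_cnj_diff: "form_cnj (\<eta> - \<theta>) = form_cnj \<eta> - form_cnj \<theta>"
 by (rule form_eqI) (simp add: form_cnj_apply right_diff_distrib)

lemma form_cnj_cmult: "form_cnj (cmult s \<theta>) = cmult (cnj s) (form_cnj \<theta>)"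
 by (rule form_eqI) (simp add: form_cnj_apply cmult_apply)

lemma form_cnj_zero [simp]: "form_cnj 0 = 0"
 by (rule form_eqI) (simp add: form_cnj_apply)

lemma form_diff_eq: "\<eta> - \<theta> = \<eta> + cmult (-1) \<theta>"
 by (rule form_eqI) (simp add: cmult_apply)

definition dform :: "'a form => 'a form" where "dform \<eta> = del \<eta> + delbar \<eta>"

text \<open>The operator usually written d^c, that is \<open>d''\<close> before any
  projection.\<close>

definition dcform :: "'a form => 'a form" where "dcform \<eta> = cmult \<i> (delbar \<eta> - del \<eta>)"

definition homogeneous :: "int => 'a form => bool" where
 "homogeneous n \<eta> \<longleftrightarrow> (\<forall>a b. \<eta> a b \<noteq> 0 \<longrightarrow> int a + int b = n)"

lemma homogeneous_apply: "homogeneous n \<eta> ==> int a + int b \<noteq> n ==> \<eta> a b c z = 0"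
 unfolding homogeneous_def by (cases "\<eta> a b = 0") auto

lemma homogeneousI: "(\<And>a b c z. int a + int b \<noteq> n ==> \<eta> a b c z = 0) ==> homogeneous n \<eta>"
 unfolding homogeneous_def
proof (intro allI impI, rule ccontr)
 fix a b assume n: "\<And>a b c z. int a + int b \<noteq> n ==> \<eta> a b c z = 0" "\<eta> a b \<noteq> 0" "int a + int b \<noteq> n"
 have "\<eta> a b = 0" by (intro ext) (simp add: n(1)[OF n(3)])
 thus False using n(2) by simp
qed

lemma homogeneous_zero [simp]: "homogeneous n 0"
 by (simp add: homogeneous_def)

lemma homogeneous_add: "homogeneous n \<eta> ==> homogeneous n \<theta> ==> homogeneous n (\<eta> + \<theta>)"
 by (rule homogeneousI) (simp add: homogeneous_apply)

lemma homogeneous_cmult: "homogeneous n \<eta> ==> homogeneous n (cmult s \<eta>)"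
 by (rule homogeneousI) (simp add: homogeneous_apply cmult_def)

lemma homogeneous_del:
 assumes "homogeneous n \<eta>" shows "homogeneous (n + 1) (del \<eta>)" "homogeneous (n + 1) (delbar \<eta>)"
proof -
 have 1: "\<eta> a b c = (\<lambda>z. 0)" if "int a + int b \<noteq> n" for a b c
  using homogeneous_apply[OF assms that] by (simp add: fun_eq_iff)
 show "homogeneous (n + 1) (del \<eta>)" "homogeneous (n + 1) (delbar \<eta>)"
  by (rule homogeneousI; auto simp: del_def delbar_def 1)+
qed

lemma homogeneous_dform: "homogeneous n \<eta> ==> homogeneous (n + 1) (dform \<eta>)"
 unfolding dform_def by (intro homogeneous_add homogeneous_del)

lemma homogeneous_dcform: "homogeneous n \<eta> ==> homogeneous (n + 1) (dcform \<eta>)"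
 unfolding dcform_def form_diff_eq by (intro homogeneous_add homogeneous_del homogeneous_cmult)

text \<open>On a curve the bound on \<open>a - b\<close> is automatic. Types have
  \<open>a, b \<le> 1\<close>, so \<open>a\<close> and \<open>b\<close> can differ only for
  \<open>j = 0\<close>, where \<open>i\<close> is odd and
  \<open>2 * k - i \<ge> \<bar>i\<bar> \<ge> 1\<close>. Hence the projection onto the target reduces
  to the test \<open>K_nonzero\<close>.\<close>

lemma (in compact_surface) K_typeI:
 assumes "K_nonzero i j k" "smooth_form \<A> \<theta>" "homogeneous (j + 1) \<theta>" "\<theta> a b \<noteq> 0" shows "K_type i j k a b"
proof -
 obtain c z where "\<theta> a b c z \<noteq> 0" using assms(4) by (metis ext zero_fun_apply)
 hence "a \<in> {0, 1}" "b \<in> {0, 1}" using smooth_formD(1)[OF assms(2)] by fastforce+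
 moreover have "int a + int b = j + 1" using assms(3,4) unfolding homogeneous_def by blast
 ultimately show ?thesis using assms(1) unfolding K_type_def K_nonzero_def
  by (auto simp: abs_if max_def split: if_splits) presburger+
qed

text \<open>The sign that conjugation produces on the power of \<open>two_pi_i\<close> in
  \<open>K_piece\<close>; it records the twist of the real structure.\<close>

definition twist :: "int => int => complex" where
 "twist i j = (- 1) powi ((1 + j - i) div 2)"

lemma cnj_two_pi_i: "cnj (two_pi_i powi n) = (- 1) powi n * two_pi_i powi n"
proof -
 have "cnj (two_pi_i powi n) = ((- 1) * two_pi_i) powi n"
  by (simp add: power_int_def complex_cnj_power complex_cnj_inverse)
 thus ?thesis by (simp only: power_int_mult_distrib)
qed

lemma two_pi_i_nonzero: "two_pi_i \<noteq> 0" by simp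

context compact_surface
begin

lemma smooth_form_diff: "smooth_form \<A> \<eta> ==> smooth_form \<A> \<theta> ==> smooth_form \<A> (\<eta> - \<theta>)"
 unfolding form_diff_eq by (intro smooth_form_add smooth_form_cmult)

lemma smooth_form_dform: "smooth_form \<A> \<eta> ==> smooth_form \<A> (dform \<eta>)"
 unfolding dform_def by (intro smooth_form_add smooth_form_del smooth_form_delbar)

lemma smooth_form_dcform: "smooth_form \<A> \<eta> ==> smooth_form \<A> (dcform \<eta>)"
 unfolding dcform_def by (intro smooth_form_cmult smooth_form_diff smooth_form_del smooth_form_delbar)

lemma del_diff:
 assumes "smooth_form \<A> \<eta>" "smooth_form \<A> \<theta>"
 shows "del (\<eta> - \<theta>) = del \<eta> - del \<theta>" "delbar (\<eta> - \<theta>) = delbar \<eta> - delbar \<theta>"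
 unfolding form_diff_eq
 using del_add[OF assms(1) smooth_form_cmult[OF assms(2)], of "-1"] del_cmult[OF assms(2), of "-1"]
 by simp_all

lemma dform_add: "smooth_form \<A> \<eta> ==> smooth_form \<A> \<theta> ==> dform (\<eta> + \<theta>) = dform \<eta> + dform \<theta>"
 by (simp add: dform_def del_add)

lemma dcform_add: "smooth_form \<A> \<eta> ==> smooth_form \<A> \<theta> ==> dcform (\<eta> + \<theta>) = dcform \<eta> + dcform \<theta>"
 by (simp add: dcform_def del_add cmult_add cmult_diff)

lemma dform_cmult: "smooth_form \<A> \<eta> ==> dform (cmult s \<eta>) = cmult s (dform \<eta>)"
 by (simp add: dform_def del_cmult cmult_add)

lemma dform_diff: "smooth_form \<A> \<eta> ==> smooth_form \<A> \<theta> ==> dform (\<eta> - \<theta>) = dform \<eta> - dform \<theta>"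
 by (simp add: dform_def del_diff)

lemma dcform_cmult: "smooth_form \<A> \<eta> ==> dcform (cmult s \<eta>) = cmult s (dcform \<eta>)"
 by (simp add: dcform_def del_cmult cmult_diff cmult_cmult mult.commute)

lemma dform_zero [simp]: "dform (0 :: 'a form) = 0" and dcform_zero [simp]: "dcform (0 :: 'a form) = 0"
 using dform_cmult[OF smooth_form_zero, of 0] dcform_cmult[OF smooth_form_zero, of 0] by simp_all

lemma form_cnj_dform: "smooth_form \<A> \<eta> ==> form_cnj (dform \<eta>) = dform (form_cnj \<eta>)"
 by (simp add: dform_def form_cnj_add del_cnj)

lemma form_cnj_dcform: "smooth_form \<A> \<eta> ==> form_cnj (dcform \<eta>) = dcform (form_cnj \<eta>)"
 unfolding dcform_def form_cnj_cmult form_cnj_diff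
 by (simp only: del_cnj) (rule form_eqI, simp add: cmult_apply algebra_simps)

lemma dform_squared:
 assumes "smooth_form \<A> \<eta>"
 shows "dform (dform \<eta>) = 0" "dcform (dcform \<eta>) = 0" "dform (dcform \<eta>) + dcform (dform \<eta>) = 0"
proof -
 note s = smooth_form_del[OF assms] smooth_form_delbar[OF assms]
 have c: "delbar (del \<eta>) a b c z = - del (delbar \<eta>) a b c z" for a b c z
 proof -
  have "(del (delbar \<eta>) + delbar (del \<eta>)) a b c z = 0" unfolding del_delbar[OF assms] by simp
  thus ?thesis by (simp add: eq_neg_iff_add_eq_0 add.commute)
 qed
 have "dform (dform \<eta>) = del (del \<eta>) + del (delbar \<eta>) + (delbar (del \<eta>) + delbar (delbar \<eta>))"
  unfolding dform_def by (simp add: del_add s)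
 thus "dform (dform \<eta>) = 0"
  by (intro form_eqI) (simp add: del_del c)
 have "dcform (dcform \<eta>) = cmult \<i> (cmult \<i> (delbar (delbar \<eta>) - delbar (del \<eta>)) - cmult \<i> (del (delbar \<eta>) - del (del \<eta>)))"
  unfolding dcform_def using s by (simp add: del_cmult del_diff smooth_form_diff)
 thus "dcform (dcform \<eta>) = 0"
  by (intro form_eqI) (simp add: del_del c cmult_apply)
 have "dform (dcform \<eta>) = cmult \<i> (del (delbar \<eta>) - del (del \<eta>)) + cmult \<i> (delbar (delbar \<eta>) - delbar (del \<eta>))"
  "dcform (dform \<eta>) = cmult \<i> ((delbar (del \<eta>) + delbar (delbar \<eta>)) - (del (del \<eta>) + del (delbar \<eta>)))"
  unfolding dform_def dcform_def using s by (simp_all add: del_cmult del_diff del_add smooth_form_diff)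
 thus "dform (dcform \<eta>) + dcform (dform \<eta>) = 0"
  by (intro form_eqI) (simp add: del_del c cmult_apply algebra_simps)
qed

text \<open>The existentially quantified real form is traded for an eigenvalue equation under
  conjugation, which can be verified directly for sums, multiples and derivatives.\<close>

lemma K_piece_iff:
 assumes "K_nonzero i j k"
 shows "\<eta> \<in> K_piece \<A> i j k \<longleftrightarrow> smooth_form \<A> \<eta> \<and> form_cnj \<eta> = cmult (twist i j) \<eta> \<and> homogeneous (j + 1) \<eta>"
proof -
 let ?s = "two_pi_i powi ((1 + j - i) div 2)"
 have s0: "?s \<noteq> 0" by simp
 have cs: "cnj ?s = twist i j * ?s" unfolding twist_def by (rule cnj_two_pi_i)
 show ?thesis
 proof
  assume "\<eta> \<in> K_piece \<A> i j k"
  then obtain \<theta> where \<theta>: "\<eta> = cmult ?s \<theta>" "real_form \<A> \<theta>" "\<And>a b. \<theta> a b \<noteq> 0 ==> K_type i j k a b"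
   using assms by (auto simp: K_piece_def)
  have "homogeneous (j + 1) \<theta>" using \<theta>(3) unfolding homogeneous_def K_type_def by auto
  thus "smooth_form \<A> \<eta> \<and> form_cnj \<eta> = cmult (twist i j) \<eta> \<and> homogeneous (j + 1) \<eta>"
   using \<theta>(1,2) cs unfolding real_form_def
   by (simp add: smooth_form_cmult form_cnj_cmult cmult_cmult homogeneous_cmult)
 next
  assume \<eta>: "smooth_form \<A> \<eta> \<and> form_cnj \<eta> = cmult (twist i j) \<eta> \<and> homogeneous (j + 1) \<eta>"
  let ?\<theta> = "cmult (inverse ?s) \<eta>"
  have tw: "twist i j * twist i j = 1"
   unfolding twist_def by (simp add: power_int_minus_left flip: power_int_mult_distrib)
  have "inverse (twist i j) = twist i j" using tw inverse_unique by blast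
  hence "cnj (inverse ?s) = twist i j * inverse ?s" using cs by (simp add: complex_cnj_inverse)
  hence "cnj (inverse ?s) * twist i j = inverse ?s" using tw by (simp add: mult_ac)
  hence "real_form \<A> ?\<theta>"
   using \<eta> unfolding real_form_def by (simp add: smooth_form_cmult form_cnj_cmult cmult_cmult)
  moreover have "K_type i j k a b" if "?\<theta> a b \<noteq> 0" for a b
   using K_typeI[OF assms smooth_form_cmult homogeneous_cmult that] \<eta> by blast
  moreover have "\<eta> = cmult ?s ?\<theta>" using s0 by (simp add: cmult_cmult) (simp add: cmult_def)
  ultimately show "\<eta> \<in> K_piece \<A> i j k" using assms unfolding K_piece_def by auto
 qed
qed

lemma K_piece_zero: "\<not> K_nonzero i j k ==> K_piece \<A> i j k = {0}"
 by (simp add: K_piece_def)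

lemma zero_in_K_piece: "0 \<in> K_piece \<A> i j k"
proof (cases "K_nonzero i j k")
 case True thus ?thesis unfolding K_piece_iff[OF True] by (simp add: smooth_form_zero)
qed (simp add: K_piece_def)

lemma K_piece_smooth: "\<eta> \<in> K_piece \<A> i j k ==> smooth_form \<A> \<eta>"
 and K_piece_homogeneous: "\<eta> \<in> K_piece \<A> i j k ==> homogeneous (j + 1) \<eta>"
 and K_piece_cnj: "\<eta> \<in> K_piece \<A> i j k ==> form_cnj \<eta> = cmult (twist i j) \<eta>"
 by (cases "K_nonzero i j k"; simp add: K_piece_iff K_piece_zero smooth_form_zero)+

lemma K_piece_add: "\<eta> \<in> K_piece \<A> i j k ==> \<theta> \<in> K_piece \<A> i j k ==> \<eta> + \<theta> \<in> K_piece \<A> i j k"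
proof (cases "K_nonzero i j k")
 case True thus "\<eta> \<in> K_piece \<A> i j k ==> \<theta> \<in> K_piece \<A> i j k ==> \<eta> + \<theta> \<in> K_piece \<A> i j k"
  unfolding K_piece_iff[OF True] by (simp add: smooth_form_add form_cnj_add cmult_add homogeneous_add)
qed (simp add: K_piece_def)

lemma K_piece_scale: "\<eta> \<in> K_piece \<A> i j k ==> r *\<^sub>R \<eta> \<in> K_piece \<A> i j k"
proof (cases "K_nonzero i j k")
 case True thus "\<eta> \<in> K_piece \<A> i j k ==> r *\<^sub>R \<eta> \<in> K_piece \<A> i j k"
  unfolding K_piece_iff[OF True] scaleR_form
  by (simp add: smooth_form_cmult form_cnj_cmult homogeneous_cmult cmult_cmult mult.commute)
qed (simp add: K_piece_def)

section \<open>The complex and its operators\<close>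

definition K_support :: "'a cochain => (int \<times> int \<times> int) set" where
 "K_support x = {(i, j, k). x i j k \<noteq> 0}"

lemma K_iff: "x \<in> K \<A> \<longleftrightarrow> (\<forall>i j k. x i j k \<in> K_piece \<A> i j k) \<and> finite (K_support x)"
 by (simp add: K_def K_support_def)

lemma KD: assumes "x \<in> K \<A>"
 shows "x i j k \<in> K_piece \<A> i j k" "finite (K_support x)" "smooth_form \<A> (x i j k)"
  "homogeneous (j + 1) (x i j k)" "form_cnj (x i j k) = cmult (twist i j) (x i j k)"
  "\<not> K_nonzero i j k ==> x i j k = 0"
proof -
 show p: "x i j k \<in> K_piece \<A> i j k" and "finite (K_support x)" using assms by (simp_all add: K_iff)
 show "smooth_form \<A> (x i j k)" "homogeneous (j + 1) (x i j k)" "form_cnj (x i j k) = cmult (twist i j) (x i j k)"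
  using K_piece_smooth[OF p] K_piece_homogeneous[OF p] K_piece_cnj[OF p] .
 show "\<not> K_nonzero i j k ==> x i j k = 0" using p by (simp add: K_piece_zero)
qed

lemma subspace_K: "subspace (K \<A>)"
proof -
 have 0: "K_support 0 = {}" by (auto simp: K_support_def)
 have 1: "K_support (x + y) \<subseteq> K_support x \<union> K_support y" "K_support (r *\<^sub>R x) \<subseteq> K_support x" for x y :: "'a cochain" and r
  by (auto simp: K_support_def scaleR_fun_apply)
 show ?thesis
  by (auto simp: subspace_def K_iff 0 zero_in_K_piece K_piece_add K_piece_scale scaleR_fun_apply intro: finite_subset[OF 1(1)] finite_subset[OF 1(2)])
qed

lemma cochain_linI:
 assumes "\<And>x y i j k. x \<in> K \<A> ==> y \<in> K \<A> ==> f (x + y) i j k = f x i j k + f y i j k"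
  and "\<And>x r i j k. x \<in> K \<A> ==> f (r *\<^sub>R x) i j k = r *\<^sub>R f x i j k"
 shows "linear_on_subspace (K \<A>) f"
 by (rule linI[OF subspace_K]) (simp_all add: fun_eq_iff scaleR_fun_apply assms)

lemma K_proj_eq:
 assumes "smooth_form \<A> \<theta>" "homogeneous (j + 1) \<theta>"
 shows "K_proj i j k \<theta> = (if K_nonzero i j k then \<theta> else 0)"
proof -
 have "\<theta> a b = 0" if "K_nonzero i j k" "\<not> K_type i j k a b" for a b using K_typeI[OF that(1) assms] that(2) by blast
 thus ?thesis by (auto simp: K_proj_def fun_eq_iff)
qed

text \<open>Two shifts \<open>c\<close> and \<open>d\<close> of the last index are allowed because
  the differential mixes two neighbouring values of \<open>k\<close>; they bound the support of
  \<open>y\<close> by shifted supports of \<open>x\<close>.\<close>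

lemma K_I:
 assumes y: "\<And>i j k. y i j k = (if K_nonzero i j k then \<theta> i j k else 0)"
  and \<theta>: "\<And>i j k. smooth_form \<A> (\<theta> i j k)" "\<And>i j k. homogeneous (j + 1) (\<theta> i j k)"
   "\<And>i j k. form_cnj (\<theta> i j k) = cmult (twist i j) (\<theta> i j k)"
  and x: "x \<in> K \<A>" "\<And>i j k. y i j k \<noteq> 0 ==> x (i - a) (j - b) (k - c) \<noteq> 0 \<or> x (i - a) (j - b) (k - d) \<noteq> 0"
 shows "y \<in> K \<A>"
 unfolding K_iff
proof (intro conjI allI)
 show "y i j k \<in> K_piece \<A> i j k" for i j k
  by (cases "K_nonzero i j k") (simp_all add: y K_piece_iff K_piece_zero \<theta>)
 let ?f = "\<lambda>c. (\<lambda>(i, j, k). (i - a, j - b, k - c))"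
 have "finite (?f n -` K_support x)" for n by (rule finite_vimageI[OF KD(2)[OF x(1)]]) (auto simp: inj_def)
 moreover have "K_support y \<subseteq> ?f c -` K_support x \<union> ?f d -` K_support x" using x(2) by (auto simp: K_support_def)
 ultimately show "finite (K_support y)" by (meson finite_UnI finite_subset)
qed

text \<open>The differential before truncation, indexed by the bidegree of the source and the last
  index of the target.\<close>

definition raw_d :: "'a cochain => int => int => int => 'a form" where
 "raw_d x i j k = dform (x i j (k - 1)) + dcform (x i j k)"

lemma smooth_raw_d: "x \<in> K \<A> ==> smooth_form \<A> (raw_d x i j k)"
 unfolding raw_d_def by (intro smooth_form_add smooth_form_dform smooth_form_dcform KD(3))

lemma homogeneous_raw_d:
 assumes "x \<in> K \<A>" shows "homogeneous (j + 1) (raw_d x (i - 1) (j - 1) k)"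
proof -
 have "homogeneous (j - 1 + 1 + 1) (raw_d x (i - 1) (j - 1) k)"
  unfolding raw_d_def by (intro homogeneous_add homogeneous_dform homogeneous_dcform KD(4)[OF assms])
 thus ?thesis by simp
qed

lemma dK_eq:
 assumes "x \<in> K \<A>"
 shows "dK x i j k = (if K_nonzero i j k then raw_d x (i - 1) (j - 1) k else 0)"
proof -
 have "dK x i j k = K_proj i j k (raw_d x (i - 1) (j - 1) k)"
  by (simp add: dK_def raw_d_def dform_def dcform_def)
 also have "homogeneous (j + 1) (raw_d x (i - 1) (j - 1) k)"
  by (rule homogeneous_raw_d[OF assms])
 ultimately show ?thesis by (simp add: K_proj_eq smooth_raw_d[OF assms])
qed

lemma NK_eq:
 assumes "x \<in> K \<A>"
 shows "NK x i j k = (if K_nonzero i j k then cmult (inverse two_pi_i) (x (i - 2) j (k - 1)) else 0)"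
 unfolding NK_def using assms
 by (intro K_proj_eq smooth_form_cmult homogeneous_cmult KD)

lemma twist_shift: "twist (i - 1) (j - 1) = twist i j"
proof -
 have "1 + (j - 1) - (i - 1) = 1 + j - i" by simp
 thus ?thesis by (simp only: twist_def)
qed

lemma dK_in_K: assumes x: "x \<in> K \<A>" shows "dK x \<in> K \<A>"
proof (rule K_I[OF dK_eq[OF x] smooth_raw_d[OF x] homogeneous_raw_d[OF x] _ x, of 1 1 0 1])
 show "form_cnj (raw_d x (i - 1) (j - 1) k) = cmult (twist i j) (raw_d x (i - 1) (j - 1) k)" for i j k
  unfolding raw_d_def using KD[OF x]
  by (simp add: form_cnj_add form_cnj_dform form_cnj_dcform smooth_form_dform smooth_form_dcform
    dform_cmult dcform_cmult cmult_add twist_shift)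
 show "x (i - 1) (j - 1) (k - 0) \<noteq> 0 \<or> x (i - 1) (j - 1) (k - 1) \<noteq> 0" if "dK x i j k \<noteq> 0" for i j k
  using that by (auto simp: dK_eq[OF x] raw_d_def split: if_splits)
qed

lemma NK_in_K: assumes x: "x \<in> K \<A>" shows "NK x \<in> K \<A>"
proof (rule K_I[OF NK_eq[OF x] _ homogeneous_cmult[OF KD(4)[OF x]] _ x, of 2 0 1 1])
 fix i j k :: int
 have "(1 + j - (i - 2)) div 2 = (1 + j - i) div 2 + 1" by simp
 hence "twist (i - 2) j = - twist i j" unfolding twist_def by (simp add: power_int_add)
 thus "smooth_form \<A> (cmult (inverse two_pi_i) (x (i - 2) j (k - 1)))"
  "form_cnj (cmult (inverse two_pi_i) (x (i - 2) j (k - 1))) = cmult (twist i j) (cmult (inverse two_pi_i) (x (i - 2) j (k - 1)))"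
  using KD[OF x] by (simp_all add: smooth_form_cmult form_cnj_cmult cmult_cmult mult_ac)
 show "x (i - 2) (j - 0) (k - 1) \<noteq> 0 \<or> x (i - 2) (j - 0) (k - 1) \<noteq> 0" if "NK x i j k \<noteq> 0"
  using that by (auto simp: NK_eq[OF x] split: if_splits)
qed

lemma raw_d_eq_0: "x \<in> K \<A> ==> k < 0 ==> raw_d x i j k = 0"
 using KD(6)[of x i j k] KD(6)[of x i j "k - 1"] by (simp add: raw_d_def K_nonzero_def)

text \<open>Inside the truncation of the target, the truncation of intermediate terms is invisible.\<close>

lemma dK_raw:
 assumes x: "x \<in> K \<A>" and k: "K_nonzero (i + 1) (j + 1) k'" "k = k' \<or> k = k' - 1"
 shows "dK x i j k = raw_d x (i - 1) (j - 1) k"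
proof (cases "k < 0")
 case True
 thus ?thesis using raw_d_eq_0[OF x True] by (simp add: dK_eq[OF x])
next
 case False
 hence "K_nonzero i j k" using k by (auto simp: K_nonzero_def)
 thus ?thesis by (simp add: dK_eq[OF x])
qed

lemma dK_dK: assumes x: "x \<in> K \<A>" shows "dK (dK x) = 0"
proof -
 have "dK (dK x) i j k = 0" for i j k
 proof (cases "K_nonzero i j k")
  case True
  let ?y = "\<lambda>k. x (i - 2) (j - 2) k"
  have s: "smooth_form \<A> (?y k)" for k using KD(3)[OF x] .
  have r: "dK x (i - 1) (j - 1) k' = dform (?y (k' - 1)) + dcform (?y k')" if "k' = k \<or> k' = k - 1" for k'
   using dK_raw[OF x, of "i - 1" "j - 1" k k'] True that by (simp add: raw_d_def)
  have "dK (dK x) i j k = dform (dK x (i - 1) (j - 1) (k - 1)) + dcform (dK x (i - 1) (j - 1) k)"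
   using True by (simp add: dK_eq[OF dK_in_K[OF x]] raw_d_def)
  also have "\<dots> = (dform (dform (?y (k - 1 - 1))) + dcform (dcform (?y k))) + (dform (dcform (?y (k - 1))) + dcform (dform (?y (k - 1))))"
   unfolding r[of "k - 1", simplified] r[of k, simplified]
   by (simp add: dform_add dcform_add smooth_form_dform smooth_form_dcform s add_ac)
  also have "\<dots> = 0" using dform_squared[OF s] by simp
  finally show ?thesis .
 qed (simp add: dK_eq[OF dK_in_K[OF x]])
 thus ?thesis by (simp add: fun_eq_iff)
qed

text \<open>A constant factor commutes with both differentials, so only truncation could tell the
  two orders apart. Inside a nonvanishing target an intermediate term is truncated only at indices
  \<open>k\<close> where the untruncated one already vanishes.\<close>

lemma NK_dK: assumes x: "x \<in> K \<A>" shows "NK (dK x) = dK (NK x)"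
proof -
 have "NK (dK x) i j k = dK (NK x) i j k" for i j k
 proof (cases "K_nonzero i j k")
  case True
  let ?y = "\<lambda>k. x (i - 3) (j - 1) k" and ?s = "inverse two_pi_i"
  have s: "smooth_form \<A> (?y k)" for k using KD(3)[OF x] .
  have N: "NK x (i - 1) (j - 1) k' = cmult ?s (?y (k' - 1))" if k': "k' = k \<or> k' = k - 1" for k'
  proof (cases "k' < 0")
   case True
   thus ?thesis using KD(6)[OF x, of "i - 3" "j - 1" "k' - 1"] by (simp add: NK_eq[OF x] K_nonzero_def)
  next
   case False
   hence "K_nonzero (i - 1) (j - 1) k'" using k' True by (auto simp: K_nonzero_def)
   thus ?thesis by (simp add: NK_eq[OF x])
  qed
  have "dK x (i - 2) j (k - 1) = raw_d x (i - 3) (j - 1) (k - 1)"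
  proof (cases "k \<le> 0")
   case True
   thus ?thesis using raw_d_eq_0[OF x, of "k - 1"] by (simp add: dK_eq[OF x])
  next
   case False
   hence "K_nonzero (i - 2) j (k - 1)" using True by (auto simp: K_nonzero_def)
   thus ?thesis by (simp add: dK_eq[OF x])
  qed
  hence "NK (dK x) i j k = cmult ?s (raw_d x (i - 3) (j - 1) (k - 1))"
   using True by (simp add: NK_eq[OF dK_in_K[OF x]])
  moreover have "dK (NK x) i j k = dform (cmult ?s (?y (k - 1 - 1))) + dcform (cmult ?s (?y (k - 1)))"
   using True N[of k] N[of "k - 1"] by (simp add: dK_eq[OF NK_in_K[OF x]] raw_d_def)
  ultimately show ?thesis by (simp add: raw_d_def cmult_add dform_cmult dcform_cmult s)
 qed (simp add: dK_eq[OF NK_in_K[OF x]] NK_eq[OF dK_in_K[OF x]])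
 thus ?thesis by (simp add: fun_eq_iff)
qed

lemma dK_linear: "linear_on_subspace (K \<A>) dK"
 by (rule cochain_linI)
  (simp_all add: dK_eq subspace_add[OF subspace_K] subspace_scale[OF subspace_K] KD(3) raw_d_def dform_add dcform_add
   scaleR_fun_apply scaleR_form dform_cmult dcform_cmult cmult_add add_ac)

lemma NK_linear: "linear_on_subspace (K \<A>) NK"
 by (rule cochain_linI)
  (simp_all add: NK_eq subspace_add[OF subspace_K] subspace_scale[OF subspace_K] cmult_add
   scaleR_fun_apply scaleR_form cmult_cmult mult.commute)

text \<open>\<open>n\<close> steps move the support by \<open>2 * n\<close> in \<open>i\<close> and
  by \<open>n\<close> in \<open>k\<close>, while a nonzero target requires \<open>i \<le> k\<close>.
  This fails once \<open>n\<close> exceeds a bound on \<open>\<bar>i\<bar> + \<bar>k\<bar>\<close>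
  over the finite support.\<close>

lemma NK_nilpotent: assumes x: "x \<in> K \<A>" shows "\<exists>n. (NK ^^ n) x = 0"
proof -
 have it: "(NK ^^ n) x \<in> K \<A> \<and> (\<forall>i j k. (NK ^^ n) x i j k \<noteq> 0 \<longrightarrow> K_nonzero i j k \<and> x (i - 2 * int n) j (k - int n) \<noteq> 0)" for n
 proof (induction n)
  case 0
  show ?case using x KD(6)[OF x] unfolding funpow_0 of_nat_0 mult_zero_right diff_zero by blast
 next
  case (Suc n)
  hence IH: "(NK ^^ n) x \<in> K \<A>" by blast
  have "K_nonzero i j k \<and> x (i - 2 * int (Suc n)) j (k - int (Suc n)) \<noteq> 0" if "NK ((NK ^^ n) x) i j k \<noteq> 0" for i j k
  proof -
   have "K_nonzero i j k" "(NK ^^ n) x (i - 2) j (k - 1) \<noteq> 0"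
    using that by (auto simp: NK_eq[OF IH] split: if_splits)
   hence "x (i - 2 - 2 * int n) j (k - 1 - int n) \<noteq> 0" using Suc by blast
   thus ?thesis using \<open>K_nonzero i j k\<close> by (simp add: algebra_simps)
  qed
  thus ?case using NK_in_K[OF IH] unfolding funpow.simps o_def by blast
 qed
 define M where "M = Max (insert 0 ((\<lambda>(i, j, k). \<bar>i\<bar> + \<bar>k\<bar>) ` K_support x))"
 have M: "\<bar>i\<bar> + \<bar>k\<bar> \<le> M" if "x i j k \<noteq> 0" for i j k
  unfolding M_def using KD(2)[OF x] that by (intro Max_ge) (auto simp: K_support_def image_iff)
 have "(NK ^^ nat (2 * M + 1)) x i j k = 0" for i j k
 proof (rule ccontr)
  let ?n = "nat (2 * M + 1)"
  assume "(NK ^^ ?n) x i j k \<noteq> 0"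
  hence "K_nonzero i j k" "x (i - 2 * int ?n) j (k - int ?n) \<noteq> 0" using it by blast+
  hence "\<bar>i - 2 * int ?n\<bar> + \<bar>k - int ?n\<bar> \<le> M" "i \<le> k" using M by (auto simp: K_nonzero_def)
  moreover have "M \<ge> 0" unfolding M_def using KD(2)[OF x] by (intro Max_ge) auto
  ultimately show False by auto
 qed
 thus ?thesis by (auto simp: fun_eq_iff)
qed

lemma K_comp_apply: "K_comp i j x i' j' = (if i' = i \<and> j' = j then x i j else 0)"
 by (simp add: K_comp_def)

lemma K_comp_in_K: assumes x: "x \<in> K \<A>" shows "K_comp i j x \<in> K \<A>"
proof -
 have "K_support (K_comp i j x) \<subseteq> K_support x" by (auto simp: K_support_def K_comp_def split: if_splits)
 hence "finite (K_support (K_comp i j x))" using KD(2)[OF x] by (rule finite_subset)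
 thus ?thesis using KD(1)[OF x] unfolding K_iff by (simp add: K_comp_def zero_in_K_piece)
qed

lemma dK_K_comp: assumes x: "x \<in> K \<A>" shows "dK (K_comp i j x) = K_comp (i + 1) (j + 1) (dK x)"
proof -
 have "dK (K_comp i j x) i' j' k = K_comp (i + 1) (j + 1) (dK x) i' j' k" for i' j' k
  by (auto simp: dK_eq[OF K_comp_in_K[OF x]] dK_eq[OF x] K_comp_apply raw_d_def)
 thus ?thesis by (simp add: fun_eq_iff)
qed

lemma NK_K_comp: assumes x: "x \<in> K \<A>" shows "NK (K_comp i j x) = K_comp (i + 2) j (NK x)"
proof -
 have "NK (K_comp i j x) i' j' k = K_comp (i + 2) j (NK x) i' j' k" for i' j' k
  by (auto simp: NK_eq[OF K_comp_in_K[OF x]] NK_eq[OF x] K_comp_apply)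
 thus ?thesis by (simp add: fun_eq_iff)
qed

lemma K_comp_linear: "linear_on_subspace (K \<A>) (K_comp i j)"
 unfolding linear_on_subspace_def using subspace_K
 by (auto simp: fun_eq_iff K_comp_def scaleR_fun_apply)

lemma K_bi_iff: "x \<in> K_bi \<A> i j \<longleftrightarrow> x \<in> K \<A> \<and> K_comp i j x = x"
 by (simp add: K_bi_def)

lemma K_comp_in_K_bi: "x \<in> K \<A> ==> K_comp i j x \<in> K_bi \<A> i j"
 unfolding K_bi_iff using K_comp_in_K by (auto simp: fun_eq_iff K_comp_def)

lemma K_sum_comp:
 assumes x: "x \<in> K \<A>" and S: "finite S" "(\<lambda>(i, j, k). (i, j)) ` K_support x \<subseteq> S"
 shows "x = (\<Sum>(i, j)\<in>S. K_comp i j x)"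
proof -
 have "(\<Sum>(i, j)\<in>S. K_comp i j x) i' j' k = x i' j' k" for i' j' k
 proof -
  have app: "(\<Sum>p\<in>S. g p) i' j' k = (\<Sum>p\<in>S. g p i' j' k)" for g :: "int \<times> int => 'a cochain"
   using S(1) by (induction S rule: finite_induct) auto
  have "(\<Sum>(i, j)\<in>S. K_comp i j x) i' j' k = (\<Sum>p\<in>S. if p = (i', j') then x i' j' k else 0)"
   unfolding app by (intro sum.cong) (auto simp: K_comp_def split: if_splits)
  also have "\<dots> = (if (i', j') \<in> S then x i' j' k else 0)" using S(1) by simp
  also have "\<dots> = x i' j' k" using S(2) by (force simp: K_support_def image_iff)
  finally show ?thesis .
 qed
 thus ?thesis by (simp add: fun_eq_iff)
qed

lemma K_j_zero: assumes x: "x \<in> K \<A>" and j: "j \<notin> {- 1, 0, 1}" shows "x i j k = 0"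
proof (rule form_eqI)
 fix a b c z
 have "int a + int b \<noteq> j + 1 \<or> a > 1 \<or> b > 1" using j by auto
 thus "x i j k a b c z = 0 a b c z"
  by (auto simp: homogeneous_apply[OF KD(4)[OF x]] smooth_form_outside[OF KD(3)[OF x]])
qed

lemma K_bi_zero: assumes "x \<in> K_bi \<A> i j" "j \<notin> {- 1, 0, 1} \<or> odd (1 + j - i)" shows "x = 0"
proof -
 have x: "x \<in> K \<A>" "K_comp i j x = x" using assms K_bi_iff by auto
 have "x i j k = 0" for k
  using assms(2) K_j_zero[OF x(1), of j i k] KD(6)[OF x(1), of i j k] by (auto simp: K_nonzero_def)
 hence "K_comp i j x = 0" by (simp add: fun_eq_iff K_comp_def)
 thus ?thesis using x(2) by simp
qed

end

section \<open>Symmetries of the polarization\<close>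

lemma surface_integral_cong:
 assumes "\<And>c z. \<eta> 1 1 c z = \<theta> 1 1 c z" shows "surface_integral \<A> \<eta> = surface_integral \<A> \<theta>"
 by (simp only: surface_integral_def assms)

lemma surface_integral_zero:
 assumes "\<And>c z. \<theta> 1 1 c z = 0" shows "surface_integral \<A> \<theta> = 0"
 unfolding surface_integral_def Let_def assms by (simp add: set_lebesgue_integral_def)

context compact_surface
begin

definition pairing :: "'a cochain => 'a cochain => int \<times> int \<times> int => complex" where
 "pairing x y = (\<lambda>(i, j, k). 1 / two_pi_i * eps (1 - j) * (- 1) powi k *
   surface_integral \<A> (wedge (x (- i) (- j) k) (weil (y i j (k + i)))))"

lemma pairing_zero: "x (- i) (- j) k = 0 \<or> y i j (k + i) = 0 ==> pairing x y (i, j, k) = 0"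
 unfolding pairing_def by (auto simp: wedge_def weil_def intro!: surface_integral_zero)

lemma polarization_eq:
 assumes "finite S" "\<And>i j k. x (- i) (- j) k \<noteq> 0 ==> y i j (k + i) \<noteq> 0 ==> (i, j, k) \<in> S"
 shows "polarization \<A> x y = (\<Sum>p\<in>S. pairing x y p)"
 unfolding polarization_def pairing_def[symmetric]
proof (rule sum.mono_neutral_cong_left[OF assms(1)])
 show "{(i, j, k). x (- i) (- j) k \<noteq> 0 \<and> y i j (k + i) \<noteq> 0} \<subseteq> S" using assms(2) by auto
 show "\<forall>p\<in>S - {(i, j, k). x (- i) (- j) k \<noteq> 0 \<and> y i j (k + i) \<noteq> 0}. pairing x y p = 0"
  by (auto intro: pairing_zero)
qed (auto simp: pairing_def)

lemma finite_neg_support: assumes "x \<in> K \<A>" shows "finite {(i, j, k). x (- i) (- j) k \<noteq> 0}"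
 by (rule finite_subset[OF _ finite_vimageI[OF KD(2)[OF assms], of "\<lambda>(i, j, k). (- i, - j, k)"]])
  (auto simp: K_support_def inj_def)

lemma polarization_orthogonal:
 assumes "x \<in> K_bi \<A> i j" "y \<in> K_bi \<A> i' j'" "i' \<noteq> - i \<or> j' \<noteq> - j"
 shows "polarization \<A> x y = 0"
proof -
 have "x i1 j1 k = 0" if "i1 \<noteq> i \<or> j1 \<noteq> j" for i1 j1 k
  using assms(1) that K_comp_apply[of i j x i1 j1] unfolding K_bi_iff by auto
 moreover have "y i1 j1 k = 0" if "i1 \<noteq> i' \<or> j1 \<noteq> j'" for i1 j1 k
  using assms(2) that K_comp_apply[of i' j' y i1 j1] unfolding K_bi_iff by auto
 ultimately have "x (- i1) (- j1) k = 0 \<or> y i1 j1 (k + i1) = 0" for i1 j1 k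
  using assms(3) by (cases "- i1 = i \<and> - j1 = j") auto
 hence "polarization \<A> x y = (\<Sum>p\<in>{}. pairing x y p)" by (intro polarization_eq) auto
 thus ?thesis by simp
qed

lemma weil_apply: "weil \<theta> a b c z = \<i> powi (int a - int b) * \<theta> a b c z"
 by (simp add: weil_def)

lemma weil_cmult: "weil (cmult s \<theta>) = cmult s (weil \<theta>)"
 by (rule form_eqI) (simp add: weil_def cmult_def)

lemma wedge_cmult: "wedge (cmult s \<eta>) \<theta> = cmult s (wedge \<eta> \<theta>)" "wedge \<eta> (cmult s \<theta>) = cmult s (wedge \<eta> \<theta>)"
 by (rule form_eqI; simp add: wedge_def cmult_def sum_distrib_left mult_ac)+

text \<open>Termwise skewness up to a translation of the index suffices, once both sums are extended
  to finite sets that correspond under the translation.\<close>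

lemma polarization_shift:
 assumes x: "x \<in> K \<A>" "x' \<in> K \<A>" and eq: "\<And>i j k. pairing x' y (i, j, k) = - pairing x y' (i + a, j + b, k + c)"
 shows "polarization \<A> x' y = - polarization \<A> x y'"
proof -
 let ?f = "\<lambda>(i, j, k). (i + a, j + b, k + c)" and ?g = "\<lambda>(i, j, k). (i - a, j - b, k - c)"
 let ?B = "{(i, j, k). x (- i) (- j) k \<noteq> 0}"
 define S where "S = {(i, j, k). x' (- i) (- j) k \<noteq> 0} \<union> ?g ` ?B"
 have S: "finite S" unfolding S_def using finite_neg_support[OF x(1)] finite_neg_support[OF x(2)] by simp
 have "?B = ?f ` ?g ` ?B" unfolding image_image by (simp add: split_beta)
 hence B: "?B \<subseteq> ?f ` S" unfolding S_def by blast
 have "polarization \<A> x' y = (\<Sum>p\<in>S. pairing x' y p)" by (rule polarization_eq[OF S]) (simp add: S_def)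
 also have "\<dots> = - (\<Sum>p\<in>S. pairing x y' (?f p))" unfolding sum_negf[symmetric] using eq by (intro sum.cong refl) auto
 also have "(\<Sum>p\<in>S. pairing x y' (?f p)) = (\<Sum>p\<in>?f ` S. pairing x y' p)" by (subst sum.reindex) (auto simp: inj_on_def)
 also have "\<dots> = polarization \<A> x y'" by (rule polarization_eq[symmetric]) (use S B in auto)
 finally show ?thesis .
qed

text \<open>\<open>N\<close> moves the matching term from \<open>k\<close> to \<open>k - 1\<close>,
  and the sign \<open>(- 1) powi k\<close> in the polarization turns this into skewness.\<close>

lemma polarization_NK:
 assumes x: "x \<in> K \<A>" and y: "y \<in> K \<A>"
 shows "polarization \<A> (NK x) y = - polarization \<A> x (NK y)"
proof (rule polarization_shift[OF x NK_in_K[OF x]])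
 fix i j k :: int
 let ?s = "inverse two_pi_i"
 have m: "- (i + 2) = - i - 2" "k + - 1 + (i + 2) = k + i + 1" by simp_all
 show "pairing (NK x) y (i, j, k) = - pairing x (NK y) (i + 2, j + 0, k + - 1)"
 proof (cases "x (- i - 2) (- j) (k - 1) = 0 \<or> y i j (k + i) = 0")
  case True
  hence "NK x (- i) (- j) k = 0 \<or> y i j (k + i) = 0" "x (- (i + 2)) (- j) (k + - 1) = 0 \<or> NK y (i + 2) j (k + - 1 + (i + 2)) = 0"
   unfolding m by (auto simp: NK_eq[OF x] NK_eq[OF y])
  thus ?thesis using pairing_zero[of "NK x" i j k y] pairing_zero[of x "i + 2" j "k + - 1" "NK y"] by simp
 next
  case False
  \<comment> \<open>When both source components are nonzero, neither image is truncated; otherwise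
    both terms are 0.\<close>
  hence "K_nonzero (- i - 2) (- j) (k - 1)" "K_nonzero i j (k + i)" using KD(6)[OF x] KD(6)[OF y] by blast+
  hence "K_nonzero (- i) (- j) k" "K_nonzero (i + 2) j (k + i + 1)" by (auto simp: K_nonzero_def)
  hence N: "NK x (- i) (- j) k = cmult ?s (x (- i - 2) (- j) (k - 1))"
   "NK y (i + 2) j (k + i + 1) = cmult ?s (y i j (k + i))"
   by (simp_all add: NK_eq[OF x] NK_eq[OF y])
  have "(- 1) powi (k + - 1) = - ((- 1 :: complex) powi k)" by (simp add: power_int_diff)
  thus ?thesis unfolding split pairing_def m N by (simp only: N weil_cmult wedge_cmult add_0_right) simp
 qed
qed

end

locale kaehler_surface = compact_surface \<A> for \<A> :: "'a::t2_space chart set" +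
 fixes \<omega> :: "'a form"
 assumes kaehler: "kaehler_form \<A> \<omega>"
begin

lemma omega_smooth: "smooth_form \<A> \<omega>" and omega_cnj: "form_cnj \<omega> = \<omega>"
 and omega_type: "a \<noteq> 1 \<or> b \<noteq> 1 ==> \<omega> a b = 0"
 using kaehler unfolding kaehler_form_def real_form_def by auto

lemma omega_apply: "a \<noteq> 1 \<or> b \<noteq> 1 ==> \<omega> a b c z = 0"
 using omega_type by simp

lemma wedge_omega: "wedge \<eta> \<omega> a b c z = \<eta> 0 0 c z * \<omega> a b c z"
proof (cases "a = 1 \<and> b = 1")
 case True
 thus ?thesis by (simp add: wedge_def omega_apply atMost_Suc)
next
 case False
 have "(\<Sum>r\<le>a. \<Sum>s\<le>b. (- 1) ^ (s * (a - r)) * \<eta> r s c z * \<omega> (a - r) (b - s) c z) = 0" if "a \<le> 1" "b \<le> 1"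
  using that False by (intro sum.neutral ballI) (auto simp: omega_apply)
 thus ?thesis using False by (auto simp: wedge_def omega_apply)
qed

lemma wedge_omega_0: "(\<And>c z. \<eta> 0 0 c z = 0) ==> wedge \<eta> \<omega> = 0"
 by (rule form_eqI) (simp add: wedge_omega)

lemma wedge_omega_smooth: assumes \<eta>: "smooth_form \<A> \<eta>" shows "smooth_form \<A> (wedge \<eta> \<omega>)"
proof (rule smooth_formI)
 fix a b c
 have eq: "wedge \<eta> \<omega> a b c = (\<lambda>z. \<eta> 0 0 c z * \<omega> a b c z)" by (intro ext wedge_omega)
 show "a \<le> 1 \<and> b \<le> 1 \<and> c \<in> \<A> \<and> z \<in> chart_range c" if "wedge \<eta> \<omega> a b c z \<noteq> 0" for z
  using that smooth_formD(1)[OF omega_smooth, of a b c z] by (simp add: wedge_omega)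
 show "smooth_on (chart_range c) (wedge \<eta> \<omega> a b c)" if "c \<in> \<A>"
  unfolding eq using that \<eta> omega_smooth smooth_formD(2) open_chart_range by (intro smooth_on_mult) auto
 show "transforms a b (wedge \<eta> \<omega> a b)"
  using smooth_formD(3)[OF \<eta>, of 0 0] smooth_formD(3)[OF omega_smooth, of a b]
  unfolding transforms_def wedge_omega by (auto simp: mult_ac)
qed

lemma wedge_omega_homogeneous: assumes "homogeneous (j - 1) \<eta>" shows "homogeneous (j + 1) (wedge \<eta> \<omega>)"
proof (rule homogeneousI)
 fix a b c z assume "int a + int b \<noteq> j + 1"
 show "wedge \<eta> \<omega> a b c z = 0"
 proof (cases "j = 1")
  case True
  hence "a \<noteq> 1 \<or> b \<noteq> 1" using \<open>int a + int b \<noteq> j + 1\<close> by auto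
  thus ?thesis by (simp add: wedge_omega omega_apply)
 next
  case False
  thus ?thesis using homogeneous_apply[OF assms, of 0 0] by (simp add: wedge_omega)
 qed
qed

lemma ellK_proj:
 assumes "x \<in> K \<A>"
 shows "ellK \<omega> x i j k = (if K_nonzero i j k then cmult two_pi_i (wedge (x i (j - 2) k) \<omega>) else 0)"
 unfolding ellK_def
 using wedge_omega_homogeneous[of j "x i (j - 2) k"] KD(4)[OF assms, of "j - 2" i k]
 by (intro K_proj_eq smooth_form_cmult wedge_omega_smooth KD(3)[OF assms] homogeneous_cmult) simp

text \<open>Raising \<open>j\<close> by 2 changes neither the parity nor the bound on
  \<open>k\<close>, so the projection cuts nothing off.\<close>

lemma ellK_eq: assumes "x \<in> K \<A>" shows "ellK \<omega> x i j k = cmult two_pi_i (wedge (x i (j - 2) k) \<omega>)"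
proof (cases "K_nonzero i j k")
 case False
 hence "\<not> K_nonzero i (j - 2) k" by (auto simp: K_nonzero_def)
 hence "x i (j - 2) k = 0" by (rule KD(6)[OF assms])
 thus ?thesis using False by (simp add: ellK_proj[OF assms] wedge_omega_0)
qed (simp add: ellK_proj[OF assms])

lemma ellK_apply: "x \<in> K \<A> ==> ellK \<omega> x i j k a b c z = two_pi_i * (x i (j - 2) k 0 0 c z * \<omega> a b c z)"
 by (simp add: ellK_eq cmult_apply wedge_omega)

lemma ellK_in_K: assumes x: "x \<in> K \<A>" shows "ellK \<omega> x \<in> K \<A>"
proof (rule K_I[OF ellK_proj[OF x] _ _ _ x, of 0 2 0 0])
 fix i j k
 let ?w = "wedge (x i (j - 2) k) \<omega>"
 show "smooth_form \<A> (cmult two_pi_i ?w)" by (intro smooth_form_cmult wedge_omega_smooth KD(3) x)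
 show "homogeneous (j + 1) (cmult two_pi_i ?w)"
  using wedge_omega_homogeneous[of j "x i (j - 2) k"] KD(4)[OF x, of "j - 2" i k] by (intro homogeneous_cmult) simp
 have "(1 + j - i) div 2 = (1 + (j - 2) - i) div 2 + 1" by simp
 hence tw: "twist i j = - twist i (j - 2)" unfolding twist_def by (simp add: power_int_add)
 have "form_cnj ?w = cmult (twist i (j - 2)) ?w"
 proof (rule form_eqI)
  fix a b c z
  have "cnj (x i (j - 2) k 0 0 c z) = twist i (j - 2) * x i (j - 2) k 0 0 c z"
   using KD(5)[OF x, of i "j - 2" k] by (metis form_cnj_apply cmult_apply mult_1 mult_zero_left power_0)
  moreover have "(- 1) ^ (a * b) * cnj (\<omega> b a c z) = \<omega> a b c z"
   using omega_cnj by (metis form_cnj_apply)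
  ultimately show "form_cnj ?w a b c z = cmult (twist i (j - 2)) ?w a b c z"
   by (simp add: form_cnj_apply cmult_apply wedge_omega mult_ac)
 qed
 thus "form_cnj (cmult two_pi_i ?w) = cmult (twist i j) (cmult two_pi_i ?w)"
  by (simp add: form_cnj_cmult cmult_cmult tw mult_ac)
 show "x (i - 0) (j - 2) (k - 0) \<noteq> 0 \<or> x (i - 0) (j - 2) (k - 0) \<noteq> 0" if "ellK \<omega> x i j k \<noteq> 0"
  using that by (auto simp: ellK_eq[OF x] wedge_omega_0)
qed

text \<open>Wedging with \<open>\<omega>\<close> lands in \<open>j = 1\<close>, the two-forms, and
  the differential leads from there to degree three.\<close>

lemma dK_ellK: assumes x: "x \<in> K \<A>" shows "dK (ellK \<omega> x) = 0"
proof -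
 note l = ellK_in_K[OF x]
 have z: "ellK \<omega> x i j k = 0" if "j \<noteq> 1" for i j k
  using homogeneous_apply[OF KD(4)[OF x], of 0 0 "j - 2"] that by (simp add: ellK_eq[OF x] wedge_omega_0)
 have "dK (ellK \<omega> x) i j k = 0" for i j k
 proof (cases "j = 2")
  case True thus ?thesis using K_j_zero[OF dK_in_K[OF l]] by simp
 next
  case False
  thus ?thesis using z[of "j - 1"] by (simp add: dK_eq[OF l] raw_d_def)
 qed
 thus ?thesis by (simp add: fun_eq_iff)
qed

text \<open>\<open>ellK\<close> sees only functions, and a function in the image of the differential
  would come from degree -1.\<close>

lemma ellK_dK: assumes x: "x \<in> K \<A>" shows "ellK \<omega> (dK x) = 0"
proof -
 have "dK x i (j - 2) k 0 0 c z = 0" for i j k c z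
 proof (cases "j = 1")
  case True
  thus ?thesis using K_j_zero[OF x, of "-2" "i - 1"] by (simp add: dK_eq[OF x] raw_d_def)
 next
  case False
  thus ?thesis using homogeneous_apply[OF KD(4)[OF dK_in_K[OF x]], of 0 0 "j - 2"] by simp
 qed
 thus ?thesis by (simp add: fun_eq_iff ellK_apply[OF dK_in_K[OF x]])
qed

lemma ellK_linear: "linear_on_subspace (K \<A>) (ellK \<omega>)"
 by (rule linI[OF subspace_K])
  (simp_all add: fun_eq_iff ellK_apply subspace_add[OF subspace_K] subspace_scale[OF subspace_K] scaleR_fun_apply algebra_simps)

lemma ellK_K_comp: "x \<in> K \<A> ==> ellK \<omega> (K_comp i j x) = K_comp i (j + 2) (ellK \<omega> x)"
 by (auto simp: fun_eq_iff ellK_apply K_comp_in_K K_comp_apply)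

lemma NK_ellK: assumes x: "x \<in> K \<A>" shows "NK (ellK \<omega> x) = ellK \<omega> (NK x)"
proof -
 have n: "K_nonzero i (j - 2) k = K_nonzero i j k" for i j k by (auto simp: K_nonzero_def)
 have "NK (ellK \<omega> x) i j k = ellK \<omega> (NK x) i j k" for i j k
  by (cases "K_nonzero i j k")
   (simp_all add: n NK_eq[OF ellK_in_K[OF x]] ellK_eq[OF NK_in_K[OF x]] NK_eq[OF x] ellK_eq[OF x] wedge_omega_0 wedge_cmult cmult_cmult mult.commute)
 thus ?thesis by (simp add: fun_eq_iff)
qed

text \<open>Only \<open>j = - 1\<close> contributes, where the two sides carry
  \<open>eps 2 = - 1\<close> and \<open>eps 0 = 1\<close>; their ratio is the sign.\<close>

lemma polarization_ellK:
 assumes x: "x \<in> K \<A>" and y: "y \<in> K \<A>"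
 shows "polarization \<A> (ellK \<omega> x) y = - polarization \<A> x (ellK \<omega> y)"
proof (rule polarization_shift[OF x ellK_in_K[OF x]])
 fix i j k :: int
 let ?x = "x (- i) (- j - 2) k" and ?y = "y i j (k + i)"
 have l: "ellK \<omega> x (- i) (- j) k = cmult two_pi_i (wedge ?x \<omega>)" and r: "ellK \<omega> y i (j + 2) (k + i) = cmult two_pi_i (wedge ?y \<omega>)"
  by (simp_all add: ellK_eq[OF x] ellK_eq[OF y])
 define I where "I = surface_integral \<A> (wedge (cmult two_pi_i (wedge ?x \<omega>)) (weil ?y))"
 have I2: "I = surface_integral \<A> (wedge ?x (weil (cmult two_pi_i (wedge ?y \<omega>))))"
  unfolding I_def
 proof (rule surface_integral_cong)
  fix c z
  show "wedge (cmult two_pi_i (wedge ?x \<omega>)) (weil ?y) 1 1 c z = wedge ?x (weil (cmult two_pi_i (wedge ?y \<omega>))) 1 1 c z"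
   by (simp add: wedge_def[of "cmult _ _"] wedge_def[of ?x "weil _"] wedge_omega cmult_apply weil_apply omega_apply atMost_Suc)
 qed
 have "pairing (ellK \<omega> x) y (i, j, k) = 1 / two_pi_i * (- 1) powi k * (eps (1 - j) * I)"
  unfolding pairing_def split l I_def by (simp only: mult_ac)
 moreover have "pairing x (ellK \<omega> y) (i, j + 2, k) = 1 / two_pi_i * (- 1) powi k * (eps (1 - (j + 2)) * I)"
 proof -
  have "- (j + 2) = - j - 2" by simp
  thus ?thesis unfolding pairing_def split r I2 by (simp only: mult_ac)
 qed
 moreover have "eps (1 - j) * I = - eps (1 - (j + 2)) * I"
 proof (cases "j = - 1")
  case True
  thus ?thesis by (simp add: eps_def power_int_minus_left)
 next
  case False
  have "?x 0 0 c z = 0" for c z using homogeneous_apply[OF KD(4)[OF x], of 0 0 "- j - 2"] False by simp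
  hence "I = 0" unfolding I2 by (intro surface_integral_zero)
    (simp add: wedge_def[of ?x "weil _"] wedge_omega cmult_apply weil_apply omega_apply atMost_Suc)
  thus ?thesis by simp
 qed
 ultimately show "pairing (ellK \<omega> x) y (i, j, k) = - pairing x (ellK \<omega> y) (i + 0, j + 2, k + 0)"
  by (simp only: mult_minus_left mult_minus_right add_0_right)
qed

end

section \<open>Local primitives and the first cohomology\<close>

text \<open>Line integral of the one-form with coefficients \<open>p\<close> and \<open>q\<close>
  along the segment from \<open>z0\<close> to \<open>z\<close>.\<close>

definition primitive :: "complex => (complex => complex) => (complex => complex) => complex => complex" where
 "primitive z0 p q z = integral {0..1}
   (\<lambda>t. p (z0 + of_real t * (z - z0)) * (z - z0) + q (z0 + of_real t * (z - z0)) * cnj (z - z0))"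

lemma bounded_linear_wirtinger: "bounded_linear (\<lambda>v. a * v + b * cnj v)"
 by (intro bounded_linear_add bounded_linear_mult_right bounded_linear_compose[OF bounded_linear_mult_right bounded_linear_cnj])

text \<open>The first line is the product rule for the integrand in direction \<open>v\<close>, the
  second the derivative in \<open>s\<close> of \<open>s\<close> times the value of the form at
  \<open>v\<close>. Their right sides coincide when \<open>P2 = Q1\<close>, which is
  closedness.\<close>

lemma primitive_identity:
 fixes P :: complex
 shows "(P * v + (P1 * s * v + P2 * s * v') * h) + (Q * v' + (Q1 * s * v + Q2 * s * v') * h')
   = (s * P1 * h + P + s * Q1 * h') * v + (s * P2 * h + s * Q2 * h' + Q) * v'"
  and "s * ((P1 * h + Q1 * h') * v + (Q1 * h + Q2 * h') * v') + 1 * (P * v + Q * v')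
   = (s * P1 * h + P + s * Q1 * h') * v + (s * Q1 * h + s * Q2 * h' + Q) * v'"
 by (simp_all add: algebra_simps)

text \<open>Poincare lemma on a disk: after differentiation under the integral sign, closedness
  makes the integrand an exact derivative in the segment parameter.\<close>

lemma primitive_has_derivative:
 assumes S: "open S" "ball z0 r \<subseteq> S" and p: "smooth_on S p" and q: "smooth_on S q"
  and closed: "\<And>w. w \<in> ball z0 r ==> wirtinger_bar p w = wirtinger q w"
  and z: "z \<in> ball z0 r"
 shows "(primitive z0 p q has_derivative (\<lambda>v. p z * v + q z * cnj v)) (at z)"
proof -
 let ?w = "\<lambda>z t. z0 + of_real t * (z - z0)"
 let ?f = "\<lambda>z t. p (?w z t) * (z - z0) + q (?w z t) * cnj (z - z0)"
 have w: "?w z t \<in> ball z0 r" if "z \<in> ball z0 r" "t \<in> {0..1}" for z and t :: real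
 proof -
  have "norm (of_real t * (z - z0)) \<le> 1 * norm (z - z0)" unfolding norm_mult using that by (intro mult_right_mono) auto
  thus ?thesis using that by (simp add: dist_norm norm_minus_commute)
 qed
 have wS: "?w z t \<in> S" if "z \<in> ball z0 r" "t \<in> {0..1}" for z and t :: real using w[OF that] S(2) by blast
 have pd: "p differentiable (at (?w z t))" and qd: "q differentiable (at (?w z t))"
  if "z \<in> ball z0 r" "t \<in> {0..1}" for z and t :: real
  using smooth_on_differentiable p q wS[OF that] by blast+
 define \<alpha> where "\<alpha> z t = of_real t * wirtinger p (?w z t) * (z - z0) + p (?w z t) + of_real t * wirtinger q (?w z t) * cnj (z - z0)" for z t
 define \<beta> where "\<beta> z t = of_real t * wirtinger_bar p (?w z t) * (z - z0) + of_real t * wirtinger_bar q (?w z t) * cnj (z - z0) + q (?w z t)" for z t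
 define fx where "fx z t = Blinfun (\<lambda>v. \<alpha> z t * v + \<beta> z t * cnj v)" for z t
 have fx: "blinfun_apply (fx z t) = (\<lambda>v. \<alpha> z t * v + \<beta> z t * cnj v)" for z t
  unfolding fx_def by (rule bounded_linear_Blinfun_apply[OF bounded_linear_wirtinger])
 have cw: "continuous_on T (\<lambda>x. h (?w (u x) (v x)))"
  if "smooth_on S h" "continuous_on T u" "continuous_on T v" "\<And>x. x \<in> T ==> u x \<in> ball z0 r \<and> v x \<in> {0..1}"
  for h T and u :: "'x::topological_space => complex" and v
  by (rule continuous_on_compose2[OF smooth_on_continuous[OF that(1)]]) (use that wS in \<open>auto intro!: continuous_intros\<close>)
 have der: "((\<lambda>z. ?f z t) has_derivative blinfun_apply (fx z t)) (at z within ball z0 r)"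
  if "z \<in> ball z0 r" "t \<in> cbox 0 1" for z t
 proof -
  have t: "t \<in> {0..1}" using that(2) by simp
  have W: "((\<lambda>z. ?w z t) has_field_derivative of_real t) (at z)" by (auto intro!: derivative_eq_intros)
  note dp = wirtinger_compose_has_derivative[OF pd[OF that(1) t] W, unfolded complex_cnj_complex_of_real]
   and dq = wirtinger_compose_has_derivative[OF qd[OF that(1) t] W, unfolded complex_cnj_complex_of_real]
  have dz: "((\<lambda>z. z - z0) has_derivative (\<lambda>v. v)) (at z)" by (auto intro!: derivative_eq_intros)
  have dzc: "((\<lambda>z. cnj (z - z0)) has_derivative (\<lambda>v. cnj v)) (at z)"
   by (rule bounded_linear.has_derivative[OF bounded_linear_cnj dz])
  have "((\<lambda>z. ?f z t) has_derivative
   (\<lambda>v. (p (?w z t) * v + (wirtinger p (?w z t) * of_real t * v + wirtinger_bar p (?w z t) * of_real t * cnj v) * (z - z0))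
    + (q (?w z t) * cnj v + (wirtinger q (?w z t) * of_real t * v + wirtinger_bar q (?w z t) * of_real t * cnj v) * cnj (z - z0)))) (at z)"
   by (rule has_derivative_add[OF has_derivative_mult[OF dp dz] has_derivative_mult[OF dq dzc]])
  hence "((\<lambda>z. ?f z t) has_derivative blinfun_apply (fx z t)) (at z)"
   by (rule has_derivative_eq_rhs) (unfold fx \<alpha>_def \<beta>_def, rule ext, rule primitive_identity(1))
  thus ?thesis by (rule has_derivative_at_withinI)
 qed
 have cfx: "continuous_on (ball z0 r \<times> {0..1}) (\<lambda>x. fx (fst x) (snd x))"
 proof (rule continuous_on_blinfun_componentwise)
  show "continuous_on (ball z0 r \<times> {0..1}) (\<lambda>x. blinfun_apply (fx (fst x) (snd x)) i)" for i
   unfolding fx \<alpha>_def \<beta>_def by (intro continuous_intros cw p q smooth_on_wirtinger[OF S(1)]) auto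
 qed
 have "((\<lambda>z. integral (cbox 0 1) (?f z)) has_derivative
   blinfun_apply (integral (cbox 0 1) (fx z))) (at z within ball z0 r)"
 proof (rule leibniz_rule[OF der _ _ z convex_ball])
  fix z assume "z \<in> ball z0 r"
  thus "?f z integrable_on cbox 0 1"
   unfolding cbox_interval by (intro integrable_continuous_real continuous_intros cw p q) simp_all
 next
  show "continuous_on (ball z0 r \<times> cbox 0 1) (\<lambda>(x, t). fx x t)" using cfx by (simp add: split_beta)
 qed
 hence "(primitive z0 p q has_derivative blinfun_apply (integral {0..1} (fx z))) (at z)"
  using at_within_open[OF z open_ball] unfolding primitive_def[abs_def] cbox_interval by simp
 moreover have "blinfun_apply (integral {0..1} (fx z)) v = p z * v + q z * cnj v" for v
 proof -
  have "continuous_on {0..1} (fx z)"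
   using z by (intro continuous_on_compose2[OF cfx, where f = "Pair z", simplified] continuous_intros) auto
  hence "fx z integrable_on {0..1}" by (rule integrable_continuous_real)
  hence "blinfun_apply (integral {0..1} (fx z)) v = integral {0..1} (\<lambda>t. blinfun_apply (fx z t) v)"
   by (rule blinfun_apply_integral)
  also have "\<dots> = p z * v + q z * cnj v"
  proof (rule integral_unique)
   \<comment> \<open>An antiderivative in \<open>t\<close> of the differentiated integrand; at the
     two ends it is 0 and the asserted derivative.\<close>
   define G where "G t = of_real t * (p (?w z t) * v + q (?w z t) * cnj v)" for t
   have "((\<lambda>t. blinfun_apply (fx z t) v) has_integral G 1 - G 0) {0..1}"
   proof (rule fundamental_theorem_of_calculus)
    fix t :: real assume t: "t \<in> {0..1}"
    have W: "(?w z has_vector_derivative (z - z0)) (at t within {0..1})"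
     by (auto intro!: derivative_eq_intros simp: has_vector_derivative_def scaleR_conv_of_real)
    have comp: "((\<lambda>t. h (?w z t)) has_vector_derivative (wirtinger h (?w z t) * (z - z0) + wirtinger_bar h (?w z t) * cnj (z - z0))) (at t within {0..1})"
     if "smooth_on S h" for h
     using vector_derivative_diff_chain_within[OF W has_derivative_at_withinI[OF wirtinger_has_derivative[OF smooth_on_differentiable[OF that wS[OF z t]]]]]
     by (simp add: o_def)
    have eq: "wirtinger_bar p (?w z t) = wirtinger q (?w z t)" by (rule closed[OF w[OF z t]])
    have "(G has_vector_derivative
     (of_real t * ((wirtinger p (?w z t) * (z - z0) + wirtinger_bar p (?w z t) * cnj (z - z0)) * v
      + (wirtinger q (?w z t) * (z - z0) + wirtinger_bar q (?w z t) * cnj (z - z0)) * cnj v)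
      + 1 * (p (?w z t) * v + q (?w z t) * cnj v))) (at t within {0..1})"
     unfolding G_def
     by (rule has_vector_derivative_mult[OF _ has_vector_derivative_add[OF
        bounded_linear.has_vector_derivative[OF bounded_linear_mult_left comp[OF p]]
        bounded_linear.has_vector_derivative[OF bounded_linear_mult_left comp[OF q]]]])
      (auto intro!: derivative_eq_intros simp: has_vector_derivative_def scaleR_conv_of_real)
    thus "(G has_vector_derivative blinfun_apply (fx z t) v) (at t within {0..1})"
     unfolding fx \<alpha>_def \<beta>_def eq primitive_identity(2) .
   qed simp
   thus "((\<lambda>t. blinfun_apply (fx z t) v) has_integral p z * v + q z * cnj v) {0..1}" by (simp add: G_def)
  qed
  finally show ?thesis .
 qed
 hence "blinfun_apply (integral {0..1} (fx z)) = (\<lambda>v. p z * v + q z * cnj v)" by (rule ext)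
 ultimately show ?thesis by simp
qed

lemma primitive_linear:
 assumes "smooth_on S p" "smooth_on S q" "smooth_on S p'" "smooth_on S q'" "ball z0 r \<subseteq> S" "z \<in> ball z0 r"
 shows "primitive z0 (\<lambda>z. p z + p' z) (\<lambda>z. q z + q' z) z = primitive z0 p q z + primitive z0 p' q' z"
  and "primitive z0 (\<lambda>z. s * p z) (\<lambda>z. s * q z) z = s * primitive z0 p q z"
proof -
 let ?w = "\<lambda>t. z0 + of_real t * (z - z0)"
 have wS: "?w t \<in> S" if "t \<in> {0..1}" for t :: real
 proof -
  have "norm (of_real t * (z - z0)) \<le> 1 * norm (z - z0)" unfolding norm_mult using that by (intro mult_right_mono) auto
  hence "?w t \<in> ball z0 r" using assms(6) by (simp add: dist_norm norm_minus_commute)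
  thus ?thesis using assms(5) by blast
 qed
 have c: "continuous_on {0..1} (\<lambda>t. h (?w t))" if "smooth_on S h" for h
  by (rule continuous_on_compose2[OF smooth_on_continuous[OF that]]) (auto intro!: continuous_intros wS)
 have int: "(\<lambda>t. p (?w t) * (z - z0) + q (?w t) * cnj (z - z0)) integrable_on {0..1}"
  if "smooth_on S p" "smooth_on S q" for p q
  by (intro integrable_continuous_real continuous_intros c that)
 show "primitive z0 (\<lambda>z. p z + p' z) (\<lambda>z. q z + q' z) z = primitive z0 p q z + primitive z0 p' q' z"
  unfolding primitive_def
  by (subst integral_add[symmetric, OF int[OF assms(1,2)] int[OF assms(3,4)]]) (simp add: algebra_simps)
 show "primitive z0 (\<lambda>z. s * p z) (\<lambda>z. s * q z) z = s * primitive z0 p q z"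
  unfolding primitive_def by (subst integral_mult_right[symmetric]) (simp add: algebra_simps)
qed

context compact_surface
begin

definition closed_form :: "'a form => bool" where
 "closed_form \<theta> \<longleftrightarrow> smooth_form \<A> \<theta> \<and> homogeneous 1 \<theta> \<and> dform \<theta> = 0"

lemma closed_form_wirtinger:
 assumes "closed_form \<theta>" "z \<in> chart_range c"
 shows "wirtinger_bar (\<theta> 1 0 c) z = wirtinger (\<theta> 0 1 c) z"
proof -
 have "dform \<theta> 1 1 c z = 0" using assms(1) unfolding closed_form_def by simp
 thus ?thesis using assms(2) by (simp add: dform_def del_def delbar_def)
qed

type_synonym 'b disk = "'b chart \<times> complex \<times> real"

text \<open>Three concentric disks per datum: the small open ones cover the surface, the closed ones
  supply compactness, and the big ones of radius \<open>2 * r\<close> are open neighbourhoods on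
  which the primitive still makes sense.\<close>

fun is_disk :: "'a disk => bool" where
 "is_disk (c, z, r) \<longleftrightarrow> c \<in> \<A> \<and> r > 0 \<and> cball z (2 * r) \<subseteq> chart_range c"

fun small_disk :: "'a disk => 'a set" where "small_disk (c, z, r) = {x \<in> fst c. snd c x \<in> ball z r}"

fun closed_disk :: "'a disk => 'a set" where "closed_disk (c, z, r) = {x \<in> fst c. snd c x \<in> cball z r}"

fun big_disk :: "'a disk => 'a set" where "big_disk (c, z, r) = {x \<in> fst c. snd c x \<in> ball z (2 * r)}"

fun disk_primitive :: "'a disk => 'a form => 'a => complex" where
 "disk_primitive (c, z, r) \<theta> x = primitive z (\<theta> 1 0 c) (\<theta> 0 1 c) (snd c x)"

lemma disk_subset: "is_disk d ==> small_disk d \<subseteq> closed_disk d \<and> closed_disk d \<subseteq> big_disk d"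
proof -
 assume d: "is_disk d"
 obtain c z r where deq: "d = (c, z, r)" by (cases d)
 have "ball z r \<subseteq> cball z r" "cball z r \<subseteq> ball z (2 * r)" using d by (simp_all add: deq subset_eq)
 thus ?thesis unfolding deq small_disk.simps closed_disk.simps big_disk.simps by blast
qed

lemma open_disks: assumes "is_disk d" shows "open (small_disk d)" "open (big_disk d)"
proof -
 obtain c z r where deq: "d = (c, z, r)" by (cases d)
 have c: "c \<in> \<A>" using assms unfolding deq is_disk.simps by (rule conjunct1)
 show "open (small_disk d)" "open (big_disk d)"
  unfolding deq small_disk.simps big_disk.simps by (rule open_chart_preimage[OF c open_ball])+
qed

lemma compact_closed_disk: assumes "is_disk d" shows "compact (closed_disk d)"
proof -
 obtain c z r where d: "d = (c, z, r)" by (cases d)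
 have c: "c \<in> \<A>" and r0: "r > 0" and sub2: "cball z (2 * r) \<subseteq> chart_range c"
  using assms unfolding d is_disk.simps by blast+
 have sub: "cball z r \<subseteq> chart_range c" using sub2 r0 by (auto intro!: order_trans[OF subset_cball sub2])
 have "closed_disk d = inv_into (fst c) (snd c) ` cball z r"
 proof
  show "closed_disk d \<subseteq> inv_into (fst c) (snd c) ` cball z r"
  proof
   fix x assume "x \<in> closed_disk d"
   hence "x \<in> fst c" "snd c x \<in> cball z r" unfolding d by simp_all
   thus "x \<in> inv_into (fst c) (snd c) ` cball z r"
    using image_eqI[of x "inv_into (fst c) (snd c)" "snd c x"] chart_inv[OF c] by simp
  qed
  show "inv_into (fst c) (snd c) ` cball z r \<subseteq> closed_disk d"
  proof
   fix x assume "x \<in> inv_into (fst c) (snd c) ` cball z r"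
   then obtain w where w: "w \<in> cball z r" "x = inv_into (fst c) (snd c) w" by blast
   hence "w \<in> chart_range c" using sub by blast
   thus "x \<in> closed_disk d" using chart_inv'[OF c] w unfolding d closed_disk.simps by simp
  qed
 qed
 moreover have "continuous_on (cball z r) (inv_into (fst c) (snd c))"
  by (rule continuous_on_subset[OF homeomorphism_cont2[OF chart_homeomorphism[OF c]] sub])
 ultimately show ?thesis using compact_continuous_image[OF _ compact_cball] by simp
qed

lemma finite_disk_cover: "\<exists>D. finite D \<and> (\<forall>d\<in>D. is_disk d) \<and> (\<Union>d\<in>D. small_disk d) = UNIV"
proof -
 have "\<exists>d. is_disk d \<and> x \<in> small_disk d" for x
 proof -
  obtain c where c: "c \<in> \<A>" "x \<in> fst c" using charts_cover by blast
  then obtain r where r: "r > 0" "cball (snd c x) r \<subseteq> chart_range c"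
   using open_chart_range[OF c(1)] chart_range_memI[OF c(2)] open_contains_cball by blast
  have "is_disk (c, snd c x, r / 2) \<and> x \<in> small_disk (c, snd c x, r / 2)" using c r by simp
  thus ?thesis by blast
 qed
 hence cover: "(UNIV :: 'a set) \<subseteq> (\<Union>d\<in>{d. is_disk d}. small_disk d)" by blast
 have op: "open (small_disk d)" if "d \<in> {d. is_disk d}" for d using open_disks(1)[of d] that by simp
 obtain D where "D \<subseteq> {d. is_disk d}" "finite D" "UNIV \<subseteq> (\<Union>d\<in>D. small_disk d)"
  using compactE_image[OF compact_surface op cover] by blast
 thus ?thesis by blast
qed

lemma disk_primitive_linear:
 assumes d: "is_disk d" "x \<in> big_disk d" and \<theta>: "smooth_form \<A> \<theta>" "smooth_form \<A> \<eta>"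
 shows "disk_primitive d (\<theta> + \<eta>) x = disk_primitive d \<theta> x + disk_primitive d \<eta> x"
  "disk_primitive d (cmult s \<theta>) x = s * disk_primitive d \<theta> x"
proof -
 obtain c z r where deq: "d = (c, z, r)" by (cases d)
 have c: "c \<in> \<A>" and sub: "ball z (2 * r) \<subseteq> chart_range c" and x: "snd c x \<in> ball z (2 * r)"
  using d order_trans[OF ball_subset_cball[of z "2 * r"], of "chart_range c"] unfolding deq by simp_all
 note l = primitive_linear[OF smooth_formD(2)[OF \<theta>(1) c] smooth_formD(2)[OF \<theta>(1) c]
   smooth_formD(2)[OF \<theta>(2) c] smooth_formD(2)[OF \<theta>(2) c] sub x]
 show "disk_primitive d (\<theta> + \<eta>) x = disk_primitive d \<theta> x + disk_primitive d \<eta> x"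
  using l(1)[of 1 0 1 0 0 1 0 1] by (simp add: deq plus_fun_def)
 show "disk_primitive d (cmult s \<theta>) x = s * disk_primitive d \<theta> x"
  using l(2)[of s 1 0 0 1] by (simp add: deq cmult_def)
qed

text \<open>The primitive is formed in the chart of the disk but must have differential
  \<open>\<theta>\<close> in every chart. The chain rule for the holomorphic transition matches the
  transformation law of one-forms.\<close>

lemma disk_primitive_deriv:
 assumes d: "is_disk d" and \<theta>: "closed_form \<theta>" and c': "c' \<in> \<A>" "x \<in> fst c'" "x \<in> big_disk d"
 shows "((\<lambda>w. disk_primitive d \<theta> (inv_into (fst c') (snd c') w)) has_derivative
  (\<lambda>v. \<theta> 1 0 c' (snd c' x) * v + \<theta> 0 1 c' (snd c' x) * cnj v)) (at (snd c' x))"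
proof -
 obtain c z r where deq: "d = (c, z, r)" by (cases d)
 have c: "c \<in> \<A>" and sub: "ball z (2 * r) \<subseteq> chart_range c" and x: "x \<in> fst c" "snd c x \<in> ball z (2 * r)"
  using d c'(3) order_trans[OF ball_subset_cball[of z "2 * r"], of "chart_range c"] unfolding deq by simp_all
 have s: "smooth_form \<A> \<theta>" using \<theta> unfolding closed_form_def by simp
 let ?T = "transition c' c" and ?f = "primitive z (\<theta> 1 0 c) (\<theta> 0 1 c)" and ?w = "snd c' x"
 have Tw: "?T ?w = snd c x" using transition_apply[OF c'(1,2)] by simp
 have w: "?w \<in> overlap c' c" using c'(2) x(1) unfolding overlap_def by simp
 have f: "(?f has_derivative (\<lambda>v. \<theta> 1 0 c (snd c x) * v + \<theta> 0 1 c (snd c x) * cnj v)) (at (?T ?w))"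
  unfolding Tw
  by (rule primitive_has_derivative[OF open_chart_range[OF c] sub smooth_formD(2)[OF s c] smooth_formD(2)[OF s c]
     closed_form_wirtinger[OF \<theta> subsetD[OF sub]] x(2)])
 note wf = wirtinger_eqI[OF f, unfolded Tw]
 have fd: "?f differentiable (at (?T ?w))" by (rule differentiableI[OF f])
 note D = wirtinger_compose_has_derivative[OF fd transition_deriv(1)[OF c'(1) c w]]
 have "\<theta> 1 0 c' ?w = \<theta> 1 0 c (?T ?w) * deriv ?T ?w" "\<theta> 0 1 c' ?w = \<theta> 0 1 c (?T ?w) * cnj (deriv ?T ?w)"
  using smooth_formD(3)[OF s, of 1 0, unfolded transforms_def, rule_format, OF c'(1) c w]
   smooth_formD(3)[OF s, of 0 1, unfolded transforms_def, rule_format, OF c'(1) c w] by simp_all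
 hence "((\<lambda>w. ?f (?T w)) has_derivative (\<lambda>v. \<theta> 1 0 c' ?w * v + \<theta> 0 1 c' ?w * cnj v)) (at ?w)"
  using D unfolding wf Tw by simp
 thus ?thesis by (simp add: deq transition_def o_def)
qed

text \<open>The difference of two primitives is locally constant, but an overlap may have many
  components. By compactness finitely many coordinate balls inside the open overlap cover the closed
  one, and the value at a centre decides the whole ball.\<close>

lemma disk_overlap_test:
 assumes d: "is_disk d" "is_disk d'"
 shows "\<exists>X. finite X \<and> X \<subseteq> big_disk d \<inter> big_disk d' \<and>
  (\<forall>\<theta>. closed_form \<theta> \<longrightarrow> (\<forall>x\<in>X. disk_primitive d \<theta> x = disk_primitive d' \<theta> x) \<longrightarrow>
   (\<forall>x\<in>small_disk d \<inter> small_disk d'. disk_primitive d \<theta> x = disk_primitive d' \<theta> x))"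
proof -
 obtain c z r where deq: "d = (c, z, r)" by (cases d)
 have c: "c \<in> \<A>" using d by (simp add: deq)
 let ?U = "big_disk d \<inter> big_disk d'"
 define G where "G = snd c ` (fst c \<inter> ?U)"
 have G: "open G" unfolding G_def by (rule open_chart_image[OF c open_Int[OF open_disks(2)[OF d(1)] open_disks(2)[OF d(2)]]])
 define ok where "ok p \<longleftrightarrow> fst p \<in> ?U \<and> snd p > 0 \<and> ball (snd c (fst p)) (snd p) \<subseteq> G" for p :: "'a \<times> real"
 define nb where "nb p = {x \<in> fst c. snd c x \<in> ball (snd c (fst p)) (snd p)}" for p :: "'a \<times> real"
 have ex: "\<exists>p. ok p \<and> x \<in> nb p" if "x \<in> closed_disk d \<inter> closed_disk d'" for x
 proof -
  have xU: "x \<in> ?U" "x \<in> fst c"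
   using that disk_subset[OF d(1)] disk_subset[OF d(2)] by (blast, simp add: deq)
  hence "snd c x \<in> G" unfolding G_def by simp
  then obtain \<rho> where "\<rho> > 0" "ball (snd c x) \<rho> \<subseteq> G" using G open_contains_ball by blast
  hence "ok (x, \<rho>) \<and> x \<in> nb (x, \<rho>)" using xU by (simp add: ok_def nb_def)
  thus ?thesis by blast
 qed
 have comp: "compact (closed_disk d \<inter> closed_disk d')"
  by (rule compact_Int[OF compact_closed_disk[OF d(1)] compact_closed_disk[OF d(2)]])
 have op: "open (nb p)" for p unfolding nb_def by (rule open_chart_preimage[OF c open_ball])
 have cov: "closed_disk d \<inter> closed_disk d' \<subseteq> (\<Union>p\<in>{p. ok p}. nb p)" using ex by blast
 obtain P where P: "P \<subseteq> {p. ok p}" "finite P" "closed_disk d \<inter> closed_disk d' \<subseteq> (\<Union>p\<in>P. nb p)"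
  using compactE_image[OF comp op cov] by blast
 have "disk_primitive d \<theta> x = disk_primitive d' \<theta> x"
  if \<theta>: "closed_form \<theta>" and eq: "\<forall>y\<in>fst ` P. disk_primitive d \<theta> y = disk_primitive d' \<theta> y"
   and x: "x \<in> small_disk d \<inter> small_disk d'" for \<theta> x
 proof -
  have "x \<in> closed_disk d \<inter> closed_disk d'" using x disk_subset[OF d(1)] disk_subset[OF d(2)] by blast
  then obtain p where p: "p \<in> P" "x \<in> nb p" using P(3) by blast
  obtain y \<rho> where yp: "p = (y, \<rho>)" by (cases p)
  have ok: "y \<in> ?U" "\<rho> > 0" "ball (snd c y) \<rho> \<subseteq> G"
   using subsetD[OF P(1) p(1)] by (simp_all add: ok_def yp)
  have xb: "x \<in> fst c" "snd c x \<in> ball (snd c y) \<rho>" using p(2) by (simp_all add: nb_def yp)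
  have yc: "y \<in> fst c" using ok(1) by (simp add: deq)
  have eqy: "disk_primitive d \<theta> y = disk_primitive d' \<theta> y" using eq p(1) unfolding yp by force
  define h where "h w = disk_primitive d \<theta> (inv_into (fst c) (snd c) w) - disk_primitive d' \<theta> (inv_into (fst c) (snd c) w)" for w
  have hd: "(h has_derivative (\<lambda>v. 0)) (at w within ball (snd c y) \<rho>)" if w: "w \<in> ball (snd c y) \<rho>" for w
  proof -
   obtain u where u: "u \<in> fst c" "u \<in> ?U" "w = snd c u" using subsetD[OF ok(3) w] unfolding G_def by blast
   have "(h has_derivative (\<lambda>v. (\<theta> 1 0 c (snd c u) * v + \<theta> 0 1 c (snd c u) * cnj v)
     - (\<theta> 1 0 c (snd c u) * v + \<theta> 0 1 c (snd c u) * cnj v))) (at (snd c u))"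
    unfolding h_def[abs_def] using u
    by (intro has_derivative_diff disk_primitive_deriv d \<theta> c) simp_all
   hence "(h has_derivative (\<lambda>v. 0)) (at (snd c u))" unfolding diff_self .
   thus ?thesis unfolding u(3) by (rule has_derivative_at_withinI)
  qed
  from has_derivative_zero_constant[OF convex_ball hd]
  obtain k where k: "\<forall>w\<in>ball (snd c y) \<rho>. h w = k" ..
  have "h (snd c x) = h (snd c y)" using bspec[OF k xb(2)] bspec[OF k, of "snd c y"] ok(2) by simp
  moreover have "h (snd c y) = 0" using eqy chart_inv[OF c yc] by (simp add: h_def)
  ultimately show ?thesis using chart_inv[OF c xb(1)] by (simp add: h_def)
 qed
 moreover have "fst ` P \<subseteq> ?U" using P(1) unfolding ok_def by blast
 ultimately show ?thesis using P(2) by (intro exI[of _ "fst ` P"]) simp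
qed

lemma glue_primitives:
 assumes D: "\<And>d. d \<in> D ==> is_disk d" "(\<Union>d\<in>D. small_disk d) = UNIV" and \<theta>: "closed_form \<theta>"
  and agree: "\<And>d d' x. d \<in> D ==> d' \<in> D ==> x \<in> small_disk d \<inter> small_disk d' ==>
   disk_primitive d \<theta> x = disk_primitive d' \<theta> x"
 shows "\<exists>F. smooth_form \<A> F \<and> homogeneous 0 F \<and> dform F = \<theta>"
proof -
 have s: "smooth_form \<A> \<theta>" and h: "homogeneous 1 \<theta>" using \<theta> unfolding closed_form_def by simp_all
 have "\<exists>sel. \<forall>x. sel x \<in> D \<and> x \<in> small_disk (sel x)" using D(2) by (intro choice) blast
 then obtain sel where sel: "\<And>x. sel x \<in> D" "\<And>x. x \<in> small_disk (sel x)" by blast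
 define g where "g x = disk_primitive (sel x) \<theta> x" for x
 have g: "g x = disk_primitive d \<theta> x" if "d \<in> D" "x \<in> small_disk d" for d x
  unfolding g_def using agree[OF sel(1) that(1)] sel(2) that(2) by blast
 define F :: "'a form" where "F a b c z = (if a = 0 \<and> b = 0 \<and> c \<in> \<A> \<and> z \<in> chart_range c then g (inv_into (fst c) (snd c) z) else 0)" for a b c z
 have F00: "F 0 0 c z = g (inv_into (fst c) (snd c) z)" if "c \<in> \<A>" "z \<in> chart_range c" for c z
  using that by (simp add: F_def)
 have F0: "F a b c = (\<lambda>z. 0)" if "a \<noteq> 0 \<or> b \<noteq> 0 \<or> c \<notin> \<A>" for a b c using that by (auto simp: F_def)
 have der: "(F 0 0 c has_derivative (\<lambda>v. \<theta> 1 0 c z * v + \<theta> 0 1 c z * cnj v)) (at z)"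
  if c: "c \<in> \<A>" "z \<in> chart_range c" for c z
 proof -
  obtain x where x: "x \<in> fst c" "z = snd c x" using c(2) unfolding chart_range_def by blast
  let ?d = "sel x"
  have d: "is_disk ?d" by (rule D(1)[OF sel(1)])
  have "((\<lambda>w. disk_primitive ?d \<theta> (inv_into (fst c) (snd c) w)) has_derivative (\<lambda>v. \<theta> 1 0 c z * v + \<theta> 0 1 c z * cnj v)) (at z)"
   unfolding x(2) using subsetD[OF order_trans, OF conjunct1 conjunct2, OF disk_subset[OF d] disk_subset[OF d] sel(2)]
   by (rule disk_primitive_deriv[OF d \<theta> c(1) x(1)])
  thus ?thesis
  proof (rule has_derivative_transform_within_open)
   show "open (snd c ` (fst c \<inter> small_disk ?d))"
    by (rule open_chart_image[OF c(1) open_disks(1)[OF d]])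
   show "z \<in> snd c ` (fst c \<inter> small_disk ?d)" unfolding x(2) by (rule imageI) (simp add: x(1) sel(2))
   fix w assume "w \<in> snd c ` (fst c \<inter> small_disk ?d)"
   then obtain u where u: "u \<in> fst c" "u \<in> small_disk ?d" "w = snd c u" by blast
   thus "disk_primitive ?d \<theta> (inv_into (fst c) (snd c) w) = F 0 0 c w"
    using F00[OF c(1) chart_range_memI[OF u(1)]] chart_inv[OF c(1) u(1)] g[OF sel(1) u(2)] by simp
  qed
 qed
 have sF: "smooth_form \<A> F"
 proof (rule smooth_formI)
  fix a b :: nat and c assume c: "c \<in> \<A>"
  show "smooth_on (chart_range c) (F a b c)"
  proof (cases "a = 0 \<and> b = 0")
   case True
   have "smooth_on (chart_range c) (F 0 0 c)"
   proof (rule smooth_onI[OF open_chart_range[OF c] der[OF c]])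
    fix v show "smooth_on (chart_range c) (\<lambda>z. \<theta> 1 0 c z * v + \<theta> 0 1 c z * cnj v)"
     by (intro smooth_on_add smooth_on_mult smooth_on_const open_chart_range[OF c] smooth_formD(2)[OF s c])
   qed
   thus ?thesis using True by simp
  next
   case False
   hence F0': "F a b c = (\<lambda>z. 0)" by (intro F0) argo
   show ?thesis unfolding F0' by (rule smooth_on_const[OF open_chart_range[OF c]])
  qed
 next
  fix a b :: nat show "transforms a b (F a b)"
  proof (cases "a = 0 \<and> b = 0")
   case True
   have "F 0 0 c z = F 0 0 c' (transition c c' z)" if C: "c \<in> \<A>" "c' \<in> \<A>" "z \<in> overlap c c'" for c c' z
    using C unfolding overlap_def by (auto simp: transition_apply F00 chart_range_memI chart_inv)
   thus ?thesis using True by (simp add: transforms_def)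
  next
   case False
   hence "F a b = (\<lambda>c z. 0)" by (auto simp: F_def intro!: ext)
   thus ?thesis by (simp add: transforms_def)
  qed
 qed (auto simp: F_def split: if_splits)
 have hF: "homogeneous 0 F" by (rule homogeneousI) (auto simp: F_def)
 have "dform F = \<theta>"
 proof (rule form_eqI)
  fix a b c z
  show "dform F a b c z = \<theta> a b c z"
  proof (cases "c \<in> \<A> \<and> z \<in> chart_range c \<and> int a + int b = 1")
   case True
   hence c: "c \<in> \<A>" "z \<in> chart_range c" and ab: "a = 1 \<and> b = 0 \<or> a = 0 \<and> b = 1" by auto
   have "wirtinger (F 0 0 c) z = \<theta> 1 0 c z" "wirtinger_bar (F 0 0 c) z = \<theta> 0 1 c z"
    using wirtinger_eqI[OF der[OF c]] by auto
   thus ?thesis using ab c(2) by (auto simp: dform_def del_def delbar_def)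
  next
   case False
   have "homogeneous 1 (dform F)" using homogeneous_dform[OF hF] by simp
   thus ?thesis
    using False homogeneous_apply[OF h, of a b c z] smooth_form_outside[OF s, of c z a b]
     homogeneous_apply[of 1 "dform F" a b c z] smooth_form_outside[OF smooth_form_dform[OF sF], of c z a b] by argo
  qed
 qed
 thus ?thesis using sF hF by blast
qed

text \<open>Finite dimensionality of the first cohomology: the differences of local primitives at
 finitely many test points detect exactness.\<close>

theorem first_cohomology_finite:
 "\<exists>\<Lambda> :: ('a form => complex) set. finite \<Lambda> \<and>
  (\<forall>\<phi>\<in>\<Lambda>. (\<forall>\<theta> \<eta>. smooth_form \<A> \<theta> \<longrightarrow> smooth_form \<A> \<eta> \<longrightarrow> \<phi> (\<theta> + \<eta>) = \<phi> \<theta> + \<phi> \<eta>) \<and>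
    (\<forall>s \<theta>. smooth_form \<A> \<theta> \<longrightarrow> \<phi> (cmult s \<theta>) = s * \<phi> \<theta>)) \<and>
  (\<forall>\<theta>. closed_form \<theta> \<longrightarrow> (\<forall>\<phi>\<in>\<Lambda>. \<phi> \<theta> = 0) \<longrightarrow>
    (\<exists>F. smooth_form \<A> F \<and> homogeneous 0 F \<and> dform F = \<theta>))"
proof -
 obtain D where D: "finite D" "\<And>d. d \<in> D ==> is_disk d" "(\<Union>d\<in>D. small_disk d) = UNIV"
  using finite_disk_cover by blast
 define X where "X d d' = (SOME X. finite X \<and> X \<subseteq> big_disk d \<inter> big_disk d' \<and>
  (\<forall>\<theta>. closed_form \<theta> \<longrightarrow> (\<forall>x\<in>X. disk_primitive d \<theta> x = disk_primitive d' \<theta> x) \<longrightarrow>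
   (\<forall>x\<in>small_disk d \<inter> small_disk d'. disk_primitive d \<theta> x = disk_primitive d' \<theta> x)))" for d d'
 have X: "finite (X d d')" "X d d' \<subseteq> big_disk d \<inter> big_disk d'"
  "\<And>\<theta> x. closed_form \<theta> ==> \<forall>x\<in>X d d'. disk_primitive d \<theta> x = disk_primitive d' \<theta> x ==>
   x \<in> small_disk d \<inter> small_disk d' ==> disk_primitive d \<theta> x = disk_primitive d' \<theta> x"
  if "d \<in> D" "d' \<in> D" for d d'
  using someI_ex[OF disk_overlap_test[OF D(2)[OF that(1)] D(2)[OF that(2)]]] unfolding X_def[symmetric] by blast+
 \<comment> \<open>One functional per test point: the discrepancy of the two primitives
   there.\<close>
 define \<Lambda> where "\<Lambda> = (\<Union>d\<in>D. \<Union>d'\<in>D. (\<lambda>x \<theta>. disk_primitive d \<theta> x - disk_primitive d' \<theta> x) ` X d d')"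
 have "finite \<Lambda>" unfolding \<Lambda>_def using D(1) X(1) by (intro finite_UN_I finite_imageI)
 moreover have "\<phi> (\<theta> + \<eta>) = \<phi> \<theta> + \<phi> \<eta>" "\<phi> (cmult s \<theta>) = s * \<phi> \<theta>"
  if \<phi>: "\<phi> \<in> \<Lambda>" and s: "smooth_form \<A> \<theta>" "smooth_form \<A> \<eta>" for \<phi> \<theta> \<eta> s
 proof -
  obtain d d' where d12: "d \<in> D" "d' \<in> D" "\<phi> \<in> (\<lambda>x \<theta>. disk_primitive d \<theta> x - disk_primitive d' \<theta> x) ` X d d'"
   using \<phi> unfolding \<Lambda>_def by blast
  from d12(3) obtain x where d3: "\<phi> = (\<lambda>\<theta>. disk_primitive d \<theta> x - disk_primitive d' \<theta> x)" "x \<in> X d d'" by (rule imageE)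
  note d = d12(1,2) d3(2,1)
  have x: "x \<in> big_disk d" "x \<in> big_disk d'" using subsetD[OF X(2)[OF d(1,2)] d(3)] by simp_all
  note l = disk_primitive_linear[OF D(2)[OF d(1)] x(1) s] disk_primitive_linear[OF D(2)[OF d(2)] x(2) s]
  show "\<phi> (\<theta> + \<eta>) = \<phi> \<theta> + \<phi> \<eta>" "\<phi> (cmult s \<theta>) = s * \<phi> \<theta>"
   unfolding d(4) l by (simp_all add: algebra_simps)
 qed
 moreover have "\<exists>F. smooth_form \<A> F \<and> homogeneous 0 F \<and> dform F = \<theta>"
  if \<theta>: "closed_form \<theta>" "\<forall>\<phi>\<in>\<Lambda>. \<phi> \<theta> = 0" for \<theta>
 proof (rule glue_primitives[OF D(2,3) \<theta>(1)])
  fix d d' x assume d: "d \<in> D" "d' \<in> D" and x: "x \<in> small_disk d \<inter> small_disk d'"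
  have "disk_primitive d \<theta> y - disk_primitive d' \<theta> y = 0" if "y \<in> X d d'" for y
  proof -
   have "(\<lambda>\<theta>. disk_primitive d \<theta> y - disk_primitive d' \<theta> y) \<in> \<Lambda>" unfolding \<Lambda>_def using d that by blast
   from bspec[OF \<theta>(2) this] show ?thesis .
  qed
  hence "\<forall>y\<in>X d d'. disk_primitive d \<theta> y = disk_primitive d' \<theta> y" by simp
  thus "disk_primitive d \<theta> x = disk_primitive d' \<theta> x" by (rule X(3)[OF d \<theta>(1) _ x])
 qed
 ultimately show ?thesis
  by (intro exI[of _ \<Lambda>] conjI allI impI ballI) (assumption | blast intro: smooth_form_zero)+
qed

text \<open>The function is locally constant in charts, hence constant by connectedness, so a single
  value determines it.\<close>

lemma constant_functions:
 assumes f: "smooth_form \<A> f" "homogeneous 0 f" "dform f = 0" and c0: "c0 \<in> \<A>" "x0 \<in> fst c0" "f 0 0 c0 (snd c0 x0) = 0"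
 shows "f = 0"
proof -
 have "\<exists>sel. \<forall>x. sel x \<in> \<A> \<and> x \<in> fst (sel x)" using charts_cover by (intro choice) blast
 then obtain sel where sel: "\<And>x. sel x \<in> \<A>" "\<And>x. x \<in> fst (sel x)" by blast
 define g where "g x = f 0 0 (sel x) (snd (sel x) x)" for x
 have g: "f 0 0 c (snd c x) = g x" if c: "c \<in> \<A>" "x \<in> fst c" for c x
 proof -
  have "snd c x \<in> overlap c (sel x)" using that(2) sel(2)[of x] unfolding overlap_def by simp
  hence "f 0 0 c (snd c x) = f 0 0 (sel x) (transition c (sel x) (snd c x))"
   using smooth_formD(3)[OF f(1), of 0 0] c(1) sel(1)[of x] unfolding transforms_def by simp
  thus ?thesis unfolding g_def using transition_apply[OF c] by simp
 qed
 have loc: "\<exists>U. open U \<and> x \<in> U \<and> (\<forall>y\<in>U. g y = g x)" for x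
 proof -
  let ?c = "sel x"
  have c: "?c \<in> \<A>" "x \<in> fst ?c" using sel by blast+
  obtain r where r: "r > 0" "ball (snd ?c x) r \<subseteq> chart_range ?c"
   using open_chart_range[OF c(1)] chart_range_memI[OF c(2)] open_contains_ball by blast
  have hd: "(f 0 0 ?c has_derivative (\<lambda>v. 0)) (at w within ball (snd ?c x) r)" if "w \<in> ball (snd ?c x) r" for w
  proof -
   have w: "w \<in> chart_range ?c" using that r by blast
   have "dform f 1 0 ?c w = 0" "dform f 0 1 ?c w = 0" using f(3) by simp_all
   hence "wirtinger (f 0 0 ?c) w = 0" "wirtinger_bar (f 0 0 ?c) w = 0"
    using w by (simp_all add: dform_def del_def delbar_def)
   with wirtinger_has_derivative[OF smooth_form_differentiable[OF f(1) c(1) w, of 0 0]]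
   have "(f 0 0 ?c has_derivative (\<lambda>v. 0)) (at w)" by simp
   thus ?thesis by (rule has_derivative_at_withinI)
  qed
  from has_derivative_zero_constant[OF convex_ball hd]
  obtain k where k: "\<forall>w\<in>ball (snd ?c x) r. f 0 0 ?c w = k" ..
  show ?thesis
  proof (intro exI conjI ballI)
   show "open {y \<in> fst ?c. snd ?c y \<in> ball (snd ?c x) r}" by (rule open_chart_preimage[OF c(1) open_ball])
   show "x \<in> {y \<in> fst ?c. snd ?c y \<in> ball (snd ?c x) r}" using c r by simp
   fix y assume "y \<in> {y \<in> fst ?c. snd ?c y \<in> ball (snd ?c x) r}"
   hence "y \<in> fst ?c" "snd ?c y \<in> ball (snd ?c x) r" by simp_all
   thus "g y = g x"
    using g[OF c(1), of y] g[OF c(1,2)] bspec[OF k, of "snd ?c y"] bspec[OF k, of "snd ?c x"] r(1) by simp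
  qed
 qed
 hence "\<forall>x\<in>UNIV. eventually (\<lambda>y. g x = g y) (at x within UNIV)" unfolding eventually_at_topological by metis
 from connected_local_const[OF connected_surface UNIV_I UNIV_I this]
 have g0: "g x = 0" for x using g[OF c0(1,2)] c0(3) by metis
 show "f = 0"
 proof (rule form_eqI)
  fix a b c z
  show "f a b c z = 0 a b c z"
  proof (cases "a = 0 \<and> b = 0 \<and> c \<in> \<A> \<and> z \<in> chart_range c")
   case True
   then obtain x where "x \<in> fst c" "z = snd c x" unfolding chart_range_def by blast
   thus ?thesis using g g0 True by simp
  next
   case False
   hence "int a + int b \<noteq> 0 \<or> (c \<notin> \<A> \<or> z \<notin> chart_range c)" by auto
   thus ?thesis using homogeneous_apply[OF f(2), of a b c z] smooth_form_outside[OF f(1), of c z a b] by (simp; argo)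
  qed
 qed
qed

end

context sl2_rep
begin

text \<open>The adjoint computed from the polarization has \<open>weyl_inv\<close> and
  \<open>weyl\<close> in the opposite order from \<open>F\<close>. Both orders agree because
  \<open>weyl\<close> and \<open>weyl_inv\<close> differ by \<open>diag2 (- 1)\<close> and
  \<open>E\<close> preserves the parity of weights.\<close>

lemma weyl_conjugate: assumes v: "v \<in> W m" shows "\<pi> weyl_inv (E (\<pi> weyl v)) = - F v"
proof -
 have vV: "v \<in> V" by (rule W_V[OF v])
 let ?u = "\<pi> weyl_inv v" and ?s = "(- 1 :: real) powi m"
 have u: "?u \<in> W (- m)" by (rule weyl_in(2)[OF v])
 have fac: "weyl = weyl_inv ** diag2 (- 1)" "weyl = diag2 (- 1) ** weyl_inv"
  unfolding sl2_defs vector2_mult by simp_all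
 have d: "diag2 (- 1) \<in> SL2" by (rule SL2_diag2) simp
 have "\<pi> weyl v = \<pi> (weyl_inv ** diag2 (- 1)) v" using fac(1) by (rule arg_cong)
 also have "\<dots> = \<pi> weyl_inv (?s *\<^sub>R v)" using pi_diag[OF _ v, of "- 1"] by (simp add: pi_mult[OF SL2_weyl_inv d vV])
 also have "\<dots> = ?s *\<^sub>R ?u" by (rule lin_scale[OF pi_lin[OF SL2_weyl_inv] vV])
 finally have 1: "\<pi> weyl v = ?s *\<^sub>R ?u" .
 have uV: "?u \<in> V" by (rule W_V[OF u])
 have Eu: "E ?u \<in> W (- m + 2)" "E ?u \<in> V" by (rule E_in[OF u], rule E_V[OF uV])
 have "\<pi> weyl (E ?u) = \<pi> (diag2 (- 1) ** weyl_inv) (E ?u)" using fac(2) by (rule arg_cong)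
 also have "\<dots> = \<pi> (diag2 (- 1)) (\<pi> weyl_inv (E ?u))" by (rule pi_mult[OF d SL2_weyl_inv Eu(2)])
 also have "\<dots> = ((- 1) powi (- (- m + 2))) *\<^sub>R \<pi> weyl_inv (E ?u)"
  by (rule pi_diag[OF _ weyl_in(2)[OF Eu(1)]]) simp
 also have "((- 1) powi (- (- m + 2))) = ?s" by (simp add: power_int_minus_left)
 finally have 2: "\<pi> weyl (E ?u) = ?s *\<^sub>R \<pi> weyl_inv (E ?u)" .
 have s: "?s * ?s = 1" by (simp add: power_int_minus_left)
 have "\<pi> weyl_inv (E (\<pi> weyl v)) = ?s *\<^sub>R \<pi> weyl_inv (E ?u)"
  unfolding 1 lin_scale[OF E_lin uV] by (rule lin_scale[OF pi_lin[OF SL2_weyl_inv] Eu(2)])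
 thus ?thesis unfolding F_def 2 by simp
qed

end

section \<open>The Lefschetz module\<close>

locale lefschetz_surface = kaehler_surface \<A> \<omega>
 for \<A> :: "'a::t2_space chart set" and \<omega> +
 fixes \<kappa> :: "'a cochain => 'h::{real_inner, complete_space}"
  and \<sigma> :: "real^2^2 => real^2^2 => 'h => 'h"
 assumes lefschetz: "lefschetz_hypercohomology \<A> \<omega> \<kappa> \<sigma>"
begin

definition V :: "'h set" where "V = \<kappa> ` cocycles \<A>"

definition W :: "int => int => 'h set" where "W i j = \<kappa> ` (cocycles \<A> \<inter> K_bi \<A> i j)"

lemmas lefschetz_parts = lefschetz[unfolded lefschetz_hypercohomology_def, folded V_def]

lemmas lefschetz_parts2 = lefschetz_parts[THEN conjunct2, THEN conjunct2]
lemmas lefschetz_parts4 = lefschetz_parts2[THEN conjunct2, THEN conjunct2]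
lemmas lefschetz_parts6 = lefschetz_parts4[THEN conjunct2, THEN conjunct2]

lemmas kappa_lin = lefschetz_parts[THEN conjunct1]
 and kappa_0 = lefschetz_parts[THEN conjunct2, THEN conjunct1, rule_format]
 and V_dense = lefschetz_parts2[THEN conjunct1]
 and sigma_lin = lefschetz_parts2[THEN conjunct2, THEN conjunct1, rule_format, THEN conjunct1]
 and sigma_sub = lefschetz_parts2[THEN conjunct2, THEN conjunct1, rule_format, THEN conjunct2]
 and sigma_one = lefschetz_parts4[THEN conjunct1, rule_format]
 and sigma_mult = lefschetz_parts4[THEN conjunct2, THEN conjunct1, rule_format]
 and sigma_diag_kappa = lefschetz_parts6[THEN conjunct1, rule_format]
 and sigma_deriv = lefschetz_parts6[THEN conjunct2, THEN conjunct1, rule_format]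
 and inner_polarization = lefschetz_parts6[THEN conjunct2, THEN conjunct2, rule_format]

lemma sigma_in: "g \<in> SL2 ==> h \<in> SL2 ==> v \<in> V ==> \<sigma> g h v \<in> V"
 by (rule subsetD[OF sigma_sub imageI])

lemma sigma_diag:
 assumes "v \<in> W i j" "a \<noteq> 0" "b \<noteq> 0" shows "\<sigma> (diag2 a) (diag2 b) v = (a powi i * b powi j) *\<^sub>R v"
proof -
 from assms(1) obtain x where x: "v = \<kappa> x" "x \<in> cocycles \<A> \<inter> K_bi \<A> i j" unfolding W_def by (rule imageE)
 show ?thesis unfolding x(1) by (rule sigma_diag_kappa[OF x(2) assms(2,3)])
qed

lemma cocycles_subspace: "subspace (cocycles \<A>)" by (rule lin_subspace[OF kappa_lin])

lemma cocyclesD: assumes "x \<in> cocycles \<A>" shows "x \<in> K \<A>" "dK x = 0"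
 using assms unfolding cocycles_def by simp_all

lemma dK_cocycle: assumes "x \<in> K \<A>" shows "dK x \<in> cocycles \<A>" "\<kappa> (dK x) = 0"
proof -
 show c: "dK x \<in> cocycles \<A>" unfolding cocycles_def using dK_in_K[OF assms] dK_dK[OF assms] by simp
 show "\<kappa> (dK x) = 0" unfolding kappa_0[OF c] coboundaries_def by (rule imageI[OF assms])
qed

lemma V_sub: "subspace V" unfolding V_def by (rule lin_image[OF kappa_lin])

lemma VE: assumes "v \<in> V" obtains x where "x \<in> cocycles \<A>" "v = \<kappa> x"
 using assms unfolding V_def by blast

lemma kappa_in: "x \<in> cocycles \<A> ==> \<kappa> x \<in> V" unfolding V_def by (rule imageI)

lemma cocycles_K_bi_subspace: "subspace (cocycles \<A> \<inter> K_bi \<A> i j)"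
proof -
 have "cocycles \<A> \<inter> K_bi \<A> i j = {x \<in> cocycles \<A>. K_comp i j x = x}" unfolding K_bi_def cocycles_def by blast
 then show ?thesis
  using cocycles_subspace cocyclesD(1) lin_zero[OF K_comp_linear]
  by (simp add: subspace_def lin_add[OF K_comp_linear] lin_scale[OF K_comp_linear])
qed

lemma W_sub: "subspace (W i j)"
 unfolding W_def
 by (rule lin_image[OF lin_mono[OF kappa_lin _ cocycles_K_bi_subspace]]) blast

lemma W_V: "v \<in> W i j ==> v \<in> V" unfolding W_def V_def by blast

text \<open>Weaker than commuting with the differential: a projection \<open>K_comp\<close> commutes
  with it only up to a shift of bidegree, yet it respects cocycles and coboundaries.\<close>

definition descends :: "('a cochain => 'a cochain) => bool" where
 "descends f \<longleftrightarrow> linear_on_subspace (K \<A>) f \<and> (\<forall>x\<in>K \<A>. f x \<in> K \<A> \<and> (dK x = 0 \<longrightarrow> dK (f x) = 0) \<and>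
   (\<exists>y\<in>K \<A>. f (dK x) = dK y))"

definition induced :: "('a cochain => 'a cochain) => 'h => 'h" where
 "induced f v = \<kappa> (f (SOME x. x \<in> cocycles \<A> \<and> \<kappa> x = v))"

lemma descends_cocycles: assumes "descends f" "x \<in> cocycles \<A>" shows "f x \<in> cocycles \<A>"
 using assms unfolding descends_def cocycles_def by blast

lemma induced_kappa: assumes f: "descends f" and x: "x \<in> cocycles \<A>" shows "induced f (\<kappa> x) = \<kappa> (f x)"
proof -
 define y where "y = (SOME y. y \<in> cocycles \<A> \<and> \<kappa> y = \<kappa> x)"
 have "y \<in> cocycles \<A> \<and> \<kappa> y = \<kappa> x" unfolding y_def by (rule someI[of _ x]) (simp add: x)
 hence y: "y \<in> cocycles \<A>" "\<kappa> y = \<kappa> x" by simp_all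
 have yx: "y - x \<in> cocycles \<A>" by (rule subspace_diff[OF cocycles_subspace y(1) x])
 have "\<kappa> (y - x) = 0" using lin_diff[OF kappa_lin y(1) x] y(2) by simp
 then obtain w where w: "w \<in> K \<A>" "y - x = dK w" unfolding kappa_0[OF yx] coboundaries_def by blast
 have lin: "linear_on_subspace (K \<A>) f" using f unfolding descends_def by simp
 obtain w' where w': "w' \<in> K \<A>" "f (dK w) = dK w'" using f w(1) unfolding descends_def by blast
 have "f y - f x = dK w'"
  using lin_diff[OF lin cocyclesD(1)[OF y(1)] cocyclesD(1)[OF x]] unfolding w(2) w'(2) by simp
 hence "\<kappa> (f y) - \<kappa> (f x) = 0"
  using lin_diff[OF kappa_lin descends_cocycles[OF f y(1)] descends_cocycles[OF f x]]
   dK_cocycle(2)[OF w'(1)] by simp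
 thus ?thesis unfolding induced_def y_def by simp
qed

lemma induced_in: assumes "descends f" "v \<in> V" shows "induced f v \<in> V"
proof -
 obtain x where x: "x \<in> cocycles \<A>" "v = \<kappa> x" by (rule VE[OF assms(2)])
 show ?thesis unfolding x(2) induced_kappa[OF assms(1) x(1)] by (rule kappa_in[OF descends_cocycles[OF assms(1) x(1)]])
qed

lemma induced_lin: assumes f: "descends f" shows "linear_on_subspace V (induced f)"
proof -
 have "linear_on_subspace (cocycles \<A>) f"
  using f cocyclesD(1) by (auto simp: descends_def intro: lin_mono[OF _ _ cocycles_subspace])
 from lin_factor[OF kappa_lin lin_compose[OF this kappa_lin] induced_kappa[OF f]] descends_cocycles[OF f]
 show ?thesis unfolding V_def by blast
qed

definition cp :: "int => int => 'h => 'h" where "cp i j = induced (K_comp i j)"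

definition Nh :: "'h => 'h" where "Nh = induced NK"

definition Lh :: "'h => 'h" where "Lh = induced (ellK \<omega>)"

lemma descends_K_comp: "descends (K_comp i j)"
 unfolding descends_def
proof (intro conjI ballI impI K_comp_linear)
 fix x assume x: "x \<in> K \<A>"
 show "K_comp i j x \<in> K \<A>" by (rule K_comp_in_K[OF x])
 show "dK (K_comp i j x) = 0" if "dK x = 0"
  unfolding dK_K_comp[OF x] that by (rule lin_zero[OF K_comp_linear])
 show "\<exists>y\<in>K \<A>. K_comp i j (dK x) = dK y"
  using dK_K_comp[OF x, of "i - 1" "j - 1"] by (intro bexI[OF _ K_comp_in_K[OF x, of "i - 1" "j - 1"]]) simp
qed

lemma descends_NK: "descends NK"
 unfolding descends_def
proof (intro conjI ballI impI NK_linear)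
 fix x assume x: "x \<in> K \<A>"
 show "NK x \<in> K \<A>" by (rule NK_in_K[OF x])
 show "dK (NK x) = 0" if "dK x = 0"
  unfolding NK_dK[OF x, symmetric] that by (rule lin_zero[OF NK_linear])
 show "\<exists>y\<in>K \<A>. NK (dK x) = dK y" using NK_dK[OF x] NK_in_K[OF x] by blast
qed

lemma descends_ellK: "descends (ellK \<omega>)"
 unfolding descends_def
proof (intro conjI ballI impI ellK_linear)
 fix x assume x: "x \<in> K \<A>"
 show "ellK \<omega> x \<in> K \<A>" by (rule ellK_in_K[OF x])
 show "dK (ellK \<omega> x) = 0" by (rule dK_ellK[OF x])
 show "\<exists>y\<in>K \<A>. ellK \<omega> (dK x) = dK y"
  unfolding ellK_dK[OF x] using lin_zero[OF dK_linear] by (intro bexI[OF _ subspace_0[OF subspace_K]]) simp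
qed

lemmas cp_kappa = induced_kappa[OF descends_K_comp, folded cp_def]
 and cp_lin = induced_lin[OF descends_K_comp, folded cp_def]
 and Nh_kappa = induced_kappa[OF descends_NK, folded Nh_def]
 and Nh_lin = induced_lin[OF descends_NK, folded Nh_def]
 and Nh_V = induced_in[OF descends_NK, folded Nh_def]
 and Lh_kappa = induced_kappa[OF descends_ellK, folded Lh_def]
 and Lh_lin = induced_lin[OF descends_ellK, folded Lh_def]
 and Lh_V = induced_in[OF descends_ellK, folded Lh_def]

lemma comp_cocycle: "x \<in> cocycles \<A> ==> K_comp i j x \<in> cocycles \<A> \<inter> K_bi \<A> i j"
 using descends_cocycles[OF descends_K_comp, of x i j] K_comp_in_K_bi[OF cocyclesD(1), of x i j] by simp

lemma WE: assumes "v \<in> W i j" obtains x where "x \<in> cocycles \<A>" "x \<in> K \<A>" "K_comp i j x = x" "v = \<kappa> x"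
 using assms unfolding W_def K_bi_def by blast

lemma induced_W:
 assumes f: "descends f" and c: "\<And>x. x \<in> K \<A> ==> f (K_comp i j x) = K_comp i' j' (f x)" and v: "v \<in> W i j"
 shows "induced f v \<in> W i' j'"
proof -
 obtain x where x: "x \<in> cocycles \<A>" "x \<in> K \<A>" "K_comp i j x = x" "v = \<kappa> x" by (rule WE[OF v])
 show ?thesis unfolding x(4) induced_kappa[OF f x(1)] W_def
  using comp_cocycle[OF descends_cocycles[OF f x(1)], of i' j'] c[OF x(2)] x(3) by (intro imageI) simp
qed

lemma cp_in: assumes "v \<in> V" shows "cp i j v \<in> W i j"
proof -
 obtain x where x: "x \<in> cocycles \<A>" "v = \<kappa> x" by (rule VE[OF assms])
 show ?thesis unfolding x(2) cp_kappa[OF x(1)] W_def by (rule imageI[OF comp_cocycle[OF x(1)]])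
qed

lemmas cp_V = W_V[OF cp_in]

lemma cp_W: assumes "v \<in> W i j" shows "cp i' j' v = (if i' = i \<and> j' = j then v else 0)"
proof -
 obtain x where x: "x \<in> cocycles \<A>" "x \<in> K \<A>" "K_comp i j x = x" "v = \<kappa> x" by (rule WE[OF assms])
 have "K_comp i' j' (K_comp i j x) = (if i' = i \<and> j' = j then K_comp i j x else 0)"
  by (auto simp: fun_eq_iff K_comp_apply)
 thus ?thesis unfolding x(3,4) cp_kappa[OF x(1)] using lin_zero[OF kappa_lin] by simp
qed

lemma W_iff: "v \<in> W i j \<longleftrightarrow> v \<in> V \<and> cp i j v = v"
 using cp_W[of v i j i j] W_V[of v i j] cp_in[of v i j] by auto

lemma W_zero: assumes "v \<in> W i j" "j \<notin> {- 1, 0, 1} \<or> odd (1 + j - i)" shows "v = 0"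
proof -
 obtain x where x: "x \<in> K_bi \<A> i j" "v = \<kappa> x" using assms(1) unfolding W_def by blast
 show ?thesis unfolding x(2) K_bi_zero[OF x(1) assms(2)] by (rule lin_zero[OF kappa_lin])
qed

definition comps :: "'h => (int \<times> int) set" where "comps v = {(i, j). cp i j v \<noteq> 0}"

lemma comps: assumes v: "v \<in> V" shows "finite (comps v)" "(\<Sum>s\<in>comps v. cp (fst s) (snd s) v) = v"
proof -
 obtain x where x: "x \<in> cocycles \<A>" "v = \<kappa> x" by (rule VE[OF v])
 note xK = cocyclesD(1)[OF x(1)]
 let ?S = "(\<lambda>(i, j, k). (i, j)) ` K_support x"
 have fin: "finite ?S" by (rule finite_imageI[OF KD(2)[OF xK]])
 have 0: "K_comp i j x = 0" if "(i, j) \<notin> ?S" for i j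
  using that by (force simp: fun_eq_iff K_comp_apply K_support_def)
 have sub: "comps v \<subseteq> ?S"
 proof (rule subrelI, rule ccontr)
  fix i j assume "(i, j) \<in> comps v" "(i, j) \<notin> ?S"
  thus False using 0[of i j] lin_zero[OF kappa_lin] unfolding comps_def x(2) cp_kappa[OF x(1)] by simp
 qed
 thus "finite (comps v)" using fin by (rule finite_subset)
 have "v = \<kappa> (\<Sum>(i, j)\<in>?S. K_comp i j x)" unfolding x(2) by (rule arg_cong[OF K_sum_comp[OF xK fin order_refl]])
 also have "\<dots> = (\<Sum>s\<in>?S. \<kappa> (K_comp (fst s) (snd s) x))"
  unfolding split_beta by (rule lin_sum[OF kappa_lin descends_cocycles[OF descends_K_comp x(1)]])
 also have "\<dots> = (\<Sum>s\<in>comps v. cp (fst s) (snd s) v)"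
  by (rule sum.mono_neutral_cong_right[OF fin sub]) (auto simp: comps_def x(2) cp_kappa[OF x(1)])
 finally show "(\<Sum>s\<in>comps v. cp (fst s) (snd s) v) = v" ..
qed

lemma lin_comps:
 assumes "linear_on_subspace V T" "v \<in> V" shows "T v = (\<Sum>s\<in>comps v. T (cp (fst s) (snd s) v))"
 by (subst comps(2)[OF assms(2), symmetric]) (rule lin_sum[OF assms(1) cp_V[OF assms(2)]])

lemma lin_in:
 "linear_on_subspace V T ==> subspace S ==> v \<in> V ==> (\<And>i j. T (cp i j v) \<in> S) ==> T v \<in> S"
 by (subst lin_comps) (auto intro: subspace_sum)

lemma lin_eqI:
 "linear_on_subspace V S ==> linear_on_subspace V T ==> v \<in> V ==> (\<And>i j. S (cp i j v) = T (cp i j v)) ==> S v = T v"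
 using lin_comps[of S v] lin_comps[of T v] by simp

lemma cp_eqI: assumes "u \<in> V" "v \<in> V" "\<And>i j. cp i j u = cp i j v" shows "u = v"
 using comps(2)[OF assms(1)] comps(2)[OF assms(2)] unfolding comps_def assms(3) by simp

lemma cp_eq_0I: "v \<in> V ==> (\<And>i j. cp i j v = 0) ==> v = 0"
 using cp_eqI[OF _ subspace_0[OF V_sub]] lin_zero[OF cp_lin] by simp

text \<open>Injectivity of \<open>\<phi>\<close> keeps distinct bidegrees apart after the operator
  has moved them.\<close>

lemma linear_cp:
 assumes T: "linear_on_subspace V T" and \<phi>: "inj \<phi>"
  and W: "\<And>i j v. v \<in> W i j ==> T v \<in> W (\<phi> i) (j + n)" and v: "v \<in> V"
 shows "cp (\<phi> i) (j + n) (T v) = T (cp i j v)"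
proof (rule lin_eqI[OF lin_compose[OF T cp_lin lin_in[OF T V_sub]] lin_compose[OF cp_lin T cp_V] v])
 note TW = W[OF cp_in]
 show TV: "T (cp i j u) \<in> V" if "u \<in> V" for u i j by (rule W_V[OF TW[OF that]])
 show "cp (\<phi> i) (j + n) (T (cp i' j' v)) = T (cp i j (cp i' j' v))" for i' j'
  using \<phi> lin_zero[OF T] by (auto simp: cp_W[OF TW[OF v]] cp_W[OF cp_in[OF v]] inj_eq)
qed

lemma Nh_in: "v \<in> W i j ==> Nh v \<in> W (i + 2) j" and Lh_in: "v \<in> W i j ==> Lh v \<in> W i (j + 2)"
 unfolding Nh_def Lh_def
 by (rule induced_W[OF descends_NK] induced_W[OF descends_ellK], erule NK_K_comp ellK_K_comp, assumption)+

lemma Nh_Lh: assumes "v \<in> V" shows "Nh (Lh v) = Lh (Nh v)"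
proof -
 obtain x where x: "x \<in> cocycles \<A>" "v = \<kappa> x" by (rule VE[OF assms])
 show ?thesis unfolding x(2) Lh_kappa[OF x(1)] Nh_kappa[OF x(1)] Nh_kappa[OF descends_cocycles[OF descends_ellK x(1)]]
  Lh_kappa[OF descends_cocycles[OF descends_NK x(1)]] NK_ellK[OF cocyclesD(1)[OF x(1)]] ..
qed

lemma Nh_pow: "x \<in> cocycles \<A> ==> (NK ^^ n) x \<in> cocycles \<A> \<and> (Nh ^^ n) (\<kappa> x) = \<kappa> ((NK ^^ n) x)"
proof (induction n)
 case (Suc n)
 hence n: "(NK ^^ n) x \<in> cocycles \<A>" "(Nh ^^ n) (\<kappa> x) = \<kappa> ((NK ^^ n) x)" by blast+
 show ?case unfolding funpow.simps o_apply n(2) Nh_kappa[OF n(1)] using descends_cocycles[OF descends_NK n(1)] by simp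
qed simp

lemma Nh_nil: assumes "v \<in> V" shows "\<exists>n. (Nh ^^ n) v = 0"
proof -
 obtain x where x: "x \<in> cocycles \<A>" "v = \<kappa> x" by (rule VE[OF assms])
 obtain n where "(NK ^^ n) x = 0" using NK_nilpotent[OF cocyclesD(1)[OF x(1)]] by blast
 hence "(Nh ^^ n) v = 0" using Nh_pow[OF x(1), of n] lin_zero[OF kappa_lin] x(2) by simp
 thus ?thesis by blast
qed

lemma cp_preserving:
 assumes "linear_on_subspace V T" "\<And>i j v. v \<in> W i j ==> T v \<in> W i (j + n)" "v \<in> V"
 shows "cp i (j + n) (T v) = T (cp i j v)"
 using linear_cp[where \<phi> = id and n = n, OF assms(1) inj_on_id _ assms(3), unfolded id_apply, OF assms(2)] by simp

lemma cp_Lh: "v \<in> V ==> cp i (j + 2) (Lh v) = Lh (cp i j v)"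
 by (rule cp_preserving[OF Lh_lin Lh_in])

lemma cp_Nh: assumes "v \<in> V" shows "cp (i + 2) j (Nh v) = Nh (cp i j v)"
 using linear_cp[where \<phi> = "\<lambda>i. i + 2" and n = 0, OF Nh_lin _ _ assms, of i j] Nh_in by (simp add: inj_def)

lemma Lh_Lh: assumes v: "v \<in> V" shows "Lh (Lh v) = 0"
proof (rule cp_eq_0I[OF Lh_V[OF Lh_V[OF v]]])
 fix i j
 have "cp i j (Lh (Lh v)) = Lh (cp i (j - 2) (Lh v))" using cp_Lh[OF Lh_V[OF v], of i "j - 2"] by simp
 also have "cp i (j - 2) (Lh v) = Lh (cp i (j - 4) v)" using cp_Lh[OF v, of i "j - 4"] by simp
 finally have eq: "cp i j (Lh (Lh v)) = Lh (Lh (cp i (j - 4) v))" .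
 show "cp i j (Lh (Lh v)) = 0"
 proof (cases "j \<in> {- 1, 0, 1}")
  case True
  hence "cp i (j - 4) v = 0" by (intro W_zero[OF cp_in[OF v]]) auto
  thus ?thesis unfolding eq using lin_zero[OF Lh_lin] by simp
 next
  case False
  thus ?thesis by (intro W_zero[OF cp_in[OF Lh_V[OF Lh_V[OF v]]]]) blast
 qed
qed

section \<open>Weights of \<open>\<sigma>\<close> and orthogonality of the bigrading\<close>

lemma diag2_1: "diag2 1 = mat 1" unfolding sl2_defs by simp

lemma sigma_diag1: "v \<in> W i j ==> a \<noteq> 0 ==> \<sigma> (diag2 a) (mat 1) v = (a powi i) *\<^sub>R v"
 and sigma_diag2: "v \<in> W i j ==> a \<noteq> 0 ==> \<sigma> (mat 1) (diag2 a) v = (a powi j) *\<^sub>R v"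
 using sigma_diag[of v i j a 1] sigma_diag[of v i j 1 a] unfolding diag2_1 by simp_all

text \<open>Comparing components on both sides of \<open>T v = d v\<close> leaves
  \<open>c i j = d\<close> or a zero component. With powers of 2 as scalars this locates a vector in
  the bigrading.\<close>

lemma scalar_component:
 assumes T: "linear_on_subspace V T" "\<And>i j w. w \<in> W i j ==> T w = c i j *\<^sub>R w" and v: "v \<in> V" "T v = d *\<^sub>R v" "c i j \<noteq> d"
 shows "cp i j v = 0"
proof -
 have "cp i j (T v) = T (cp i j v)"
  using cp_preserving[where n = 0, OF T(1) _ v(1)] by (simp add: T(2) subspace_scale[OF W_sub])
 thus ?thesis using v(3) unfolding v(2) lin_scale[OF cp_lin v(1)] T(2)[OF cp_in[OF v(1)]] by simp
qed

lemma weightI: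
 assumes v: "v \<in> V" and 1: "\<sigma> (diag2 2) (mat 1) v = (2 powi m) *\<^sub>R v" and 2: "\<sigma> (mat 1) (diag2 2) v = (2 powi n) *\<^sub>R v"
 shows "v \<in> W m n"
proof -
 have ne: "(2::real) powi p \<noteq> 2 powi q" if "p \<noteq> q" for p q
  using that power_int_strict_increasing[of p q "2::real"] power_int_strict_increasing[of q p "2::real"]
  by (cases p q rule: linorder_cases) simp_all
 have "cp i j v = 0" if "i \<noteq> m" for i j
  using scalar_component[OF sigma_lin _ v 1, where c = "\<lambda>i j. 2 powi i" and i = i] ne[OF that] by (simp add: sigma_diag1)
 moreover have "cp i j v = 0" if "j \<noteq> n" for i j
  using scalar_component[OF sigma_lin _ v 2, where c = "\<lambda>i j. 2 powi j" and j = j] ne[OF that] by (simp add: sigma_diag2)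
 ultimately have "v = cp m n v"
  by (intro cp_eqI[OF v cp_V[OF v]]) (auto simp: cp_W[OF cp_in[OF v]])
 thus ?thesis using cp_in[OF v] by metis
qed

lemma diag2_weyl: "diag2 2 ** weyl = weyl ** diag2 (1 / 2)" "diag2 2 ** weyl_inv = weyl_inv ** diag2 (1 / 2)"
 unfolding sl2_defs vector2_mult vector2_eq_iff by simp_all

lemma half_powi: "(1 / 2 :: real) powi m = 2 powi (- m)"
 by (simp add: power_int_minus power_int_divide_distrib field_simps)

lemma sigma_weyl_in:
 assumes v: "v \<in> W i j" and g: "g \<in> {weyl, weyl_inv}"
 shows "\<sigma> g (mat 1) v \<in> W (- i) j" "\<sigma> (mat 1) g v \<in> W i (- j)"
proof -
 have gS: "g \<in> SL2" "mat 1 \<in> SL2" and dg: "diag2 2 ** g = g ** diag2 (1 / 2)" using g diag2_weyl by auto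
 have d: "diag2 2 \<in> SL2" "diag2 (1 / 2) \<in> SL2" by simp_all
 have vV: "v \<in> V" by (rule W_V[OF v])
 have sc: "\<sigma> g h (r *\<^sub>R v) = r *\<^sub>R \<sigma> g h v" if "g \<in> SL2" "h \<in> SL2" for g h r
  by (rule lin_scale[OF sigma_lin[OF that] vV])
 note simps = sigma_mult[OF _ _ _ _ vV, symmetric] gS d dg
 have "\<sigma> (diag2 2) (mat 1) (\<sigma> g (mat 1) v) = \<sigma> g (mat 1) (\<sigma> (diag2 (1/2)) (mat 1) v)"
  "\<sigma> (mat 1) (diag2 2) (\<sigma> g (mat 1) v) = \<sigma> g (mat 1) (\<sigma> (mat 1) (diag2 2) v)"
  "\<sigma> (mat 1) (diag2 2) (\<sigma> (mat 1) g v) = \<sigma> (mat 1) g (\<sigma> (mat 1) (diag2 (1/2)) v)"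
  "\<sigma> (diag2 2) (mat 1) (\<sigma> (mat 1) g v) = \<sigma> (mat 1) g (\<sigma> (diag2 2) (mat 1) v)"
  by (simp_all add: simps)
 note eq = this[unfolded sigma_diag1[OF v zero_neq_numeral[symmetric]] sigma_diag2[OF v zero_neq_numeral[symmetric]]]
 have h: "(1 / 2 :: real) \<noteq> 0" by simp
 show "\<sigma> g (mat 1) v \<in> W (- i) j" "\<sigma> (mat 1) g v \<in> W i (- j)"
  by (rule weightI; simp add: sigma_in gS vV eq sigma_diag1[OF v h] sigma_diag2[OF v h] sc half_powi del: power_int_divide_distrib)+
qed

lemma sigma_factor: "v \<in> V ==> g \<in> SL2 ==> h \<in> SL2 ==> \<sigma> g h v = \<sigma> g (mat 1) (\<sigma> (mat 1) h v)"
 and sigma_factor': "v \<in> V ==> g \<in> SL2 ==> h \<in> SL2 ==> \<sigma> g h v = \<sigma> (mat 1) h (\<sigma> g (mat 1) v)"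
 using sigma_mult[OF _ SL2_mat_1 SL2_mat_1, of g h v] sigma_mult[OF SL2_mat_1 _ _ SL2_mat_1, of h g v] by simp_all

text \<open>\<open>\<sigma> weyl weyl\<close> negates both degrees, and the polarization pairs only
  opposite bidegrees, so the inner product pairs only equal ones.\<close>

lemma W_orth: assumes u: "u \<in> W i j" and v: "v \<in> W i' j'" and ne: "i \<noteq> i' \<or> j \<noteq> j'" shows "u \<bullet> v = 0"
proof -
 obtain x where x: "x \<in> cocycles \<A>" "x \<in> K_bi \<A> i j" "u = \<kappa> x" using u unfolding W_def by blast
 obtain y where y: "y \<in> cocycles \<A>" "v = \<kappa> y" by (rule VE[OF W_V[OF v]])
 have "\<sigma> weyl weyl v \<in> W (- i') (- j')"
  unfolding sigma_factor[OF W_V[OF v] SL2_weyl SL2_weyl]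
  by (rule sigma_weyl_in(1)[OF sigma_weyl_in(2)[OF v]]) simp_all
 then obtain y' where y': "y' \<in> cocycles \<A>" "y' \<in> K_bi \<A> (- i') (- j')" "\<sigma> weyl weyl v = \<kappa> y'"
  unfolding W_def by blast
 have "complex_of_real (u \<bullet> v) = polarization \<A> x y'"
  unfolding x(3) y(2) by (rule inner_polarization[OF x(1) y(1) y'(1)]) (simp add: y'(3)[symmetric] y(2))
 also have "\<dots> = 0" by (rule polarization_orthogonal[OF x(2) y'(2)]) (use ne in auto)
 finally show ?thesis by simp
qed

lemma orthI:
 assumes u: "u \<in> V" and v: "v \<in> V" and ij: "\<And>i j. cp i j u = 0 \<or> cp i j v = 0" shows "u \<bullet> v = 0"
proof -
 have z: "cp i j u \<bullet> cp i' j' v = 0" for i j i' j'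
  using ij[of i j] W_orth[OF cp_in[OF u] cp_in[OF v], of i i' j j'] by (cases "i = i' \<and> j = j'") auto
 have "(\<Sum>s\<in>comps u. cp (fst s) (snd s) u) \<bullet> (\<Sum>s\<in>comps v. cp (fst s) (snd s) v) = 0"
  unfolding inner_sum_left unfolding inner_sum_right z by simp
 thus ?thesis unfolding comps(2)[OF u] comps(2)[OF v] .
qed

text \<open>With \<open>fst\<close> or \<open>snd\<close> for \<open>s\<close> one development gives
  the weight spaces of either factor; each is a sum over the other degree.\<close>

definition weight_space :: "(int \<times> int => int) => int => 'h set" where
 "weight_space s m = {v \<in> V. \<forall>i j. s (i, j) \<noteq> m \<longrightarrow> cp i j v = 0}"

abbreviation "W1 \<equiv> weight_space fst"

abbreviation "W2 \<equiv> weight_space snd"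

lemma weight_spaceD: assumes "v \<in> weight_space s m" shows "v \<in> V" "s (i, j) \<noteq> m ==> cp i j v = 0"
 using assms unfolding weight_space_def by simp_all

lemma W_W12: "v \<in> W i j \<longleftrightarrow> v \<in> W1 i \<and> v \<in> W2 j"
proof
 assume v: "v \<in> W i j"
 thus "v \<in> W1 i \<and> v \<in> W2 j" using W_V[OF v] unfolding weight_space_def by (simp add: cp_W[OF v])
next
 assume v: "v \<in> W1 i \<and> v \<in> W2 j"
 hence vV: "v \<in> V" using weight_spaceD by blast
 have "cp i j v = v"
  using v by (intro cp_eqI[OF cp_V[OF vV] vV]) (auto simp: cp_W[OF cp_in[OF vV]] weight_space_def)
 thus "v \<in> W i j" using vV W_iff by simp
qed

lemma weight_space_sub: "subspace (weight_space s m)"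
 using lin_kernel[OF V_sub, of "{p. s p \<noteq> m}" "\<lambda>p. cp (fst p) (snd p)"] cp_lin by (simp add: weight_space_def)

lemma cp_weight_space: "v \<in> V ==> cp i j v \<in> weight_space s (s (i, j))"
 by (auto simp: weight_space_def cp_V cp_W[OF cp_in])

lemma weight_space_decomp:
 assumes v: "v \<in> V" shows "\<exists>S f. finite S \<and> (\<forall>m. f m \<in> weight_space s m) \<and> v = (\<Sum>m\<in>S. f m)"
proof (intro exI conjI allI)
 show "finite (s ` comps v)" using comps(1)[OF v] by simp
 show "v = (\<Sum>m\<in>s ` comps v. \<Sum>p\<in>{p \<in> comps v. s p = m}. cp (fst p) (snd p) v)"
  using sum.image_gen[OF comps(1)[OF v], of "\<lambda>p. cp (fst p) (snd p) v" s] comps(2)[OF v] by simp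
 show "(\<Sum>p\<in>{p \<in> comps v. s p = m}. cp (fst p) (snd p) v) \<in> weight_space s m" for m
  by (rule subspace_sum[OF weight_space_sub]) (use cp_weight_space[OF v] in force)
qed

lemma weight_space_orth: "x \<in> weight_space s m ==> y \<in> weight_space s n ==> m \<noteq> n ==> x \<bullet> y = 0"
 by (rule orthI) (metis weight_spaceD)+

lemma weight_space_map:
 assumes T: "linear_on_subspace V T" and S: "subspace S" and v: "v \<in> weight_space s m"
  and TW: "\<And>i j w. w \<in> W i j ==> s (i, j) = m ==> T w \<in> S"
 shows "T v \<in> S"
proof (rule lin_in[OF T S])
 show vV: "v \<in> V" by (rule weight_spaceD[OF v])
 show "T (cp i j v) \<in> S" for i j
  using TW[OF cp_in[OF vV], of i j] weight_spaceD(2)[OF v, of i j] lin_zero[OF T] subspace_0[OF S] by metis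
qed

lemma weight_space_scalar:
 assumes T: "linear_on_subspace V T" and v: "v \<in> weight_space s m"
  and TW: "\<And>i j w. w \<in> W i j ==> s (i, j) = m ==> T w = c *\<^sub>R w"
 shows "T v = c *\<^sub>R v"
proof (rule lin_eqI[OF T lin_scaleR[OF V_sub]])
 show vV: "v \<in> V" by (rule weight_spaceD[OF v])
 show "T (cp i j v) = c *\<^sub>R cp i j v" for i j
  using TW[OF cp_in[OF vV], of i j] weight_spaceD(2)[OF v, of i j] lin_zero[OF T] by (metis scaleR_zero_right)
qed

lemmas weight_space_rep = weight_space_sub weight_spaceD(1) weight_space_orth

sublocale r1: sl2_rep V W1 "\<lambda>g. \<sigma> g (mat 1)" Nh
proof
 fix m and x v :: 'h and a :: real and g h :: "real^2^2"
 show "\<exists>S f. finite S \<and> (\<forall>m. f m \<in> W1 m) \<and> v = (\<Sum>m\<in>S. f m)" if "v \<in> V" by (rule weight_space_decomp[OF that])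
 show "\<sigma> (diag2 a) (mat 1) x = (a powi m) *\<^sub>R x" if "a \<noteq> 0" "x \<in> W1 m"
  by (rule weight_space_scalar[OF sigma_lin that(2)]) (simp_all add: that sigma_diag1)
 show "((\<lambda>t. \<sigma> (exp_E t) (mat 1) v) has_vector_derivative Nh v) (at 0)" if "v \<in> V"
  using that sigma_deriv Nh_kappa by (metis VE)
 show "Nh x \<in> W1 (m + 2)" if "x \<in> W1 m"
  by (rule weight_space_map[OF Nh_lin weight_space_sub that]) (use Nh_in W_W12 in force)
 show "\<sigma> (g ** h) (mat 1) v = \<sigma> g (mat 1) (\<sigma> h (mat 1) v)" if "g \<in> SL2" "h \<in> SL2" "v \<in> V"
  using sigma_mult[OF that(1) SL2_mat_1 that(2) SL2_mat_1 that(3)] by simp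
qed (auto intro: weight_space_rep sigma_one Nh_lin Nh_nil sigma_lin sigma_in)

text \<open>The weights of the second factor are the values of \<open>j\<close>, and a surface has
  forms of degree 0, 1 and 2 only.\<close>

sublocale r2: sl2_rep_small V W2 "\<lambda>g. \<sigma> (mat 1) g" Lh
proof
 fix m and x v :: 'h and a :: real and g h :: "real^2^2"
 show "\<exists>S f. finite S \<and> (\<forall>m. f m \<in> W2 m) \<and> v = (\<Sum>m\<in>S. f m)" if "v \<in> V" by (rule weight_space_decomp[OF that])
 show "\<sigma> (mat 1) (diag2 a) x = (a powi m) *\<^sub>R x" if "a \<noteq> 0" "x \<in> W2 m"
  by (rule weight_space_scalar[OF sigma_lin that(2)]) (simp_all add: that sigma_diag2)
 show "((\<lambda>t. \<sigma> (mat 1) (exp_E t) v) has_vector_derivative Lh v) (at 0)" if "v \<in> V"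
  using that sigma_deriv Lh_kappa by (metis VE)
 show "Lh x \<in> W2 (m + 2)" if "x \<in> W2 m"
  by (rule weight_space_map[OF Lh_lin weight_space_sub that]) (use Lh_in W_W12 in force)
 show "\<exists>k. (Lh ^^ k) x = 0" if "x \<in> V" using Lh_Lh[OF that] by (intro exI[of _ 2]) (simp add: numeral_2_eq_2)
 show "\<sigma> (mat 1) (g ** h) v = \<sigma> (mat 1) g (\<sigma> (mat 1) h v)" if "g \<in> SL2" "h \<in> SL2" "v \<in> V"
  using sigma_mult[OF SL2_mat_1 that(1) SL2_mat_1 that(2,3)] by simp
 show "x = 0" if x: "x \<in> W2 m" "m \<notin> {- 1, 0, 1}"
  using W_zero[OF cp_in[OF weight_spaceD(1)[OF x(1)]]] weight_spaceD[OF x(1)] x(2) by (metis cp_eq_0I snd_conv)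
qed (auto intro: weight_space_rep sigma_one Lh_lin sigma_lin sigma_in)

text \<open>On second weight -1 the operator \<open>L\<close> coincides with
  \<open>\<sigma> (mat 1) weyl\<close> by \<open>r2.weyl_neg1\<close>, and this commutes with the
  first factor; on the other weights \<open>L\<close> is 0.\<close>

lemma weyl_Lh: assumes v: "v \<in> V" shows "\<sigma> weyl (mat 1) (Lh v) = Lh (\<sigma> weyl (mat 1) v)"
proof -
 have S: "linear_on_subspace V (\<sigma> weyl (mat 1))" by (rule sigma_lin[OF SL2_weyl SL2_mat_1])
 have W2: "\<sigma> weyl (mat 1) x \<in> W2 m" if x: "x \<in> W2 m" for x m
 proof (rule r2.weightI)
  have xV: "x \<in> V" by (rule r2.W_V[OF x])
  show "\<sigma> weyl (mat 1) x \<in> V" by (rule sigma_in[OF SL2_weyl SL2_mat_1 xV])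
  have "\<sigma> (mat 1) (diag2 2) (\<sigma> weyl (mat 1) x) = \<sigma> weyl (mat 1) (\<sigma> (mat 1) (diag2 2) x)"
   using sigma_factor[OF xV SL2_weyl, of "diag2 2"] sigma_factor'[OF xV SL2_weyl, of "diag2 2"] by simp
  thus "\<sigma> (mat 1) (diag2 2) (\<sigma> weyl (mat 1) x) = (2 powi m) *\<^sub>R \<sigma> weyl (mat 1) x"
   using r2.pi_diag[OF _ x, of 2] lin_scale[OF S xV] by simp
 qed
 have SV: "\<sigma> weyl (mat 1) u \<in> V" if "u \<in> V" for u by (rule sigma_in[OF SL2_weyl SL2_mat_1 that])
 show ?thesis
 proof (rule r2.lin_eq[OF lin_compose[OF Lh_lin S Lh_V] lin_compose[OF S Lh_lin SV] _ v])
  fix m x assume x: "x \<in> W2 m"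
  note xV = r2.W_V[OF x]
  consider "m = - 1" | "m \<in> {0, 1}" | "m \<notin> {- 1, 0, 1}" by blast
  thus "\<sigma> weyl (mat 1) (Lh x) = Lh (\<sigma> weyl (mat 1) x)"
  proof cases
   case 1
   have "\<sigma> weyl (mat 1) (\<sigma> (mat 1) weyl x) = \<sigma> (mat 1) weyl (\<sigma> weyl (mat 1) x)"
    using sigma_factor[OF xV SL2_weyl SL2_weyl] sigma_factor'[OF xV SL2_weyl SL2_weyl] by simp
   thus ?thesis using r2.weyl_neg1[of x] r2.weyl_neg1[OF W2, of x] x 1 by simp
  next
   case 2
   thus ?thesis using r2.E_0 r2.E_1 x W2[OF x] lin_zero[OF S] by fastforce
  next
   case 3
   thus ?thesis using r2.W_bound[OF x] lin_zero[OF S] lin_zero[OF Lh_lin] by simp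
  qed
 qed
qed

lemma Nh_W2: "x \<in> W2 m ==> Nh x \<in> W2 m"
 by (rule weight_space_map[OF Nh_lin weight_space_sub]) (use Nh_in W_W12 in force)+

text \<open>\<open>N\<close> commutes with \<open>L\<close> already on cochains and preserves the
  second weight; \<open>r2.commutes\<close> integrates this to the group.\<close>

lemma Nh_rho: "g \<in> SL2 ==> v \<in> V ==> Nh (rho \<sigma> g v) = rho \<sigma> g (Nh v)"
 by (rule r2.commutes[OF Nh_lin Nh_W2 Nh_Lh])

text \<open>The inner product is the polarization of \<open>x\<close> with
  \<open>\<sigma> weyl weyl y\<close>. Skewness moves \<open>f\<close> to the second argument with a
  minus sign, and \<open>z\<close> is the vector that absorbs it.\<close>

lemma adjoint_general:
 assumes fS: "descends f" and skew: "\<And>x y. x \<in> K \<A> ==> y \<in> K \<A> ==> polarization \<A> (f x) y = - polarization \<A> x (f y)"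
  and x: "x \<in> V" and y: "y \<in> V" and z: "z \<in> V" "\<sigma> weyl weyl z = - induced f (\<sigma> weyl weyl y)"
 shows "induced f x \<bullet> y = x \<bullet> z"
proof -
 have SS: "\<sigma> weyl weyl u \<in> V" if "u \<in> V" for u by (rule sigma_in[OF SL2_weyl SL2_weyl that])
 obtain x0 where x0: "x0 \<in> cocycles \<A>" "x = \<kappa> x0" by (rule VE[OF x])
 obtain y0 where y0: "y0 \<in> cocycles \<A>" "y = \<kappa> y0" by (rule VE[OF y])
 obtain y1 where y1: "y1 \<in> cocycles \<A>" "\<sigma> weyl weyl y = \<kappa> y1" by (rule VE[OF SS[OF y]])
 obtain z0 where z0: "z0 \<in> cocycles \<A>" "z = \<kappa> z0" by (rule VE[OF z(1)])
 have f1: "f y1 \<in> cocycles \<A>" by (rule descends_cocycles[OF fS y1(1)])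
 have "complex_of_real (induced f x \<bullet> y) = polarization \<A> (f x0) y1"
  unfolding x0(2) y0(2) induced_kappa[OF fS x0(1)]
  by (rule inner_polarization[OF descends_cocycles[OF fS x0(1)] y0(1) y1(1)]) (simp add: y0(2)[symmetric] y1(2))
 also have "\<dots> = - polarization \<A> x0 (f y1)" by (rule skew[OF cocyclesD(1)[OF x0(1)] cocyclesD(1)[OF y1(1)]])
 also have "polarization \<A> x0 (f y1) = complex_of_real (\<kappa> x0 \<bullet> \<kappa> (- z0))"
 proof (rule inner_polarization[symmetric, OF x0(1) subspace_neg[OF cocycles_subspace z0(1)] f1])
  have "\<sigma> weyl weyl (\<kappa> (- z0)) = - \<sigma> weyl weyl z"
   unfolding lin_minus[OF kappa_lin z0(1)] z0(2)
   by (rule lin_minus[OF sigma_lin[OF SL2_weyl SL2_weyl] kappa_in[OF z0(1)]])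
  thus "\<kappa> (f y1) = \<sigma> weyl weyl (\<kappa> (- z0))"
   unfolding z(2) y1(2) induced_kappa[OF fS y1(1)] by simp
 qed
 also have "\<kappa> (- z0) = - z" unfolding z0(2) by (rule lin_minus[OF kappa_lin z0(1)])
 finally have "complex_of_real (induced f x \<bullet> y) = complex_of_real (x \<bullet> z)" unfolding x0(2) by simp
 thus ?thesis by (simp only: of_real_eq_iff)
qed

text \<open>Writing \<open>\<sigma> weyl weyl\<close> as \<open>S'\<close> after \<open>S\<close>,
  with \<open>S'\<close> commuting with the operator, solves for \<open>z\<close>: the adjoint is
  minus the conjugate by \<open>S\<close> alone.\<close>

lemma adjoint_conjugate:
 assumes f: "descends f" "\<And>x y. x \<in> K \<A> ==> y \<in> K \<A> ==> polarization \<A> (f x) y = - polarization \<A> x (f y)"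
  and x: "x \<in> V" and y: "y \<in> V"
  and S: "linear_on_subspace V S" "\<And>u. u \<in> V ==> S u \<in> V" "linear_on_subspace V S'" "\<And>u. u \<in> V ==> \<sigma> weyl weyl u = S' (S u)"
  and R: "\<And>u. u \<in> V ==> R u \<in> V" "\<And>u. u \<in> V ==> S (R u) = u"
  and c: "\<And>u. u \<in> V ==> S' (induced f u) = induced f (S' u)"
 shows "induced f x \<bullet> y = x \<bullet> (- R (induced f (S y)))"
proof (rule adjoint_general[OF f x y])
 have V: "induced f (S y) \<in> V" "R (induced f (S y)) \<in> V" using induced_in[OF f(1)] S(2) R(1) y by blast+
 show m: "- R (induced f (S y)) \<in> V" by (rule subspace_neg[OF V_sub V(2)])
 show "\<sigma> weyl weyl (- R (induced f (S y))) = - induced f (\<sigma> weyl weyl y)"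
  unfolding S(4)[OF m] S(4)[OF y] lin_minus[OF S(1) V(2)] R(2)[OF V(1)] lin_minus[OF S(3) V(1)] c[OF S(2)[OF y]] ..
qed

lemma adjoint_Nh: assumes x: "x \<in> V" and y: "y \<in> W1 m" shows "Nh x \<bullet> y = x \<bullet> r1.F y"
proof -
 have "Nh x \<bullet> y = x \<bullet> (- \<sigma> weyl_inv (mat 1) (Nh (\<sigma> weyl (mat 1) y)))"
  unfolding Nh_def
  by (rule adjoint_conjugate[OF descends_NK polarization_NK x r1.W_V[OF y], where S' = "rho \<sigma> weyl"])
   (simp_all add: sigma_lin sigma_in sigma_factor'[OF _ SL2_weyl SL2_weyl] r1.pi_weyl_cancel Nh_rho[unfolded Nh_def])
 thus ?thesis using r1.weyl_conjugate[OF y] by simp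
qed

lemma adjoint_Lh: assumes x: "x \<in> V" and y: "y \<in> W2 m" shows "Lh x \<bullet> y = x \<bullet> r2.F y"
proof -
 have "Lh x \<bullet> y = x \<bullet> (- \<sigma> (mat 1) weyl_inv (Lh (\<sigma> (mat 1) weyl y)))"
  unfolding Lh_def
  by (rule adjoint_conjugate[OF descends_ellK polarization_ellK x r2.W_V[OF y], where S' = "\<sigma> weyl (mat 1)"])
   (simp_all add: sigma_lin sigma_in sigma_factor[OF _ SL2_weyl SL2_weyl] r2.pi_weyl_cancel weyl_Lh[unfolded Lh_def])
 thus ?thesis using r2.weyl_conjugate[OF y] by simp
qed

definition Fh :: "'h => 'h" where "Fh = r1.F"

lemma Fh_V: "v \<in> V ==> Fh v \<in> V" and Fh_lin: "linear_on_subspace V Fh"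
 unfolding Fh_def by (fact r1.F_V r1.F_lin)+

lemma Fh_in: assumes v: "v \<in> W i j" shows "Fh v \<in> W (i - 2) j"
proof -
 have "\<sigma> weyl (mat 1) (Nh (\<sigma> weyl_inv (mat 1) v)) \<in> W (- (- i + 2)) j"
  by (rule sigma_weyl_in(1)[OF Nh_in[OF sigma_weyl_in(1)[OF v]]]) simp_all
 hence "- \<sigma> weyl (mat 1) (Nh (\<sigma> weyl_inv (mat 1) v)) \<in> W (i - 2) j"
  using subspace_neg[OF W_sub] by simp
 thus ?thesis unfolding Fh_def r1.F_def .
qed

lemma cp_Fh: assumes "v \<in> V" shows "cp (i - 2) j (Fh v) = Fh (cp i j v)"
 using linear_cp[where \<phi> = "\<lambda>i. i - 2" and n = 0, OF Fh_lin _ _ assms, of i j] Fh_in by (simp add: inj_def)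

lemma Fh_rho: assumes g: "g \<in> SL2" and v: "v \<in> V" shows "Fh (rho \<sigma> g v) = rho \<sigma> g (Fh v)"
proof -
 have c: "\<sigma> h (mat 1) (rho \<sigma> g u) = rho \<sigma> g (\<sigma> h (mat 1) u)" if "h \<in> SL2" "u \<in> V" for h u
  using sigma_factor[OF that(2,1) g] sigma_factor'[OF that(2,1) g] by simp
 have 1: "\<sigma> weyl_inv (mat 1) v \<in> V" by (rule r1.pi_in[OF SL2_weyl_inv v])
 have 2: "\<sigma> weyl (mat 1) (Nh (\<sigma> weyl_inv (mat 1) v)) \<in> V" by (rule r1.pi_in[OF SL2_weyl Nh_V[OF 1]])
 show ?thesis
  unfolding Fh_def r1.F_def c[OF SL2_weyl_inv v] Nh_rho[OF g 1] c[OF SL2_weyl Nh_V[OF 1]]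
  by (rule lin_minus[OF r2.pi_lin[OF g] 2, symmetric])
qed

text \<open>Commutator and adjointness hold on \<open>W1\<close>; fixing \<open>j\<close> as well
  makes the weight spaces the bidegree pieces, the form in which the Lefschetz lemmas are applied to
  classes.\<close>

lemma module: "sl2_module (\<lambda>i. W i j) Nh Fh"
proof -
 interpret m: sl2_module W1 Nh Fh unfolding Fh_def
  by (rule r1.sl2_module) (rule adjoint_Nh[OF r1.W_V])
 show ?thesis
 proof
  fix x y m
  show "linear_on_subspace (W m j) Nh" "linear_on_subspace (W m j) Fh"
   by (rule lin_mono[OF Nh_lin _ W_sub] lin_mono[OF Fh_lin _ W_sub],
     rule subsetI, erule W_V)+
  assume x: "x \<in> W m j"
  hence x1: "x \<in> W1 m" unfolding W_W12 by blast
  show "Nh x \<in> W (m + 2) j" "Fh x \<in> W (m - 2) j" by (rule Nh_in[OF x], rule Fh_in[OF x])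
  show "Nh (Fh x) - Fh (Nh x) = of_int m *\<^sub>R x" by (rule m.comm[OF x1])
  show "\<exists>k. (Nh ^^ k) x = 0" "\<exists>k. (Fh ^^ k) x = 0" by (rule m.E_nil[OF x1], rule m.F_nil[OF x1])
  assume "y \<in> W (m + 2) j"
  hence "y \<in> W1 (m + 2)" unfolding W_W12 by blast
  thus "Nh x \<bullet> y = x \<bullet> Fh y" by (rule m.adj[OF x1])
 qed
qed

lemma adjoint: assumes "x \<in> V" "y \<in> V" shows "Nh x \<bullet> y = x \<bullet> Fh y"
proof -
 obtain S f where f: "finite S" "\<And>m. f m \<in> W1 m" "y = (\<Sum>m\<in>S. f m)" using r1.decomp[OF assms(2)] by blast
 have "Fh y = (\<Sum>m\<in>S. Fh (f m))" unfolding f(3) by (rule lin_sum[OF Fh_lin r1.W_V[OF f(2)]])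
 thus ?thesis unfolding f(3) inner_sum_right using adjoint_Nh[OF assms(1) f(2)] unfolding Fh_def
  by (simp add: inner_sum_right)
qed

text \<open>The lowering operator of the second factor leads to weight -3, so it vanishes here, and
  \<open>norm_E\<close> at weight -1 leaves an isometry.\<close>

lemma norm_Lh: assumes x: "x \<in> W2 (- 1)" shows "norm (Lh x) = norm x"
proof -
 interpret m: sl2_module W2 Lh r2.F
  by (rule r2.sl2_module) (rule adjoint_Lh[OF r2.W_V])
 have "r2.F x = 0" using r2.W_bound[OF r2.F_in[OF x]] by simp
 hence "Lh x \<bullet> Lh x = x \<bullet> x" using m.norm_E[OF x] by simp
 thus ?thesis unfolding norm_eq_sqrt_inner by simp
qed

lemma rho_bounded: assumes g: "g \<in> SL2" shows "\<exists>C. \<forall>v\<in>V. norm (rho \<sigma> g v) \<le> C * norm v"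
 by (rule r2.bounded[OF norm_Lh g])

lemma rho_extension:
 assumes g: "g \<in> SL2" shows "\<exists>R. bounded_linear R \<and> (\<forall>v\<in>V. R v = rho \<sigma> g v)"
proof -
 obtain C where "\<forall>v\<in>V. norm (rho \<sigma> g v) \<le> C * norm v" using rho_bounded[OF g] by blast
 thus ?thesis using bounded_linear_extension[OF r2.pi_lin[OF g] V_dense, of C] by blast
qed

lemma rho_W: assumes v: "v \<in> W1 m" and g: "g \<in> SL2" shows "rho \<sigma> g v \<in> W1 m"
proof (rule r1.weightI)
 have vV: "v \<in> V" by (rule r1.W_V[OF v])
 show "rho \<sigma> g v \<in> V" by (rule r2.pi_in[OF g vV])
 have "\<sigma> (diag2 2) (mat 1) (rho \<sigma> g v) = rho \<sigma> g (\<sigma> (diag2 2) (mat 1) v)"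
  using sigma_factor[OF vV _ g, of "diag2 2"] sigma_factor'[OF vV _ g, of "diag2 2"] by simp
 thus "\<sigma> (diag2 2) (mat 1) (rho \<sigma> g v) = (2 powi m) *\<^sub>R rho \<sigma> g v"
  using r1.pi_diag[OF _ v, of 2] lin_scale[OF r2.pi_lin[OF g] vV] by simp
qed

end

text \<open>Encodes dimension at most \<open>n\<close> without \<open>dim\<close>, which is the
  cardinality of a basis and therefore 0 in infinite dimension.\<close>

definition spanned :: "nat => 'v::real_vector set => bool" where
 "spanned n M \<longleftrightarrow> (\<exists>S. finite S \<and> card S \<le> n \<and> M \<subseteq> span S)"

lemma spanned_mono: "spanned m N ==> m \<le> n ==> M \<subseteq> N ==> spanned n M"
 unfolding spanned_def by (meson order_trans)

lemma spanned_0: "M \<subseteq> {0} ==> spanned n M"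
 unfolding spanned_def by (intro exI[of _ "{}"]) simp

lemma spanned_basis:
 assumes "subspace M" "spanned n M" shows "\<exists>A. independent A \<and> finite A \<and> card A \<le> n \<and> span A = M"
proof -
 obtain S where S: "finite S" "card S \<le> n" "M \<subseteq> span S" using assms(2) unfolding spanned_def by blast
 obtain A where A: "A \<subseteq> M" "independent A" "M \<subseteq> span A" using maximal_independent_subset[of M] by blast
 have "finite A \<and> card A \<le> card S" using independent_span_bound[OF S(1) A(2)] A(1) S(3) by blast
 thus ?thesis using A S(2) span_minimal[OF A(1) assms(1)] by (intro exI[of _ A]) auto
qed

lemma spanned_image: assumes f: "linear_on_subspace M f" and M: "spanned n M" shows "spanned n (f ` M)"
proof -
 obtain A where A: "finite A" "card A \<le> n" "span A = M" using spanned_basis[OF lin_subspace[OF f] M] by blast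
 hence "f ` M = span (f ` A)" using lin_span[OF f, of A] span_superset by blast
 thus ?thesis unfolding spanned_def using A card_image_le[OF A(1), of f] by (intro exI[of _ "f ` A"]) auto
qed

lemma spanned_inj:
 assumes g: "linear_on_subspace M g" and inj: "\<And>x. x \<in> M ==> g x = 0 ==> x = 0" and N: "spanned n (g ` M)"
 shows "spanned n M"
proof -
 have "inj_on g M" using inj[OF subspace_diff[OF lin_subspace[OF g]]] lin_diff[OF g] by (intro inj_onI) fastforce
 hence i: "inv_into M g (g x) = x" if "x \<in> M" for x using that by simp
 have "inv_into M g ` g ` M = M" using i by force
 thus ?thesis using spanned_image[OF lin_factor[OF g lin_id[OF lin_subspace[OF g]] i] N] by simp
qed

text \<open>Each real functional costs at most one dimension: a vector \<open>u\<close> with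
  \<open>\<psi> u \<noteq> 0\<close> reduces every element to the kernel of \<open>\<psi>\<close>.
  When no functional is left, \<open>f\<close> is 0 by the last hypothesis.\<close>

lemma spanned_functionals:
 fixes f :: "'v::real_vector => 'w::real_vector" and \<Lambda> :: "('v => real) set"
 assumes "finite \<Lambda>" "linear_on_subspace P f" "\<And>\<phi>. \<phi> \<in> \<Lambda> ==> linear_on_subspace P \<phi>"
  and "\<And>x. x \<in> P ==> (\<And>\<phi>. \<phi> \<in> \<Lambda> ==> \<phi> x = 0) ==> f x = 0"
 shows "spanned (card \<Lambda>) (f ` P)"
 using assms
proof (induction \<Lambda> arbitrary: P rule: finite_induct)
 case empty
 thus ?case by (intro spanned_0) auto
next
 case (insert \<psi> \<Lambda>)
 have sub: "subspace P" by (rule lin_subspace[OF insert.prems(1)])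
 have psi: "linear_on_subspace P \<psi>" by (rule insert.prems(2)) simp
 let ?Q = "{x \<in> P. \<psi> x = 0}"
 have Q: "subspace ?Q" using lin_kernel[OF sub psi, where I = "{()}"] by simp
 have "spanned (card \<Lambda>) (f ` ?Q)"
  by (rule insert.IH) (use insert.prems in \<open>auto intro: lin_mono[OF _ _ Q]\<close>)
 then obtain S where S: "finite S" "card S \<le> card \<Lambda>" "f ` ?Q \<subseteq> span S" unfolding spanned_def by blast
 show ?case
 proof (cases "\<exists>u\<in>P. \<psi> u \<noteq> 0")
  case False
  hence "?Q = P" by blast
  thus ?thesis using S insert.hyps unfolding spanned_def by (intro exI[of _ S]) simp
 next
  case True
  then obtain u where u: "u \<in> P" "\<psi> u \<noteq> 0" by blast
  have "f x \<in> span (insert (f u) S)" if x: "x \<in> P" for x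
  proof -
   define c where "c = \<psi> x / \<psi> u"
   have cu: "c *\<^sub>R u \<in> P" by (rule subspace_scale[OF sub u(1)])
   have "x - c *\<^sub>R u \<in> ?Q"
    using u lin_diff[OF psi x cu] lin_scale[OF psi u(1), of c] subspace_diff[OF sub x cu] by (simp add: c_def)
   hence "f x - c *\<^sub>R f u \<in> span S"
    using S(3) lin_diff[OF insert.prems(1) x cu] lin_scale[OF insert.prems(1) u(1), of c] by fastforce
   thus ?thesis by (rule span_breakdown_eq[THEN iffD2, OF exI])
  qed
  moreover have "card (insert (f u) S) \<le> card (insert \<psi> \<Lambda>)"
   using S(1,2) insert.hyps card_insert_le_m1[of "card (insert \<psi> \<Lambda>)" S "f u"] by simp
  ultimately show ?thesis unfolding spanned_def using S(1) by (intro exI[of _ "insert (f u) S"]) auto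
 qed
qed

context compact_surface
begin

lemma twist_real: "cnj (twist i j) = twist i j" "twist i j * twist i j = 1"
 unfolding twist_def by (simp_all add: power_int_minus_left)

text \<open>A potential of a form with the right symmetry under conjugation can be symmetrised.\<close>

lemma symmetrize_potential:
 assumes F: "smooth_form \<A> F" "homogeneous 0 F" "dform F = \<theta>" and \<theta>: "form_cnj \<theta> = cmult t \<theta>"
  and t: "cnj t = t" "t * t = 1"
 shows "\<exists>G. smooth_form \<A> G \<and> homogeneous 0 G \<and> dform G = \<theta> \<and> form_cnj G = cmult t G"
proof -
 let ?c = "cmult t (form_cnj F)"
 define G where "G = cmult (1 / 2) (F + ?c)"
 have s: "smooth_form \<A> (form_cnj F)" "smooth_form \<A> ?c" "smooth_form \<A> (F + ?c)"
  using F(1) by (auto intro: smooth_form_cnj smooth_form_cmult smooth_form_add)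
 have h: "homogeneous 0 ?c"
 proof (rule homogeneous_cmult, rule homogeneousI)
  fix a b c z assume "int a + int b \<noteq> 0"
  thus "form_cnj F a b c z = 0" using homogeneous_apply[OF F(2), of b a c z] by (simp add: form_cnj_apply)
 qed
 have "dform ?c = cmult t (form_cnj \<theta>)" unfolding dform_cmult[OF s(1)] form_cnj_dform[OF F(1), symmetric] F(3) ..
 also have "\<dots> = \<theta>" unfolding \<theta> cmult_cmult t(2) by (rule form_eqI) (simp add: cmult_apply)
 finally have "dform G = cmult (1 / 2) (\<theta> + \<theta>)" unfolding G_def dform_cmult[OF s(3)] dform_add[OF F(1) s(2)] F(3) by simp
 also have "\<dots> = \<theta>" by (rule form_eqI) (simp add: cmult_apply)
 finally have 1: "dform G = \<theta>" .
 have "form_cnj G = cmult t G"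
 proof (rule form_eqI)
  fix a b c z
  have tt: "t * (t * w) = w" for w unfolding mult.assoc[symmetric] t(2) by simp
  have "(-1) ^ (a * b) * ((-1) ^ (b * a) * w) = w" for w :: complex
   by (simp add: mult.commute[of a b] flip: mult.assoc power_add power_mult_distrib)
  thus "form_cnj G a b c z = cmult t G a b c z"
   by (simp add: G_def form_cnj_apply cmult_apply t(1) tt algebra_simps)
 qed
 thus ?thesis using 1 F(1,2) h s unfolding G_def
  by (intro exI[of _ G]) (simp add: G_def smooth_form_cmult homogeneous_cmult homogeneous_add)
qed

end

context lefschetz_surface
begin

text \<open>The differential shifts the bidegree by \<open>(1, 1)\<close>, so a primitive may be
  replaced by one of its components.\<close>

lemma coboundary_homogeneous:
 assumes x: "x \<in> cocycles \<A>" "K_comp i j x = x" "\<kappa> x = 0"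
 shows "\<exists>w\<in>K_bi \<A> (i - 1) (j - 1). x = dK w"
proof -
 obtain w where w: "w \<in> K \<A>" "x = dK w" using x(3) unfolding kappa_0[OF x(1)] coboundaries_def by blast
 have "x = dK (K_comp (i - 1) (j - 1) w)" using dK_K_comp[OF w(1), of "i - 1" "j - 1"] x(2) w(2) by simp
 thus ?thesis using K_comp_in_K_bi[OF w(1)] by blast
qed

lemma K_biD: assumes "x \<in> K_bi \<A> i j" shows "x \<in> K \<A>" "K_comp i j x = x" "i' \<noteq> i \<or> j' \<noteq> j ==> x i' j' k = 0"
proof -
 show x: "x \<in> K \<A>" "K_comp i j x = x" using assms unfolding K_bi_def by simp_all
 assume "i' \<noteq> i \<or> j' \<noteq> j"
 hence "\<not> (i' = i \<and> j' = j)" by blast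
 hence "K_comp i j x i' j' = 0" unfolding K_comp_apply by (rule if_not_P)
 thus "x i' j' k = 0" unfolding x(2) by simp
qed

lemma K_bi_subspace: "subspace (K_bi \<A> i j)"
 using subspace_K by (auto simp: subspace_def K_bi_def lin_add[OF K_comp_linear] lin_scale[OF K_comp_linear] lin_zero[OF K_comp_linear])

text \<open>Degree zero: on the kernel of $N$ a cocycle reduces to a constant function.\<close>

lemma kernel_lift:
 assumes v: "v \<in> W i j" "Nh v = 0"
 obtains a w where "a \<in> cocycles \<A>" "a \<in> K_bi \<A> i j" "w \<in> K_bi \<A> (i + 1) (j - 1)" "NK a = dK w" "v = \<kappa> a"
proof -
 obtain a where a: "a \<in> cocycles \<A>" "a \<in> K_bi \<A> i j" "v = \<kappa> a" using v(1) unfolding W_def by blast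
 have c: "K_comp (i + 2) j (NK a) = NK a" using NK_K_comp[OF cocyclesD(1)[OF a(1)], of i j] K_biD(2)[OF a(2)] by simp
 have "\<kappa> (NK a) = 0" using v(2) unfolding a(3) Nh_kappa[OF a(1)] .
 then obtain w where "w \<in> K_bi \<A> (i + 2 - 1) (j - 1)" "NK a = dK w"
  using coboundary_homogeneous[OF descends_cocycles[OF descends_NK a(1)] c] by blast
 moreover have "i + 2 - 1 = i + 1" by simp
 ultimately show thesis using that a by metis
qed

text \<open>The equation \<open>NK a = 0\<close> removes all components with \<open>k > i\<close>,
  since for them the target is not truncated. For the one at \<open>k = i\<close> the cocycle
  condition at \<open>(i + 1, 0, i + 1)\<close> makes it a closed function, that is a constant, and
  one value decides.\<close>

lemma kernel_functions_zero:
 assumes i: "i \<ge> 0" and a: "a \<in> cocycles \<A> \<inter> K_bi \<A> i (- 1)" and N: "NK a = 0"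
  and c0: "c0 \<in> \<A>" "x0 \<in> fst c0" "a i (- 1) i 0 0 c0 (snd c0 x0) = 0"
 shows "a = 0"
proof (cases "odd i")
 case True
 thus ?thesis using K_bi_zero[of a i "- 1"] a by simp
next
 case False
 have aK: "a \<in> K \<A>" "dK a = 0" using cocyclesD[of a] a by blast+
 have big: "a i (- 1) k = 0" if "k > i" for k
 proof -
  have "NK a (i + 2) (- 1) (k + 1) = 0" unfolding N by simp
  moreover have "K_nonzero (i + 2) (- 1) (k + 1)" using that i False unfolding K_nonzero_def by auto
  ultimately have "cmult (inverse two_pi_i) (a i (- 1) k) = 0" unfolding NK_eq[OF aK(1)] by simp
  thus ?thesis by (rule iffD1[OF cmult_eq_0_iff, rotated]) simp
 qed
 have "dK a (i + 1) 0 (i + 1) = 0" unfolding aK(2) by simp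
 moreover have "K_nonzero (i + 1) 0 (i + 1)" using i False unfolding K_nonzero_def by auto
 ultimately have "dform (a i (- 1) i) = 0" unfolding dK_eq[OF aK(1)] raw_d_def by (simp add: big)
 hence ai: "a i (- 1) i = 0"
  using constant_functions[OF KD(3)[OF aK(1)] _ _ c0(1,2,3)] KD(4)[OF aK(1), of "- 1" i i] by simp
 have "a i' j' k = 0" for i' j' k
 proof (cases "i' = i \<and> j' = - 1")
  case True
  thus ?thesis using big[of k] ai KD(6)[OF aK(1), of i "- 1" k] i
   by (cases k i rule: linorder_cases) (auto simp: K_nonzero_def)
 next
  case False thus ?thesis using K_biD(3)[of a i "- 1"] a by blast
 qed
 thus "a = 0" by (intro ext) simp
qed

text \<open>From \<open>N a = d y\<close> every component of \<open>a\<close> with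
  \<open>k > i\<close> is \<open>d Y_k + d^c Y_{k+1}\<close>, where \<open>Y\<close> is
  \<open>two_pi_i\<close> times \<open>y\<close>. Subtracting the coboundary built from these
  \<open>Y\<close> leaves this single one-form at \<open>k = i\<close>.\<close>

definition residual_form :: "int => 'a cochain => 'a cochain => 'a form" where
 "residual_form i a y = a i 0 i - cmult two_pi_i (dcform (y (i + 1) (- 1) (i + 1)))"

text \<open>Degree one: modulo coboundaries an element of the kernel of $N$ is determined by one closed
 one-form.\<close>

lemma residual_form:
 assumes i: "i \<ge> 1" "odd i" and a: "a \<in> cocycles \<A> \<inter> K_bi \<A> i 0" and y: "y \<in> K_bi \<A> (i + 1) (- 1)"
  and N: "NK a = dK y"
 shows "closed_form (residual_form i a y)"
  and "smooth_form \<A> F ==> homogeneous 0 F ==> dform F = residual_form i a y ==> \<kappa> a = 0"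
proof -
 have aK: "a \<in> K \<A>" "dK a = 0" using cocyclesD[of a] a by blast+
 have yK: "y \<in> K \<A>" by (rule K_biD(1)[OF y])
 define Y where "Y k = cmult two_pi_i (y (i + 1) (- 1) k)" for k
 have Ys: "smooth_form \<A> (Y k)" for k unfolding Y_def by (rule smooth_form_cmult[OF KD(3)[OF yK]])
 have Yh: "homogeneous 0 (Y k)" for k unfolding Y_def using homogeneous_cmult[OF KD(4)[OF yK, of "- 1"]] by simp
 define \<theta> where "\<theta> = residual_form i a y"
 have th: "\<theta> = a i 0 i - dcform (Y (i + 1))"
  unfolding \<theta>_def residual_form_def Y_def dcform_cmult[OF KD(3)[OF yK]] ..
 have as: "smooth_form \<A> (a i 0 k)" for k by (rule KD(3)[OF aK(1)])
 have eq: "a i 0 k = dform (Y k) + dcform (Y (k + 1))" if "k \<ge> i + 1" for k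
 proof -
  have nz: "K_nonzero (i + 2) 0 (k + 1)" using that i unfolding K_nonzero_def by auto
  have e: "i + 2 - 2 = i" "i + 2 - 1 = i + 1" "(0::int) - 1 = - 1" "k + 1 - 1 = k" by simp_all
  have "NK a (i + 2) 0 (k + 1) = dK y (i + 2) 0 (k + 1)" unfolding N ..
  hence "cmult (inverse two_pi_i) (a i 0 k) = dform (y (i + 1) (- 1) k) + dcform (y (i + 1) (- 1) (k + 1))"
   unfolding NK_eq[OF aK(1)] dK_eq[OF yK] raw_d_def if_P[OF nz] e .
  hence "cmult two_pi_i (cmult (inverse two_pi_i) (a i 0 k)) =
   cmult two_pi_i (dform (y (i + 1) (- 1) k) + dcform (y (i + 1) (- 1) (k + 1)))" by simp
  moreover have "cmult two_pi_i (cmult (inverse two_pi_i) \<eta>) = \<eta>" for \<eta> :: "'a form"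
   unfolding cmult_cmult right_inverse[OF two_pi_i_nonzero] by (rule form_eqI) (simp add: cmult_apply)
  ultimately show ?thesis
   unfolding Y_def dform_cmult[OF KD(3)[OF yK]] dcform_cmult[OF KD(3)[OF yK]] cmult_add by simp
 qed
 have s: "smooth_form \<A> \<theta>" unfolding th by (rule smooth_form_diff[OF as smooth_form_dcform[OF Ys]])
 have h: "homogeneous 1 \<theta>"
  unfolding th form_diff_eq
  using homogeneous_add[OF KD(4)[OF aK(1), of 0 i i] homogeneous_cmult[OF homogeneous_dcform[OF Yh[of "i + 1"]]]] by simp
 \<comment> \<open>Closedness: the cocycle condition gives \<open>d a_i = - d^c a_{i+1}\<close>, and
   inserting \<open>a_{i+1} = d Y_{i+1} + d^c Y_{i+2}\<close> turns this into
   \<open>- d^c d Y_{i+1} = d d^c Y_{i+1}\<close>.\<close>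
 have "dK a (i + 1) 1 (i + 1) = 0" unfolding aK(2) by simp
 moreover have "K_nonzero (i + 1) 1 (i + 1)" using i unfolding K_nonzero_def by auto
 ultimately have d1: "dform (a i 0 i) + dcform (a i 0 (i + 1)) = 0" unfolding dK_eq[OF aK(1)] raw_d_def by simp
 have d2: "dcform (a i 0 (i + 1)) = dcform (dform (Y (i + 1)))"
  unfolding eq[OF order_refl] dcform_add[OF smooth_form_dform[OF Ys] smooth_form_dcform[OF Ys]] dform_squared(2)[OF Ys] by simp
 have d3: "dform (dcform (Y (i + 1))) + dcform (dform (Y (i + 1))) = 0" by (rule dform_squared(3)[OF Ys])
 have "dform (a i 0 i) = dform (dcform (Y (i + 1)))" using d1 d3 unfolding d2[symmetric] by (metis add_right_cancel)
 hence "dform \<theta> = 0" unfolding th dform_diff[OF as smooth_form_dcform[OF Ys]] by simp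
 thus "closed_form (residual_form i a y)" using s h unfolding closed_form_def \<theta>_def by simp
 have tw: "twist (i + 1) (- 1) = - twist i 0" "twist (i - 1) (- 1) = twist i 0"
 proof -
  have "(1 + 0 - i) div 2 = (1 + (- 1) - (i + 1)) div 2 + 1" by simp
  thus "twist (i + 1) (- 1) = - twist i 0" unfolding twist_def by (simp add: power_int_add)
  have "1 + (- 1) - (i - 1) = 1 + 0 - i" by simp
  thus "twist (i - 1) (- 1) = twist i 0" unfolding twist_def by (simp only:)
 qed
 have Yc: "form_cnj (Y k) = cmult (twist i 0) (Y k)" for k
  unfolding Y_def form_cnj_cmult KD(5)[OF yK] tw(1) cmult_cmult by (simp add: mult_ac)
 have thc: "form_cnj \<theta> = cmult (twist i 0) \<theta>"
  unfolding th form_cnj_diff form_cnj_dcform[OF Ys] KD(5)[OF aK(1)] Yc dcform_cmult[OF Ys] cmult_diff ..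
 assume F: "smooth_form \<A> F" "homogeneous 0 F" "dform F = residual_form i a y"
 then obtain G where G: "smooth_form \<A> G" "homogeneous 0 G" "dform G = \<theta>" "form_cnj G = cmult (twist i 0) G"
  using symmetrize_potential[OF F(1,2) F(3)[folded \<theta>_def] thc twist_real] by blast
 \<comment> \<open>The primitive of \<open>a\<close>: the potential \<open>G\<close> in the lowest
   admissible place \<open>k = i - 1\<close>, and above it the \<open>Y\<close> shifted by one
   place, which reproduce \<open>a\<close> for \<open>k > i\<close> and the correction term at
   \<open>k = i\<close>.\<close>
 define x :: "'a cochain" where
  "x i' j' k = (if i' = i - 1 \<and> j' = - 1 then (if k = i - 1 then G else if k \<ge> i then Y (k + 1) else 0) else 0)" for i' j' k
 have xK: "x \<in> K \<A>"
  unfolding K_iff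
 proof (intro conjI allI)
  fix i' j' k
  show "x i' j' k \<in> K_piece \<A> i' j' k"
  proof (cases "i' = i - 1 \<and> j' = - 1 \<and> k \<ge> i - 1")
   case True
   hence e: "i' = i - 1" "j' = - 1" by simp_all
   have nz: "K_nonzero (i - 1) (- 1) k" using True i unfolding K_nonzero_def by auto
   show ?thesis
    unfolding e K_piece_iff[OF nz] tw(2) using True G Ys Yh Yc by (simp add: x_def)
  next
   case False
   hence "x i' j' k = 0" unfolding x_def by auto
   thus ?thesis using zero_in_K_piece by simp
  qed
 next
  let ?f = "\<lambda>(i, j, k). (i + 2, j, k + 1)"
  have "K_support x \<subseteq> insert (i - 1, - 1, i - 1) (?f -` K_support y)"
   by (auto simp: K_support_def x_def Y_def add.commute split: if_splits)
  moreover have "finite (?f -` K_support y)" by (rule finite_vimageI[OF KD(2)[OF yK]]) (auto simp: inj_def)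
  ultimately show "finite (K_support x)" by (meson finite_insert finite_subset)
 qed
 have "dK x i' j' k = a i' j' k" for i' j' k
 proof (cases "i' = i \<and> j' = 0 \<and> K_nonzero i 0 k")
  case True
  hence e: "i' = i" "j' = 0" and nz: "K_nonzero i 0 k" by simp_all
  have k: "k \<ge> i" using nz i unfolding K_nonzero_def by simp
  have d: "dK x i' j' k = dform (x (i - 1) (- 1) (k - 1)) + dcform (x (i - 1) (- 1) k)"
   unfolding e dK_eq[OF xK] raw_d_def using nz by simp
  show ?thesis
  proof (cases "k = i")
   case True
   have "dK x i' j' k = \<theta> + dcform (Y (i + 1))" using d unfolding True by (simp add: x_def G(3))
   thus ?thesis unfolding th e True by simp
  next
   case False
   hence "dK x i' j' k = dform (Y k) + dcform (Y (k + 1))" unfolding d using k by (simp add: x_def)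
   thus ?thesis using eq[of k] k False unfolding e by simp
  qed
 next
  case False
  have "a i' j' k = 0" using False KD(6)[OF aK(1), of i 0 k] K_biD(3)[of a i 0 i' j' k] a by (cases "i' = i \<and> j' = 0") auto
  moreover have "dK x i' j' k = 0" using False by (auto simp: dK_eq[OF xK] raw_d_def x_def)
  ultimately show ?thesis by simp
 qed
 hence "a = dK x" by (intro ext) simp
 thus "\<kappa> a = 0" using dK_cocycle(2)[OF xK] by simp
qed

lemma kernel_span_functions:
 assumes i: "i \<ge> 0" and f: "linear_on_subspace {a \<in> cocycles \<A> \<inter> K_bi \<A> i (- 1). NK a = 0} f"
 shows "spanned 2 (f ` {a \<in> cocycles \<A> \<inter> K_bi \<A> i (- 1). NK a = 0})"
proof -
 let ?P = "{a \<in> cocycles \<A> \<inter> K_bi \<A> i (- 1). NK a = 0}"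
 obtain c0 x0 where c0: "c0 \<in> \<A>" "x0 \<in> fst c0" using charts_cover by blast
 define ev where "ev a = a i (- 1) i 0 0 c0 (snd c0 x0)" for a :: "'a cochain"
 \<comment> \<open>The spaces are real, so one complex value counts as two functionals.\<close>
 let ?L = "{\<lambda>a. Re (ev a), \<lambda>a. Im (ev a)}"
 have "spanned (card ?L) (f ` ?P)"
 proof (rule spanned_functionals[OF _ f])
  show "linear_on_subspace ?P \<phi>" if "\<phi> \<in> ?L" for \<phi>
   using that lin_subspace[OF f] unfolding linear_on_subspace_def ev_def by (auto simp: scaleR_fun_apply)
  show "f a = 0" if a: "a \<in> ?P" and z: "\<And>\<phi>. \<phi> \<in> ?L ==> \<phi> a = 0" for a
  proof -
   have "ev a = 0" using z[of "\<lambda>a. Re (ev a)"] z[of "\<lambda>a. Im (ev a)"] by (simp add: complex_eq_iff)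
   hence "a = 0" using kernel_functions_zero[OF i _ _ c0] a unfolding ev_def by blast
   thus ?thesis using lin_zero[OF f] by simp
  qed
 qed simp
 thus ?thesis by (rule spanned_mono) (simp_all add: card_insert_if)
qed

text \<open>The bound does not depend on \<open>i\<close> because the tests concern the surface
  alone: one value of a constant, or the functionals in \<open>\<Lambda>\<close> applied to one
  closed one-form. The case \<open>j = 1\<close> is transported from \<open>j = - 1\<close> by
  \<open>L\<close>.\<close>

lemma kernel_finite:
 "\<exists>C. \<forall>i\<ge>0. \<forall>j. spanned C {v \<in> W i j. Nh v = 0}"
proof -
 obtain \<Lambda> :: "('a form => complex) set" where L: "finite \<Lambda>"
  "\<forall>\<phi>\<in>\<Lambda>. (\<forall>\<theta> \<eta>. smooth_form \<A> \<theta> \<longrightarrow> smooth_form \<A> \<eta> \<longrightarrow> \<phi> (\<theta> + \<eta>) = \<phi> \<theta> + \<phi> \<eta>) \<and>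
    (\<forall>s \<theta>. smooth_form \<A> \<theta> \<longrightarrow> \<phi> (cmult s \<theta>) = s * \<phi> \<theta>)"
  "\<forall>\<theta>. closed_form \<theta> \<longrightarrow> (\<forall>\<phi>\<in>\<Lambda>. \<phi> \<theta> = 0) \<longrightarrow> (\<exists>F. smooth_form \<A> F \<and> homogeneous 0 F \<and> dform F = \<theta>)"
  using first_cohomology_finite by (elim exE conjE) (rule that)
 have "spanned (2 * card \<Lambda> + 2) {v \<in> W i j. Nh v = 0}" if i: "i \<ge> 0" for i j
 proof -
  let ?P1 = "{a \<in> cocycles \<A> \<inter> K_bi \<A> i (- 1). NK a = 0}"
  have NKlin: "linear_on_subspace (cocycles \<A> \<inter> K_bi \<A> i j) NK" for j
   by (rule lin_mono[OF NK_linear _ cocycles_K_bi_subspace]) (unfold cocycles_def, blast)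
  have P1: "subspace ?P1"
   using lin_kernel[OF cocycles_K_bi_subspace NKlin, where I = "{()}"] by simp
  have k1: "linear_on_subspace ?P1 \<kappa>" by (rule lin_mono[OF kappa_lin _ P1]) blast
  have W1: "\<exists>a\<in>?P1. v = \<kappa> a" if v: "v \<in> W i (- 1)" "Nh v = 0" for v
  proof -
   obtain a w where a: "a \<in> cocycles \<A>" "a \<in> K_bi \<A> i (- 1)" "v = \<kappa> a"
    and w: "w \<in> K_bi \<A> (i + 1) (- 1 - 1)" "NK a = dK w" by (rule kernel_lift[OF v])
   have "w = 0" by (rule K_bi_zero[OF w(1)]) simp
   hence "NK a = 0" using w(2) lin_zero[OF dK_linear] by simp
   thus ?thesis using a by blast
  qed
  consider "j = - 1" | "j = 0" "odd i" | "j = 1" | "j \<notin> {- 1, 0, 1} \<or> odd (1 + j - i)" by auto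
  thus ?thesis
  proof cases
   case 1
   have sub: "{v \<in> W i j. Nh v = 0} \<subseteq> \<kappa> ` ?P1" using W1 unfolding 1 by blast
   show ?thesis by (rule spanned_mono[OF kernel_span_functions[OF i k1] _ sub]) simp
  next
   case 3
   have f: "linear_on_subspace ?P1 (\<lambda>a. Lh (\<kappa> a))"
    by (rule lin_compose[OF k1 Lh_lin]) (auto intro: kappa_in)
   have sub: "{v \<in> W i j. Nh v = 0} \<subseteq> (\<lambda>a. Lh (\<kappa> a)) ` ?P1"
   proof
    fix v assume "v \<in> {v \<in> W i j. Nh v = 0}"
    hence v: "v \<in> W i 1" "Nh v = 0" unfolding 3 by simp_all
    \<comment> \<open>Every class of second weight 1 is \<open>L\<close> of one of weight -1. As
      \<open>N\<close> commutes with \<open>L\<close>, which is injective there, the preimage is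
      again in the kernel of \<open>N\<close>.\<close>
    obtain y where y: "y \<in> W2 (- 1)" "v = Lh y" using r2.weyl_1 v(1) unfolding W_W12 by blast
    have yV: "y \<in> V" by (rule r2.W_V[OF y(1)])
    let ?u = "cp i (- 1) y"
    have u: "?u \<in> W i (- 1)" by (rule cp_in[OF yV])
    have vu: "v = Lh ?u" using cp_Lh[OF yV, of i "- 1"] cp_W[OF v(1), of i 1] y(2) by simp
    have Nu: "Nh ?u \<in> W2 (- 1)" using Nh_in[OF u] unfolding W_W12 by blast
    have "Lh (Nh ?u) = 0" using Nh_Lh[OF W_V[OF u]] v(2) vu by simp
    hence "norm (Nh ?u) = 0" using norm_Lh[OF Nu] by simp
    then obtain a where a: "a \<in> ?P1" "?u = \<kappa> a" using W1[OF u] by auto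
    show "v \<in> (\<lambda>a. Lh (\<kappa> a)) ` ?P1" by (rule image_eqI[OF _ a(1)]) (simp only: a(2)[symmetric] vu[symmetric])
   qed
   show ?thesis by (rule spanned_mono[OF kernel_span_functions[OF i f] _ sub]) simp
  next
   case 2
   have i1: "i \<ge> 1" "odd i" using 2(2) i by (cases "i = 0"; simp)+
   \<comment> \<open>The cochain with \<open>N a = d y\<close> is not determined by
     \<open>a\<close>, so the functionals are defined on the space of pairs.\<close>
   define P where "P = {p. fst p \<in> cocycles \<A> \<inter> K_bi \<A> i 0 \<and> snd p \<in> K_bi \<A> (i + 1) (- 1) \<and> NK (fst p) = dK (snd p)}"
   have dKlin: "linear_on_subspace (K_bi \<A> (i + 1) (- 1)) dK"
    by (rule lin_mono[OF dK_linear _ K_bi_subspace]) (use K_biD(1) in blast)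
   have PD: "fst p \<in> cocycles \<A> \<inter> K_bi \<A> i 0" "snd p \<in> K_bi \<A> (i + 1) (- 1)" "NK (fst p) = dK (snd p)"
    "fst p \<in> K \<A>" "snd p \<in> K \<A>" if "p \<in> P" for p
    using that cocyclesD(1)[of "fst p"] K_biD(1)[of "snd p"] unfolding P_def by blast+
   let ?A = "(cocycles \<A> \<inter> K_bi \<A> i 0) \<times> K_bi \<A> (i + 1) (- 1)"
   have A: "subspace ?A" by (rule subspace_Times[OF cocycles_K_bi_subspace K_bi_subspace])
   have l: "linear_on_subspace ?A (\<lambda>p. NK (fst p) + - dK (snd p))"
    by (rule lin_plus[OF lin_compose[OF lin_fst[OF A] NKlin] lin_uminus[OF lin_compose[OF lin_snd[OF A] dKlin]]]) auto
   have e: "P = {p \<in> ?A. \<forall>u\<in>{()}. NK (fst p) + - dK (snd p) = 0}" by (auto simp: P_def mem_Times_iff)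
   have P: "subspace P" unfolding e by (rule lin_kernel[OF A l])
   have f: "linear_on_subspace P (\<lambda>p. \<kappa> (fst p))"
    by (rule lin_compose[OF lin_fst[OF P] kappa_lin]) (use PD(1) in blast)
   define \<theta> where "\<theta> p = residual_form i (fst p) (snd p)" for p
   have ths: "smooth_form \<A> (\<theta> p)" if "p \<in> P" for p
    unfolding \<theta>_def residual_form_def
    by (intro smooth_form_diff smooth_form_cmult smooth_form_dcform KD(3) PD that)
   have thadd: "\<theta> (p + q) = \<theta> p + \<theta> q" if p: "p \<in> P" and q: "q \<in> P" for p q
   proof -
    have e: "fst (p + q) i 0 i = fst p i 0 i + fst q i 0 i"
     "snd (p + q) (i + 1) (- 1) (i + 1) = snd p (i + 1) (- 1) (i + 1) + snd q (i + 1) (- 1) (i + 1)" by simp_all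
    show ?thesis
     unfolding \<theta>_def residual_form_def e dcform_add[OF KD(3)[OF PD(5)[OF p]] KD(3)[OF PD(5)[OF q]]] cmult_add
     by (rule add_diff_add)
   qed
   have thscale: "\<theta> (r *\<^sub>R p) = cmult (of_real r) (\<theta> p)" if p: "p \<in> P" for r p
    unfolding \<theta>_def residual_form_def fst_scaleR snd_scaleR scaleR_fun_apply scaleR_form
     dcform_cmult[OF KD(3)[OF PD(5)[OF p]]] cmult_diff cmult_cmult by (simp add: mult.commute)
   let ?g = "\<lambda>(c :: bool, \<phi>) p. (if c then Re else Im) (\<phi> (\<theta> p))"
   let ?L = "?g ` (UNIV \<times> \<Lambda>)"
   have S: "spanned (card ?L) ((\<lambda>p. \<kappa> (fst p)) ` P)"
   proof (rule spanned_functionals[OF _ f])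
    show "finite ?L" using L(1) by simp
    fix \<psi> assume "\<psi> \<in> ?L"
    then obtain c \<phi> where phi: "\<phi> \<in> \<Lambda>" "\<psi> = ?g (c, \<phi>)" by auto
    have "\<phi> (\<theta> (p + q)) = \<phi> (\<theta> p) + \<phi> (\<theta> q)" "\<phi> (\<theta> (r *\<^sub>R p)) = of_real r * \<phi> (\<theta> p)"
     if p: "p \<in> P" "q \<in> P" for p q r
     unfolding thadd[OF p] thscale[OF p(1)] using bspec[OF L(2) phi(1)] ths[OF p(1)] ths[OF p(2)] by simp_all
    thus "linear_on_subspace P \<psi>" unfolding linear_on_subspace_def phi(2) using P by simp
   next
    fix p assume p: "p \<in> P" and z: "\<And>\<psi>. \<psi> \<in> ?L ==> \<psi> p = 0"
    have "\<phi> (\<theta> p) = 0" if "\<phi> \<in> \<Lambda>" for \<phi>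
     using that z[OF imageI, of "(True, \<phi>)"] z[OF imageI, of "(False, \<phi>)"] by (simp add: complex_eq_iff)
    note r = residual_form[OF i1 PD(1)[OF p] PD(2)[OF p] PD(3)[OF p], folded \<theta>_def]
    obtain F where "smooth_form \<A> F" "homogeneous 0 F" "dform F = \<theta> p"
     using L(3) r(1) \<open>\<And>\<phi>. \<phi> \<in> \<Lambda> ==> \<phi> (\<theta> p) = 0\<close> by blast
    thus "\<kappa> (fst p) = 0" by (rule r(2))
   qed
   \<comment> \<open>Real and imaginary parts double the number of functionals; the summand 2 covers
     the cases \<open>j = - 1\<close> and \<open>j = 1\<close>.\<close>
   have cardL: "card ?L \<le> 2 * card \<Lambda> + 2"
    using card_image_le[of "UNIV \<times> \<Lambda>" ?g] L(1) by (simp add: card_cartesian_product)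
   have "{v \<in> W i j. Nh v = 0} \<subseteq> (\<lambda>p. \<kappa> (fst p)) ` P"
   proof
    fix v assume "v \<in> {v \<in> W i j. Nh v = 0}"
    hence v: "v \<in> W i 0" "Nh v = 0" unfolding 2(1) by simp_all
    obtain a w where a: "a \<in> cocycles \<A>" "a \<in> K_bi \<A> i 0" "v = \<kappa> a"
     and w: "w \<in> K_bi \<A> (i + 1) (0 - 1)" "NK a = dK w" by (rule kernel_lift[OF v])
    have "(a, w) \<in> P" unfolding P_def using a w by simp
    thus "v \<in> (\<lambda>p. \<kappa> (fst p)) ` P" unfolding a(3) by (rule rev_image_eqI) simp
   qed
   thus ?thesis by (rule spanned_mono[OF S cardL])
  next
   case 4
   thus ?thesis using W_zero[of _ i j] by (intro spanned_0) blast
  qed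
 qed
 thus ?thesis by blast
qed

text \<open>Lowest weight vectors are detected in the kernel by the power of $N$ that inverts the weight.\<close>

lemma lowest_finite: "\<exists>C. \<forall>i\<ge>0. \<forall>j. spanned C {v \<in> W (- i) j. Fh v = 0}"
proof -
 obtain C where C: "\<And>i j. i \<ge> 0 ==> spanned C {v \<in> W i j. Nh v = 0}" using kernel_finite by blast
 have "spanned C {v \<in> W (- i) j. Fh v = 0}" if i: "i \<ge> 0" for i j
 proof -
  interpret m: sl2_module "\<lambda>i. W i j" Nh Fh by (rule module)
  obtain n where n: "i = int n" using i by (metis nat_0_le)
  let ?P = "{v \<in> W (- int n) j. Fh v = 0}"
  have P: "subspace ?P" using lin_kernel[OF W_sub m.F_lin, where I = "{()}"] by simp
  have "spanned C ?P"
  proof (rule spanned_inj)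
   show "linear_on_subspace ?P (Nh ^^ n)" by (rule lin_mono[OF m.Epow_lin[of "- int n"] _ P]) blast
   show "v = 0" if "v \<in> ?P" "(Nh ^^ n) v = 0" for v using m.lowest_inj[OF _ _ order_refl that(2)] that(1) by simp
   have "(Nh ^^ n) ` ?P \<subseteq> {v \<in> W i j. Nh v = 0}"
    using m.Epow_in[of _ "- int n" n] m.lowest_top unfolding n by auto
   thus "spanned C ((Nh ^^ n) ` ?P)" by (rule spanned_mono[OF C[OF i] order_refl])
  qed
  thus ?thesis unfolding n .
 qed
 thus ?thesis by blast
qed

end

text \<open>The difference of two candidates is orthogonal to \<open>closure S\<close> by continuity
  and is itself a difference of two elements of it, hence orthogonal to itself.\<close>

lemma orth_part_eqI:
 assumes "v - u \<in> closure S" "\<And>s. s \<in> S ==> s \<bullet> u = 0" shows "orth_part S v = u"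
 unfolding orth_part_def
proof (rule the_equality)
 show "v - u \<in> closure S \<and> (\<forall>s\<in>S. s \<bullet> u = 0)" using assms by blast
next
 fix w assume w: "v - w \<in> closure S \<and> (\<forall>s\<in>S. s \<bullet> w = 0)"
 have "closure S \<subseteq> {s. s \<bullet> (u - w) = 0}"
 proof (rule closure_minimal)
  show "S \<subseteq> {s. s \<bullet> (u - w) = 0}" using assms(2) w by (auto simp: inner_diff_right)
  show "closed {s. s \<bullet> (u - w) = 0}" by (intro closed_Collect_eq continuous_intros)
 qed
 hence "(v - w) \<bullet> (u - w) = 0" "(v - u) \<bullet> (u - w) = 0" using w assms(1) by blast+
 hence "((v - w) - (v - u)) \<bullet> (u - w) = 0" unfolding inner_diff_left[of "v - w"] by simp
 hence "(u - w) \<bullet> (u - w) = 0" by simp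
 thus "w = u" by simp
qed

section \<open>The cohomology of the cone in terms of kernel and cokernel of N\<close>

context lefschetz_surface
begin

definition KK :: "('a cochain \<times> 'a cochain) set" where "KK = K \<A> \<times> K \<A>"

lemma KKD: assumes "x \<in> KK" shows "fst x \<in> K \<A>" "snd x \<in> K \<A>"
 using assms unfolding KK_def by auto

lemma KKI: "fst x \<in> K \<A> ==> snd x \<in> K \<A> ==> x \<in> KK"
 unfolding KK_def by (cases x) simp

lemma KK_subspace: "subspace KK"
 unfolding KK_def by (rule subspace_Times[OF subspace_K subspace_K])

lemma KK_linear:
 assumes "linear_on_subspace (K \<A>) f"
 shows "linear_on_subspace KK (\<lambda>x. f (fst x))" "linear_on_subspace KK (\<lambda>x. f (snd x))"
 by (rule lin_compose[OF _ assms], rule lin_fst lin_snd, rule KK_subspace, erule KKD)+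

lemma D_cone_linear: "linear_on_subspace KK D_cone"
 using lin_Pair[OF lin_uminus[OF KK_linear(1)[OF dK_linear]] lin_plus[OF KK_linear(1)[OF NK_linear] KK_linear(2)[OF dK_linear]]]
 unfolding D_cone_def[abs_def] .

lemma D_cone_KK: assumes x: "x \<in> KK" shows "D_cone x \<in> KK" "D_cone (D_cone x) = 0"
proof -
 note x = KKD[OF x]
 show "D_cone x \<in> KK"
  unfolding D_cone_def
  by (rule KKI) (simp_all only: fst_conv snd_conv subspace_neg[OF subspace_K dK_in_K[OF x(1)]]
    subspace_add[OF subspace_K NK_in_K[OF x(1)] dK_in_K[OF x(2)]])
 have "dK (- dK (fst x)) = 0"
  unfolding lin_minus[OF dK_linear dK_in_K[OF x(1)]] dK_dK[OF x(1)] by simp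
 moreover have "NK (- dK (fst x)) + dK (NK (fst x) + dK (snd x)) = 0"
  unfolding lin_minus[OF NK_linear dK_in_K[OF x(1)]] NK_dK[OF x(1)]
   lin_add[OF dK_linear NK_in_K[OF x(1)] dK_in_K[OF x(2)]] dK_dK[OF x(2)] by simp
 ultimately show "D_cone (D_cone x) = 0" unfolding D_cone_def by (simp add: zero_prod_def)
qed

abbreviation "Zc \<equiv> cone_cocycles \<A>"
abbreviation "Bc \<equiv> cone_coboundaries \<A>"

lemma Zc_iff: "x \<in> Zc \<longleftrightarrow> x \<in> KK \<and> D_cone x = 0" unfolding cone_cocycles_def KK_def by blast

lemma ZcD: assumes "x \<in> Zc"
 shows "x \<in> KK" "fst x \<in> cocycles \<A>" "fst x \<in> K \<A>" "snd x \<in> K \<A>" "NK (fst x) = - dK (snd x)" "D_cone x = 0"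
proof -
 show x: "x \<in> KK" and D: "D_cone x = 0" using assms Zc_iff by simp_all
 show f: "fst x \<in> K \<A>" "snd x \<in> K \<A>" by (rule KKD[OF x])+
 have "- dK (fst x) = 0" "NK (fst x) + dK (snd x) = 0" using D unfolding D_cone_def by (simp_all add: zero_prod_def)
 thus "fst x \<in> cocycles \<A>" "NK (fst x) = - dK (snd x)"
  using f(1) unfolding cocycles_def by (simp_all add: eq_neg_iff_add_eq_0)
qed

lemma ZcI: assumes "a \<in> cocycles \<A>" "b \<in> K \<A>" "NK a + dK b = 0" shows "(a, b) \<in> Zc"
 unfolding Zc_iff D_cone_def using assms cocyclesD[OF assms(1)] by (simp add: KKI zero_prod_def)

lemma Zc_subspace: "subspace Zc"
 using lin_kernel[OF KK_subspace D_cone_linear, of "{()}"] by (simp add: cone_cocycles_def KK_def)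

lemma Bc_iff: "x \<in> Bc \<longleftrightarrow> (\<exists>w\<in>KK. x = D_cone w)" unfolding cone_coboundaries_def KK_def by blast

lemma Bc_subspace: "subspace Bc"
 using lin_image[OF D_cone_linear] unfolding cone_coboundaries_def KK_def .

lemma Bc_Zc: "Bc \<subseteq> Zc"
proof
 fix x assume "x \<in> Bc"
 then obtain w where w: "w \<in> KK" "x = D_cone w" unfolding Bc_iff by blast
 show "x \<in> Zc" unfolding w(2) Zc_iff using D_cone_KK[OF w(1)] by simp
qed

lemma gr_linear: "linear_on_subspace KK (gr p q)"
 unfolding gr_def[abs_def] by (intro lin_Pair KK_linear K_comp_linear)

lemma gr_D_cone:
 assumes x: "x \<in> KK"
 shows "gr p q (D_cone x) = D_cone (K_comp (q - 2 * p - 1) (q - 2) (fst x), K_comp (q - 2 * p) (q - 3) (snd x))"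
proof -
 note x = KKD[OF x]
 have 1: "dK (K_comp (q - 2 * p - 1) (q - 2) (fst x)) = K_comp (q - 2 * p) (q - 1) (dK (fst x))"
  using dK_K_comp[OF x(1), of "q - 2 * p - 1" "q - 2"] by (simp add: algebra_simps)
 have 2: "dK (K_comp (q - 2 * p) (q - 3) (snd x)) = K_comp (q - 2 * p + 1) (q - 2) (dK (snd x))"
  using dK_K_comp[OF x(2), of "q - 2 * p" "q - 3"] by (simp add: algebra_simps)
 have 3: "NK (K_comp (q - 2 * p - 1) (q - 2) (fst x)) = K_comp (q - 2 * p + 1) (q - 2) (NK (fst x))"
  using NK_K_comp[OF x(1), of "q - 2 * p - 1" "q - 2"] by (simp add: algebra_simps)
 show ?thesis
  unfolding gr_def D_cone_def fst_conv snd_conv 1 2 3 lin_minus[OF K_comp_linear dK_in_K[OF x(1)]]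
   lin_add[OF K_comp_linear NK_in_K[OF x(1)] dK_in_K[OF x(2)]] ..
qed

lemma gr_Bc: assumes "x \<in> Bc" shows "gr p q x \<in> Bc"
proof -
 obtain w where w: "w \<in> KK" "x = D_cone w" using assms unfolding Bc_iff by blast
 let ?w = "(K_comp (q - 2 * p - 1) (q - 2) (fst w), K_comp (q - 2 * p) (q - 3) (snd w))"
 have "?w \<in> KK"
  by (rule KKI) (simp_all only: fst_conv snd_conv K_comp_in_K[OF KKD(1)[OF w(1)]] K_comp_in_K[OF KKD(2)[OF w(1)]])
 thus ?thesis unfolding w(2) gr_D_cone[OF w(1)] Bc_iff by blast
qed

lemma gr_Zc: assumes x: "x \<in> Zc" shows "gr p q x \<in> Zc"
proof -
 have 1: "NK (K_comp (q - 2 * p) (q - 1) (fst x)) = K_comp (q - 2 * p + 2) (q - 1) (NK (fst x))"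
  by (rule NK_K_comp[OF ZcD(3)[OF x]])
 have 2: "dK (K_comp (q - 2 * p + 1) (q - 2) (snd x)) = K_comp (q - 2 * p + 2) (q - 1) (dK (snd x))"
  using dK_K_comp[OF ZcD(4)[OF x], of "q - 2 * p + 1" "q - 2"] by (simp add: algebra_simps)
 have 3: "NK (K_comp (q - 2 * p) (q - 1) (fst x)) + dK (K_comp (q - 2 * p + 1) (q - 2) (snd x)) = 0"
  unfolding 1 2 ZcD(5)[OF x] lin_minus[OF K_comp_linear dK_in_K[OF ZcD(4)[OF x]]] by simp
 show ?thesis unfolding gr_def
  by (rule ZcI[OF descends_cocycles[OF descends_K_comp ZcD(2)[OF x]] K_comp_in_K[OF ZcD(4)[OF x]] 3])
qed

lemma gr_gr:
 fixes x :: "'a cochain \<times> 'a cochain"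
 shows "gr p q (gr p' q' x) = (if p = p' \<and> q = q' then gr p q x else 0)"
proof (cases "p = p' \<and> q = q'")
 case True
 have "K_comp i j (K_comp i j y) = K_comp i j y" for i j and y :: "'a cochain"
  by (rule ext, rule ext) (simp add: K_comp_apply)
 thus ?thesis using True by (simp add: gr_def)
next
 case False
 have z: "K_comp i j (K_comp i' j' y) = 0" if "i \<noteq> i' \<or> j \<noteq> j'" for i j i' j' and y :: "'a cochain"
  using that by (intro ext) (auto simp: K_comp_apply zero_fun_def)
 have "K_comp (q - 2 * p) (q - 1) (K_comp (q' - 2 * p') (q' - 1) (fst x)) = 0"
  "K_comp (q - 2 * p + 1) (q - 2) (K_comp (q' - 2 * p' + 1) (q' - 2) (snd x)) = 0"
  using False by (intro z; force)+
 thus ?thesis using False by (auto simp: gr_def zero_prod_def)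
qed

lemma sum_K_comp:
 assumes x: "x \<in> K \<A>" and \<phi>: "inj_on \<phi> S" "finite S" and S: "\<And>i j. x i j \<noteq> 0 ==> (i, j) \<in> \<phi> ` S"
 shows "(\<Sum>s\<in>S. K_comp (fst (\<phi> s)) (snd (\<phi> s)) x) = x"
proof -
 have "(\<Sum>s\<in>S. K_comp (fst (\<phi> s)) (snd (\<phi> s)) x) = (\<Sum>(i, j)\<in>\<phi> ` S. K_comp i j x)"
  unfolding sum.reindex[OF \<phi>(1)] by (simp add: split_beta)
 also have "\<dots> = x"
 proof (rule K_sum_comp[OF x finite_imageI[OF \<phi>(2)], symmetric])
  show "(\<lambda>(i, j, k). (i, j)) ` K_support x \<subseteq> \<phi> ` S"
  proof
   fix p assume "p \<in> (\<lambda>(i, j, k). (i, j)) ` K_support x"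
   then obtain r where r: "p = (\<lambda>(i, j, k). (i, j)) r" "r \<in> K_support x" by (rule imageE)
   obtain i j k where ijk: "r = (i, j, k)" by (cases r)
   have "x i j k \<noteq> 0" using r(2) unfolding ijk K_support_def by simp
   hence "x i j \<noteq> 0" by auto
   thus "p \<in> \<phi> ` S" using S r(1) unfolding ijk by simp
  qed
 qed
 finally show ?thesis .
qed

text \<open>The bidegrees of the two summands at \<open>(p, q)\<close>. Both maps are injective, so
  sums over \<open>gr_support\<close> reindex to sums over bidegrees.\<close>

abbreviation bi1 :: "int \<times> int => int \<times> int" where "bi1 \<equiv> \<lambda>(p, q). (q - 2 * p, q - 1)"
abbreviation bi2 :: "int \<times> int => int \<times> int" where "bi2 \<equiv> \<lambda>(p, q). (q - 2 * p + 1, q - 2)"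

lemma bi_inj: "inj bi1" "inj bi2" by (auto simp: inj_def)

lemma K_support_bi:
 assumes x: "x \<in> K \<A>" and nz: "x i j \<noteq> 0" shows "even (1 + j - i)" "j \<in> {- 1, 0, 1}"
proof -
 have "\<exists>k. x i j k \<noteq> 0"
 proof (rule ccontr)
  assume "\<nexists>k. x i j k \<noteq> 0"
  hence "x i j = 0" by (intro ext[of "x i j" 0]) simp
  thus False using nz by simp
 qed
 then obtain k where k: "x i j k \<noteq> 0" by blast
 thus "even (1 + j - i)" using KD(6)[OF x, of i j k] unfolding K_nonzero_def by blast
 show "j \<in> {- 1, 0, 1}" using K_j_zero[OF x, of j i k] k by blast
qed

lemma gr_support_bi:
 assumes x: "x \<in> KK"
 shows "fst x i j \<noteq> 0 ==> (i, j) \<in> bi1 ` gr_support x" "snd x i j \<noteq> 0 ==> (i, j) \<in> bi2 ` gr_support x"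
proof -
 have nz: "K_comp i j y \<noteq> 0" if "y i j \<noteq> 0" for y :: "'a cochain"
  using that by (metis K_comp_apply zero_fun_apply)
 show "(i, j) \<in> bi1 ` gr_support x" if "fst x i j \<noteq> 0"
 \<comment> \<open>The preimage under \<open>bi1\<close>; the parity of \<open>1 + j - i\<close> on
   the support makes the division exact.\<close>
 proof (rule image_eqI[of _ _ "((1 + j - i) div 2, j + 1)"])
  have ij: "(i, j) = (j + 1 - 2 * ((1 + j - i) div 2), j + 1 - 1)" using K_support_bi[OF KKD(1)[OF x] that] by simp
  thus "(i, j) = bi1 ((1 + j - i) div 2, j + 1)" by simp
  show "((1 + j - i) div 2, j + 1) \<in> gr_support x" using nz[of "fst x", OF that] ij unfolding gr_support_def gr_def by (simp add: zero_prod_def)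
 qed
 show "(i, j) \<in> bi2 ` gr_support x" if "snd x i j \<noteq> 0"
 proof (rule image_eqI[of _ _ "((j + 3 - i) div 2, j + 2)"])
  have ij: "(i, j) = (j + 2 - 2 * ((j + 3 - i) div 2) + 1, j + 2 - 2)" using K_support_bi[OF KKD(2)[OF x] that] by simp
  thus "(i, j) = bi2 ((j + 3 - i) div 2, j + 2)" by simp
  show "((j + 3 - i) div 2, j + 2) \<in> gr_support x" using nz[of "snd x", OF that] ij unfolding gr_support_def gr_def by (simp add: zero_prod_def)
 qed
qed

lemma finite_gr_support: assumes x: "x \<in> KK" shows "finite (gr_support x)"
proof -
 have fin: "finite {(i, j). y i j \<noteq> 0}" if y: "y \<in> K \<A>" for y
 proof (rule finite_subset)
  have "\<exists>k. y i j k \<noteq> 0" if "y i j \<noteq> 0" for i j using that by (metis ext zero_fun_apply)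
  show "finite ((\<lambda>(i, j, k). (i, j)) ` K_support y)" using KD(2)[OF y] by simp
  thus "{(i, j). y i j \<noteq> 0} \<subseteq> (\<lambda>(i, j, k). (i, j)) ` K_support y" unfolding K_support_def by (force simp: image_iff)
 qed
 have "gr_support x \<subseteq> bi1 -` {(i, j). fst x i j \<noteq> 0} \<union> bi2 -` {(i, j). snd x i j \<noteq> 0}"
 proof
  fix s assume s: "s \<in> gr_support x"
  obtain p q where pq: "s = (p, q)" by (cases s)
  have "gr p q x \<noteq> 0" using s unfolding pq gr_support_def by simp
  moreover have z: "K_comp i j y = 0" if "y i j = 0" for i j and y :: "'a cochain"
   using that by (intro ext) (auto simp: K_comp_apply zero_fun_def)
  ultimately have "fst x (q - 2 * p) (q - 1) \<noteq> 0 \<or> snd x (q - 2 * p + 1) (q - 2) \<noteq> 0"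
   unfolding gr_def zero_prod_def using z by auto
  thus "s \<in> bi1 -` {(i, j). fst x i j \<noteq> 0} \<union> bi2 -` {(i, j). snd x i j \<noteq> 0}" unfolding pq by simp
 qed
 thus ?thesis
  using finite_vimageI[OF fin[OF KKD(1)[OF x]] bi_inj(1)] finite_vimageI[OF fin[OF KKD(2)[OF x]] bi_inj(2)]
  by (meson finite_UnI finite_subset)
qed

lemma gr_sum:
 assumes x: "x \<in> KK" and S: "finite S" "gr_support x \<subseteq> S"
 shows "(\<Sum>(p, q)\<in>S. gr p q x) = x"
proof (rule prod_eqI)
 have "fst (\<Sum>(p, q)\<in>S. gr p q x) = (\<Sum>s\<in>S. K_comp (fst (bi1 s)) (snd (bi1 s)) (fst x))"
  unfolding fst_sum by (rule sum.cong[OF refl]) (simp add: split_beta gr_def)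
 also have "\<dots> = fst x"
  using gr_support_bi(1)[OF x] S(2) by (intro sum_K_comp[OF KKD(1)[OF x] inj_on_subset[OF bi_inj(1)] S(1)]) blast+
 finally show "fst (\<Sum>(p, q)\<in>S. gr p q x) = fst x" .
 have "snd (\<Sum>(p, q)\<in>S. gr p q x) = (\<Sum>s\<in>S. K_comp (fst (bi2 s)) (snd (bi2 s)) (snd x))"
  unfolding snd_sum by (rule sum.cong[OF refl]) (simp add: split_beta gr_def)
 also have "\<dots> = snd x"
  using gr_support_bi(2)[OF x] S(2) by (intro sum_K_comp[OF KKD(2)[OF x] inj_on_subset[OF bi_inj(2)] S(1)]) blast+
 finally show "snd (\<Sum>(p, q)\<in>S. gr p q x) = snd x" .
qed

text \<open>The normal form of a cokernel class: by adjointness the image of \<open>N\<close> is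
  orthogonal to the kernel of \<open>Fh\<close>, so a representing class in that kernel is unique.
  It removes the choice made in \<open>coker_rep\<close>.\<close>

definition lowest_rep :: "'a cochain \<times> 'a cochain => 'h => bool" where
 "lowest_rep x f \<longleftrightarrow> f \<in> V \<and> Fh f = 0 \<and> (\<exists>b\<in>cocycles \<A>. \<kappa> b = f \<and> x - (0, b) \<in> Bc)"

lemma Bc_snd: assumes b: "b \<in> cocycles \<A>" "(0, b) \<in> Bc" shows "\<exists>u\<in>V. \<kappa> b = Nh u"
proof -
 obtain w where w: "w \<in> KK" "(0, b) = D_cone w" using b(2) unfolding Bc_iff by blast
 note wK = KKD[OF w(1)]
 have "dK (fst w) = 0" and bw: "b = NK (fst w) + dK (snd w)" using w(2) unfolding D_cone_def by simp_all
 hence c: "fst w \<in> cocycles \<A>" using wK unfolding cocycles_def by simp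
 have "\<kappa> b = Nh (\<kappa> (fst w))"
  unfolding bw lin_add[OF kappa_lin descends_cocycles[OF descends_NK c] dK_cocycle(1)[OF wK(2)]]
   dK_cocycle(2)[OF wK(2)] Nh_kappa[OF c] by simp
 thus ?thesis using kappa_in[OF c] by blast
qed

lemma Nh_Fh_orth: assumes "u \<in> V" "f \<in> V" "Nh u = f" "Fh f = 0" shows "f = 0"
proof -
 have "f \<bullet> f = u \<bullet> Fh f" using adjoint[OF assms(1,2)] unfolding assms(3) .
 thus ?thesis using assms(4) by simp
qed

lemma lowest_rep_scale: assumes "lowest_rep x f" shows "lowest_rep (r *\<^sub>R x) (r *\<^sub>R f)"
proof -
 obtain b where b: "f \<in> V" "Fh f = 0" "b \<in> cocycles \<A>" "\<kappa> b = f" "x - (0, b) \<in> Bc" using assms unfolding lowest_rep_def by blast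
 have "r *\<^sub>R (x - (0, b)) \<in> Bc" by (rule subspace_scale[OF Bc_subspace b(5)])
 moreover have "r *\<^sub>R (x - (0, b)) = r *\<^sub>R x - (0, r *\<^sub>R b)" unfolding scaleR_diff_right scaleR_Pair by simp
 ultimately show ?thesis
  unfolding lowest_rep_def using b subspace_scale[OF V_sub b(1)] lin_scale[OF Fh_lin b(1), of r]
   lin_scale[OF kappa_lin b(3), of r] subspace_scale[OF cocycles_subspace b(3), of r]
  by (intro conjI bexI[of _ "r *\<^sub>R b"]) simp_all
qed

lemma lowest_rep_add: assumes "lowest_rep x f" "lowest_rep y g" shows "lowest_rep (x + y) (f + g)"
proof -
 obtain b where b: "f \<in> V" "Fh f = 0" "b \<in> cocycles \<A>" "\<kappa> b = f" "x - (0, b) \<in> Bc" using assms(1) unfolding lowest_rep_def by blast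
 obtain c where c: "g \<in> V" "Fh g = 0" "c \<in> cocycles \<A>" "\<kappa> c = g" "y - (0, c) \<in> Bc" using assms(2) unfolding lowest_rep_def by blast
 have "(x - (0, b)) + (y - (0, c)) \<in> Bc" by (rule subspace_add[OF Bc_subspace b(5) c(5)])
 moreover have "(x - (0, b)) + (y - (0, c)) = (x + y) - (0, b + c)" by (simp add: prod_eq_iff)
 ultimately show ?thesis
  unfolding lowest_rep_def using b c subspace_add[OF V_sub b(1) c(1)] lin_add[OF Fh_lin b(1) c(1)]
   lin_add[OF kappa_lin b(3) c(3)] subspace_add[OF cocycles_subspace b(3) c(3)]
  by (intro conjI bexI[of _ "b + c"]) simp_all
qed

lemma lowest_rep_0: assumes "lowest_rep 0 f" shows "f = 0"
proof -
 obtain b where b: "f \<in> V" "Fh f = 0" "b \<in> cocycles \<A>" "\<kappa> b = f" "0 - (0, b) \<in> Bc" using assms unfolding lowest_rep_def by blast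
 have "- (0 - (0, b)) \<in> Bc" by (rule subspace_neg[OF Bc_subspace b(5)])
 hence "(0, b) \<in> Bc" by simp
 then obtain u where u: "u \<in> V" "\<kappa> b = Nh u" using Bc_snd[OF b(3)] by blast
 show ?thesis by (rule Nh_Fh_orth[OF u(1) b(1) _ b(2)]) (use u(2) b(4) in simp)
qed

lemma lowest_rep_unique: assumes "lowest_rep x f" "lowest_rep x g" shows "f = g"
proof -
 have "lowest_rep (x + (- 1) *\<^sub>R x) (f + (- 1) *\<^sub>R g)" by (rule lowest_rep_add[OF assms(1) lowest_rep_scale[OF assms(2)]])
 hence "lowest_rep 0 (f - g)" by simp
 thus ?thesis using lowest_rep_0 by fastforce
qed

lemma lowest_rep_Bc: assumes "lowest_rep x f" shows "x \<in> Bc \<longleftrightarrow> f = 0"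
proof
 assume x: "x \<in> Bc"
 have "lowest_rep x 0"
  unfolding lowest_rep_def using x subspace_0[OF V_sub] lin_zero[OF Fh_lin] subspace_0[OF cocycles_subspace]
   lin_zero[OF kappa_lin]
  by (intro conjI bexI[of _ 0]) (simp_all flip: zero_prod_def)
 thus "f = 0" by (rule lowest_rep_unique[OF assms])
next
 assume "f = 0"
 then obtain b where b: "b \<in> cocycles \<A>" "\<kappa> b = 0" "x - (0, b) \<in> Bc" using assms unfolding lowest_rep_def by blast
 obtain w where w: "w \<in> K \<A>" "b = dK w" using b(2) unfolding kappa_0[OF b(1)] coboundaries_def by blast
 have "(0, b) = D_cone (0, w)"
  unfolding D_cone_def w(2) using lin_zero[OF dK_linear] lin_zero[OF NK_linear] by simp
 moreover have "(0, w) \<in> KK" using w(1) subspace_0[OF subspace_K] unfolding KK_def by simp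
 ultimately have "(0, b) \<in> Bc" unfolding Bc_iff by blast
 hence "(x - (0, b)) + (0, b) \<in> Bc" by (rule subspace_add[OF Bc_subspace b(3)])
 thus "x \<in> Bc" by simp
qed

definition emb :: "int => int => 'a cochain \<times> 'a cochain => 'h" where
 "emb p q x = gr_embed \<A> \<kappa> p q (gr p q x)"

lemma emb_kernel:
 assumes x: "x \<in> Zc" and pq: "2 * p \<le> q" shows "emb p q x = cp (q - 2 * p) (q - 1) (\<kappa> (fst x))"
 unfolding emb_def gr_embed_def if_P[OF pq] gr_def fst_conv cp_kappa[OF ZcD(2)[OF x]] ..

lemma Nh_fst: assumes x: "x \<in> Zc" shows "Nh (\<kappa> (fst x)) = 0"
proof -
 have "Nh (\<kappa> (fst x)) = \<kappa> (- dK (snd x))" unfolding Nh_kappa[OF ZcD(2)[OF x]] ZcD(5)[OF x] ..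
 also have "\<dots> = 0"
  unfolding lin_minus[OF kappa_lin dK_cocycle(1)[OF ZcD(4)[OF x]]] dK_cocycle(2)[OF ZcD(4)[OF x]] by simp
 finally show ?thesis .
qed

lemma Nh_cp: assumes "v \<in> V" "Nh v = 0" shows "Nh (cp i j v) = 0"
 using cp_Nh[OF assms(1), of i j] lin_zero[OF cp_lin] unfolding assms(2) by simp

lemma Fh_cp: assumes "v \<in> V" "Fh v = 0" shows "Fh (cp i j v) = 0"
 using cp_Fh[OF assms(1), of i j] lin_zero[OF cp_lin] unfolding assms(2) by simp

lemma kernel_negative: assumes "v \<in> V" "Nh v = 0" "i < 0" shows "cp i j v = 0"
 by (rule sl2_module.E_inj[OF module cp_in[OF assms(1)] assms(3) Nh_cp[OF assms(1,2)]])

lemma lowest_positive: assumes "v \<in> V" "Fh v = 0" "i > 0" shows "cp i j v = 0"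
proof -
 have "cp i j v \<in> W (- (- i)) j" using cp_in[OF assms(1)] by simp
 thus ?thesis
  by (rule sl2_module.E_inj[OF sl2_module.swap[OF module]]) (simp_all add: assms(3) Fh_cp[OF assms(1,2)])
qed

lemma NK_K_bi: assumes a: "a \<in> K_bi \<A> i j" shows "NK a \<in> K_bi \<A> (i + 2) j"
proof -
 have "K_comp (i + 2) j (NK a) = NK a" using NK_K_comp[OF K_biD(1)[OF a], of i j] K_biD(2)[OF a] by simp
 thus ?thesis using NK_in_K[OF K_biD(1)[OF a]] by (simp add: K_bi_def)
qed

lemma NK_Bc: assumes "w \<in> K \<A>" shows "(- dK w, NK w) \<in> Bc"
proof -
 have "D_cone (w, 0) = (- dK w, NK w)" unfolding D_cone_def using lin_zero[OF dK_linear] by simp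
 moreover have "(w, 0) \<in> KK" using assms subspace_0[OF subspace_K] unfolding KK_def by simp
 ultimately show ?thesis unfolding Bc_iff by metis
qed

text \<open>If the first component is \<open>d w\<close>, the coboundary of \<open>(- w, 0)\<close>
  moves the cocycle into the second summand, at the price of adding \<open>N w\<close>
  there.\<close>

lemma gr_reduce:
 assumes x: "x \<in> Zc" and z: "\<kappa> (fst (gr p q x)) = 0"
 obtains b where "b \<in> cocycles \<A> \<inter> K_bi \<A> (q - 2 * p + 1) (q - 2)" "gr p q x - (0, b) \<in> Bc"
proof -
 obtain a b where y: "gr p q x = (a, b)" by (cases "gr p q x")
 have Z: "(a, b) \<in> Zc" using gr_Zc[OF x, of p q] unfolding y .
 have ab: "a = K_comp (q - 2 * p) (q - 1) (fst x)" "b = K_comp (q - 2 * p + 1) (q - 2) (snd x)" using y unfolding gr_def by simp_all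
 have a: "a \<in> cocycles \<A>" "K_comp (q - 2 * p) (q - 1) a = a" and b: "b \<in> K_bi \<A> (q - 2 * p + 1) (q - 2)" and bK: "b \<in> K \<A>" and N: "NK a = - dK b"
  using ZcD[OF Z] K_biD(2)[OF K_comp_in_K_bi[OF ZcD(3)[OF x]]] K_comp_in_K_bi[OF ZcD(4)[OF x]] unfolding ab by simp_all
 obtain w where w: "w \<in> K_bi \<A> (q - 2 * p - 1) (q - 1 - 1)" "a = dK w"
  using coboundary_homogeneous[OF a] z[unfolded y fst_conv] by blast
 have wK: "w \<in> K \<A>" by (rule K_biD(1)[OF w(1)])
 have "NK w \<in> K_bi \<A> (q - 2 * p + 1) (q - 2)" using NK_K_bi[OF w(1)] by (simp add: algebra_simps)
 moreover have "dK (b + NK w) = 0"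
  unfolding lin_add[OF dK_linear bK NK_in_K[OF wK]] NK_dK[OF wK, symmetric] w(2)[symmetric] N by simp
 ultimately have "b + NK w \<in> cocycles \<A> \<inter> K_bi \<A> (q - 2 * p + 1) (q - 2)"
  using subspace_add[OF K_bi_subspace b] K_biD(1)[OF subspace_add[OF K_bi_subspace b]] unfolding cocycles_def by simp
 moreover have "gr p q x - (0, b + NK w) \<in> Bc" using subspace_neg[OF Bc_subspace NK_Bc[OF wK]] unfolding y w(2) by simp
 ultimately show ?thesis by (rule that)
qed

text \<open>For \<open>q < 2 * p\<close> the class of the first component lies in the kernel of
  \<open>N\<close> at negative weight, so it is 0 and the cocycle reduces to \<open>(0, c)\<close>.
  Now \<open>c\<close> has weight at most 0, and \<open>lowest_decomposition\<close> splits its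
  class as \<open>Nh u + f\<close>. Then \<open>f\<close> is the orthogonal part and, after changing
  \<open>c\<close> by \<open>NK u0\<close>, the class of an admissible representative.\<close>

lemma emb_lowest:
 assumes x: "x \<in> Zc" and pq: "q < 2 * p"
 shows "emb p q x \<in> W (q - 2 * p + 1) (q - 2)" "lowest_rep (gr p q x) (emb p q x)"
  "\<exists>b\<in>cocycles \<A> \<inter> K_bi \<A> (q - 2 * p + 1) (q - 2). \<kappa> b = emb p q x \<and> gr p q x - (0, b) \<in> Bc"
proof -
 define i j where "i = q - 2 * p" and "j = q - 1"
 have i: "i < 0" using pq by (simp add: i_def)
 let ?y = "gr p q x"
 have y: "?y \<in> Zc" by (rule gr_Zc[OF x])
 have e: "q - 2 * p + 1 = i + 1" "q - 2 = j - 1" "q - 1 - 2 * p = i - 1" by (simp_all add: i_def j_def)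
 have "\<kappa> (fst ?y) \<in> W i j"
  unfolding W_def gr_def fst_conv i_def j_def using ZcD(2)[OF y] K_comp_in_K_bi[OF ZcD(3)[OF x]] by (simp add: gr_def)
 hence "\<kappa> (fst ?y) = 0" by (rule sl2_module.E_inj[OF module _ i Nh_fst[OF y]])
 then obtain b0 where b0: "b0 \<in> cocycles \<A> \<inter> K_bi \<A> (q - 2 * p + 1) (q - 2)" "?y - (0, b0) \<in> Bc" by (rule gr_reduce[OF x])
 define c where "c = coker_rep \<A> p q ?y"
 have "c \<in> cocycles \<A> \<inter> K_bi \<A> (q - 2 * p + 1) (q - 2) \<and> ?y - (0, c) \<in> Bc"
  unfolding c_def coker_rep_def by (rule someI[of _ b0]) (use b0 in blast)
 hence c: "c \<in> cocycles \<A> \<inter> K_bi \<A> (i + 1) (j - 1)" "?y - (0, c) \<in> Bc" unfolding e by blast+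
 have cc: "c \<in> cocycles \<A>" using c(1) by blast
 have cW: "\<kappa> c \<in> W (i + 1) (j - 1)" unfolding W_def by (rule imageI[OF c(1)])
 have "i + 1 \<le> 0" using i by simp
 then obtain u f where uf: "u \<in> W (i + 1 - 2) (j - 1)" "f \<in> W (i + 1) (j - 1)" "\<kappa> c = Nh u + f" "Fh f = 0"
  using sl2_module.lowest_decomposition[OF module _ cW] by blast
 have e2: "i + 1 - 2 = i - 1" by simp
 let ?S = "\<kappa> ` NK ` (cocycles \<A> \<inter> K_bi \<A> (i - 1) (j - 1))"
 have S: "?S = Nh ` W (i - 1) (j - 1)"
  unfolding W_def image_image by (rule image_cong[OF refl]) (simp add: Nh_kappa)
 have "orth_part ?S (\<kappa> c) = f"
 proof (rule orth_part_eqI)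
  have "Nh u \<in> ?S" unfolding S using uf(1) unfolding e2 by (rule imageI)
  thus "\<kappa> c - f \<in> closure ?S" unfolding uf(3) using closure_subset[of ?S] by auto
  fix s assume "s \<in> ?S"
  then obtain v where v: "v \<in> W (i - 1) (j - 1)" "s = Nh v" unfolding S by (rule imageE)
  show "s \<bullet> f = 0" unfolding v(2) adjoint[OF W_V[OF v(1)] W_V[OF uf(2)]] uf(4) by simp
 qed
 moreover have "\<not> 2 * p \<le> q" using pq by simp
 ultimately have emb: "emb p q x = f" unfolding emb_def gr_embed_def c_def e by simp
 show "emb p q x \<in> W (q - 2 * p + 1) (q - 2)" unfolding emb e by (rule uf(2))
 obtain u0 where u0: "u0 \<in> cocycles \<A> \<inter> K_bi \<A> (i - 1) (j - 1)" "u = \<kappa> u0" using uf(1) unfolding e2 W_def by blast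
 have u0c: "u0 \<in> cocycles \<A>" and u0K: "u0 \<in> K \<A>" using u0(1) cocyclesD(1) by blast+
 have Nu0: "NK u0 \<in> K_bi \<A> (i + 1) (j - 1)" using NK_K_bi[of u0 "i - 1" "j - 1"] u0(1) by (simp add: algebra_simps)
 have Nu0c: "NK u0 \<in> cocycles \<A>" by (rule descends_cocycles[OF descends_NK u0c])
 define b1 where "b1 = c - NK u0"
 have b1: "b1 \<in> cocycles \<A> \<inter> K_bi \<A> (i + 1) (j - 1)"
  unfolding b1_def using c(1) Nu0 Nu0c by (intro subspace_diff[OF cocycles_K_bi_subspace]) blast+
 have kb1: "\<kappa> b1 = f"
  unfolding b1_def lin_diff[OF kappa_lin cc Nu0c] uf(3) u0(2) Nh_kappa[OF u0c] by simp
 have "(0, NK u0) \<in> Bc" using NK_Bc[OF u0K] cocyclesD(2)[OF u0c] by simp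
 hence "(?y - (0, c)) + (0, NK u0) \<in> Bc" by (rule subspace_add[OF Bc_subspace c(2)])
 moreover have "(?y - (0, c)) + (0, NK u0) = ?y - (0, b1)" unfolding b1_def by (simp add: prod_eq_iff)
 ultimately have yb1: "?y - (0, b1) \<in> Bc" by simp
 show "\<exists>b\<in>cocycles \<A> \<inter> K_bi \<A> (q - 2 * p + 1) (q - 2). \<kappa> b = emb p q x \<and> gr p q x - (0, b) \<in> Bc"
  unfolding emb e using b1 kb1 yb1 by blast
 show "lowest_rep (gr p q x) (emb p q x)"
  unfolding emb lowest_rep_def using W_V[OF uf(2)] uf(4) b1 kb1 yb1 by blast
qed

lemma emb_in: "x \<in> Zc ==> 2 * p \<le> q ==> emb p q x \<in> W (q - 2 * p) (q - 1)"
 unfolding emb_kernel by (rule cp_in[OF kappa_in[OF ZcD(2)]])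

lemma emb_V: assumes "x \<in> Zc" shows "emb p q x \<in> V"
 using W_V[OF emb_in[OF assms, of p q]] W_V[OF emb_lowest(1)[OF assms, of q p]] by fastforce

lemma emb_linear: "linear_on_subspace Zc (emb p q)"
proof (cases "2 * p \<le> q")
 case True
 have "linear_on_subspace Zc (\<lambda>x. cp (q - 2 * p) (q - 1) (\<kappa> (fst x)))"
  by (rule lin_compose[OF lin_compose[OF lin_fst[OF Zc_subspace] kappa_lin ZcD(2)] cp_lin kappa_in[OF ZcD(2)]])
 then show ?thesis by (rule lin_cong) (rule emb_kernel[OF _ True])
next
 case False
 then have pq: "q < 2 * p" by simp
 show ?thesis
 proof (rule linI[OF Zc_subspace])
  fix x y r assume x: "x \<in> Zc"
  note e = emb_lowest(2)[OF _ pq]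
  show "emb p q (x + y) = emb p q x + emb p q y" if y: "y \<in> Zc"
   using lowest_rep_unique[OF e[OF subspace_add[OF Zc_subspace x y]]] lowest_rep_add[OF e[OF x] e[OF y]]
   unfolding lin_add[OF gr_linear ZcD(1)[OF x] ZcD(1)[OF y]] by blast
  show "emb p q (r *\<^sub>R x) = r *\<^sub>R emb p q x"
   using lowest_rep_unique[OF e[OF subspace_scale[OF Zc_subspace x]]] lowest_rep_scale[OF e[OF x], of r]
   unfolding lin_scale[OF gr_linear ZcD(1)[OF x]] by blast
 qed
qed

text \<open>In the kernel range the point is that the second summand contributes nothing: a cocycle
  \<open>(0, b)\<close> there has first weight at least 1, where \<open>E_surj\<close> makes the
  class of \<open>b\<close> an image under \<open>N\<close>, so \<open>(0, b)\<close> is a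
  coboundary.\<close>

lemma emb_eq_0_iff: assumes x: "x \<in> Zc" shows "emb p q x = 0 \<longleftrightarrow> gr p q x \<in> Bc"
proof (cases "2 * p \<le> q")
 case False
 hence pq: "q < 2 * p" by simp
 show ?thesis using lowest_rep_Bc[OF emb_lowest(2)[OF x pq]] by blast
next
 case True
 let ?y = "gr p q x"
 have y: "?y \<in> Zc" by (rule gr_Zc[OF x])
 have emb: "emb p q x = \<kappa> (fst ?y)" unfolding emb_def gr_embed_def using True by simp
 show ?thesis
 proof
  assume "?y \<in> Bc"
  then obtain w where w: "w \<in> KK" "?y = D_cone w" unfolding Bc_iff by blast
  hence "fst ?y = - dK (fst w)" unfolding D_cone_def by simp
  thus "emb p q x = 0"
   unfolding emb using lin_minus[OF kappa_lin dK_cocycle(1)[OF KKD(1)[OF w(1)]]] dK_cocycle(2)[OF KKD(1)[OF w(1)]] by simp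
 next
  assume "emb p q x = 0"
  then obtain b where b: "b \<in> cocycles \<A> \<inter> K_bi \<A> (q - 2 * p + 1) (q - 2)" "?y - (0, b) \<in> Bc" unfolding emb by (rule gr_reduce[OF x])
  have e: "q - 2 * p - 1 + 2 = q - 2 * p + 1" by simp
  have bW: "\<kappa> b \<in> W (q - 2 * p - 1 + 2) (q - 2)" unfolding W_def e by (rule imageI[OF b(1)])
  have bc: "b \<in> cocycles \<A>" using b(1) by blast
  obtain u where u: "u \<in> W (q - 2 * p - 1) (q - 2)" "Nh u = \<kappa> b" using sl2_module.E_surj[OF module _ bW] True by auto
  obtain c where c: "c \<in> cocycles \<A>" "u = \<kappa> c" by (rule VE[OF W_V[OF u(1)]])
  have Nc: "NK c \<in> cocycles \<A>" by (rule descends_cocycles[OF descends_NK c(1)])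
  have "\<kappa> (b - NK c) = 0"
   unfolding lin_diff[OF kappa_lin bc Nc] using u(2) unfolding c(2) Nh_kappa[OF c(1)] by simp
  then obtain v where v: "v \<in> K \<A>" "b - NK c = dK v"
   unfolding kappa_0[OF subspace_diff[OF cocycles_subspace bc Nc]] coboundaries_def by blast
  have "(0, b) = D_cone (c, v)" unfolding D_cone_def using cocyclesD(2)[OF c(1)] v(2)[symmetric] by simp
  moreover have "(c, v) \<in> KK" using cocyclesD(1)[OF c(1)] v(1) unfolding KK_def by simp
  ultimately have "(0, b) \<in> Bc" unfolding Bc_iff by blast
  from subspace_add[OF Bc_subspace b(2) this] show "?y \<in> Bc" by simp
 qed
qed

lemma emb_gr: assumes x: "x \<in> Zc" shows "emb p q (gr p' q' x) = (if p = p' \<and> q = q' then emb p q x else 0)"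
proof (cases "p = p' \<and> q = q'")
 case True thus ?thesis unfolding emb_def gr_gr by simp
next
 case False
 have "gr p q (gr p' q' x) \<in> Bc" unfolding gr_gr if_not_P[OF False] by (rule subspace_0[OF Bc_subspace])
 thus ?thesis unfolding emb_eq_0_iff[OF gr_Zc[OF x], symmetric] if_not_P[OF False] .
qed

text \<open>Kernel and cokernel classes can have the same bidegree, namely with
  \<open>i = 0\<close>, so they are placed in two orthogonal copies of the Hilbert space.\<close>

definition emb2 :: "int => int => 'a cochain \<times> 'a cochain => 'h \<times> 'h" where
 "emb2 p q x = (if 2 * p \<le> q then (emb p q x, 0) else (0, emb p q x))"

lemma emb2_linear: "linear_on_subspace Zc (emb2 p q)"
 using emb_linear[of p q] unfolding linear_on_subspace_def emb2_def by auto

lemma emb2_eq_0_iff: "x \<in> Zc ==> emb2 p q x = 0 \<longleftrightarrow> gr p q x \<in> Bc"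
 unfolding emb2_def using emb_eq_0_iff[of x p q] by (simp add: zero_prod_def)

lemma emb2_inner:
 assumes x: "x \<in> Zc" and y: "y \<in> Zc"
 shows "emb2 p q x \<bullet> emb2 p' q' y = (if p = p' \<and> q = q' then emb p q x \<bullet> emb p q y else 0)"
proof (cases "p = p' \<and> q = q'")
 case True thus ?thesis by (simp add: emb2_def)
next
 case False
 have "emb p q x \<bullet> emb p' q' y = 0" if "(2 * p \<le> q) = (2 * p' \<le> q')"
 proof (cases "2 * p \<le> q")
  case True
  thus ?thesis using False that by (intro W_orth[OF emb_in[OF x] emb_in[OF y]]) auto
 next
  case no: False
  hence "q < 2 * p" "q' < 2 * p'" using that by simp_all
  thus ?thesis using False by (intro W_orth[OF emb_lowest(1)[OF x] emb_lowest(1)[OF y]]) auto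
 qed
 thus ?thesis unfolding if_not_P[OF False] by (simp add: emb2_def)
qed

definition Emb :: "'a cochain \<times> 'a cochain => 'h \<times> 'h" where
 "Emb x = (\<Sum>(p, q)\<in>gr_support x. emb2 p q x)"

lemma emb2_outside: assumes "x \<in> Zc" "(p, q) \<notin> gr_support x" shows "emb2 p q x = 0"
 using assms subspace_0[OF Bc_subspace] unfolding emb2_eq_0_iff[OF assms(1)] gr_support_def by simp

lemma Emb_eq:
 assumes x: "x \<in> Zc" and S: "finite S" "gr_support x \<subseteq> S" shows "Emb x = (\<Sum>(p, q)\<in>S. emb2 p q x)"
 unfolding Emb_def
proof (rule sum.mono_neutral_left[OF S])
 show "\<forall>s\<in>S - gr_support x. (case s of (p, q) => emb2 p q x) = 0"
  using emb2_outside[OF x] by auto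
qed

lemma gr_support_add: "x \<in> KK ==> y \<in> KK ==> gr_support (x + y) \<subseteq> gr_support x \<union> gr_support y"
 using lin_add[OF gr_linear] unfolding gr_support_def by auto

lemma gr_support_scale: "x \<in> KK ==> gr_support (r *\<^sub>R x) \<subseteq> gr_support x"
 using lin_scale[OF gr_linear] unfolding gr_support_def by auto

lemmas Zc_support = finite_gr_support[OF ZcD(1)]

lemma Emb_linear: "linear_on_subspace Zc Emb"
 unfolding linear_on_subspace_def
proof (intro conjI ballI allI Zc_subspace)
 fix x assume x: "x \<in> Zc"
 { fix y assume y: "y \<in> Zc"
  define S where "S = gr_support x \<union> gr_support y"
  have S: "finite S" "gr_support x \<subseteq> S" "gr_support y \<subseteq> S" "gr_support (x + y) \<subseteq> S"
   unfolding S_def using Zc_support[OF x] Zc_support[OF y] gr_support_add[OF ZcD(1)[OF x] ZcD(1)[OF y]] by blast+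
  show "Emb (x + y) = Emb x + Emb y"
   unfolding Emb_eq[OF x S(1,2)] Emb_eq[OF y S(1,3)] Emb_eq[OF subspace_add[OF Zc_subspace x y] S(1,4)] sum.distrib[symmetric]
   by (rule sum.cong[OF refl]) (simp add: split_beta lin_add[OF emb2_linear x y]) }
 fix r
 show "Emb (r *\<^sub>R x) = r *\<^sub>R Emb x"
  unfolding Emb_eq[OF subspace_scale[OF Zc_subspace x] Zc_support[OF x] gr_support_scale[OF ZcD(1)[OF x]]]
   Emb_eq[OF x Zc_support[OF x] order_refl] scaleR_right.sum
  by (rule sum.cong[OF refl]) (simp add: split_beta lin_scale[OF emb2_linear x])
qed

lemma Emb_inner: assumes x: "x \<in> Zc" and y: "y \<in> Zc" shows "Emb x \<bullet> Emb y = ip_X \<A> \<kappa> x y"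
proof -
 define g where "g s = emb (fst s) (snd s) x \<bullet> emb (fst s) (snd s) y" for s
 have in1: "emb2 (fst s) (snd s) x \<bullet> emb2 (fst t) (snd t) y = (if s = t then g s else 0)" for s t
  unfolding emb2_inner[OF x y] g_def prod_eq_iff ..
 have "Emb x \<bullet> Emb y = (\<Sum>s\<in>gr_support x. \<Sum>t\<in>gr_support y. if s = t then g s else 0)"
  unfolding Emb_def split_beta inner_sum_left unfolding inner_sum_right in1 ..
 also have "\<dots> = (\<Sum>s\<in>gr_support x. if s \<in> gr_support y then g s else 0)"
  using Zc_support[OF y] by (intro sum.cong refl) simp
 also have "\<dots> = (\<Sum>s\<in>gr_support x \<inter> gr_support y. g s)"
  by (rule sum.inter_restrict[OF Zc_support[OF x], symmetric])
 also have "\<dots> = ip_X \<A> \<kappa> x y" unfolding ip_X_def g_def emb_def split_beta ..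
 finally show ?thesis .
qed

text \<open>The summands \<open>emb2 p q x\<close> are mutually orthogonal, so a vanishing sum makes
  each of them vanish, and each detects the coboundaries of its own degree.\<close>

lemma Emb_eq_0_iff: assumes x: "x \<in> Zc" shows "Emb x = 0 \<longleftrightarrow> x \<in> Bc"
proof
 assume "x \<in> Bc"
 hence "emb2 p q x = 0" for p q unfolding emb2_eq_0_iff[OF x] by (rule gr_Bc)
 thus "Emb x = 0" unfolding Emb_def by simp
next
 assume 0: "Emb x = 0"
 have "gr p q x \<in> Bc" for p q
 proof -
  have "Emb x \<bullet> emb2 p q x = (\<Sum>s\<in>gr_support x. if s = (p, q) then emb p q x \<bullet> emb p q x else 0)"
   unfolding Emb_def split_beta inner_sum_left emb2_inner[OF x x] by (rule sum.cong[OF refl]) (auto simp: prod_eq_iff)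
  also have "\<dots> = (if (p, q) \<in> gr_support x then emb p q x \<bullet> emb p q x else 0)" using Zc_support[OF x] by simp
  finally have "(p, q) \<in> gr_support x ==> emb p q x = 0" unfolding 0 by simp
  moreover have "(p, q) \<notin> gr_support x ==> gr p q x \<in> Bc"
   using subspace_0[OF Bc_subspace] unfolding gr_support_def by simp
  ultimately show ?thesis using emb_eq_0_iff[OF x, of p q] by blast
 qed
 hence "(\<Sum>(p, q)\<in>gr_support x. gr p q x) \<in> Bc" by (intro subspace_sum[OF Bc_subspace]) (auto split: prod.split)
 thus "x \<in> Bc" unfolding gr_sum[OF ZcD(1)[OF x] Zc_support[OF x] order_refl] .
qed

theorem ip_X_inner_product: "inner_product_on_quotient Zc Bc (ip_X \<A> \<kappa>)"
 unfolding inner_product_on_quotient_def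
proof (intro conjI ballI Zc_subspace Bc_subspace Bc_Zc)
 fix x assume x: "x \<in> Zc"
 show "linear_on_subspace Zc (ip_X \<A> \<kappa> x)"
  unfolding linear_on_subspace_def
  using Zc_subspace by (simp add: Emb_inner[OF x, symmetric] subspace_add subspace_scale
    lin_add[OF Emb_linear] lin_scale[OF Emb_linear] inner_add_right)
 show "0 \<le> ip_X \<A> \<kappa> x x" unfolding Emb_inner[OF x x, symmetric] by simp
 show "(ip_X \<A> \<kappa> x x = 0) = (x \<in> Bc)" unfolding Emb_inner[OF x x, symmetric] Emb_eq_0_iff[OF x, symmetric] by simp
 fix y assume y: "y \<in> Zc"
 show "ip_X \<A> \<kappa> x y = ip_X \<A> \<kappa> y x"
  unfolding Emb_inner[OF x y, symmetric] Emb_inner[OF y x, symmetric] by (rule inner_commute)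
qed

lemma assemble:
 assumes fin: "finite {(i, j). g i j \<noteq> 0}" and g: "\<And>i j. g i j \<in> W i j"
 shows "\<exists>v\<in>V. \<forall>i j. cp i j v = g i j"
proof (intro bexI allI)
 let ?S = "{(i, j). g i j \<noteq> 0}" and ?g = "\<lambda>s. g (fst s) (snd s)"
 have gV: "?g s \<in> V" for s by (rule W_V[OF g])
 show "sum ?g ?S \<in> V" by (rule subspace_sum[OF V_sub gV])
 fix i j
 have "cp i j (sum ?g ?S) = (\<Sum>s\<in>?S. if s = (i, j) then g i j else 0)"
  unfolding lin_sum[OF cp_lin gV] cp_W[OF g] by (intro sum.cong) (auto split: if_splits)
 thus "cp i j (sum ?g ?S) = g i j" using fin by simp
qed

lemma kernelI: assumes "v \<in> V" "\<And>i j. Nh (cp i j v) = 0" shows "Nh v = 0"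
proof (rule cp_eq_0I[OF Nh_V[OF assms(1)]])
 show "cp i j (Nh v) = 0" for i j using cp_Nh[OF assms(1), of "i - 2" j] assms(2)[of "i - 2" j] by simp
qed

lemma lowestI: assumes "v \<in> V" "\<And>i j. Fh (cp i j v) = 0" shows "Fh v = 0"
proof (rule cp_eq_0I[OF Fh_V[OF assms(1)]])
 show "cp i j (Fh v) = 0" for i j using cp_Fh[OF assms(1), of "i + 2" j] assms(2)[of "i + 2" j] by simp
qed

section \<open>Kernel part, dual part and the duality between them\<close>

definition kerN :: "'h set" where "kerN = {u \<in> V. Nh u = 0}"
definition kerF :: "'h set" where "kerF = {v \<in> V. Fh v = 0}"

lemma kerN_subspace: "subspace kerN" and kerF_subspace: "subspace kerF"
 using lin_kernel[OF V_sub Nh_lin, of "{()}"] lin_kernel[OF V_sub Fh_lin, of "{()}"] unfolding kerN_def kerF_def by simp_all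

text \<open>The relation behind \<open>\<delta>\<close>, read on classes: the hard Lefschetz power
  of \<open>N\<close> carries the part of \<open>v\<close> at \<open>- i\<close> to the part of
  \<open>u\<close> at \<open>i\<close>.\<close>

definition dual_pair :: "'h => 'h => bool" where
 "dual_pair u v \<longleftrightarrow> (\<forall>i\<ge>0. \<forall>j. (Nh ^^ nat i) (cp (- i) j v) = cp i j u)"

lemma power_in: "v \<in> V ==> i \<ge> 0 ==> (Nh ^^ nat i) (cp (- i) j v) \<in> W i j"
 using sl2_module.Epow_in[OF module cp_in[of v "- i" j], of "nat i"] by simp

lemma power_lowest: assumes "v \<in> kerF" "i \<ge> 0" shows "Nh ((Nh ^^ nat i) (cp (- i) j v)) = 0"
proof -
 have v: "v \<in> V" "Fh v = 0" using assms(1) unfolding kerF_def by simp_all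
 have "cp (- i) j v \<in> W (- int (nat i)) j" using cp_in[OF v(1), of "- i" j] assms(2) by simp
 hence "(Nh ^^ Suc (nat i)) (cp (- i) j v) = 0" by (rule sl2_module.lowest_top[OF module _ Fh_cp[OF v]])
 thus ?thesis by simp
qed

lemma dual_pair_left: assumes v: "v \<in> kerF" shows "\<exists>u\<in>kerN. dual_pair u v"
proof -
 have vV: "v \<in> V" using v unfolding kerF_def by simp
 define g where "g i j = (if i \<ge> 0 then (Nh ^^ nat i) (cp (- i) j v) else 0)" for i j
 have gW: "g i j \<in> W i j" for i j using power_in[OF vV] subspace_0[OF W_sub] unfolding g_def by simp
 have "cp (- i) j v \<noteq> 0" if "g i j \<noteq> 0" for i j
  using that lin_zero[OF sl2_module.Epow_lin[OF module]] unfolding g_def by (auto split: if_splits)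
 hence "{(i, j). g i j \<noteq> 0} \<subseteq> (\<lambda>(i, j). (- i, j)) ` comps v" unfolding comps_def by (force simp: image_iff)
 hence "finite {(i, j). g i j \<noteq> 0}" by (rule finite_subset[OF _ finite_imageI[OF comps(1)[OF vV]]])
 from assemble[OF this gW] obtain u where u: "u \<in> V" "\<And>i j. cp i j u = g i j" by blast
 have "Nh (cp i j u) = 0" for i j
  unfolding u(2) g_def using power_lowest[OF v] lin_zero[OF Nh_lin] by simp
 hence "u \<in> kerN" unfolding kerN_def using kernelI[OF u(1)] u(1) by simp
 moreover have "dual_pair u v" unfolding dual_pair_def u(2) g_def by simp
 ultimately show ?thesis by blast
qed

text \<open>The powers of \<open>N\<close> in question are injective on nonpositive weights by
  \<open>Epow_inj\<close>, and vectors killed by \<open>Fh\<close> have no positive weights.\<close>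

lemma dual_pair_unique:
 assumes "v \<in> kerF" "v' \<in> kerF" "dual_pair u v" "dual_pair u v'" shows "v = v'"
proof -
 have V: "v \<in> V" "v' \<in> V" "Fh v = 0" "Fh v' = 0" using assms unfolding kerF_def by simp_all
 show ?thesis
 proof (rule cp_eqI[OF V(1,2)])
  fix i j
  show "cp i j v = cp i j v'"
  proof (cases "i \<le> 0")
   case True
   define n where "n = nat (- i)"
   have n: "i = - int n" using True by (simp add: n_def)
   have W: "cp i j v \<in> W (- int n) j" "cp i j v' \<in> W (- int n) j" unfolding n by (rule cp_in[OF V(1)], rule cp_in[OF V(2)])
   have "(Nh ^^ n) (cp i j v) = (Nh ^^ n) (cp i j v')"
    using assms(3,4) True unfolding dual_pair_def n_def by (metis minus_minus neg_0_le_iff_le)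
   hence "(Nh ^^ n) (cp i j v - cp i j v') = 0"
    using lin_diff[OF sl2_module.Epow_lin[OF module] W, of n] by simp
   hence "cp i j v - cp i j v' = 0" by (rule sl2_module.Epow_inj[OF module subspace_diff[OF W_sub W]])
   thus ?thesis by simp
  next
   case False
   thus ?thesis using lowest_positive[OF V(1,3), of i j] lowest_positive[OF V(2,4), of i j] by simp
  qed
 qed
qed

text \<open>The second factor preserves the first weight only, so the pairing is tested on the
 components $\bigoplus_j W_{ij}$.\<close>

definition c1 :: "int => 'h => 'h" where "c1 i v = cp i (- 1) v + cp i 0 v + cp i 1 v"

lemma c1_lin: "linear_on_subspace V (c1 i)"
 unfolding c1_def[abs_def] by (intro lin_plus cp_lin)

lemma c1_V: "v \<in> V ==> c1 i v \<in> V"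
 unfolding c1_def by (intro subspace_add[OF V_sub] cp_V)

lemma cp_c1: assumes v: "v \<in> V" shows "cp i' j (c1 i v) = (if i' = i then cp i' j v else 0)"
 using W_zero[OF cp_in[OF v], of j i]
 by (auto simp: c1_def lin_add[OF cp_lin] subspace_add[OF V_sub] cp_V[OF v] cp_W[OF cp_in[OF v]])

lemma c1_W1: "v \<in> W1 m ==> c1 i v = (if i = m then v else 0)"
 by (rule cp_eqI) (auto simp: c1_V cp_c1 weight_space_def subspace_0[OF V_sub] lin_zero[OF cp_lin])

lemma c1_rho: assumes g: "g \<in> SL2" and v: "v \<in> V" shows "c1 i (rho \<sigma> g v) = rho \<sigma> g (c1 i v)"
proof (rule lin_eqI[OF lin_compose[OF r2.pi_lin[OF g] c1_lin r2.pi_in[OF g]] lin_compose[OF c1_lin r2.pi_lin[OF g] c1_V] v])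
 fix i' j
 have "cp i' j v \<in> W1 i'" using cp_weight_space[OF v, of i' j fst] by simp
 thus "c1 i (rho \<sigma> g (cp i' j v)) = rho \<sigma> g (c1 i (cp i' j v))"
  using lin_zero[OF r2.pi_lin[OF g]] by (simp add: c1_W1 c1_W1[OF rho_W[OF _ g]])
qed

lemma cp_Npow: "v \<in> V ==> cp i j ((Nh ^^ n) v) = (Nh ^^ n) (cp (i - 2 * int n) j v)"
proof (induction n arbitrary: i)
 case (Suc n)
 thus ?case using cp_Nh[OF r1.Epow_V[OF Suc.prems], of "i - 2" j n] by (simp add: algebra_simps)
qed simp

lemma dual_pair_c1:
 assumes u: "u \<in> V" and v: "v \<in> V"
 shows "dual_pair u v \<longleftrightarrow> (\<forall>i\<ge>0. (Nh ^^ nat i) (c1 (- i) v) = c1 i u)"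
proof -
 have "(Nh ^^ nat i) (c1 (- i) v) = c1 i u \<longleftrightarrow> (\<forall>j. (Nh ^^ nat i) (cp (- i) j v) = cp i j u)" if i: "i \<ge> 0" for i
 proof -
  have "cp i' j ((Nh ^^ nat i) (c1 (- i) v)) = (if i' = i then (Nh ^^ nat i) (cp (- i) j v) else 0)" for i' j
   using i lin_zero[OF sl2_module.Epow_lin[OF module]] by (simp add: cp_Npow[OF c1_V[OF v]] cp_c1[OF v])
  thus ?thesis
   using cp_eqI[OF r1.Epow_V[OF c1_V[OF v]] c1_V[OF u], of "nat i" "- i" i] cp_c1[OF u] by (auto split: if_splits) metis
 qed
 thus ?thesis unfolding dual_pair_def by blast
qed

lemma dual_pair_rho:
 assumes g: "g \<in> SL2" and u: "u \<in> V" and v: "v \<in> V" and d: "dual_pair u v"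
 shows "dual_pair (rho \<sigma> g u) (rho \<sigma> g v)"
 unfolding dual_pair_c1[OF r2.pi_in[OF g u] r2.pi_in[OF g v]]
proof (intro allI impI)
 fix i :: int assume i: "0 \<le> i"
 have pw: "(Nh ^^ n) (rho \<sigma> g w) = rho \<sigma> g ((Nh ^^ n) w)" if w: "w \<in> V" for n w
 proof (induction n)
  case (Suc n)
  thus ?case using Nh_rho[OF g r1.Epow_V[OF w]] by simp
 qed simp
 have "(Nh ^^ nat i) (c1 (- i) v) = c1 i u" using d i unfolding dual_pair_c1[OF u v] by blast
 thus "(Nh ^^ nat i) (c1 (- i) (rho \<sigma> g v)) = c1 i (rho \<sigma> g u)"
  unfolding c1_rho[OF g v] c1_rho[OF g u] pw[OF c1_V[OF v]] by simp
qed

lemma rho_kerN: "g \<in> SL2 ==> u \<in> kerN ==> rho \<sigma> g u \<in> kerN"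
 and rho_kerF: "g \<in> SL2 ==> u \<in> kerF ==> rho \<sigma> g u \<in> kerF"
 using Nh_rho[of g u] Fh_rho[of g u] r2.pi_in[of g u] lin_zero[OF r2.pi_lin, of g]
 unfolding kerN_def kerF_def by simp_all

text \<open>In the dual range the first components have negative weight and classes in the kernel of
  \<open>N\<close>, so these classes are 0 and nothing is lost when \<open>emb2\<close> drops
  them.\<close>

lemma fst_Emb: assumes x: "x \<in> Zc" shows "fst (Emb x) = \<kappa> (fst x)"
proof -
 note xV = kappa_in[OF ZcD(2)[OF x]]
 have "fst x = (\<Sum>(p, q)\<in>gr_support x. K_comp (q - 2 * p) (q - 1) (fst x))"
  using arg_cong[OF gr_sum[OF ZcD(1)[OF x] Zc_support[OF x] order_refl], of fst]
  unfolding fst_sum by (simp add: gr_def split_beta)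
 hence "\<kappa> (fst x) = \<kappa> (\<Sum>s\<in>gr_support x. K_comp (snd s - 2 * fst s) (snd s - 1) (fst x))"
  by (simp add: split_beta)
 also have "\<dots> = (\<Sum>s\<in>gr_support x. \<kappa> (K_comp (snd s - 2 * fst s) (snd s - 1) (fst x)))"
  by (rule lin_sum[OF kappa_lin descends_cocycles[OF descends_K_comp ZcD(2)[OF x]]])
 also have "\<dots> = (\<Sum>s\<in>gr_support x. fst (emb2 (fst s) (snd s) x))"
 proof (rule sum.cong[OF refl])
  fix s
  show "\<kappa> (K_comp (snd s - 2 * fst s) (snd s - 1) (fst x)) = fst (emb2 (fst s) (snd s) x)"
  proof (cases "2 * fst s \<le> snd s")
   case True thus ?thesis unfolding emb2_def by (simp add: emb_kernel[OF x True] cp_kappa[OF ZcD(2)[OF x]])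
  next
   case False
   hence "cp (snd s - 2 * fst s) (snd s - 1) (\<kappa> (fst x)) = 0" by (intro kernel_negative[OF xV Nh_fst[OF x]]) simp
   thus ?thesis using False unfolding emb2_def by (simp add: cp_kappa[OF ZcD(2)[OF x]])
  qed
 qed
 finally show ?thesis unfolding Emb_def fst_sum by (simp add: split_beta)
qed

lemma cp_snd_Emb:
 assumes x: "x \<in> Zc" and pq: "q < 2 * p" shows "cp (q - 2 * p + 1) (q - 2) (snd (Emb x)) = emb p q x"
proof -
 define S where "S = insert (p, q) (gr_support x)"
 have S: "finite S" "gr_support x \<subseteq> S" "(p, q) \<in> S" unfolding S_def using Zc_support[OF x] by auto
 have sV: "snd (emb2 p q x) \<in> V" for p q using emb_V[OF x] subspace_0[OF V_sub] by (simp add: emb2_def)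
 have "snd (Emb x) = (\<Sum>s\<in>S. snd (emb2 (fst s) (snd s) x))" unfolding Emb_eq[OF x S(1,2)] snd_sum by (simp add: split_beta)
 hence "cp (q - 2 * p + 1) (q - 2) (snd (Emb x)) = (\<Sum>s\<in>S. cp (q - 2 * p + 1) (q - 2) (snd (emb2 (fst s) (snd s) x)))"
  using lin_sum[OF cp_lin sV] by simp
 also have "\<dots> = (\<Sum>s\<in>S. if s = (p, q) then emb p q x else 0)"
 proof (rule sum.cong[OF refl])
  fix s :: "int \<times> int"
  obtain p' q' where s: "s = (p', q')" by (cases s)
  show "cp (q - 2 * p + 1) (q - 2) (snd (emb2 (fst s) (snd s) x)) = (if s = (p, q) then emb p q x else 0)"
  proof (cases "2 * p' \<le> q'")
   case True
   thus ?thesis using pq lin_zero[OF cp_lin] unfolding s emb2_def by auto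
  next
   case False
   hence "q' < 2 * p'" by simp
   thus ?thesis using False cp_W[OF emb_lowest(1)[OF x], of q' p'] unfolding s emb2_def by auto
  qed
 qed
 also have "\<dots> = emb p q x" using S(1,3) by simp
 finally show ?thesis .
qed

lemma snd_Emb: assumes x: "x \<in> Zc" shows "snd (Emb x) \<in> kerF"
proof -
 have "snd (emb2 p q x) \<in> kerF" for p q
  using emb_lowest(2)[OF x, of q p] subspace_0[OF kerF_subspace] unfolding lowest_rep_def kerF_def emb2_def by simp
 hence "(\<Sum>s\<in>gr_support x. snd (emb2 (fst s) (snd s) x)) \<in> kerF" by (rule subspace_sum[OF kerF_subspace])
 thus ?thesis unfolding Emb_def snd_sum by (simp add: split_beta)
qed

lemma fst_Emb_in: "x \<in> Zc ==> fst (Emb x) \<in> kerN"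
 unfolding fst_Emb kerN_def using kappa_in[OF ZcD(2)] Nh_fst by simp

lemma part_subspace: assumes "\<And>x. x \<in> P \<longleftrightarrow> x \<in> Zc \<and> gr_support x \<subseteq> R" shows "subspace P"
proof -
 have "P = {x \<in> Zc. \<forall>s\<in>- R. gr (fst s) (snd s) x = 0}"
  by (intro set_eqI, unfold assms gr_support_def) force
 then show ?thesis
  using lin_kernel[OF Zc_subspace lin_mono[OF gr_linear _ Zc_subspace]] ZcD(1) by (simp add: subset_iff)
qed

lemma ker_part_iff: "x \<in> ker_part \<A> \<longleftrightarrow> x \<in> Zc \<and> gr_support x \<subseteq> {(p, q). 2 * p \<le> q}"
 and dual_part_iff: "x \<in> dual_part \<A> \<longleftrightarrow> x \<in> Zc \<and> gr_support x \<subseteq> {(p, q). q < 2 * p}"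
 unfolding ker_part_def dual_part_def by auto

lemma ker_part_Zc: "x \<in> ker_part \<A> ==> x \<in> Zc" and dual_part_Zc: "x \<in> dual_part \<A> ==> x \<in> Zc"
 unfolding ker_part_iff dual_part_iff by simp_all

lemma Emb_ker_part: assumes "x \<in> ker_part \<A>" shows "Emb x = (\<kappa> (fst x), 0)"
proof -
 have "snd (Emb x) = (\<Sum>s\<in>gr_support x. 0)"
  unfolding Emb_def snd_sum using assms unfolding ker_part_iff by (intro sum.cong refl) (auto simp: emb2_def)
 thus ?thesis using fst_Emb[OF ker_part_Zc[OF assms]] by (simp add: prod_eq_iff)
qed

lemma Emb_dual_part: assumes "x \<in> dual_part \<A>" shows "fst (Emb x) = 0"
proof -
 have "fst (Emb x) = (\<Sum>s\<in>gr_support x. 0)"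
  unfolding Emb_def fst_sum using assms unfolding dual_part_iff by (intro sum.cong refl) (auto simp: emb2_def)
 thus ?thesis by simp
qed

lemma homogeneous_Emb:
 assumes x: "x \<in> Zc" "gr p q x = x" shows "gr_support x \<subseteq> {(p, q)}" "Emb x = emb2 p q x"
proof -
 have "gr p' q' x = 0" if "(p', q') \<noteq> (p, q)" for p' q'
  using gr_gr[of p' q' p q x] that unfolding x(2) by auto
 thus s: "gr_support x \<subseteq> {(p, q)}" unfolding gr_support_def by blast
 show "Emb x = emb2 p q x" using Emb_eq[OF x(1) _ s] by simp
qed

text \<open>A class killed by \<open>N\<close> is represented by some \<open>a\<close> with
  \<open>NK a = dK w\<close>, and \<open>(a, - w)\<close> is a cone cocycle above it.\<close>

lemma ker_part_component:
 assumes u: "u \<in> W i j" "Nh u = 0" shows "\<exists>x\<in>ker_part \<A>. Emb x = (u, 0)"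
proof (cases "u = 0")
 case True
 have "subspace (ker_part \<A>)" by (rule part_subspace) (rule ker_part_iff)
 thus ?thesis using True subspace_0 lin_zero[OF Emb_linear] by (force simp: zero_prod_def)
next
 case False
 have i: "i \<ge> 0" using kernel_negative[OF W_V[OF u(1)] u(2), of i j] cp_W[OF u(1), of i j] False by force
 have par: "even (1 + j - i)" using W_zero[OF u(1)] False by blast
 \<comment> \<open>Solves \<open>q - 2 * p = i\<close> and \<open>q - 1 = j\<close>.\<close>
 define q p where "q = j + 1" and "p = (1 + j - i) div 2"
 have ij: "q - 2 * p = i" "q - 1 = j" "q - 2 = j - 1" using par unfolding q_def p_def by auto
 obtain a w where a: "a \<in> cocycles \<A>" "a \<in> K_bi \<A> i j" "u = \<kappa> a"
  and w1: "w \<in> K_bi \<A> (i + 1) (j - 1)" and w: "NK a = dK w" by (rule kernel_lift[OF u])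
 have wK: "w \<in> K \<A>" by (rule K_biD(1)[OF w1])
 let ?x = "(a, - w)"
 have x: "?x \<in> Zc"
  by (rule ZcI[OF a(1) subspace_neg[OF subspace_K wK]]) (simp add: lin_minus[OF dK_linear wK] w)
 have g: "gr p q ?x = ?x"
  unfolding gr_def fst_conv snd_conv ij K_biD(2)[OF a(2)] lin_minus[OF K_comp_linear wK] K_biD(2)[OF w1] ..
 have pq: "2 * p \<le> q" using i ij by simp
 have "?x \<in> ker_part \<A>" unfolding ker_part_iff using x homogeneous_Emb(1)[OF x g] pq by auto
 moreover have "Emb ?x = (u, 0)"
  unfolding homogeneous_Emb(2)[OF x g] emb2_def if_P[OF pq] emb_kernel[OF x pq] ij fst_conv a(3)[symmetric]
  using cp_W[OF u(1), of i j] by simp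
 ultimately show ?thesis by blast
qed

lemma dual_part_component:
 assumes v: "v \<in> W i j" "Fh v = 0" shows "\<exists>x\<in>dual_part \<A>. Emb x = (0, v)"
proof (cases "v = 0")
 case True
 have "subspace (dual_part \<A>)" by (rule part_subspace) (rule dual_part_iff)
 thus ?thesis using True subspace_0 lin_zero[OF Emb_linear] by (force simp: zero_prod_def)
next
 case False
 have i: "i \<le> 0" using lowest_positive[OF W_V[OF v(1)] v(2), of i j] cp_W[OF v(1), of i j] False by force
 have par: "even (1 + j - i)" using W_zero[OF v(1)] False by blast
 \<comment> \<open>Now the second summand has to sit in bidegree \<open>(i, j)\<close>:
   \<open>q - 2 * p + 1 = i\<close> and \<open>q - 2 = j\<close>.\<close>
 define q p where "q = j + 2" and "p = (3 + j - i) div 2"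
 have ij: "q - 2 * p + 1 = i" "q - 2 = j" using par unfolding q_def p_def by auto
 obtain b where b: "b \<in> cocycles \<A>" "b \<in> K_bi \<A> i j" "v = \<kappa> b" using v(1) unfolding W_def by blast
 let ?x = "(0, b)"
 have x: "?x \<in> Zc"
  by (rule ZcI[OF subspace_0[OF cocycles_subspace] cocyclesD(1)[OF b(1)]])
   (simp add: lin_zero[OF NK_linear] cocyclesD(2)[OF b(1)])
 have g: "gr p q ?x = ?x"
  unfolding gr_def fst_conv snd_conv ij K_biD(2)[OF b(2)] lin_zero[OF K_comp_linear] ..
 have pq: "q < 2 * p" using i ij by simp
 have "?x \<in> dual_part \<A>" unfolding dual_part_iff using x homogeneous_Emb(1)[OF x g] pq by auto
 moreover have "lowest_rep ?x v"
  unfolding lowest_rep_def using W_V[OF v(1)] v(2) b(1,3) subspace_0[OF Bc_subspace] by (intro conjI bexI[of _ b]) simp_all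
 hence "emb p q ?x = v" using lowest_rep_unique[OF emb_lowest(2)[OF x pq]] unfolding g by blast
 hence "Emb ?x = (0, v)" unfolding homogeneous_Emb(2)[OF x g] emb2_def using pq by simp
 ultimately show ?thesis by blast
qed

lemma ker_part_onto: assumes "u \<in> kerN" shows "\<exists>x\<in>ker_part \<A>. Emb x = (u, 0)"
proof -
 have u: "u \<in> V" "Nh u = 0" using assms unfolding kerN_def by simp_all
 have P: "subspace (ker_part \<A>)" by (rule part_subspace) (rule ker_part_iff)
 have "(u, 0) \<in> Emb ` ker_part \<A>"
 proof (rule lin_in[OF lin_Pair[OF lin_id[OF V_sub] lin_0[OF V_sub]] lin_image[OF lin_mono[OF Emb_linear _ P]] u(1)])
  show "(cp i j u, 0) \<in> Emb ` ker_part \<A>" for i j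
   using ker_part_component[OF cp_in[OF u(1)] Nh_cp[OF u], of i j] unfolding image_iff by (simp only: eq_commute)
 qed (use ker_part_Zc in blast)
 thus ?thesis unfolding image_iff by (simp only: eq_commute)
qed

lemma dual_part_onto: assumes "v \<in> kerF" shows "\<exists>x\<in>dual_part \<A>. Emb x = (0, v)"
proof -
 have v: "v \<in> V" "Fh v = 0" using assms unfolding kerF_def by simp_all
 have P: "subspace (dual_part \<A>)" by (rule part_subspace) (rule dual_part_iff)
 have "(0, v) \<in> Emb ` dual_part \<A>"
 proof (rule lin_in[OF lin_Pair[OF lin_0[OF V_sub] lin_id[OF V_sub]] lin_image[OF lin_mono[OF Emb_linear _ P]] v(1)])
  show "(0, cp i j v) \<in> Emb ` dual_part \<A>" for i j
   using dual_part_component[OF cp_in[OF v(1)] Fh_cp[OF v], of i j] unfolding image_iff by (simp only: eq_commute)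
 qed (use dual_part_Zc in blast)
 thus ?thesis unfolding image_iff by (simp only: eq_commute)
qed

lemma Emb_image: "Emb ` Zc = kerN \<times> kerF"
proof
 show "Emb ` Zc \<subseteq> kerN \<times> kerF" by (rule image_subsetI) (simp only: mem_Times_iff fst_Emb_in snd_Emb simp_thms)
 show "kerN \<times> kerF \<subseteq> Emb ` Zc"
 proof
  fix w assume "w \<in> kerN \<times> kerF"
  hence w: "fst w \<in> kerN" "snd w \<in> kerF" by auto
  obtain x where x: "x \<in> ker_part \<A>" "Emb x = (fst w, 0)" using ker_part_onto[OF w(1)] by blast
  obtain y where y: "y \<in> dual_part \<A>" "Emb y = (0, snd w)" using dual_part_onto[OF w(2)] by blast
  note xy = ker_part_Zc[OF x(1)] dual_part_Zc[OF y(1)]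
  have "Emb (x + y) = w" unfolding lin_add[OF Emb_linear xy] x(2) y(2) by simp
  thus "w \<in> Emb ` Zc" using subspace_add[OF Zc_subspace xy] by blast
 qed
qed

lemma duality_iff:
 "duality \<A> \<kappa> x x' \<longleftrightarrow> x \<in> ker_part \<A> \<and> x' \<in> dual_part \<A> \<and> dual_pair (fst (Emb x)) (snd (Emb x'))"
proof (cases "x \<in> ker_part \<A> \<and> x' \<in> dual_part \<A>")
 case False thus ?thesis unfolding duality_def by blast
next
 case True
 hence x: "x \<in> Zc" and x': "x' \<in> Zc" using ker_part_Zc dual_part_Zc by blast+
 note xV = kappa_in[OF ZcD(2)[OF x]]
 have sV: "snd (Emb x') \<in> V" using snd_Emb[OF x'] unfolding kerF_def by simp
 let ?R = "\<lambda>i j. (Nh ^^ nat i) (cp (- i) j (snd (Emb x'))) = cp i j (fst (Emb x))"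
 have key: "(\<exists>b \<in> cocycles \<A> \<inter> K_bi \<A> (2 * p - q) (q - 1). \<kappa> ((NK ^^ nat (q - 2 * p)) b) = \<kappa> (fst (gr p q x)) \<and>
    gr (q - p + 1) (q + 1) x' - (0, b) \<in> Bc) \<longleftrightarrow> ?R (q - 2 * p) (q - 1)" (is "?L \<longleftrightarrow> _") if pq: "2 * p \<le> q" for p q
 proof -
  let ?p = "q - p + 1" and ?q = "q + 1" and ?n = "nat (q - 2 * p)"
  have pq': "?q < 2 * ?p" using pq by simp
  have e: "?q - 2 * ?p + 1 = 2 * p - q" "?q - 2 = q - 1" by simp_all
  have n: "- int ?n = 2 * p - q" and n': "- (q - 2 * p) = 2 * p - q" using pq by simp_all
  note cpe = cp_snd_Emb[OF x' pq', unfolded e]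
  have fx: "\<kappa> (fst (gr p q x)) = cp (q - 2 * p) (q - 1) (fst (Emb x))"
   unfolding fst_Emb[OF x] cp_kappa[OF ZcD(2)[OF x]] gr_def by simp
  show ?thesis unfolding n'
  proof
   assume ?L
   then obtain b where b: "b \<in> cocycles \<A>" "b \<in> K_bi \<A> (2 * p - q) (q - 1)"
    "\<kappa> ((NK ^^ ?n) b) = \<kappa> (fst (gr p q x))" "gr ?p ?q x' - (0, b) \<in> Bc" by blast
   have bW: "\<kappa> b \<in> W (- int ?n) (q - 1)" unfolding n W_def using b(1,2) by blast
   have nb: "(Nh ^^ ?n) (\<kappa> b) = cp (q - 2 * p) (q - 1) (fst (Emb x))" using Nh_pow[OF b(1), of ?n] b(3) fx by simp
   have "Nh ((Nh ^^ ?n) (\<kappa> b)) = 0"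
    unfolding nb using Nh_cp[of "fst (Emb x)"] fst_Emb_in[OF x] unfolding kerN_def by simp
   hence "Fh (\<kappa> b) = 0" using sl2_module.lowest_of_power[OF module bW] by simp
   hence "lowest_rep (gr ?p ?q x') (\<kappa> b)" unfolding lowest_rep_def using b(1,4) kappa_in[OF b(1)] by blast
   hence "emb ?p ?q x' = \<kappa> b" by (rule lowest_rep_unique[OF emb_lowest(2)[OF x' pq']])
   thus "(Nh ^^ ?n) (cp (2 * p - q) (q - 1) (snd (Emb x'))) = cp (q - 2 * p) (q - 1) (fst (Emb x))" unfolding cpe using nb by simp
  next
   assume R: "(Nh ^^ ?n) (cp (2 * p - q) (q - 1) (snd (Emb x'))) = cp (q - 2 * p) (q - 1) (fst (Emb x))"
   obtain b where b: "b \<in> cocycles \<A> \<inter> K_bi \<A> (2 * p - q) (q - 1)" "\<kappa> b = emb ?p ?q x'" "gr ?p ?q x' - (0, b) \<in> Bc"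
    using emb_lowest(3)[OF x' pq', unfolded e] by blast
   have bc: "b \<in> cocycles \<A>" using b(1) by blast
   have "\<kappa> ((NK ^^ ?n) b) = \<kappa> (fst (gr p q x))" unfolding fx R[symmetric] cpe b(2)[symmetric] using Nh_pow[OF bc, of ?n] by simp
   thus ?L using b(1,3) by blast
  qed
 qed
 \<comment> \<open>Bidegrees of the wrong parity carry no classes; all others have the form
   \<open>(q - 2 * p, q - 1)\<close>.\<close>
 have R: "?R i j" if i: "0 \<le> i" and A: "\<And>p q. 2 * p \<le> q ==> ?R (q - 2 * p) (q - 1)" for i j
 proof (cases "even (1 + j - i)")
  case True
  hence "j + 1 - 2 * ((1 + j - i) div 2) = i" by simp
  thus ?thesis using A[of "(1 + j - i) div 2" "j + 1"] i by simp
 next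
  case False
  have "(Nh ^^ nat i) (cp (- i) j (snd (Emb x'))) = 0" by (rule W_zero[OF power_in[OF sV i]]) (use False in blast)
  moreover have "cp i j (fst (Emb x)) = 0"
   unfolding fst_Emb[OF x] by (rule W_zero[OF cp_in[OF xV]]) (use False in blast)
  ultimately show ?thesis by simp
 qed
 have "dual_pair (fst (Emb x)) (snd (Emb x')) \<longleftrightarrow> (\<forall>p q. 2 * p \<le> q \<longrightarrow> ?R (q - 2 * p) (q - 1))"
  unfolding dual_pair_def using R by (auto simp del: minus_diff_eq)
 thus ?thesis unfolding duality_def using True key by simp
qed

end

section \<open>Orthonormal bases, group ring actions and commutators\<close>

lemma spanned_orthonormal_basis:
 fixes M :: "'m::real_inner set"
 assumes "subspace M" "spanned n M"
 shows "\<exists>B. finite B \<and> card B \<le> n \<and> (\<forall>e\<in>B. \<forall>e'\<in>B. e \<bullet> e' = (if e = e' then 1 else 0)) \<and> span B = M"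
proof -
 obtain A where A: "finite A" "card A \<le> n" "span A = M" using spanned_basis[OF assms] by blast
 obtain C where C: "finite C" "card C \<le> card A" "span C = span A" "pairwise orthogonal C"
  using basis_orthogonal[OF A(1)] by blast
 let ?B = "(\<lambda>c. (1 / norm c) *\<^sub>R c) ` (C - {0})"
 have "card ?B \<le> card C" using card_image_le[of "C - {0}"] card_mono[of C "C - {0}"] C(1) by (meson Diff_subset finite_Diff le_trans)
 moreover have "e \<bullet> e' = (if e = e' then 1 else 0)" if "e \<in> ?B" "e' \<in> ?B" for e e'
 proof -
  obtain c c' where c: "c \<in> C" "c \<noteq> 0" "e = (1 / norm c) *\<^sub>R c" "c' \<in> C" "e' = (1 / norm c') *\<^sub>R c'" using \<open>e \<in> ?B\<close> \<open>e' \<in> ?B\<close> by blast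
  have "e \<bullet> e = 1" unfolding c(3) using c(2) by (simp add: dot_square_norm power2_eq_square)
  moreover have "c \<noteq> c' ==> e \<bullet> e' = 0" using C(4) c unfolding pairwise_def orthogonal_def by simp
  ultimately show ?thesis using c(3,5) by (metis zero_neq_one)
 qed
 moreover have "span ?B = M" using span_image_scale[of "C - {0}" "\<lambda>c. 1 / norm c"] C(1,3) A(3) by simp
 ultimately show ?thesis using C(1,2) A(2) by (intro exI[of _ ?B]) simp
qed

lemma ring_action_eq:
 assumes "finite S" "{g. f g \<noteq> 0} \<subseteq> S" shows "ring_action \<pi> f v = (\<Sum>g\<in>S. f g *\<^sub>R \<pi> g v)"
 unfolding ring_action_def by (rule sum.mono_neutral_left[OF assms]) simp

lemma SL2_inv:
 assumes "u \<in> SL2" shows "matrix_inv u ** u = mat 1" "u ** matrix_inv u = mat 1"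
proof -
 have "invertible u" using assms unfolding SL2_def by (simp add: invertible_det_nz)
 hence "u ** matrix_inv u = mat 1 \<and> matrix_inv u ** u = mat 1"
  unfolding invertible_def matrix_inv_def by (rule someI_ex)
 thus "matrix_inv u ** u = mat 1" "u ** matrix_inv u = mat 1" by simp_all
qed

lemma bounded_group_ring_actionI:
 fixes \<pi> :: "real^2^2 => 'm => 'm::real_normed_vector"
 assumes bl: "\<And>g. g \<in> SL2 ==> bounded_linear (\<pi> g)" and one: "\<pi> (mat 1) = id"
  and mult: "\<And>g h. g \<in> SL2 ==> h \<in> SL2 ==> \<pi> (g ** h) = \<pi> g \<circ> \<pi> h"
 shows "bounded_group_ring_action \<pi>"
proof -
 have GR: "finite {g. f g \<noteq> 0}" "\<And>g. f g \<noteq> 0 ==> g \<in> SL2" if "f \<in> group_ring" for f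
  using that unfolding group_ring_def by blast+
 have 1: "bounded_linear (ring_action \<pi> f)" if f: "f \<in> group_ring" for f
  unfolding ring_action_def
  by (rule bounded_linear_sum) (rule bounded_linear_compose[OF bounded_linear_scaleR_right bl[OF GR(2)[OF f]]], simp)
 have 2: "ring_action \<pi> gr_ring_one = id"
 proof
  fix v
  have "ring_action \<pi> gr_ring_one v = (\<Sum>g\<in>{mat 1}. gr_ring_one g *\<^sub>R \<pi> g v)"
   by (rule ring_action_eq) (auto simp: gr_ring_one_def)
  thus "ring_action \<pi> gr_ring_one v = id v" unfolding gr_ring_one_def using one by simp
 qed
 have 3: "ring_action \<pi> (f + h) = ring_action \<pi> f + ring_action \<pi> h" if f: "f \<in> group_ring" and h: "h \<in> group_ring" for f h
 proof
  fix v
  let ?S = "{g. f g \<noteq> 0} \<union> {g. h g \<noteq> 0}"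
  have S: "finite ?S" using GR(1)[OF f] GR(1)[OF h] by simp
  have "ring_action \<pi> (f + h) v = (\<Sum>g\<in>?S. (f + h) g *\<^sub>R \<pi> g v)" by (rule ring_action_eq[OF S]) auto
  also have "\<dots> = (\<Sum>g\<in>?S. f g *\<^sub>R \<pi> g v) + (\<Sum>g\<in>?S. h g *\<^sub>R \<pi> g v)"
   unfolding sum.distrib[symmetric] by (rule sum.cong[OF refl]) (simp add: scaleR_add_left)
  also have "\<dots> = ring_action \<pi> f v + ring_action \<pi> h v"
   using ring_action_eq[OF S, of f \<pi> v] ring_action_eq[OF S, of h \<pi> v] by simp
  finally show "ring_action \<pi> (f + h) v = (ring_action \<pi> f + ring_action \<pi> h) v" by simp
 qed
 have 4: "ring_action \<pi> (r *\<^sub>R f) = r *\<^sub>R ring_action \<pi> f" if f: "f \<in> group_ring" for f and r :: real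
 proof
  fix v
  have "ring_action \<pi> (r *\<^sub>R f) v = (\<Sum>g\<in>{g. f g \<noteq> 0}. (r *\<^sub>R f) g *\<^sub>R \<pi> g v)"
   by (rule ring_action_eq[OF GR(1)[OF f]]) (auto simp: scaleR_fun_apply)
  also have "\<dots> = r *\<^sub>R ring_action \<pi> f v"
   unfolding ring_action_def scaleR_right.sum by (rule sum.cong[OF refl]) (simp add: scaleR_fun_apply)
  finally show "ring_action \<pi> (r *\<^sub>R f) v = (r *\<^sub>R ring_action \<pi> f) v" by (simp add: scaleR_fun_apply)
 qed
 have 5: "ring_action \<pi> (gr_ring_mult f h) = ring_action \<pi> f \<circ> ring_action \<pi> h" if f: "f \<in> group_ring" and h: "h \<in> group_ring" for f h
 proof
  fix v
  let ?F = "{g. f g \<noteq> 0}" and ?H = "{g. h g \<noteq> 0}"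
  define S where "S = (\<lambda>(u, w). u ** w) ` (?F \<times> ?H)"
  have fin: "finite ?F" "finite ?H" by (rule GR(1)[OF f], rule GR(1)[OF h])
  have S: "finite S" unfolding S_def using fin by simp
  have inv: "u ** (matrix_inv u ** g) = g" "matrix_inv u ** (u ** g) = g" if "f u \<noteq> 0" for u g
   using SL2_inv[OF GR(2)[OF f that]] by (simp_all add: matrix_mul_assoc)
  have supp: "{g. gr_ring_mult f h g \<noteq> 0} \<subseteq> S"
  proof
   fix g assume "g \<in> {g. gr_ring_mult f h g \<noteq> 0}"
   hence "(\<Sum>u | f u \<noteq> 0. f u * h (matrix_inv u ** g)) \<noteq> 0" unfolding gr_ring_mult_def by simp
   from sum.not_neutral_contains_not_neutral[OF this]
   obtain u where u: "f u \<noteq> 0" "f u * h (matrix_inv u ** g) \<noteq> 0" by blast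
   thus "g \<in> S" unfolding S_def using inv(1)[OF u(1), of g] by (intro image_eqI[of _ _ "(u, matrix_inv u ** g)"]) simp_all
  qed
  \<comment> \<open>Substitution \<open>g = u ** w\<close>: the set \<open>S\<close> contains all
    such products, and elements that do not come from the support of \<open>h\<close> contribute
    0.\<close>
  have inner: "(\<Sum>g\<in>S. h (matrix_inv u ** g) *\<^sub>R \<pi> g v) = (\<Sum>w\<in>?H. h w *\<^sub>R \<pi> (u ** w) v)" if u: "f u \<noteq> 0" for u
   by (rule sum.reindex_bij_witness_not_neutral[of "{g\<in>S. h (matrix_inv u ** g) = 0}" "{}" _ "(**) u" "(**) (matrix_inv u)"])
    (use S u in \<open>auto simp: inv S_def\<close>)
  have "ring_action \<pi> (gr_ring_mult f h) v = (\<Sum>g\<in>S. gr_ring_mult f h g *\<^sub>R \<pi> g v)" by (rule ring_action_eq[OF S supp])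
  also have "\<dots> = (\<Sum>g\<in>S. \<Sum>u\<in>?F. f u *\<^sub>R h (matrix_inv u ** g) *\<^sub>R \<pi> g v)"
   unfolding gr_ring_mult_def by (simp add: scaleR_sum_left)
  also have "\<dots> = (\<Sum>u\<in>?F. \<Sum>g\<in>S. f u *\<^sub>R h (matrix_inv u ** g) *\<^sub>R \<pi> g v)" by (rule sum.swap)
  also have "\<dots> = (\<Sum>u\<in>?F. f u *\<^sub>R (\<Sum>w\<in>?H. h w *\<^sub>R \<pi> (u ** w) v))"
   unfolding scaleR_right.sum[symmetric] by (simp add: inner)
  also have "\<dots> = (\<Sum>u\<in>?F. f u *\<^sub>R \<pi> u (ring_action \<pi> h v))"
  proof (rule sum.cong[OF refl])
   fix u assume "u \<in> ?F"
   hence u: "u \<in> SL2" using GR(2)[OF f] by simp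
   have lu: "linear (\<pi> u)" by (rule bounded_linear.linear[OF bl[OF u]])
   have "\<pi> u (ring_action \<pi> h v) = (\<Sum>w\<in>?H. \<pi> u (h w *\<^sub>R \<pi> w v))" unfolding ring_action_def by (rule linear_sum[OF lu])
   also have "\<dots> = (\<Sum>w\<in>?H. h w *\<^sub>R \<pi> (u ** w) v)"
    using GR(2)[OF h] by (intro sum.cong refl) (simp add: linear_scale[OF lu] mult[OF u])
   finally show "f u *\<^sub>R (\<Sum>w\<in>?H. h w *\<^sub>R \<pi> (u ** w) v) = f u *\<^sub>R \<pi> u (ring_action \<pi> h v)" by simp
  qed
  finally show "ring_action \<pi> (gr_ring_mult f h) v = (ring_action \<pi> f \<circ> ring_action \<pi> h) v"
   unfolding ring_action_def[of \<pi> f] by simp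
 qed
 show ?thesis unfolding bounded_group_ring_action_def using 1 2 3 4 5 by blast
qed

lemma bounded_commutator_zero: "subspace G ==> bounded_commutator G (\<lambda>v. 0)"
 unfolding bounded_commutator_def
 by (intro exI[of _ "\<lambda>v. 0"]) (auto intro!: exI[of _ 0] simp: zero_prod_def[symmetric] subspace_0)

lemma bounded_commutator_add:
 assumes G: "subspace G" and a: "bounded_commutator G a" and b: "bounded_commutator G b"
 shows "bounded_commutator G (\<lambda>v. a v + b v)"
proof -
 obtain B where B: "bounded_linear B" "\<And>x y. (x, y) \<in> G ==> \<exists>z. (a x, z) \<in> G \<and> z - a y = B x"
  using a unfolding bounded_commutator_def by blast
 obtain C where C: "bounded_linear C" "\<And>x y. (x, y) \<in> G ==> \<exists>z. (b x, z) \<in> G \<and> z - b y = C x"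
  using b unfolding bounded_commutator_def by blast
 show ?thesis
  unfolding bounded_commutator_def
 proof (intro exI[of _ "\<lambda>x. B x + C x"] conjI ballI, rule bounded_linear_add[OF B(1) C(1)])
  fix w assume w: "w \<in> G"
  obtain x y where xy: "w = (x, y)" by (cases w)
  obtain z where z: "(a x, z) \<in> G" "z - a y = B x" using B(2) w unfolding xy by blast
  obtain z' where z': "(b x, z') \<in> G" "z' - b y = C x" using C(2) w unfolding xy by blast
  have "(a x + b x, z + z') \<in> G" using subspace_add[OF G z(1) z'(1)] by simp
  moreover have "z + z' - (a y + b y) = B x + C x" unfolding z(2)[symmetric] z'(2)[symmetric] by simp
  ultimately show "case w of (x, y) => \<exists>z. (a x + b x, z) \<in> G \<and> z - (a y + b y) = B x + C x" unfolding xy by auto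
 qed
qed

lemma bounded_commutator_scale:
 assumes G: "subspace G" and a: "bounded_commutator G a"
 shows "bounded_commutator G (\<lambda>v. r *\<^sub>R a v)"
proof -
 obtain B where B: "bounded_linear B" "\<And>x y. (x, y) \<in> G ==> \<exists>z. (a x, z) \<in> G \<and> z - a y = B x"
  using a unfolding bounded_commutator_def by blast
 show ?thesis
  unfolding bounded_commutator_def
 proof (intro exI[of _ "\<lambda>x. r *\<^sub>R B x"] conjI ballI, rule bounded_linear_compose[OF bounded_linear_scaleR_right B(1)])
  fix w assume w: "w \<in> G"
  obtain x y where xy: "w = (x, y)" by (cases w)
  obtain z where z: "(a x, z) \<in> G" "z - a y = B x" using B(2) w unfolding xy by blast
  have "(r *\<^sub>R a x, r *\<^sub>R z) \<in> G" using subspace_scale[OF G z(1), of r] by simp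
  moreover have "r *\<^sub>R z - r *\<^sub>R a y = r *\<^sub>R B x" unfolding z(2)[symmetric] by (simp add: scaleR_diff_right)
  ultimately show "case w of (x, y) => \<exists>z. (r *\<^sub>R a x, z) \<in> G \<and> z - r *\<^sub>R a y = r *\<^sub>R B x" unfolding xy by auto
 qed
qed

lemma bounded_commutator_ring_action:
 assumes G: "subspace G" and f: "f \<in> group_ring" and \<pi>: "\<And>g. g \<in> SL2 ==> bounded_commutator G (\<pi> g)"
 shows "bounded_commutator G (ring_action \<pi> f)"
proof -
 have fin: "finite {g. f g \<noteq> 0}" "{g. f g \<noteq> 0} \<subseteq> SL2" using f unfolding group_ring_def by simp_all
 have "bounded_commutator G (\<lambda>v. \<Sum>g\<in>S. f g *\<^sub>R \<pi> g v)" if "finite S" "S \<subseteq> SL2" for S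
  using that
 proof (induction S rule: finite_induct)
  case empty thus ?case using bounded_commutator_zero[OF G] by simp
 next
  case (insert g S)
  hence "bounded_commutator G (\<lambda>v. f g *\<^sub>R \<pi> g v + (\<Sum>g\<in>S. f g *\<^sub>R \<pi> g v))"
   by (intro bounded_commutator_add[OF G] bounded_commutator_scale[OF G] \<pi>) auto
  thus ?case using insert.hyps by simp
 qed
 thus ?thesis using fin unfolding ring_action_def by blast
qed

section \<open>The weight operator that induces \<Phi>\<close>

context lefschetz_surface
begin

text \<open>The weight \<open>i\<close> as an operator on all of \<open>V\<close>. Written through
  \<open>N\<close> and its adjoint, it commutes with the second factor because both of them
  do.\<close>

definition degree1 :: "'h => 'h" where "degree1 v = Nh (Fh v) - Fh (Nh v)"

definition degree2 :: "'h => 'h" where "degree2 v = Lh (r2.F v) - r2.F (Lh v)"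

text \<open>The operator \<open>(1 + j - i) / 2\<close>. It equals \<open>p\<close> at
  \<open>(i, j) = (q - 2 * p, q - 1)\<close> and \<open>p - 1\<close> at
  \<open>(q - 2 * p + 1, q - 2)\<close>, so it induces \<open>\<Phi>\<close> on both parts at
  once.\<close>

definition Om :: "'h => 'h" where "Om v = (1 / 2) *\<^sub>R (v + degree2 v - degree1 v)"

lemma degree1_lin: "linear_on_subspace V degree1"
 unfolding linear_on_subspace_def degree1_def
 using V_sub Nh_V Fh_V lin_add[OF Nh_lin] lin_scale[OF Nh_lin]
  lin_add[OF Fh_lin] lin_scale[OF Fh_lin]
 by (simp add: scaleR_diff_right)

lemma degree2_lin: "linear_on_subspace V degree2"
 unfolding linear_on_subspace_def degree2_def
 using V_sub Lh_V r2.F_V lin_add[OF Lh_lin] lin_scale[OF Lh_lin]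
  lin_add[OF r2.F_lin] lin_scale[OF r2.F_lin]
 by (simp add: scaleR_diff_right)

lemma degree_V: assumes "v \<in> V" shows "degree1 v \<in> V" "degree2 v \<in> V"
 unfolding degree1_def degree2_def
 by (rule subspace_diff[OF V_sub Nh_V[OF Fh_V[OF assms]] Fh_V[OF Nh_V[OF assms]]],
   rule subspace_diff[OF V_sub Lh_V[OF r2.F_V[OF assms]] r2.F_V[OF Lh_V[OF assms]]])

lemma Om_V: "v \<in> V ==> Om v \<in> V"
 unfolding Om_def by (intro subspace_scale subspace_diff subspace_add V_sub degree_V)

lemma Om_lin: "linear_on_subspace V Om"
 unfolding linear_on_subspace_def Om_def
 using V_sub lin_add[OF degree1_lin] lin_scale[OF degree1_lin]
  lin_add[OF degree2_lin] lin_scale[OF degree2_lin]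
 by (simp add: algebra_simps)

lemma degree2_W2: "v \<in> W2 m ==> degree2 v = of_int m *\<^sub>R v"
 unfolding degree2_def by (rule r2.comm)

definition weight :: "int => int => int" where "weight i j = (1 + j - i) div 2"

lemma Om_W: assumes v: "v \<in> W i j" shows "Om v = of_int (weight i j) *\<^sub>R v"
proof (cases "even (1 + j - i)")
 case True
 have "degree1 v = of_int i *\<^sub>R v" unfolding degree1_def by (rule sl2_module.comm[OF module v])
 moreover have "degree2 v = of_int j *\<^sub>R v" using v degree2_W2 unfolding W_W12 by blast
 ultimately have "Om v = (1 / 2) *\<^sub>R (1 *\<^sub>R v + of_int j *\<^sub>R v - of_int i *\<^sub>R v)" unfolding Om_def by simp
 also have "\<dots> = (of_int (1 + j - i) / 2) *\<^sub>R v"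
  unfolding scaleR_add_left[symmetric] scaleR_diff_left[symmetric] by simp
 also have "of_int (1 + j - i) / 2 = (of_int (weight i j) :: real)"
 proof -
  have "1 + j - i = 2 * weight i j" using True unfolding weight_def by simp
  thus ?thesis by (simp only: of_int_mult of_int_numeral)
 qed
 finally show ?thesis .
next
 case False
 have "v = 0" by (rule W_zero[OF v]) (use False in blast)
 thus ?thesis using lin_zero[OF Om_lin] by simp
qed

lemma cp_Om: assumes v: "v \<in> V" shows "cp i j (Om v) = of_int (weight i j) *\<^sub>R cp i j v"
proof -
 have "Om w \<in> W i j" if "w \<in> W i j" for w i j unfolding Om_W[OF that] by (rule subspace_scale[OF W_sub that])
 hence "cp i (j + 0) (Om v) = Om (cp i j v)" by (intro cp_preserving[OF Om_lin _ v]) simp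
 thus ?thesis unfolding Om_W[OF cp_in[OF v]] by simp
qed

lemma Om_kerN: assumes "v \<in> kerN" shows "Om v \<in> kerN"
proof -
 have v: "v \<in> V" "Nh v = 0" using assms unfolding kerN_def by simp_all
 have "Nh (Om v) = 0"
  by (rule kernelI[OF Om_V[OF v(1)]])
   (simp add: cp_Om[OF v(1)] lin_scale[OF Nh_lin cp_V[OF v(1)]] Nh_cp[OF v])
 thus ?thesis unfolding kerN_def using Om_V[OF v(1)] by simp
qed

lemma Om_kerF: assumes "v \<in> kerF" shows "Om v \<in> kerF"
proof -
 have v: "v \<in> V" "Fh v = 0" using assms unfolding kerF_def by simp_all
 have "Fh (Om v) = 0"
  by (rule lowestI[OF Om_V[OF v(1)]])
   (simp add: cp_Om[OF v(1)] lin_scale[OF Fh_lin cp_V[OF v(1)]] Fh_cp[OF v])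
 thus ?thesis unfolding kerF_def using Om_V[OF v(1)] by simp
qed

lemma degree2_norm: assumes "v \<in> V" shows "norm (degree2 v) \<le> norm v"
proof -
 obtain a b c where abc: "a \<in> W2 (- 1)" "b \<in> W2 0" "c \<in> W2 1" "v = a + b + c" using r2.decompE[OF assms] .
 have V: "a \<in> V" "b \<in> V" "c \<in> V" by (rule r2.W_V[OF abc(1)], rule r2.W_V[OF abc(2)], rule r2.W_V[OF abc(3)])
 have "degree2 v = - a + 0 + c"
  unfolding abc(4) lin_add[OF degree2_lin subspace_add[OF V_sub V(1,2)] V(3)]
   lin_add[OF degree2_lin V(1,2)] degree2_W2[OF abc(1)] degree2_W2[OF abc(2)] degree2_W2[OF abc(3)] by simp
 hence "(norm (degree2 v))\<^sup>2 = (norm a)\<^sup>2 + (norm c)\<^sup>2"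
  using r2.norm_sum[OF subspace_neg[OF weight_space_sub abc(1)] subspace_0[OF weight_space_sub[of snd 0]] abc(3)] by simp
 moreover have "(norm v)\<^sup>2 = (norm a)\<^sup>2 + (norm b)\<^sup>2 + (norm c)\<^sup>2"
  unfolding abc(4) by (rule r2.norm_sum[OF abc(1-3)]) simp_all
 ultimately have "(norm (degree2 v))\<^sup>2 \<le> (norm v)\<^sup>2" by simp
 thus ?thesis by (rule power2_le_imp_le) simp
qed

text \<open>Only the second weight fails to commute with the action, and it is bounded.\<close>

lemma Om_rho:
 assumes g: "g \<in> SL2" and v: "v \<in> V"
 shows "Om (rho \<sigma> g v) - rho \<sigma> g (Om v) = (1 / 2) *\<^sub>R (degree2 (rho \<sigma> g v) - rho \<sigma> g (degree2 v))"
proof -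
 note lin = r2.pi_lin[OF g]
 have 1: "degree1 (rho \<sigma> g v) = rho \<sigma> g (degree1 v)"
  unfolding degree1_def Fh_rho[OF g v] Nh_rho[OF g v] Nh_rho[OF g Fh_V[OF v]] Fh_rho[OF g Nh_V[OF v]]
  by (rule lin_diff[OF lin Nh_V[OF Fh_V[OF v]] Fh_V[OF Nh_V[OF v]], symmetric])
 have "rho \<sigma> g (Om v) = (1 / 2) *\<^sub>R (rho \<sigma> g v + rho \<sigma> g (degree2 v) - rho \<sigma> g (degree1 v))"
  unfolding Om_def lin_scale[OF lin subspace_diff[OF V_sub subspace_add[OF V_sub v degree_V(2)[OF v]] degree_V(1)[OF v]]]
   lin_diff[OF lin subspace_add[OF V_sub v degree_V(2)[OF v]] degree_V(1)[OF v]]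
   lin_add[OF lin v degree_V(2)[OF v]] ..
 thus ?thesis unfolding Om_def 1 by (simp add: scaleR_diff_right scaleR_add_right)
qed

lemma Om_rho_bounded:
 assumes g: "g \<in> SL2" shows "\<exists>C. \<forall>v\<in>V. norm (Om (rho \<sigma> g v) - rho \<sigma> g (Om v)) \<le> C * norm v"
proof -
 obtain C where C: "\<And>v. v \<in> V ==> norm (rho \<sigma> g v) \<le> C * norm v" using rho_bounded[OF g] by blast
 have "norm (Om (rho \<sigma> g v) - rho \<sigma> g (Om v)) \<le> \<bar>C\<bar> * norm v" if v: "v \<in> V" for v
 proof -
  have gv: "norm (rho \<sigma> g w) \<le> \<bar>C\<bar> * norm w" if "w \<in> V" for w
   by (rule order_trans[OF C[OF that]], rule mult_right_mono) simp_all
  have "norm (degree2 (rho \<sigma> g v)) \<le> \<bar>C\<bar> * norm v"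
   by (rule order_trans[OF degree2_norm[OF r2.pi_in[OF g v]] gv[OF v]])
  moreover have "norm (rho \<sigma> g (degree2 v)) \<le> \<bar>C\<bar> * norm v"
   by (rule order_trans[OF gv[OF degree_V(2)[OF v]]], rule mult_left_mono[OF degree2_norm[OF v]]) simp
  ultimately have "norm (degree2 (rho \<sigma> g v) - rho \<sigma> g (degree2 v)) \<le> 2 * (\<bar>C\<bar> * norm v)"
   using norm_triangle_ineq4[of "degree2 (rho \<sigma> g v)" "rho \<sigma> g (degree2 v)"] by simp
  thus ?thesis unfolding Om_rho[OF g v] by simp
 qed
 thus ?thesis by blast
qed

definition U :: "('h \<times> 'h) set" where "U = kerN \<times> kerF"

definition pairwise_map :: "('h => 'h) => 'h \<times> 'h => 'h \<times> 'h" where "pairwise_map T w = (T (fst w), T (snd w))"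

lemma U_subspace: "subspace U" unfolding U_def by (rule subspace_Times[OF kerN_subspace kerF_subspace])

lemma UD: assumes "w \<in> U" shows "fst w \<in> kerN" "snd w \<in> kerF" "fst w \<in> V" "snd w \<in> V"
 using assms unfolding U_def kerN_def kerF_def by (auto simp: mem_Times_iff)

lemma pairwise_lin: assumes T: "linear_on_subspace V T" shows "linear_on_subspace U (pairwise_map T)"
 unfolding pairwise_map_def[abs_def]
 by (intro lin_Pair lin_compose[OF lin_fst T] lin_compose[OF lin_snd T] U_subspace UD)

lemma pairwise_in:
 assumes "\<And>v. v \<in> kerN ==> T v \<in> kerN" "\<And>v. v \<in> kerF ==> T v \<in> kerF" "w \<in> U" shows "pairwise_map T w \<in> U"
 unfolding pairwise_map_def U_def using assms UD[OF assms(3)] by simp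

lemma pairwise_bound:
 assumes T: "\<And>v. v \<in> V ==> norm (T v) \<le> C * norm v" and w: "w \<in> U"
 shows "norm (pairwise_map T w) \<le> (2 * \<bar>C\<bar>) * norm w"
proof -
 have 1: "norm (T v) \<le> \<bar>C\<bar> * norm v" if "v \<in> V" for v
  by (rule order_trans[OF T[OF that]], rule mult_right_mono) simp_all
 have "norm (T (fst w)) \<le> \<bar>C\<bar> * norm w"
  by (rule order_trans[OF 1[OF UD(3)[OF w]]], rule mult_left_mono[OF norm_fst_le[of "fst w" "snd w", simplified]]) simp
 moreover have "norm (T (snd w)) \<le> \<bar>C\<bar> * norm w"
  by (rule order_trans[OF 1[OF UD(4)[OF w]]], rule mult_left_mono[OF norm_snd_le[of "snd w" "fst w", simplified]]) simp
 ultimately show ?thesis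
  unfolding pairwise_map_def using norm_Pair_le[of "T (fst w)" "T (snd w)"] by simp
qed

lemma Emb_Phi_alg: assumes x: "x \<in> Zc" shows "Phi_alg x \<in> Zc" "Emb (Phi_alg x) = pairwise_map Om (Emb x)"
proof -
 let ?l = "\<lambda>(p, q). of_int (Phi_eigenvalue p q) *\<^sub>R gr p q x"
 have t: "?l s \<in> Zc" for s by (cases s) (simp add: subspace_scale[OF Zc_subspace gr_Zc[OF x]])
 show "Phi_alg x \<in> Zc" unfolding Phi_alg_def by (rule subspace_sum[OF Zc_subspace t])
 have e: "Emb (gr p q x) = emb2 p q x" for p q
  using homogeneous_Emb(2)[OF gr_Zc[OF x], of p q p q] emb_gr[OF x, of p q p q] unfolding gr_gr emb2_def by simp
 hence U2: "(case s of (p, q) => emb2 p q x) \<in> U" for s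
  unfolding U_def Emb_image[symmetric] using gr_Zc[OF x] by (cases s) (simp flip: e)
 have ev: "pairwise_map Om (emb2 p q x) = of_int (Phi_eigenvalue p q) *\<^sub>R emb2 p q x" for p q
 proof -
  have "weight (q - 2 * p) (q - 1) = p" "weight (q - 2 * p + 1) (q - 2) = p - 1" unfolding weight_def by simp_all
  thus ?thesis
   using Om_W[OF emb_in[OF x, of p q]] Om_W[OF emb_lowest(1)[OF x, of q p]] lin_zero[OF Om_lin]
   unfolding pairwise_map_def emb2_def Phi_eigenvalue_def by (cases "2 * p \<le> q") simp_all
 qed
 have "Emb (Phi_alg x) = (\<Sum>s\<in>gr_support x. Emb (?l s))" unfolding Phi_alg_def by (rule lin_sum[OF Emb_linear t])
 also have "\<dots> = (\<Sum>s\<in>gr_support x. pairwise_map Om (case s of (p, q) => emb2 p q x))"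
  by (intro sum.cong refl) (simp add: split_beta lin_scale[OF Emb_linear gr_Zc[OF x]] e ev)
 also have "\<dots> = pairwise_map Om (Emb x)" unfolding Emb_def by (rule lin_sum[OF pairwise_lin[OF Om_lin] U2, symmetric])
 finally show "Emb (Phi_alg x) = pairwise_map Om (Emb x)" .
qed

end

section \<open>Operators on the completion\<close>

locale completed_surface = lefschetz_surface \<A> \<omega> \<kappa> \<sigma>
 for \<A> :: "'a::t2_space chart set" and \<omega> and \<kappa> :: "'a cochain => 'h::{real_inner, complete_space}" and \<sigma> +
 fixes \<iota> :: "'a cochain \<times> 'a cochain => 'm::{real_inner, complete_space}"
 assumes completion: "hilbert_completion (cone_cocycles \<A>) (ip_X \<A> \<kappa>) \<iota>"
begin

lemma iota_lin: "linear_on_subspace Zc \<iota>" and iota_dense: "closure (\<iota> ` Zc) = UNIV"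
 using completion unfolding hilbert_completion_def by simp_all

lemma iota_inner: assumes "x \<in> Zc" "y \<in> Zc" shows "\<iota> x \<bullet> \<iota> y = Emb x \<bullet> Emb y"
 using completion assms Emb_inner[OF assms] unfolding hilbert_completion_def by simp

text \<open>The completion is given abstractly by \<open>\<iota>\<close>. Since \<open>Emb\<close>
  induces the same inner product, \<open>\<iota>\<close> factors through it, and this isometry
  identifies a dense subspace of \<open>'m\<close> with the concrete model \<open>U\<close>.\<close>

definition emU :: "'h \<times> 'h => 'm" where "emU w = \<iota> (SOME x. x \<in> Zc \<and> Emb x = w)"

lemma emU_Emb: assumes x: "x \<in> Zc" shows "emU (Emb x) = \<iota> x"
proof -
 define y where "y = (SOME y. y \<in> Zc \<and> Emb y = Emb x)"
 have "y \<in> Zc \<and> Emb y = Emb x" unfolding y_def by (rule someI[of _ x]) (simp add: x)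
 hence y: "y \<in> Zc" "Emb y = Emb x" by simp_all
 have yx: "y - x \<in> Zc" by (rule subspace_diff[OF Zc_subspace y(1) x])
 have "Emb (y - x) = 0" unfolding lin_diff[OF Emb_linear y(1) x] y(2) by simp
 hence "\<iota> (y - x) \<bullet> \<iota> (y - x) = 0" unfolding iota_inner[OF yx yx] by simp
 hence "\<iota> y = \<iota> x" using lin_diff[OF iota_lin y(1) x] by simp
 thus ?thesis unfolding emU_def y_def .
qed

lemma UE: assumes "w \<in> U" obtains x where "x \<in> Zc" "w = Emb x"
 using assms unfolding U_def Emb_image[symmetric] by blast

lemma Emb_U: "x \<in> Zc ==> Emb x \<in> U" unfolding U_def Emb_image[symmetric] by (rule imageI)

lemma emU_lin: "linear_on_subspace U emU"
 using lin_factor[OF Emb_linear iota_lin emU_Emb] unfolding U_def Emb_image[symmetric] .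

lemma emU_inner: assumes "w \<in> U" "w' \<in> U" shows "emU w \<bullet> emU w' = w \<bullet> w'"
proof -
 obtain x where x: "x \<in> Zc" "w = Emb x" by (rule UE[OF assms(1)])
 obtain y where y: "y \<in> Zc" "w' = Emb y" by (rule UE[OF assms(2)])
 show ?thesis unfolding x(2) y(2) emU_Emb[OF x(1)] emU_Emb[OF y(1)] by (rule iota_inner[OF x(1) y(1)])
qed

lemma emU_norm: "w \<in> U ==> norm (emU w) = norm w"
 unfolding norm_eq_sqrt_inner using emU_inner by simp

lemma emU_image: "emU ` U = \<iota> ` Zc"
proof
 show "emU ` U \<subseteq> \<iota> ` Zc"
 proof (rule image_subsetI)
  fix w assume "w \<in> U"
  then obtain x where x: "x \<in> Zc" "w = Emb x" by (rule UE)
  show "emU w \<in> \<iota> ` Zc" unfolding x(2) emU_Emb[OF x(1)] by (rule imageI[OF x(1)])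
 qed
 show "\<iota> ` Zc \<subseteq> emU ` U"
  using emU_Emb Emb_U by (metis image_eqI image_subsetI)
qed

lemma emU_dense: "closure (emU ` U) = UNIV" unfolding emU_image by (rule iota_dense)

lemma emU_eq: assumes "w \<in> U" "w' \<in> U" "emU w = emU w'" shows "w = w'"
proof -
 have "emU (w - w') = 0" using lin_diff[OF emU_lin assms(1,2)] assms(3) by simp
 hence "norm (w - w') = 0" using emU_norm[OF subspace_diff[OF U_subspace assms(1,2)]] by simp
 thus ?thesis by simp
qed

text \<open>The model embeds isometrically onto a dense subspace, so a bound on \<open>U\<close> is
  all that an extension requires.\<close>

lemma lift_operator:
 assumes S: "linear_on_subspace U S" "\<And>w. w \<in> U ==> S w \<in> U" "\<And>w. w \<in> U ==> norm (S w) \<le> C * norm w"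
 shows "\<exists>T. bounded_linear T \<and> (\<forall>w\<in>U. T (emU w) = emU (S w))"
proof -
 define inv where "inv m = (SOME w. w \<in> U \<and> emU w = m)" for m
 have inv: "inv (emU w) = w" if "w \<in> U" for w
 proof -
  have "inv (emU w) \<in> U \<and> emU (inv (emU w)) = emU w" unfolding inv_def by (rule someI[of _ w]) (simp add: that)
  thus ?thesis using emU_eq[of "inv (emU w)" w] that by blast
 qed
 define f where "f m = emU (S (inv m))" for m
 have f: "f (emU w) = emU (S w)" if "w \<in> U" for w unfolding f_def inv[OF that] ..
 have "linear_on_subspace (emU ` U) f" using lin_factor[OF emU_lin lin_compose[OF S(1) emU_lin S(2)] f] .
 moreover have "norm (f m) \<le> C * norm m" if m: "m \<in> emU ` U" for m
 proof -
  obtain w where w: "w \<in> U" "m = emU w" using m by blast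
  show ?thesis unfolding w(2) f[OF w(1)] emU_norm[OF w(1)] emU_norm[OF S(2)[OF w(1)]] by (rule S(3)[OF w(1)])
 qed
 ultimately obtain T where T: "bounded_linear T" "\<forall>y\<in>emU ` U. T y = f y"
  using bounded_linear_extension[OF _ emU_dense, of f C] by blast
 thus ?thesis using f by (intro exI[of _ T]) simp
qed

lemma lift_unique:
 assumes "bounded_linear S" "bounded_linear T" "\<And>w. w \<in> U ==> S (emU w) = T (emU w)" shows "S = T"
 by (rule bounded_linear_eq_on_dense[OF assms(1,2) emU_dense]) (use assms(3) in blast)

abbreviation rho2 :: "real^2^2 => 'h \<times> 'h => 'h \<times> 'h" where "rho2 g \<equiv> pairwise_map (rho \<sigma> g)"

lemma rho2_in: "g \<in> SL2 ==> w \<in> U ==> rho2 g w \<in> U"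
 by (rule pairwise_in[OF rho_kerN rho_kerF])

lemma Om2_in: "w \<in> U ==> pairwise_map Om w \<in> U"
 by (rule pairwise_in[OF Om_kerN Om_kerF])

lemma emU_split: assumes w: "w \<in> U" shows "(fst w, 0) \<in> U" "(0, snd w) \<in> U" "emU w = emU (fst w, 0) + emU (0, snd w)"
proof -
 show 1: "(fst w, 0) \<in> U" "(0, snd w) \<in> U"
  unfolding U_def using UD[OF w] subspace_0[OF kerN_subspace] subspace_0[OF kerF_subspace] by simp_all
 show "emU w = emU (fst w, 0) + emU (0, snd w)" using lin_add[OF emU_lin 1] by simp
qed

text \<open>Turns the relational definition into one formula on \<open>U\<close>. Forwards, every
  vector of either part has representatives, and a dual vector has a partner, so the relation
  determines \<open>T\<close>. Backwards, \<open>dual_pair_unique\<close> shows that partners of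
  vectors related by \<open>g\<close> are related by \<open>g\<close>.\<close>

lemma induced_operator_iff:
 assumes g: "g \<in> SL2"
 shows "induced_operator \<A> \<kappa> \<sigma> \<iota> g T \<longleftrightarrow> bounded_linear T \<and> (\<forall>w\<in>U. T (emU w) = emU (rho2 g w))"
proof
 note r0 = lin_zero[OF r2.pi_lin[OF g]]
 assume ind: "induced_operator \<A> \<kappa> \<sigma> \<iota> g T"
 hence T: "bounded_linear T" unfolding induced_operator_def by simp
 have lift: "\<exists>x\<in>ker_part \<A>. \<exists>y\<in>ker_part \<A>. Emb x = (u, 0) \<and> Emb y = (rho \<sigma> g u, 0) \<and> \<kappa> (fst y) = rho \<sigma> g (\<kappa> (fst x))"
  if u: "u \<in> kerN" for u
 proof -
  obtain x where x: "x \<in> ker_part \<A>" "Emb x = (u, 0)" using ker_part_onto[OF u] by blast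
  obtain y where y: "y \<in> ker_part \<A>" "Emb y = (rho \<sigma> g u, 0)" using ker_part_onto[OF rho_kerN[OF g u]] by blast
  have "\<kappa> (fst y) = rho \<sigma> g (\<kappa> (fst x))" using x(2) y(2) unfolding Emb_ker_part[OF x(1)] Emb_ker_part[OF y(1)] by simp
  thus ?thesis using x y by blast
 qed
 have 1: "T (emU (u, 0)) = emU (rho \<sigma> g u, 0)" if u: "u \<in> kerN" for u
 proof -
  obtain x y where xy: "x \<in> ker_part \<A>" "y \<in> ker_part \<A>" "Emb x = (u, 0)" "Emb y = (rho \<sigma> g u, 0)"
   "\<kappa> (fst y) = rho \<sigma> g (\<kappa> (fst x))" using lift[OF u] by blast
  have "T (\<iota> x) = \<iota> y" using ind xy(1,2,5) unfolding induced_operator_def by blast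
  thus ?thesis
   unfolding xy(3)[symmetric] xy(4)[symmetric] emU_Emb[OF ker_part_Zc[OF xy(1)]] emU_Emb[OF ker_part_Zc[OF xy(2)]] .
 qed
 have 2: "T (emU (0, v)) = emU (0, rho \<sigma> g v)" if v: "v \<in> kerF" for v
 proof -
  \<comment> \<open>The definition reaches the dual vector \<open>v\<close> only through a partner
    in the kernel part.\<close>
  obtain u where u: "u \<in> kerN" "dual_pair u v" using dual_pair_left[OF v] by blast
  have V: "u \<in> V" "v \<in> V" using u(1) v unfolding kerN_def kerF_def by simp_all
  obtain x y where xy: "x \<in> ker_part \<A>" "y \<in> ker_part \<A>" "Emb x = (u, 0)" "Emb y = (rho \<sigma> g u, 0)"
   "\<kappa> (fst y) = rho \<sigma> g (\<kappa> (fst x))" using lift[OF u(1)] by blast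
  obtain x' where x': "x' \<in> dual_part \<A>" "Emb x' = (0, v)" using dual_part_onto[OF v] by blast
  obtain y' where y': "y' \<in> dual_part \<A>" "Emb y' = (0, rho \<sigma> g v)" using dual_part_onto[OF rho_kerF[OF g v]] by blast
  have "duality \<A> \<kappa> x x'" unfolding duality_iff xy(3) x'(2) using xy(1) x'(1) u(2) by simp
  moreover have "duality \<A> \<kappa> y y'"
   unfolding duality_iff xy(4) y'(2) using xy(2) y'(1) dual_pair_rho[OF g V u(2)] by simp
  ultimately have "T (\<iota> x') = \<iota> y'" using ind xy(1,2,5) unfolding induced_operator_def by blast
  thus ?thesis
   unfolding x'(2)[symmetric] y'(2)[symmetric] emU_Emb[OF dual_part_Zc[OF x'(1)]] emU_Emb[OF dual_part_Zc[OF y'(1)]] .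
 qed
 have "T (emU w) = emU (rho2 g w)" if w: "w \<in> U" for w
 proof -
  have "T (emU w) = T (emU (fst w, 0)) + T (emU (0, snd w))"
   unfolding emU_split(3)[OF w] by (rule linear_add[OF bounded_linear.linear[OF T]])
  also have "\<dots> = emU (rho2 g w)"
   unfolding 1[OF UD(1)[OF w]] 2[OF UD(2)[OF w]] using emU_split(3)[OF rho2_in[OF g w]] by (simp add: pairwise_map_def)
  finally show ?thesis .
 qed
 thus "bounded_linear T \<and> (\<forall>w\<in>U. T (emU w) = emU (rho2 g w))" using T by blast
next
 note r0 = lin_zero[OF r2.pi_lin[OF g]]
 assume T: "bounded_linear T \<and> (\<forall>w\<in>U. T (emU w) = emU (rho2 g w))"
 have step: "T (\<iota> x) = \<iota> y" if "x \<in> Zc" "y \<in> Zc" "Emb y = rho2 g (Emb x)" for x y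
  using T Emb_U[OF that(1)] unfolding emU_Emb[OF that(1), symmetric] emU_Emb[OF that(2), symmetric] that(3) by blast
 show "induced_operator \<A> \<kappa> \<sigma> \<iota> g T"
  unfolding induced_operator_def
 proof (intro conjI ballI impI allI)
  show "bounded_linear T" using T by blast
  fix x y assume x: "x \<in> ker_part \<A>" and y: "y \<in> ker_part \<A>" and xy: "\<kappa> (fst y) = rho \<sigma> g (\<kappa> (fst x))"
  show "T (\<iota> x) = \<iota> y"
   by (rule step[OF ker_part_Zc[OF x] ker_part_Zc[OF y]])
    (simp add: Emb_ker_part[OF x] Emb_ker_part[OF y] pairwise_map_def xy r0)
  fix x' y' assume dx: "duality \<A> \<kappa> x x'" and dy: "duality \<A> \<kappa> y y'"
  have x': "x' \<in> dual_part \<A>" "dual_pair (fst (Emb x)) (snd (Emb x'))" using dx unfolding duality_iff by blast+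
  have y': "y' \<in> dual_part \<A>" "dual_pair (fst (Emb y)) (snd (Emb y'))" using dy unfolding duality_iff by blast+
  have V: "fst (Emb x) \<in> V" "snd (Emb x') \<in> V"
   using fst_Emb_in[OF ker_part_Zc[OF x]] snd_Emb[OF dual_part_Zc[OF x'(1)]] unfolding kerN_def kerF_def by simp_all
  have e: "fst (Emb y) = rho \<sigma> g (fst (Emb x))" unfolding Emb_ker_part[OF x] Emb_ker_part[OF y] using xy by simp
  have "snd (Emb y') = rho \<sigma> g (snd (Emb x'))"
   by (rule dual_pair_unique[OF snd_Emb[OF dual_part_Zc[OF y'(1)]] rho_kerF[OF g snd_Emb[OF dual_part_Zc[OF x'(1)]]]
      y'(2)[unfolded e] dual_pair_rho[OF g V x'(2)]])
  hence "Emb y' = rho2 g (Emb x')"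
   unfolding pairwise_map_def using Emb_dual_part[OF x'(1)] Emb_dual_part[OF y'(1)] r0 by (simp add: prod_eq_iff)
  thus "T (\<iota> x') = \<iota> y'" by (rule step[OF dual_part_Zc[OF x'(1)] dual_part_Zc[OF y'(1)]])
 qed
qed

lemma induced_operator_ex1: assumes g: "g \<in> SL2" shows "\<exists>!T. induced_operator \<A> \<kappa> \<sigma> \<iota> g T"
proof -
 obtain C where C: "\<And>v. v \<in> V ==> norm (rho \<sigma> g v) \<le> C * norm v" using rho_bounded[OF g] by blast
 obtain T where T: "bounded_linear T" "\<forall>w\<in>U. T (emU w) = emU (rho2 g w)"
  using lift_operator[OF pairwise_lin[OF r2.pi_lin[OF g]] rho2_in[OF g] pairwise_bound[OF C]] by blast
 show ?thesis
 proof (rule ex1I[of _ T])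
  show "induced_operator \<A> \<kappa> \<sigma> \<iota> g T" unfolding induced_operator_iff[OF g] using T by blast
  fix T' assume "induced_operator \<A> \<kappa> \<sigma> \<iota> g T'"
  hence T': "bounded_linear T'" "\<forall>w\<in>U. T' (emU w) = emU (rho2 g w)" unfolding induced_operator_iff[OF g] by blast+
  show "T' = T" by (rule lift_unique[OF T'(1) T(1)]) (use T(2) T'(2) in simp)
 qed
qed

abbreviation "Rx \<equiv> rho_X \<A> \<kappa> \<sigma> \<iota>"

lemma Rx: assumes g: "g \<in> SL2" shows "bounded_linear (Rx g)" "w \<in> U ==> Rx g (emU w) = emU (rho2 g w)"
 using theI'[OF induced_operator_ex1[OF g]] unfolding induced_operator_iff[OF g] rho_X_def by blast+

lemma Rx_action: "bounded_group_ring_action Rx"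
proof (rule bounded_group_ring_actionI)
 show "bounded_linear (Rx g)" if "g \<in> SL2" for g by (rule Rx(1)[OF that])
 show "Rx (mat 1) = id"
  unfolding id_def
 proof (rule lift_unique[OF Rx(1)[OF SL2_mat_1] bounded_linear_ident])
  fix w assume w: "w \<in> U"
  have "rho2 (mat 1) w = w" unfolding pairwise_map_def using sigma_one[OF UD(3)[OF w]] sigma_one[OF UD(4)[OF w]] by simp
  thus "Rx (mat 1) (emU w) = emU w" unfolding Rx(2)[OF SL2_mat_1 w] by simp
 qed
 fix g h assume g: "g \<in> SL2" and h: "h \<in> SL2"
 show "Rx (g ** h) = Rx g \<circ> Rx h"
  unfolding o_def
 proof (rule lift_unique[OF Rx(1)[OF SL2_mult[OF g h]] bounded_linear_compose[OF Rx(1)[OF g] Rx(1)[OF h]]])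
  fix w assume w: "w \<in> U"
  have "rho2 (g ** h) w = rho2 g (rho2 h w)"
   unfolding pairwise_map_def using r2.pi_mult[OF g h UD(3)[OF w]] r2.pi_mult[OF g h UD(4)[OF w]] by simp
  thus "Rx (g ** h) (emU w) = Rx g (Rx h (emU w))"
   unfolding Rx(2)[OF SL2_mult[OF g h] w] Rx(2)[OF h w] Rx(2)[OF g rho2_in[OF h w]] by simp
 qed
qed

definition G0 :: "('m \<times> 'm) set" where "G0 = (\<lambda>w. (emU w, emU (pairwise_map Om w))) ` U"

lemma Phi_eq: "Phi \<A> \<iota> = closure G0"
proof -
 have "{(\<iota> x, \<iota> (Phi_alg x)) | x. x \<in> Zc} = (\<lambda>x. (\<iota> x, \<iota> (Phi_alg x))) ` Zc" by blast
 also have "\<dots> = (\<lambda>x. (emU (Emb x), emU (pairwise_map Om (Emb x)))) ` Zc"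
 proof (rule image_cong[OF refl])
  fix x assume x: "x \<in> Zc"
  show "(\<iota> x, \<iota> (Phi_alg x)) = (emU (Emb x), emU (pairwise_map Om (Emb x)))"
   unfolding Emb_Phi_alg(2)[OF x, symmetric] emU_Emb[OF x] emU_Emb[OF Emb_Phi_alg(1)[OF x]] ..
 qed
 also have "\<dots> = G0" unfolding G0_def U_def Emb_image[symmetric] image_image ..
 finally show ?thesis unfolding Phi_def by simp
qed

text \<open>The commutator bound on the algebraic part makes \<open>L\<close> a continuous map of
  pairs that carries the algebraic graph into itself. By continuity it preserves the closure, which
  gives the invariance of the domain and the commutator formula together.\<close>

lemma Phi_commutator: assumes g: "g \<in> SL2" shows "bounded_commutator (Phi \<A> \<iota>) (Rx g)"
proof -
 define D where "D v = Om (rho \<sigma> g v) - rho \<sigma> g (Om v)" for v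
 have D: "linear_on_subspace V D"
  unfolding linear_on_subspace_def D_def
  using V_sub Om_V r2.pi_in[OF g] lin_add[OF Om_lin] lin_scale[OF Om_lin]
   lin_add[OF r2.pi_lin[OF g]] lin_scale[OF r2.pi_lin[OF g]]
  by (simp add: scaleR_diff_right)
 have DU: "pairwise_map D w \<in> U" if w: "w \<in> U" for w
  using subspace_diff[OF kerN_subspace Om_kerN[OF rho_kerN[OF g]] rho_kerN[OF g Om_kerN]]
   subspace_diff[OF kerF_subspace Om_kerF[OF rho_kerF[OF g]] rho_kerF[OF g Om_kerF]]
  by (intro pairwise_in[OF _ _ w]) (simp_all add: D_def)
 obtain C where C: "\<And>v. v \<in> V ==> norm (D v) \<le> C * norm v" using Om_rho_bounded[OF g] unfolding D_def by blast
 obtain B where B: "bounded_linear B" "\<And>w. w \<in> U ==> B (emU w) = emU (pairwise_map D w)"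
  using lift_operator[OF pairwise_lin[OF D] DU pairwise_bound[OF C]] by blast
 define L where "L z = (Rx g (fst z), Rx g (snd z) + B (fst z))" for z
 have cont: "continuous_on UNIV L"
  unfolding L_def
  by (intro continuous_intros bounded_linear.continuous_on[OF Rx(1)[OF g]] bounded_linear.continuous_on[OF B(1)])
 have "L ` G0 \<subseteq> G0"
 proof (rule image_subsetI)
  fix z assume "z \<in> G0"
  then obtain w where w: "w \<in> U" "z = (emU w, emU (pairwise_map Om w))" unfolding G0_def by blast
  note gw = rho2_in[OF g w(1)] and gO = rho2_in[OF g Om2_in[OF w(1)]]
  have "pairwise_map Om (rho2 g w) = rho2 g (pairwise_map Om w) + pairwise_map D w"
   unfolding pairwise_map_def D_def by simp
  hence "emU (pairwise_map Om (rho2 g w)) = Rx g (snd z) + B (fst z)"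
   unfolding w(2) fst_conv snd_conv Rx(2)[OF g Om2_in[OF w(1)]] B(2)[OF w(1)]
   using lin_add[OF emU_lin gO DU[OF w(1)]] by simp
  moreover have "Rx g (fst z) = emU (rho2 g w)" unfolding w(2) fst_conv by (rule Rx(2)[OF g w(1)])
  ultimately have "L z = (emU (rho2 g w), emU (pairwise_map Om (rho2 g w)))" unfolding L_def by simp
  thus "L z \<in> G0" unfolding G0_def using gw by blast
 qed
 hence "L ` closure G0 \<subseteq> closure G0"
  using image_closure_subset[OF continuous_on_subset[OF cont subset_UNIV] closed_closure] closure_subset by blast
 hence Lin: "L z \<in> closure G0" if "z \<in> closure G0" for z using that by blast
 show ?thesis
  unfolding bounded_commutator_def Phi_eq
 proof (intro exI[of _ B] conjI ballI B(1))
  fix z assume z: "z \<in> closure G0"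
  obtain x y where xy: "z = (x, y)" by (cases z)
  have "(Rx g x, Rx g y + B x) \<in> closure G0" using Lin[OF z] unfolding xy L_def by simp
  thus "case z of (x, y) => \<exists>z. (Rx g x, z) \<in> closure G0 \<and> z - Rx g y = B x" unfolding xy by auto
 qed
qed

section \<open>Diagonalisation of \<Phi>\<close>

definition side :: "bool => 'h => 'h \<times> 'h" where "side t v = (if t then (v, 0) else (0, v))"

definition ker2 :: "bool => 'h set" where "ker2 t = (if t then kerN else kerF)"

definition piece :: "bool \<times> int \<times> int => 'm set" where
 "piece = (\<lambda>(t, i, j). (\<lambda>v. emU (side t v)) ` (ker2 t \<inter> W i j))"

abbreviation "wt \<equiv> \<lambda>(t :: bool, i, j). weight i j"

lemma ker2_subspace: "subspace (ker2 t)" by (simp add: ker2_def kerN_subspace kerF_subspace)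

lemma ker2_V: "v \<in> ker2 t ==> v \<in> V" by (auto simp: ker2_def kerN_def kerF_def split: if_splits)

lemma side_lin: "linear_on_subspace V (side t)"
 using V_sub by (cases t) (simp_all add: linear_on_subspace_def side_def)

lemma side_U: "v \<in> ker2 t ==> side t v \<in> U"
 using subspace_0[OF kerN_subspace] subspace_0[OF kerF_subspace] by (auto simp: ker2_def side_def U_def split: if_splits)

lemma emU_side_inner: "v \<in> ker2 t ==> v' \<in> ker2 t' ==> emU (side t v) \<bullet> emU (side t' v') = (if t = t' then v \<bullet> v' else 0)"
 by (simp add: emU_inner side_U) (auto simp: side_def)

lemma emU_side_lin: "linear_on_subspace (ker2 t \<inter> W i j) (\<lambda>v. emU (side t v))"
 by (rule lin_compose[OF lin_mono[OF side_lin _ subspace_inter[OF ker2_subspace W_sub]] emU_lin]) (auto intro: ker2_V side_U)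

lemma piece_subspace: "subspace (piece s)"
 by (cases s) (simp add: piece_def lin_image[OF emU_side_lin])

lemma piece_orth: assumes "x \<in> piece s" "x' \<in> piece s'" "s \<noteq> s'" shows "x \<bullet> x' = 0"
 using assms by (cases s; cases s') (auto simp: piece_def emU_side_inner intro: W_orth)

lemma piece_zero:
 assumes "x \<in> piece (t, i, j)" "j \<notin> {- 1, 0, 1} \<or> odd (1 + j - i)" shows "x = 0"
proof -
 obtain v where v: "v \<in> ker2 t \<inter> W i j" "x = emU (side t v)" using assms(1) unfolding piece_def by auto
 hence "v = 0" using W_zero[OF _ assms(2)] by blast
 thus ?thesis using lin_zero[OF emU_side_lin] v(2) by simp
qed

text \<open>\<open>kerN\<close> lives in \<open>i \<ge> 0\<close> and \<open>kerF\<close> in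
  \<open>i \<le> 0\<close>: outside these ranges a piece is 0, inside one of the two uniform bounds
  applies.\<close>

lemma piece_finite: "\<exists>C. \<forall>s. spanned C (piece s)"
proof -
 obtain C1 where C1: "\<And>i j. i \<ge> 0 ==> spanned C1 {v \<in> W i j. Nh v = 0}" using kernel_finite by blast
 obtain C2 where C2: "\<And>i j. i \<ge> 0 ==> spanned C2 {v \<in> W (- i) j. Fh v = 0}" using lowest_finite by blast
 have "spanned (C1 + C2) (ker2 t \<inter> W i j)" for t i j
 proof (cases "if t then i \<ge> 0 else i \<le> 0")
  case True
  hence "t \<and> i \<ge> 0 \<or> \<not> t \<and> - i \<ge> 0" by (simp split: if_splits)
  thus ?thesis
  proof (elim disjE conjE)
   assume "t" "i \<ge> 0"
   show ?thesis by (rule spanned_mono[OF C1[OF \<open>i \<ge> 0\<close>, of j]]) (auto simp: \<open>t\<close> ker2_def kerN_def)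
  next
   assume "\<not> t" "- i \<ge> 0"
   show ?thesis by (rule spanned_mono[OF C2[OF \<open>- i \<ge> 0\<close>, of j]]) (auto simp: \<open>\<not> t\<close> ker2_def kerF_def)
  qed
 next
  case False
  have "v = 0" if v: "v \<in> ker2 t \<inter> W i j" for v
   using v False kernel_negative[of v i j] lowest_positive[of v i j] cp_W[of v i j i j]
   by (auto simp: ker2_def kerN_def kerF_def split: if_splits)
  thus ?thesis by (intro spanned_0) blast
 qed
 hence "spanned (C1 + C2) (piece s)" for s by (cases s) (simp add: piece_def spanned_image[OF emU_side_lin])
 thus ?thesis by blast
qed

lemma U_pieces: assumes w: "w \<in> U" shows "w \<in> span (\<Union>(t, i, j). side t ` (ker2 t \<inter> W i j))" (is "w \<in> span ?S")
proof -
 have "side t v \<in> span ?S" if v: "v \<in> ker2 t" for t v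
 proof (rule lin_in[OF side_lin subspace_span ker2_V[OF v]])
  fix i j
  have "cp i j v \<in> ker2 t \<inter> W i j"
   using v Nh_cp[of v i j] Fh_cp[of v i j] cp_V[of v i j] cp_in[of v i j] by (auto simp: ker2_def kerN_def kerF_def split: if_splits)
  thus "side t (cp i j v) \<in> span ?S" by (intro span_base UN_I[of "(t, i, j)"]) auto
 qed
 from span_add[OF this[of "fst w" True] this[of "snd w" False]] show ?thesis
  using UD(1,2)[OF w] by (simp add: ker2_def side_def)
qed

text \<open>The algebraic graph is generated by eigenvectors; from here orthonormal bases of the
  pieces turn its closure into a diagonal graph.\<close>

lemma G0_span: "G0 = span (\<Union>s. (\<lambda>x. (x, of_int (wt s) *\<^sub>R x)) ` piece s)"
proof -
 let ?S = "\<Union>(t, i, j). side t ` (ker2 t \<inter> W i j)" and ?G = "\<lambda>w. (emU w, emU (pairwise_map Om w))"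
 have S: "?S \<subseteq> U" using side_U by auto
 have U: "U = span ?S" using U_pieces span_minimal[OF S U_subspace] by blast
 have l: "linear_on_subspace U ?G" by (intro lin_Pair emU_lin lin_compose[OF pairwise_lin[OF Om_lin] emU_lin] Om2_in)
 have G: "emU (pairwise_map Om (side t v)) = of_int (weight i j) *\<^sub>R emU (side t v)" if v: "v \<in> ker2 t" "v \<in> W i j" for t v i j
 proof -
  have "pairwise_map Om (side t v) = of_int (weight i j) *\<^sub>R side t v"
   using v Om_W lin_zero[OF Om_lin] by (simp add: pairwise_map_def side_def)
  thus ?thesis using lin_scale[OF emU_lin side_U[OF v(1)]] by simp
 qed
 have "G0 = span (?G ` ?S)" unfolding G0_def using lin_span[OF l S] U by simp
 also have "?G ` ?S = (\<Union>s. (\<lambda>x. (x, of_int (wt s) *\<^sub>R x)) ` piece s)"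
  unfolding image_UN by (rule SUP_cong[OF refl]) (auto simp: piece_def image_image G intro!: image_cong split: prod.splits)
 finally show ?thesis .
qed

text \<open>The basis is the union of orthonormal bases of the mutually orthogonal pieces. A value
  of \<open>\<Phi>\<close> together with \<open>j\<close> fixes \<open>i\<close>, so a level meets
  boundedly many pieces.\<close>

lemma spectral_basis:
 "\<exists>B (l :: 'm => int) C. orthonormal_system B \<and> Phi \<A> \<iota> = orthonormal_system.diagonal_graph B (\<lambda>e. of_int (l e)) \<and>
  (\<forall>k. finite {e\<in>B. \<bar>l e\<bar> = int k}) \<and> (\<forall>k. card {e\<in>B. \<bar>l e\<bar> = int k} \<le> C)"
proof -
 obtain C where C: "\<And>s. spanned C (piece s)" using piece_finite by blast
 obtain Bs where Bs: "\<And>s. finite (Bs s)" "\<And>s. card (Bs s) \<le> C"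
  "\<And>s e e'. e \<in> Bs s ==> e' \<in> Bs s ==> e \<bullet> e' = (if e = e' then 1 else 0)" "\<And>s. span (Bs s) = piece s"
  using spanned_orthonormal_basis[OF piece_subspace C] by metis
 have Bs_in: "e \<in> piece s" if "e \<in> Bs s" for s e using span_base[OF that] unfolding Bs(4) .
 have same: "s = s'" if "e \<in> Bs s" "e \<in> Bs s'" for s s' e
  using piece_orth[OF Bs_in[OF that(1)] Bs_in[OF that(2)]] Bs(3)[OF that(1,1)] by fastforce
 define B where "B = (\<Union>s. Bs s)"
 \<comment> \<open>The choice is unambiguous, since a unit vector cannot lie in two orthogonal
   pieces.\<close>
 define l where "l e = wt (SOME s. e \<in> Bs s)" for e
 have l: "l e = wt s" if "e \<in> Bs s" for e s
  unfolding l_def using someI[of "\<lambda>s. e \<in> Bs s", OF that] same[OF that] by metis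
 let ?X = "(\<lambda>e. (e, of_int (l e) *\<^sub>R e)) ` B" and ?h = "\<lambda>s x. (x, of_int (wt s) *\<^sub>R x)"
 have X: "?X = (\<Union>s. ?h s ` Bs s)" unfolding B_def image_UN by (intro SUP_cong refl image_cong) (simp add: l)
 have "?h s ` piece s = span (?h s ` Bs s)" for s
  unfolding Bs(4)[symmetric] by (rule lin_span[OF lin_Pair[OF lin_id lin_scaleR] span_superset]) simp_all
 hence "G0 = span (\<Union>s. span (?h s ` Bs s))" unfolding G0_span by simp
 also have "\<dots> = span ?X" unfolding X
  by (intro subset_antisym span_minimal subspace_span span_mono UN_mono span_superset) (auto intro!: UN_least span_mono)
 finally have G0: "G0 = span ?X" .
 have ons: "orthonormal_system B"
 proof
  show "e \<bullet> e' = (if e = e' then 1 else 0)" if "e \<in> B" "e' \<in> B" for e e'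
   using that Bs(3) piece_orth[OF Bs_in Bs_in] same unfolding B_def by (metis UN_E)
  have "emU ` U = fst ` G0" unfolding G0_def image_image by simp
  also have "\<dots> = span B" unfolding G0 using linear_span_image[OF linear_fst, of ?X] by (simp add: image_image)
  finally show "closure (span B) = UNIV" using emU_dense by simp
 qed
 interpret orthonormal_system B by (rule ons)
 have Phi: "Phi \<A> \<iota> = diagonal_graph (\<lambda>e. of_int (l e))" unfolding Phi_eq diagonal_graph_eq_closure G0 ..
 \<comment> \<open>Candidates for a level: the copy, the signed eigenvalue \<open>m\<close> and
   \<open>j\<close>; the first weight is recovered as \<open>i = j + 1 - 2 * m\<close>.\<close>
 define D where "D k = (UNIV :: bool set) \<times> {int k, - int k} \<times> {- 1, 0, 1 :: int}" for k
 let ?s = "\<lambda>(t :: bool, m, j). (t, j + 1 - 2 * m, j)"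
 have level: "{e\<in>B. \<bar>l e\<bar> = int k} \<subseteq> (\<Union>d\<in>D k. Bs (?s d))" for k
 proof
  fix e assume "e \<in> {e\<in>B. \<bar>l e\<bar> = int k}"
  then obtain t i j where s: "e \<in> Bs (t, i, j)" and k: "\<bar>weight i j\<bar> = int k" unfolding B_def using l by fastforce
  have "e \<noteq> 0" using Bs(3)[OF s s] by auto
  hence j: "j \<in> {- 1, 0, 1}" "even (1 + j - i)" using piece_zero[OF Bs_in[OF s]] by blast+
  hence "?s (t, weight i j, j) = (t, i, j)" unfolding weight_def by simp
  thus "e \<in> (\<Union>d\<in>D k. Bs (?s d))" using s j k by (intro UN_I[of "(t, weight i j, j)"]) (auto simp: D_def)
 qed
 have fin: "finite (\<Union>d\<in>D k. Bs (?s d))" for k using Bs(1) by (simp add: D_def)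
 have card: "card {e\<in>B. \<bar>l e\<bar> = int k} \<le> 12 * C" for k
 proof -
  have "card {e\<in>B. \<bar>l e\<bar> = int k} \<le> (\<Sum>d\<in>D k. card (Bs (?s d)))"
   by (rule order_trans[OF card_mono[OF fin level] card_UN_le]) (simp add: D_def)
  also have "\<dots> \<le> card (D k) * C" by (rule order_trans[OF sum_bounded_above[OF Bs(2)]]) simp
  \<comment> \<open>Two copies, two signs and three values of \<open>j\<close>.\<close>
  also have "\<dots> \<le> 12 * C" by (rule mult_right_mono) (simp_all add: D_def card_cartesian_product card_insert_if)
  finally show ?thesis .
 qed
 show ?thesis using ons Phi card finite_subset[OF level fin] by blast
qed

lemma Phi_properties:
 "self_adjoint (Phi \<A> \<iota>)" "compact_resolvent (Phi \<A> \<iota>)" "one_summable (Phi \<A> \<iota>)"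
proof -
 obtain B and l :: "'m => int" and C where B: "orthonormal_system B"
  "Phi \<A> \<iota> = orthonormal_system.diagonal_graph B (\<lambda>e. of_int (l e))"
  "\<And>k. finite {e\<in>B. \<bar>l e\<bar> = int k}" "\<And>k. card {e\<in>B. \<bar>l e\<bar> = int k} \<le> C"
  using spectral_basis by blast
 interpret orthonormal_system B by (rule B(1))
 show "self_adjoint (Phi \<A> \<iota>)" unfolding B(2) by (rule self_adjoint_diagonal_graph)
 show "compact_resolvent (Phi \<A> \<iota>)" unfolding B(2)
  by (rule compact_resolvent_diagonal_graph[OF finite_levels[OF B(3)]])
 show "one_summable (Phi \<A> \<iota>)" unfolding B(2) by (rule one_summable_diagonal_graph[OF B(3) B(4)])
qed

lemma Phi_commutators: assumes "a \<in> ring_action Rx ` group_ring" shows "bounded_commutator (Phi \<A> \<iota>) a"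
proof -
 obtain f where f: "f \<in> group_ring" "a = ring_action Rx f" using assms by blast
 have "subspace (Phi \<A> \<iota>)" using Phi_properties(1) unfolding self_adjoint_def by simp
 thus ?thesis unfolding f(2) by (rule bounded_commutator_ring_action[OF _ f(1) Phi_commutator])
qed

end

theorem theorem3p7:
  fixes \<A> :: "'a::t2_space chart set"
    and \<omega> :: "'a form"
    and \<kappa> :: "'a cochain \<Rightarrow> 'h::{real_inner, complete_space}"
    and \<sigma> :: "real^2^2 \<Rightarrow> real^2^2 \<Rightarrow> 'h \<Rightarrow> 'h"
  assumes "compact_riemann_surface \<A>"
    and "kaehler_form \<A> \<omega>"
    and "lefschetz_hypercohomology \<A> \<omega> \<kappa> \<sigma>"
  shows "inner_product_on_quotient (cone_cocycles \<A>) (cone_coboundaries \<A>) (ip_X \<A> \<kappa>) \<and>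
    (\<forall>g\<in>SL2. \<exists>R. bounded_linear R \<and> (\<forall>v\<in>\<kappa> ` cocycles \<A>. R v = rho \<sigma> g v)) \<and>
    (\<forall>\<iota> :: 'a cochain \<times> 'a cochain \<Rightarrow> 'm::{real_inner, complete_space}.
       hilbert_completion (cone_cocycles \<A>) (ip_X \<A> \<kappa>) \<iota> \<longrightarrow>
       (\<forall>g\<in>SL2. \<exists>!T. induced_operator \<A> \<kappa> \<sigma> \<iota> g T) \<and>
       bounded_group_ring_action (rho_X \<A> \<kappa> \<sigma> \<iota>) \<and>
       self_adjoint (Phi \<A> \<iota>) \<and>
       compact_resolvent (Phi \<A> \<iota>) \<and>
       (\<forall>a \<in> ring_action (rho_X \<A> \<kappa> \<sigma> \<iota>) ` group_ring. bounded_commutator (Phi \<A> \<iota>) a) \<and>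
       one_summable (Phi \<A> \<iota>))"
proof -
 interpret lefschetz_surface \<A> \<omega> \<kappa> \<sigma>
  by unfold_locales (fact assms)+
 have "(\<forall>g\<in>SL2. \<exists>!T. induced_operator \<A> \<kappa> \<sigma> \<iota> g T) \<and>
    bounded_group_ring_action (rho_X \<A> \<kappa> \<sigma> \<iota>) \<and>
    self_adjoint (Phi \<A> \<iota>) \<and>
    compact_resolvent (Phi \<A> \<iota>) \<and>
    (\<forall>a \<in> ring_action (rho_X \<A> \<kappa> \<sigma> \<iota>) ` group_ring. bounded_commutator (Phi \<A> \<iota>) a) \<and>
    one_summable (Phi \<A> \<iota>)"
  if "hilbert_completion (cone_cocycles \<A>) (ip_X \<A> \<kappa>) \<iota>" for \<iota> :: "'a cochain \<times> 'a cochain \<Rightarrow> 'm"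
 proof -
  interpret completed_surface \<A> \<omega> \<kappa> \<sigma> \<iota> by unfold_locales (rule that)
  show ?thesis using induced_operator_ex1 Rx_action Phi_properties Phi_commutators by blast
 qed
 thus ?thesis using ip_X_inner_product rho_extension unfolding V_def by blast
qed

end
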